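(* Let $\omega_0$ denote the standard symplectic form on $\mathbb{R}^{2n}$, $S^{2n-1}\subseteq\mathbb{R}^{2n}$ the unit sphere and $\overline{B}^{2n}\subseteq\mathbb{R}^{2n}$ the closed unit ball. The following statements hold. (i) For every integer $n\ge 2$ we have $$\operatorname{diam}(S^{2n-1},\mathbb{R}^{2n},\omega_0)\ \ge\ \frac{\pi}{2}.$$ (ii) For every integer $n\ge 2$ and every real number $d\in[n,2n-1]$ there exists a compact subset $X\subseteq\overline{B}^{2n}$ of Hausdorff dimension at most $d+1$ such that $$\operatorname{diam}(X,\mathbb{R}^{2n},\omega_0)\ \ge\ \frac{\pi}{\mathrm{k}(n,d)}.$$ Here $\operatorname{diam}(X,Y,\omega)$ is the relative Hofer diameter and $\mathrm{k}(n,d)$ is the number defined in the context.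
   Context: Let $(M,\omega)$ be a symplectic manifold (without boundary). For a time-dependent vector field $V:[0,1]\times M\to TM$ let $\mathcal{D}_V^t$ be the set of $x_0\in M$ for which $\dot x(s)=V(s,x(s))$, $x(0)=x_0$ has a solution $x\in C^\infty([0,t],M)$, and put $\varphi_V^t(x_0):=x(t)$ on $\mathcal{D}_V^t$. For $H\in C^\infty([0,1]\times M,\mathbb{R})$, $H^t:=H(t,\cdot)$, the Hamiltonian vector field is given by $\omega(X_{H^t},\cdot)=dH^t$, and $\varphi_H^t:=\varphi_{X_H}^t$. For a closed subset $X\subseteq M$, $V$ is called $X$-compatible iff $X\subseteq\mathcal{D}_V^1$ and $\varphi_V^t(X)=X$ for every $t\in[0,1]$. Define $\mathcal{H}(M,\omega,X):=\{H\in C^\infty([0,1]\times M,\mathbb{R})\mid X_H \text{ is } X\text{-compatible}\}$ and $\operatorname{Ham}(X,\omega):=\{\varphi_H^1|_X\mid H\in\mathcal{H}(M,\omega,X)\}$. Put $\Vert H\Vert_X:=\int_0^1\big(\sup_X H^t-\inf_X H^t\big)dt\in[0,\infty]$, and for $\varphi\in\operatorname{Ham}(X,\omega)$ put $\Vert\varphi\Vert^{X,\omega}:=\inf\{\Vert H\Vert_X\mid H\in\mathcal{H}(M,\omega,X),\ \varphi_H^1|_X=\varphi\}$. For closed subsets $X\subseteq Y\subseteq M$ and $\varphi\in\operatorname{Ham}(X,\omega)$ put $\Vert\varphi\Vert_X^{Y,\omega}:=\inf\{\Vert\psi\Vert^{Y,\omega}\mid\psi\in\operatorname{Ham}(Y,\omega),\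 \psi|_X=\varphi\}$ (with $\inf\emptyset=\infty$), and $\operatorname{diam}(X,Y,\omega):=\sup\{\Vert\varphi\Vert_X^{Y,\omega}\mid\varphi\in\operatorname{Ham}(X,\omega)\}$. In the claim $(M,\omega)=(\mathbb{R}^{2n},\omega_0)$ and $Y=M$. With $\mathbb{N}=\{1,2,\ldots\}$, for $n\in\mathbb{N}$ and $d\in[0,\infty)$, $\mathrm{k}(n,d)\in\mathbb{N}\cup\{\infty\}$ is the infimum of all sums $\sum_{i=1}^\ell k_i$, where $\ell\in\mathbb{N}$, $\ell\ge2$, and $k_1,\ldots,k_\ell\in\mathbb{N}$ are integers for which there exist $n_1,\ldots,n_\ell\in\mathbb{N}$ such that $n_i\ge k_i$ for all $i$, $\sum_i k_in_i\ge n$, $\sum_i k_i(2n_i-k_i)\le d$, and $2\min\{n_1,\ldots,n_\ell\}\le n$. *)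

theory Defs
  imports "HOL-Analysis.Analysis"
begin

text \<open>
  Smoothness on an open set is iterated Frechet differentiability. Smoothness on an arbitrary
  set, such as \<open>[0,1] \<times> M\<close> or a compact interval, is the existence of local smooth extensions,
  as usual for manifolds with boundary.
\<close>

primrec Ck_open :: "nat \<Rightarrow> ('a::real_normed_vector \<Rightarrow> 'b::real_normed_vector) \<Rightarrow> 'a set \<Rightarrow> bool" where
  "Ck_open 0 f U \<longleftrightarrow> continuous_on U f"
| "Ck_open (Suc k) f U \<longleftrightarrow>
     (\<forall>x\<in>U. f differentiable (at x)) \<and> (\<forall>v. Ck_open k (\<lambda>x. frechet_derivative f (at x) v) U)"

definition smooth_on :: "'a::euclidean_space set \<Rightarrow> ('a \<Rightarrow> 'b::real_normed_vector) \<Rightarrow> bool" where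
  "smooth_on S f \<longleftrightarrow>
     (\<forall>x\<in>S. \<exists>U g. open U \<and> x \<in> U \<and> (\<forall>k. Ck_open k g U) \<and> (\<forall>y\<in>S \<inter> U. g y = f y))"


text \<open>
  The ambient manifold \<open>M\<close> is the whole Euclidean space \<open>'a\<close>. Time-dependent functions and vector
  fields are total in the time variable, but only their values at times in \<open>[0,1]\<close> are used.
\<close>

definition ode_solution ::
    "(real \<Rightarrow> 'a::euclidean_space \<Rightarrow> 'a) \<Rightarrow> real \<Rightarrow> 'a \<Rightarrow> (real \<Rightarrow> 'a) \<Rightarrow> bool" where
  "ode_solution V t x0 x \<longleftrightarrow>
     smooth_on {0..t} x \<and> x 0 = x0 \<and>
     (\<forall>s\<in>{0..t}. (x has_vector_derivative V s (x s)) (at s within {0..t}))"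

definition flow_domain :: "(real \<Rightarrow> 'a::euclidean_space \<Rightarrow> 'a) \<Rightarrow> real \<Rightarrow> 'a set" where
  "flow_domain V t = {x0. \<exists>x. ode_solution V t x0 x}"

definition flow :: "(real \<Rightarrow> 'a::euclidean_space \<Rightarrow> 'a) \<Rightarrow> real \<Rightarrow> 'a \<Rightarrow> 'a" where
  "flow V t x0 = (THE y. \<exists>x. ode_solution V t x0 x \<and> x t = y)"

definition compatible :: "'a set \<Rightarrow> (real \<Rightarrow> 'a::euclidean_space \<Rightarrow> 'a) \<Rightarrow> bool" where
  "compatible X V \<longleftrightarrow> X \<subseteq> flow_domain V 1 \<and> (\<forall>t\<in>{0..1}. flow V t ` X = X)"


text \<open>
  A translation-invariant form on \<open>'a\<close> is given by its value \<open>\<omega>\<close> on a single tangent space.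
\<close>

definition ham_vf :: "('a \<Rightarrow> 'a \<Rightarrow> real) \<Rightarrow> ('a::euclidean_space \<Rightarrow> real) \<Rightarrow> 'a \<Rightarrow> 'a" where
  "ham_vf \<omega> h x = (THE v. \<forall>w. \<omega> v w = frechet_derivative h (at x) w)"

definition ham_flow ::
    "('a \<Rightarrow> 'a \<Rightarrow> real) \<Rightarrow> (real \<Rightarrow> 'a::euclidean_space \<Rightarrow> real) \<Rightarrow> real \<Rightarrow> 'a \<Rightarrow> 'a" where
  "ham_flow \<omega> H = flow (\<lambda>t. ham_vf \<omega> (H t))"

definition hamiltonians ::
    "('a \<Rightarrow> 'a \<Rightarrow> real) \<Rightarrow> 'a::euclidean_space set \<Rightarrow> (real \<Rightarrow> 'a \<Rightarrow> real) set" where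
  "hamiltonians \<omega> X =
     {H. smooth_on ({0..1} \<times> UNIV) (\<lambda>(t, x). H t x) \<and> compatible X (\<lambda>t. ham_vf \<omega> (H t))}"

text \<open>
  A map defined on \<open>X\<close> is represented by its extension by \<^term>\<open>undefined\<close> outside \<open>X\<close>.
\<close>

definition Ham :: "('a \<Rightarrow> 'a \<Rightarrow> real) \<Rightarrow> 'a::euclidean_space set \<Rightarrow> ('a \<Rightarrow> 'a) set" where
  "Ham \<omega> X = {restrict (ham_flow \<omega> H 1) X | H. H \<in> hamiltonians \<omega> X}"

definition hofer_length :: "'a::euclidean_space set \<Rightarrow> (real \<Rightarrow> 'a \<Rightarrow> real) \<Rightarrow> ennreal" where
  "hofer_length X H =
     (\<integral>\<^sup>+t\<in>{0..1}. e2ennreal ((SUP x\<in>X. ereal (H t x)) - (INF x\<in>X. ereal (H t x))) \<partial>lborel)"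

definition hofer_norm ::
    "('a \<Rightarrow> 'a \<Rightarrow> real) \<Rightarrow> 'a::euclidean_space set \<Rightarrow> ('a \<Rightarrow> 'a) \<Rightarrow> ennreal" where
  "hofer_norm \<omega> X \<phi> =
     Inf {hofer_length X H | H. H \<in> hamiltonians \<omega> X \<and> restrict (ham_flow \<omega> H 1) X = \<phi>}"

definition rel_hofer_norm ::
    "('a \<Rightarrow> 'a \<Rightarrow> real) \<Rightarrow> 'a::euclidean_space set \<Rightarrow> 'a set \<Rightarrow> ('a \<Rightarrow> 'a) \<Rightarrow> ennreal" where
  "rel_hofer_norm \<omega> X Y \<phi> = Inf {hofer_norm \<omega> Y \<psi> | \<psi>. \<psi> \<in> Ham \<omega> Y \<and> restrict \<psi> X = \<phi>}"

definition rel_hofer_diam ::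
    "'a::euclidean_space set \<Rightarrow> 'a set \<Rightarrow> ('a \<Rightarrow> 'a \<Rightarrow> real) \<Rightarrow> ennreal" where
  "rel_hofer_diam X Y \<omega> = Sup (rel_hofer_norm \<omega> X Y ` Ham \<omega> X)"


text \<open>
  \<open>\<real>\<^sup>2\<^sup>n\<close> is \<open>(real ^ 'n) \<times> (real ^ 'n)\<close> with coordinates \<open>(q, p)\<close>; its product norm is the
  Euclidean one, and \<open>\<omega>\<^sub>0 = \<Sum>\<^sub>i dq\<^sub>i \<and> dp\<^sub>i\<close>.
\<close>

definition omega0 :: "(real ^ 'n) \<times> (real ^ 'n) \<Rightarrow> (real ^ 'n) \<times> (real ^ 'n) \<Rightarrow> real" where
  "omega0 v w = (\<Sum>i\<in>UNIV. fst v $ i * snd w $ i - snd v $ i * fst w $ i)"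

lemma omega0_inner: "omega0 v w = fst v \<bullet> snd w - snd v \<bullet> fst w"
  by (simp add: omega0_def inner_vec_def sum_subtractf)

lemma omega0_eq_frechet_derivative_iff:
  fixes v :: "(real ^ 'n) \<times> (real ^ 'n)"
  assumes "(h has_derivative (\<lambda>w. g \<bullet> w)) (at x)"
  shows "(\<forall>w. omega0 v w = frechet_derivative h (at x) w) \<longleftrightarrow> v = (snd g, - fst g)"
proof -
  have d: "frechet_derivative h (at x) = (\<lambda>w. g \<bullet> w)"
    using assms by (rule frechet_derivative_at[symmetric])
  have "omega0 v w = (- snd v, fst v) \<bullet> w" for w
    by (cases w) (simp add: omega0_inner inner_prod_def)
  then have "(\<forall>w. omega0 v w = frechet_derivative h (at x) w) \<longleftrightarrow> (- snd v, fst v) = g"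
    unfolding d by (simp only: vector_eq_rdot)
  then show ?thesis
    by (cases v; cases g) auto
qed

lemma ham_vf_omega0:
  assumes "(h has_derivative (\<lambda>w. g \<bullet> w)) (at x)"
  shows "ham_vf omega0 h x = (snd g, - fst g)"
  unfolding ham_vf_def omega0_eq_frechet_derivative_iff[OF assms] by (rule the_eq_trivial)


text \<open>
  Since \<open>0 powr 0 = 0\<close>, the formula below does not give the counting measure for \<open>s = 0\<close>, so the
  Hausdorff dimension is taken as an infimum over \<open>s > 0\<close>, which does not change its value.
\<close>

definition hausdorff_content :: "real \<Rightarrow> real \<Rightarrow> 'a::metric_space set \<Rightarrow> ennreal" where
  "hausdorff_content s \<delta> A =
     Inf {(\<Sum>i. ennreal (diameter (C i) powr s)) | C :: nat \<Rightarrow> 'a set.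
            A \<subseteq> (\<Union>i. C i) \<and> (\<forall>i. bounded (C i) \<and> diameter (C i) \<le> \<delta>)}"

definition hausdorff_measure :: "real \<Rightarrow> 'a::metric_space set \<Rightarrow> ennreal" where
  "hausdorff_measure s A = (SUP \<delta>\<in>{0<..}. hausdorff_content s \<delta> A)"

definition hausdorff_dim :: "'a::metric_space set \<Rightarrow> ennreal" where
  "hausdorff_dim A = Inf {ennreal s | s. 0 < s \<and> hausdorff_measure s A = 0}"


definition k_num :: "nat \<Rightarrow> real \<Rightarrow> enat" where
  "k_num n d =
     Inf {enat (\<Sum>i=1..l. k i) | (l :: nat) (k :: nat \<Rightarrow> nat).
            2 \<le> l \<and> (\<forall>i\<in>{1..l}. 1 \<le> k i) \<and>
            (\<exists>m :: nat \<Rightarrow> nat.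
               (\<forall>i\<in>{1..l}. 1 \<le> m i \<and> k i \<le> m i) \<and>
               n \<le> (\<Sum>i=1..l. k i * m i) \<and>
               (\<Sum>i=1..l. real (k i) * (2 * real (m i) - real (k i))) \<le> d \<and>
               2 * Min (m ` {1..l}) \<le> n)}"

end

theory Submission
  imports Defs "HOL-Complex_Analysis.Great_Picard"
begin

text \<open>
  Group the vectors of a frame into blocks and let \<open>N\<close> be the set of points whose \<open>j\<close>-th block is a
  complex rotation of a real vector of length \<open>r\<^sub>j\<close>. Hamiltonian orbits with both ends in \<open>N\<close> are critical
  points of an action functional with Lagrange multipliers. Restricted to trigonometric polynomials it
  has, by a linking argument, almost critical points whenever \<open>\<integral> osc H dt < min \<pi> r\<^sub>j\<^sup>2 / 2\<close>, and Bessel's inequality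
  with Arzela--Ascoli turns these into an orbit. Hence a Hamiltonian diffeomorphism that displaces \<open>N\<close> has
  Hofer norm at least \<open>min \<pi> r\<^sub>j\<^sup>2 / 2\<close>.

  The displacement is a quarter turn of the coordinates \<open>z\<^sub>a\<close>, \<open>z\<^sub>b\<close>, generated by a quadratic Hamiltonian
  that preserves every set invariant under these rotations. It displaces \<open>N\<close> as soon as \<open>\<bar>z\<^sub>a\<bar> > \<bar>z\<^sub>b\<bar>\<close> on \<open>N\<close>.
  On the sphere take for \<open>N\<close> a circle \<open>\<bar>z\<^sub>a\<bar>\<^sup>2 = \<rho>\<close> times a sphere of squared radius \<open>1 - \<rho>\<close>, with \<open>\<rho> \<down> 1/2\<close>.
  This also settles \<open>d \<ge> 2n - 2\<close>, as \<open>k(n,d) \<ge> 2\<close>. If \<open>d < 2n - 2\<close> then \<open>n \<ge> 3\<close> and \<open>k(n,d) \<ge> 3\<close>; the second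
  factor is replaced by the rotations of a sphere in a real subspace on which \<open>\<bar>z\<^sub>b\<bar> = \<bar>z\<^sub>c\<bar>\<close>, so that
  \<open>\<rho> \<down> 1/3\<close> is allowed and the bound \<open>\<pi> / 3\<close> results on a set of dimension \<open>n + 1\<close>.
\<close>

section \<open>Zeros on cubes and small variations\<close>

text \<open>One theorem serves both sets because \<open>symplectic_frame\<close> admits overcomplete
  Parseval frames. With one complex coordinate per frame vector, the Hamiltonian pulls back along
  the synthesis map, its orbits map to orbits, and the boundary set becomes a product of
  phase-rotated real spheres. If a plane is covered twice, by \<open>Ebasis i\<close> and
  \<open>J (Ebasis i)\<close> with weight 1 / sqrt 2, real combinations fill it: a real sphere of
  squared radius 2 c maps onto a sphere of squared radius c, and its bound pi / 2 times 2 c is pi c.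
  An undoubled block of squared radius c yields only pi c / 2. So the sphere gives pi (1 - \<rho>)
  with \<rho> > 1/2, while in low dimension pi \<rho> and pi (1 - \<rho>) / 2 meet at \<rho> = 1/3,
  just where \<rho> begins to exceed the bound (1 - \<rho>) / 2 on the squared modulus of the second
  coordinate and the quarter turn begins to displace. The action is unbounded in both directions on
  infinitely many modes, hence the linking in finitely many modes; the bounds on the multipliers
  must not depend on their number.\<close>

lemma compact_fun_interval: "compact {lo..hi :: 'i \<Rightarrow> real}"
proof -
  have "{lo..hi} = PiE UNIV (\<lambda>i. {lo i..hi i})"
    by (auto simp: PiE_def le_fun_def Pi_def)
  moreover have "compactin (product_topology (\<lambda>i. euclidean) UNIV) (PiE UNIV (\<lambda>i. {lo i..hi i}))"
    unfolding compactin_PiE by auto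
  ultimately show ?thesis
    by (simp add: euclidean_product_topology)
qed

lemma continuous_on_coord:
  fixes f :: "'a::topological_space \<Rightarrow> 'i \<Rightarrow> 'b::topological_space"
  assumes "continuous_on S f"
  shows "continuous_on S (\<lambda>x. f x i)"
  using continuous_on_compose2[OF continuous_on_product_coordinates assms] by simp

lemma continuous_on_coords [continuous_intros]:
  fixes S :: "('i \<Rightarrow> 'b::topological_space) set"
    and T :: "(('i \<Rightarrow> 'b) \<times> 'c::topological_space) set"
    and U :: "('c \<times> ('i \<Rightarrow> 'b)) set"
  shows "continuous_on S (\<lambda>x. x i)" "continuous_on T (\<lambda>p. fst p i)" "continuous_on U (\<lambda>p. snd p i)"
  by (rule continuous_on_coord[OF continuous_on_id[unfolded id_def]]
      continuous_on_coord[OF continuous_on_fst[OF continuous_on_id]]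
      continuous_on_coord[OF continuous_on_snd[OF continuous_on_id]])+

text \<open>Uniform continuity without a metric: the index type may be infinite, so only the product
  topology is at hand, but the perturbation is confined to the finite set \<open>I\<close>. The
  pairs violating the estimate form a compact set on which the l1 distance over \<open>I\<close> has
  no zero, hence a positive minimum.\<close>

lemma small_variation:
  fixes f :: "('i \<Rightarrow> real) \<Rightarrow> real"
  assumes fin: "finite I" and cont: "continuous_on UNIV f" and e: "e > 0"
  obtains s where "0 < s" "\<And>z w. z \<in> {lo..hi} \<Longrightarrow> (\<And>i. i \<in> I \<Longrightarrow> \<bar>w i - z i\<bar> \<le> s) \<Longrightarrow>
     (\<And>i. i \<notin> I \<Longrightarrow> w i = z i) \<Longrightarrow> \<bar>f w - f z\<bar> < e"
proof -
  \<comment> \<open>The second factor is enlarged by 1 to hold the perturbed points; the bound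
    \<open>s \<le> 1\<close> keeps them inside.\<close>
  define B where "B = {lo..hi} \<times> {(\<lambda>i. lo i - 1)..(\<lambda>i. hi i + 1)}"
  define P where "P = {p \<in> B. e \<le> \<bar>f (snd p) - f (fst p)\<bar>} \<inter> (\<Inter>i\<in>-I. {p. snd p i = fst p i})"
  define d where "d p = (\<Sum>i\<in>I. \<bar>snd p i - fst p i\<bar>)" for p :: "('i \<Rightarrow> real) \<times> ('i \<Rightarrow> real)"
  have cf: "continuous_on UNIV (\<lambda>p::('i \<Rightarrow> real) \<times> ('i \<Rightarrow> real). f (snd p))"
     "continuous_on UNIV (\<lambda>p::('i \<Rightarrow> real) \<times> ('i \<Rightarrow> real). f (fst p))"
    using continuous_on_compose2[OF cont continuous_on_snd[OF continuous_on_id]]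
      continuous_on_compose2[OF cont continuous_on_fst[OF continuous_on_id]] by simp_all
  have "compact B" unfolding B_def by (intro compact_Times compact_fun_interval)
  moreover have "closed ({p. e \<le> \<bar>f (snd p) - f (fst p)\<bar>} \<inter> (\<Inter>i\<in>-I. {p. snd p i = fst p i}))"
  proof (intro closed_Int closed_INT ballI)
    show "closed {p. e \<le> \<bar>f (snd p) - f (fst p)\<bar>}"
      by (rule closed_Collect_le[OF continuous_on_const continuous_on_rabs[OF continuous_on_diff[OF cf]]])
    show "closed {p :: ('i \<Rightarrow> real) \<times> ('i \<Rightarrow> real). snd p i = fst p i}" for i :: 'i
      by (intro closed_Collect_eq continuous_on_coords)
  qed
  moreover have "P = B \<inter> ({p. e \<le> \<bar>f (snd p) - f (fst p)\<bar>} \<inter> (\<Inter>i\<in>-I. {p. snd p i = fst p i}))"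
    unfolding P_def by auto
  ultimately have cP: "compact P" by (simp add: compact_Int_closed)
  have cd: "continuous_on P d"
    unfolding d_def by (intro continuous_on_sum continuous_on_rabs continuous_on_diff continuous_on_coords)
  obtain m where m: "m > 0" "\<And>p. p \<in> P \<Longrightarrow> m \<le> d p"
  proof (cases "P = {}")
    case True then show ?thesis using that[of 1] by auto
  next
    case False
    then obtain p where p: "p \<in> P" "\<And>q. q \<in> P \<Longrightarrow> d p \<le> d q"
      using continuous_attains_inf[OF cP False cd] by blast
    have "d p \<noteq> 0"
    proof
      assume "d p = 0"
      then have "\<forall>i\<in>I. snd p i = fst p i" using fin unfolding d_def by (subst (asm) sum_nonneg_eq_0_iff) auto
      then have "snd p = fst p" using p(1) unfolding P_def by auto
      then show False using p(1) e unfolding P_def by auto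
    qed
    moreover have "d p \<ge> 0" unfolding d_def by (simp add: sum_nonneg)
    ultimately show ?thesis using that[of "d p"] p(2) by auto
  qed
  define s where "s = min 1 (m / (2 * (real (card I) + 1)))"
  show ?thesis
  proof (rule that[of s])
    show "s > 0" using m by (auto simp: s_def)
    fix z w assume z: "z \<in> {lo..hi}" and w: "\<And>i. i \<in> I \<Longrightarrow> \<bar>w i - z i\<bar> \<le> s" "\<And>i. i \<notin> I \<Longrightarrow> w i = z i"
    show "\<bar>f w - f z\<bar> < e"
    proof (rule ccontr)
      assume n: "\<not> ?thesis"
      have w1: "\<bar>w i - z i\<bar> \<le> 1" for i using w(1)[of i] w(2)[of i] by (cases "i \<in> I") (auto simp: s_def)
      have "lo i - 1 \<le> w i \<and> w i \<le> hi i + 1" for i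
      proof -
        have "lo i \<le> z i" "z i \<le> hi i" using z by (auto simp: le_fun_def)
        then show ?thesis using w1[of i] by linarith
      qed
      then have "(z, w) \<in> P" using z n w(2) unfolding P_def B_def by (auto simp: le_fun_def)
      then have "m \<le> d (z, w)" by (rule m)
      also have "d (z, w) \<le> (\<Sum>i\<in>I. s)" unfolding d_def using w by (intro sum_mono) auto
      also have "\<dots> \<le> real (card I) * (m / (2 * (real (card I) + 1)))"
        by (simp only: s_def sum_constant) (intro mult_left_mono min.cobounded2; simp)
      also have "\<dots> < m"
      proof -
        have "0 \<le> m * real (card I)" using m(1) by simp
        moreover have "m * (2 * (real (card I) + 1)) = m * real (card I) + m * real (card I) + 2 * m"
          by (simp add: algebra_simps)
        ultimately have "real (card I) * m < m * (2 * (real (card I) + 1))"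
          using m(1) unfolding mult.commute[of "real (card I)" m] by linarith
        then show ?thesis by (simp add: divide_less_eq)
      qed
      finally show False by simp
    qed
  qed
qed

text \<open>Derived from Kuhn's combinatorial lemma on a grid over the coordinates in
  \<open>A\<close>, the others being frozen by \<open>lo i = hi i\<close>. Kuhn's lemma supplies a
  small cell in which each component of \<open>G\<close> takes both weak signs, so all components
  are small there, against the positive minimum of their absolute sum.\<close>

lemma poincare_miranda:
  fixes G :: "('i \<Rightarrow> real) \<Rightarrow> 'i \<Rightarrow> real"
  assumes fin: "finite A" and lohi: "\<And>i. i \<in> A \<Longrightarrow> lo i < hi i" "\<And>i. i \<notin> A \<Longrightarrow> lo i = hi i"
    and cont: "\<And>i. i \<in> A \<Longrightarrow> continuous_on UNIV (\<lambda>x. G x i)"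
    and faces: "\<And>x i. x \<in> {lo..hi} \<Longrightarrow> i \<in> A \<Longrightarrow> x i = lo i \<Longrightarrow> G x i \<le> 0"
      "\<And>x i. x \<in> {lo..hi} \<Longrightarrow> i \<in> A \<Longrightarrow> x i = hi i \<Longrightarrow> G x i \<ge> 0"
  shows "\<exists>x\<in>{lo..hi}. \<forall>i\<in>A. G x i = 0"
proof (rule ccontr)
  assume no: "\<not> ?thesis"
  have lohi': "lo i \<le> hi i" for i using lohi[of i] by (cases "i \<in> A") auto
  define N where "N x = (\<Sum>i\<in>A. \<bar>G x i\<bar>)" for x
  have "compact {lo..hi}" by (rule compact_fun_interval)
  moreover have "continuous_on {lo..hi} N"
    unfolding N_def by (intro continuous_on_sum continuous_on_rabs continuous_on_subset[OF cont] subset_UNIV)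
  moreover have "{lo..hi} \<noteq> {}" using lohi' by (auto simp: le_fun_def)
  ultimately obtain x0 where x0: "x0 \<in> {lo..hi}" "\<And>x. x \<in> {lo..hi} \<Longrightarrow> N x0 \<le> N x"
    using continuous_attains_inf[of "{lo..hi}" N] by blast
  have N0: "N x0 > 0"
  proof -
    obtain i where "i \<in> A" "G x0 i \<noteq> 0" using no x0 by blast
    then have "\<bar>G x0 i\<bar> > 0" "\<bar>G x0 i\<bar> \<le> N x0"
      unfolding N_def using fin by (auto intro!: member_le_sum)
    then show ?thesis by linarith
  qed
  \<comment> \<open>Components below \<open>e\<close> in absolute value would have a sum below its
    minimum \<open>N x0\<close>.\<close>
  define e where "e = N x0 / (real (card A) + 1)"
  have e: "e > 0" using N0 by (simp add: e_def)
  have "\<forall>i\<in>A. \<exists>s>0. \<forall>z w. z \<in> {lo..hi} \<longrightarrow> (\<forall>j\<in>A. \<bar>w j - z j\<bar> \<le> s) \<longrightarrow> (\<forall>j. j \<notin> A \<longrightarrow> w j = z j)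
     \<longrightarrow> \<bar>G w i - G z i\<bar> < e"
  proof
    fix i assume "i \<in> A"
    obtain s where "0 < s" "\<And>z w. z \<in> {lo..hi} \<Longrightarrow> (\<And>j. j \<in> A \<Longrightarrow> \<bar>w j - z j\<bar> \<le> s) \<Longrightarrow>
     (\<And>j. j \<notin> A \<Longrightarrow> w j = z j) \<Longrightarrow> \<bar>G w i - G z i\<bar> < e" by (rule small_variation[OF fin cont[OF \<open>i \<in> A\<close>] e, of lo hi]) (rule that; blast)
    then show "\<exists>s>0. \<forall>z w. z \<in> {lo..hi} \<longrightarrow> (\<forall>j\<in>A. \<bar>w j - z j\<bar> \<le> s) \<longrightarrow> (\<forall>j. j \<notin> A \<longrightarrow> w j = z j)
     \<longrightarrow> \<bar>G w i - G z i\<bar> < e" by blast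
  qed
  then obtain s where s': "\<forall>i\<in>A. s i > 0 \<and> (\<forall>z w. z \<in> {lo..hi} \<longrightarrow> (\<forall>j\<in>A. \<bar>w j - z j\<bar> \<le> s i) \<longrightarrow> (\<forall>j. j \<notin> A \<longrightarrow> w j = z j)
     \<longrightarrow> \<bar>G w i - G z i\<bar> < e)"
    unfolding Bex_def by (rule bchoice[THEN exE])
  then have s: "\<And>i. i \<in> A \<Longrightarrow> s i > 0" "\<And>i z w. i \<in> A \<Longrightarrow> z \<in> {lo..hi} \<Longrightarrow> (\<forall>j\<in>A. \<bar>w j - z j\<bar> \<le> s i)
     \<Longrightarrow> (\<forall>j. j \<notin> A \<longrightarrow> w j = z j) \<Longrightarrow> \<bar>G w i - G z i\<bar> < e"
    by blast+
  define s0 where "s0 = Min (insert 1 (s ` A))"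
  have s0: "s0 > 0" "\<And>i. i \<in> A \<Longrightarrow> s0 \<le> s i" using fin s(1) by (auto simp: s0_def)
  define len where "len = (\<Sum>i\<in>A. hi i - lo i)"
  have len: "hi i - lo i \<le> len" if "i \<in> A" for i
    unfolding len_def using that fin lohi' by (intro member_le_sum) auto
  obtain p0 :: nat where p0: "len / s0 < real p0" using reals_Archimedean2 by blast
  define p where "p = Suc p0"
  have p: "p > 0" "len / real p < s0"
  proof -
    show "p > 0" by (simp add: p_def)
    have "len / s0 < real p" using p0 by (simp add: p_def)
    then show "len / real p < s0" using s0(1) \<open>p > 0\<close> by (simp add: field_simps)
  qed
  define n where "n = card A"
  obtain f where f: "bij_betw f {..<n} A"
    using ex_bij_betw_nat_finite[OF fin] unfolding n_def atLeast0LessThan by blast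
  define f' where "f' = the_inv_into {..<n} f"
  have f': "f' i < n" "f (f' i) = i" if "i \<in> A" for i
    using that f unfolding f'_def
    by (auto simp: bij_betw_def f_the_inv_into_f dest: the_inv_into_into[of f "{..<n}" i "{..<n}"])
  have fA: "f k \<in> A" "f' (f k) = k" if "k < n" for k
    using that f unfolding f'_def by (auto simp: bij_betw_def the_inv_into_f_f)
  define pt where "pt x = (\<lambda>i. if i \<in> A then lo i + (hi i - lo i) * real (x (f' i)) / real p else lo i)" for x :: "nat \<Rightarrow> nat"
  have pt_in: "pt x \<in> {lo..hi}" if "\<forall>k<n. x k \<le> p" for x
  proof -
    have "(hi i - lo i) * real (x (f' i)) / real p \<le> hi i - lo i" if "i \<in> A" for i
    proof -
      have "x (f' i) \<le> p" using \<open>\<forall>k<n. x k \<le> p\<close> f'(1)[OF that] by auto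
      then have "(hi i - lo i) * real (x (f' i)) \<le> (hi i - lo i) * real p"
        using lohi'[of i] by (intro mult_left_mono) auto
      then show ?thesis using p(1) by (simp add: divide_le_eq)
    qed
    moreover have "0 \<le> (hi i - lo i) * real (x (f' i)) / real p" for i
      using lohi'[of i] by simp
    ultimately show ?thesis using lohi' unfolding pt_def atLeastAtMost_iff le_fun_def
      by (auto simp: le_diff_eq add.commute)
  qed
  \<comment> \<open>The label is the sign of \<open>G\<close>, overridden on the faces as Kuhn's
    lemma prescribes: 0 where the grid coordinate is 0, and 1 where it is \<open>p\<close>. By the
    face hypotheses the override agrees with the weak sign, which is \<open>lab0\<close> and
    \<open>lab1\<close>.\<close>
  define label where "label x k = (if x k = 0 \<or> (G (pt x) (f k) < 0 \<and> x k \<noteq> p) then 0 else (1::nat))" for x k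
  obtain q where q: "\<forall>k<n. q k < p"
     "\<forall>k<n. \<exists>r s. (\<forall>j<n. q j \<le> r j \<and> r j \<le> q j + 1) \<and> (\<forall>j<n. q j \<le> s j \<and> s j \<le> q j + 1) \<and> label r k \<noteq> label s k"
    by (rule kuhn_lemma[of p n label]) (use p in \<open>auto simp: label_def\<close>)
  have lab0: "G (pt x) (f k) \<le> 0" if "label x k = 0" "\<forall>k<n. x k \<le> p" "k < n" for x k
  proof (cases "x k = 0")
    case True
    then have "pt x (f k) = lo (f k)" using fA[OF that(3)] by (simp add: pt_def)
    then show ?thesis using faces(1) pt_in[OF that(2)] fA[OF that(3)] by blast
  next
    case False then show ?thesis using that(1) by (auto simp: label_def split: if_splits)
  qed
  have lab1: "G (pt x) (f k) \<ge> 0" if "label x k \<noteq> 0" "\<forall>k<n. x k \<le> p" "k < n" for x k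
  proof (cases "x k = p")
    case True
    then have "pt x (f k) = hi (f k)" using fA[OF that(3)] p(1) by (simp add: pt_def)
    then show ?thesis using faces(2) pt_in[OF that(2)] fA[OF that(3)] by blast
  next
    case False then show ?thesis using that(1) by (auto simp: label_def split: if_splits)
  qed
  have lab01: "label x k = 0 \<or> label x k = 1" for x k by (simp add: label_def)
  have q_in: "pt q \<in> {lo..hi}" using pt_in[of q] q(1) by (auto intro: less_imp_le)
  have near: "\<bar>pt r j - pt q j\<bar> \<le> s0" if "\<forall>j<n. q j \<le> r j \<and> r j \<le> q j + 1" "j \<in> A" for r j
  proof -
    have "pt r j - pt q j = (hi j - lo j) * (real (r (f' j)) - real (q (f' j))) / real p"
      using that(2) by (simp add: pt_def diff_divide_distrib right_diff_distrib)
    moreover have "\<bar>real (r (f' j)) - real (q (f' j))\<bar> \<le> 1"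
      using that(1) f'(1)[OF that(2)] by auto
    ultimately have "\<bar>pt r j - pt q j\<bar> \<le> (hi j - lo j) * 1 / real p"
      using lohi'[of j] p(1) by (simp add: abs_mult divide_right_mono mult_left_mono mult_left_le)
    also have "\<dots> \<le> len / real p" using len[OF that(2)] by (simp add: divide_right_mono)
    finally show ?thesis using p(2) by simp
  qed
  have close: "\<bar>G (pt r) i - G (pt q) i\<bar> < e" if "\<forall>j<n. q j \<le> r j \<and> r j \<le> q j + 1" "i \<in> A" for r i
  proof (rule s(2)[OF that(2) q_in])
    show "\<forall>j\<in>A. \<bar>pt r j - pt q j\<bar> \<le> s i"
      using near[OF that(1)] s0(2)[OF that(2)] order_trans by blast
    show "\<forall>j. j \<notin> A \<longrightarrow> pt r j = pt q j" by (simp add: pt_def)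
  qed
  have "\<bar>G (pt q) i\<bar> < e" if i: "i \<in> A" for i
  proof -
    obtain r u where ru: "\<forall>j<n. q j \<le> r j \<and> r j \<le> q j + 1" "\<forall>j<n. q j \<le> u j \<and> u j \<le> q j + 1" "label r (f' i) \<noteq> label u (f' i)"
      using q(2) f'(1)[OF i] by blast
    have le: "\<forall>k<n. r k \<le> p" "\<forall>k<n. u k \<le> p"
    proof -
      have "r k \<le> p" "u k \<le> p" if "k < n" for k
        using ru(1)[rule_format, OF that] ru(2)[rule_format, OF that] q(1)[rule_format, OF that] by linarith+
      then show "\<forall>k<n. r k \<le> p" "\<forall>k<n. u k \<le> p" by blast+
    qed
    have l: "G (pt r) i \<le> 0 \<and> 0 \<le> G (pt u) i \<or> G (pt u) i \<le> 0 \<and> 0 \<le> G (pt r) i"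
      using lab0[OF _ le(1) f'(1)[OF i]] lab0[OF _ le(2) f'(1)[OF i]] lab1[OF _ le(1) f'(1)[OF i]] lab1[OF _ le(2) f'(1)[OF i]]
        ru(3) lab01[of r "f' i"] lab01[of u "f' i"] unfolding f'(2)[OF i] by (cases "label r (f' i) = 0"; cases "label u (f' i) = 0") auto
    show ?thesis
      using l close[OF ru(1) i] close[OF ru(2) i] by arith
  qed
  then have "N (pt q) \<le> (\<Sum>i\<in>A. e)" unfolding N_def by (intro sum_mono) (auto intro: less_imp_le)
  also have "\<dots> < N x0" using N0 by (simp add: e_def field_simps)
  finally show False using x0(2)[OF q_in] by simp
qed

section \<open>A linking argument\<close>

text \<open>If the gradient had norm at least \<open>\<epsilon>\<close> near \<open>S ` Q\<close>, small normalised Euler steps would push the sheet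
  \<open>S\<close> down. By Poincare--Miranda the moved sheet always meets \<open>F = 0\<close>, and it cannot leave \<open>\<mu> < 0\<close> because
  \<open>\<Phi> > c1\<close> on the barrier \<open>\<mu> = 0\<close>; so \<open>\<Phi> \<ge> c0\<close> persists somewhere, against a descent of more than
  \<open>c1 - c0\<close> over the distance \<open>D\<close>.\<close>

lemma linking_descent:
  fixes \<Phi> :: "('i \<Rightarrow> real) \<Rightarrow> real" and g :: "'i \<Rightarrow> ('i \<Rightarrow> real) \<Rightarrow> real"
    and S F :: "('i \<Rightarrow> real) \<Rightarrow> 'i \<Rightarrow> real" and \<mu> :: "('i \<Rightarrow> real) \<Rightarrow> real"
  assumes fin: "finite I" and AI: "A \<subseteq> I" and Rpos: "\<And>i. i \<in> A \<Longrightarrow> R i > 0"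
    and deriv: "\<And>z w x. ((\<lambda>x. \<Phi> (\<lambda>i. z i + x * w i)) has_real_derivative
       (\<Sum>i\<in>I. g i (\<lambda>i. z i + x * w i) * w i)) (at x)"
    and contg: "\<And>i. i \<in> I \<Longrightarrow> continuous_on UNIV (g i)"
    and contS: "\<And>i. continuous_on UNIV (\<lambda>\<sigma>. S \<sigma> i)"
    and contF: "\<And>i. i \<in> A \<Longrightarrow> continuous_on UNIV (\<lambda>z. F z i)"
    and cont\<mu>: "continuous_on UNIV \<mu>"
    and Q_def: "Q = {\<sigma>. \<forall>i. if i \<in> A then \<bar>\<sigma> i\<bar> \<le> 2 * R i else \<sigma> i = 0}"
    and supp: "\<And>\<sigma> i. i \<notin> I \<Longrightarrow> S \<sigma> i = 0"
    and face_hi: "\<And>\<sigma> i. \<sigma> \<in> Q \<Longrightarrow> i \<in> A \<Longrightarrow> \<sigma> i = 2 * R i \<Longrightarrow> F (S \<sigma>) i \<ge> 0"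
    and face_lo: "\<And>\<sigma> i. \<sigma> \<in> Q \<Longrightarrow> i \<in> A \<Longrightarrow> \<sigma> i = - 2 * R i \<Longrightarrow> F (S \<sigma>) i \<le> 0"
    and init: "\<And>\<sigma>. \<sigma> \<in> Q \<Longrightarrow> \<forall>i\<in>A. F (S \<sigma>) i = 0 \<Longrightarrow> \<mu> (S \<sigma>) < 0"
    and upper: "\<And>\<sigma>. \<sigma> \<in> Q \<Longrightarrow> \<Phi> (S \<sigma>) \<le> c1"
    and low: "\<And>\<sigma> i. \<sigma> \<in> Q \<Longrightarrow> i \<in> A \<Longrightarrow> \<bar>\<sigma> i\<bar> > R i \<Longrightarrow> \<Phi> (S \<sigma>) < c0 \<or>
        (\<forall>z. (\<forall>k\<in>I. \<bar>z k - S \<sigma> k\<bar> \<le> D) \<longrightarrow> (\<exists>i\<in>A. F z i \<noteq> 0))"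
    and Gam: "\<And>z. \<forall>i\<in>A. F z i = 0 \<Longrightarrow> \<mu> z \<le> 0 \<Longrightarrow> c0 \<le> \<Phi> z"
    and Gam0: "\<And>z. \<forall>i\<in>A. F z i = 0 \<Longrightarrow> \<mu> z = 0 \<Longrightarrow> c1 < \<Phi> z"
    and eps: "\<epsilon> > 0" and D: "D > 0" "D * \<epsilon> > 2 * (c1 - c0)"
  shows "\<exists>\<sigma>\<in>Q. \<exists>z. (\<forall>k\<in>I. \<bar>z k - S \<sigma> k\<bar> \<le> D) \<and> L2_set (\<lambda>i. g i z) I < \<epsilon>"
proof (rule ccontr)
  assume no: "\<not> ?thesis"
  have big: "L2_set (\<lambda>i. g i z) I \<ge> \<epsilon>" if "\<sigma> \<in> Q" "\<And>k. k \<in> I \<Longrightarrow> \<bar>z k - S \<sigma> k\<bar> \<le> D" for \<sigma> z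
  proof (rule ccontr)
    assume "\<not> ?thesis"
    then show False using no that unfolding not_le by blast
  qed
  define lo where "lo i = (if i \<in> A then - 2 * R i else 0)" for i
  define hi where "hi i = (if i \<in> A then 2 * R i else 0)" for i
  have Q: "Q = {lo..hi}"
  proof -
    have "(if i \<in> A then \<bar>\<sigma> i\<bar> \<le> 2 * R i else \<sigma> i = 0) \<longleftrightarrow> lo i \<le> \<sigma> i \<and> \<sigma> i \<le> hi i" for i \<sigma>
      by (auto simp: lo_def hi_def abs_le_iff)
    then show ?thesis unfolding Q_def by (auto simp: le_fun_def)
  qed
  have "\<exists>b. \<forall>\<sigma>\<in>Q. \<bar>S \<sigma> k\<bar> \<le> b" for k
  proof -
    have "compact ((\<lambda>\<sigma>. S \<sigma> k) ` Q)"
      unfolding Q by (intro compact_continuous_image compact_fun_interval continuous_on_subset[OF contS] subset_UNIV)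
    then have "bounded ((\<lambda>\<sigma>. S \<sigma> k) ` Q)" by (rule compact_imp_bounded)
    then show ?thesis unfolding bounded_iff by (simp only: ball_simps real_norm_def)
  qed
  then have "\<exists>b. \<forall>k. \<forall>\<sigma>\<in>Q. \<bar>S \<sigma> k\<bar> \<le> b k" by (rule choice[OF allI])
  then obtain b where b: "\<And>k \<sigma>. \<sigma> \<in> Q \<Longrightarrow> \<bar>S \<sigma> k\<bar> \<le> b k" by blast
  \<comment> \<open>The box \<open>{lo2..hi2}\<close> contains every deformed point within
    \<open>D\<close> of the sheet, so one modulus of continuity of the gradient serves all Euler
    steps.\<close>
  define lo2 where "lo2 k = (if k \<in> I then - b k - D else 0)" for k
  define hi2 where "hi2 k = (if k \<in> I then b k + D else 0)" for k
  \<comment> \<open>Summed over \<open>I\<close>, the change of the gradient along one step costs at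
    most half of \<epsilon>; the other half remains as descent rate.\<close>
  define e where "e = \<epsilon> / (2 * (real (card I) + 1))"
  have e: "e > 0" using eps by (simp add: e_def)
  have "\<forall>i\<in>I. \<exists>s>0. \<forall>z w. z \<in> {lo2..hi2} \<longrightarrow> (\<forall>j\<in>I. \<bar>w j - z j\<bar> \<le> s) \<longrightarrow> (\<forall>j. j \<notin> I \<longrightarrow> w j = z j)
     \<longrightarrow> \<bar>g i w - g i z\<bar> < e"
  proof
    fix i assume i: "i \<in> I"
    obtain s where "0 < s" "\<And>z w. z \<in> {lo2..hi2} \<Longrightarrow> (\<And>j. j \<in> I \<Longrightarrow> \<bar>w j - z j\<bar> \<le> s) \<Longrightarrow>
     (\<And>j. j \<notin> I \<Longrightarrow> w j = z j) \<Longrightarrow> \<bar>g i w - g i z\<bar> < e"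
      by (rule small_variation[OF fin contg[OF i] e, of lo2 hi2]) (rule that; blast)
    then show "\<exists>s>0. \<forall>z w. z \<in> {lo2..hi2} \<longrightarrow> (\<forall>j\<in>I. \<bar>w j - z j\<bar> \<le> s) \<longrightarrow> (\<forall>j. j \<notin> I \<longrightarrow> w j = z j)
     \<longrightarrow> \<bar>g i w - g i z\<bar> < e" by blast
  qed
  then obtain s' where "\<forall>i\<in>I. s' i > 0 \<and> (\<forall>z w. z \<in> {lo2..hi2} \<longrightarrow> (\<forall>j\<in>I. \<bar>w j - z j\<bar> \<le> s' i) \<longrightarrow> (\<forall>j. j \<notin> I \<longrightarrow> w j = z j)
     \<longrightarrow> \<bar>g i w - g i z\<bar> < e)"
    unfolding Bex_def by (rule bchoice[THEN exE])
  then have s': "\<And>i. i \<in> I \<Longrightarrow> s' i > 0" "\<And>i z w. i \<in> I \<Longrightarrow> z \<in> {lo2..hi2} \<Longrightarrow> (\<forall>j\<in>I. \<bar>w j - z j\<bar> \<le> s' i)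
     \<Longrightarrow> (\<forall>j. j \<notin> I \<longrightarrow> w j = z j) \<Longrightarrow> \<bar>g i w - g i z\<bar> < e"
    by blast+
  define s0 where "s0 = Min (insert 1 (s' ` I))"
  have s0: "s0 > 0" "\<And>i. i \<in> I \<Longrightarrow> s0 \<le> s' i" using fin s'(1) by (auto simp: s0_def)
  obtain K0 :: nat where K0: "D / s0 < real K0" using reals_Archimedean2 by blast
  define K where "K = Suc K0"
  define s where "s = D / real K"
  have s: "s > 0" "s \<le> s0" "real K * s = D"
  proof -
    show "s > 0" "real K * s = D" using D by (simp_all add: s_def K_def)
    have "D \<le> s0 * real K" using K0 s0(1) by (simp add: K_def field_simps)
    then show "s \<le> s0" by (simp add: s_def K_def field_simps)
  qed
  define n where "n z = L2_set (\<lambda>i. g i z) I" for z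
  \<comment> \<open>The maximum with \<epsilon> keeps the direction continuous everywhere; wherever
    a descent is claimed the gradient has norm at least \<epsilon>, and the direction has length
    1.\<close>
  define u where "u z = (\<lambda>i. if i \<in> I then g i z / max \<epsilon> (n z) else 0)" for z
  define st where "st \<tau> z = (\<lambda>i. z i - \<tau> * s * u z i)" for \<tau> z
  have nsq: "(\<Sum>i\<in>I. (g i z)\<^sup>2) = (n z)\<^sup>2" for z
    unfolding n_def L2_set_def by (simp add: sum_nonneg)
  have n0: "n z \<ge> 0" for z unfolding n_def by (rule L2_set_nonneg)
  have gle: "\<bar>g i z\<bar> \<le> n z" if "i \<in> I" for i z
    unfolding n_def using member_le_L2_set[OF fin that, of "\<lambda>i. \<bar>g i z\<bar>"] by (simp add: L2_set_def)
  have ule: "\<bar>u z i\<bar> \<le> 1" for z i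
    using gle[of i z] eps n0[of z] by (auto simp: u_def divide_le_eq)
  have decrease: "\<Phi> (st \<tau> z) \<le> \<Phi> z - \<tau> * s * \<epsilon> / 2"
    if z: "z \<in> {lo2..hi2}" and nz: "n z \<ge> \<epsilon>" and \<tau>: "0 \<le> \<tau>" "\<tau> \<le> 1" for \<tau> z
  proof -
    have uz: "u z i = g i z / n z" if "i \<in> I" for i using that nz by (simp add: u_def max_def)
    have npos: "n z > 0" using nz eps by linarith
    define w where "w i = - u z i" for i
    define \<phi> where "\<phi> x = \<Phi> (\<lambda>i. z i + x * w i) + x * (\<epsilon> / 2)" for x
    have "\<phi> (\<tau> * s) \<le> \<phi> 0"
    proof (rule DERIV_nonpos_imp_nonincreasing[of 0 "\<tau> * s" \<phi>])
      show "0 \<le> \<tau> * s" using \<tau> s by simp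
      fix x assume x: "0 \<le> x" "x \<le> \<tau> * s"
      have xs: "x \<le> s" using x mult_right_mono[OF \<tau>(2), of s] s(1) by linarith
      let ?y = "\<lambda>i. z i + x * w i"
      have d: "(\<phi> has_real_derivative ((\<Sum>i\<in>I. g i ?y * w i) + \<epsilon> / 2)) (at x)"
        unfolding \<phi>_def by (auto intro!: derivative_eq_intros deriv)
      have small: "\<bar>g i ?y - g i z\<bar> < e" if "i \<in> I" for i
      proof (rule s'(2)[OF that z])
        show "\<forall>j\<in>I. \<bar>z j + x * w j - z j\<bar> \<le> s' i"
        proof
          fix j assume "j \<in> I"
          have "\<bar>x * w j\<bar> \<le> x * 1" using ule[of z j] x(1) by (simp add: abs_mult w_def mult_left_le)
          then show "\<bar>z j + x * w j - z j\<bar> \<le> s' i" using xs s(2) s0(2)[OF that] by simp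
        qed
        show "\<forall>j. j \<notin> I \<longrightarrow> z j + x * w j = z j" by (simp add: w_def u_def)
      qed
      have "(\<Sum>i\<in>I. g i ?y * w i) = (\<Sum>i\<in>I. g i z * w i) + (\<Sum>i\<in>I. (g i ?y - g i z) * w i)"
        by (simp add: sum.distrib[symmetric] algebra_simps)
      also have "(\<Sum>i\<in>I. g i z * w i) = - n z"
      proof -
        have "(\<Sum>i\<in>I. g i z * w i) = - ((\<Sum>i\<in>I. (g i z)\<^sup>2) / n z)"
          by (simp add: w_def uz sum_negf sum_divide_distrib power2_eq_square)
        then show ?thesis using npos unfolding nsq by (simp add: power2_eq_square)
      qed
      also have "(\<Sum>i\<in>I. (g i ?y - g i z) * w i) \<le> (\<Sum>i\<in>I. e)"
      proof (rule sum_mono)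
        fix i assume i: "i \<in> I"
        have "(g i ?y - g i z) * w i \<le> \<bar>g i ?y - g i z\<bar> * \<bar>w i\<bar>" by (simp flip: abs_mult)
        also have "\<dots> \<le> e * 1" using small[OF i] ule[of z i] e by (intro mult_mono) (auto simp: w_def)
        finally show "(g i ?y - g i z) * w i \<le> e" by simp
      qed
      also have "(\<Sum>i\<in>I. e) \<le> \<epsilon> / 2" using eps by (simp add: e_def field_simps)
      finally have "(\<Sum>i\<in>I. g i ?y * w i) + \<epsilon> / 2 \<le> 0" using nz by linarith
      then show "\<exists>y. (\<phi> has_real_derivative y) (at x) \<and> y \<le> 0" using d by blast
    qed
    moreover have "(\<lambda>i. z i + \<tau> * s * w i) = st \<tau> z" by (simp add: st_def w_def fun_eq_iff)
    ultimately show ?thesis by (simp add: \<phi>_def)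
  qed
  have iter: "(\<forall>k. \<bar>((st \<tau> ^^ m) (S \<sigma>)) k - S \<sigma> k\<bar> \<le> real m * s) \<and> (\<forall>k. k \<notin> I \<longrightarrow> ((st \<tau> ^^ m) (S \<sigma>)) k = 0) \<and>
      \<Phi> ((st \<tau> ^^ m) (S \<sigma>)) \<le> \<Phi> (S \<sigma>) - real m * (\<tau> * s * \<epsilon> / 2)"
    if \<sigma>: "\<sigma> \<in> Q" and \<tau>: "0 \<le> \<tau>" "\<tau> \<le> 1" and "m \<le> K" for \<sigma> \<tau> m
    using \<open>m \<le> K\<close>
  proof (induction m)
    case 0 then show ?case using supp by simp
  next
    case (Suc m)
    let ?z = "(st \<tau> ^^ m) (S \<sigma>)"
    have IH: "\<bar>?z k - S \<sigma> k\<bar> \<le> real m * s" "k \<notin> I \<longrightarrow> ?z k = 0" for k using Suc by simp_all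
    have IH3: "\<Phi> ?z \<le> \<Phi> (S \<sigma>) - real m * (\<tau> * s * \<epsilon> / 2)" using Suc by simp
    have mD: "real m * s \<le> D" using Suc.prems s(1) unfolding s(3)[symmetric] by (intro mult_right_mono) auto
    have near: "\<bar>?z k - S \<sigma> k\<bar> \<le> D" for k using IH(1)[of k] mD by linarith
    have "n ?z \<ge> \<epsilon>" unfolding n_def by (rule big[OF \<sigma>]) (rule near)
    moreover have "?z \<in> {lo2..hi2}"
      unfolding atLeastAtMost_iff le_fun_def lo2_def hi2_def
    proof (intro conjI allI)
      fix k
      show "(if k \<in> I then - b k - D else 0) \<le> ?z k" "?z k \<le> (if k \<in> I then b k + D else 0)"
        using near[of k] b[OF \<sigma>, of k] IH(2)[of k] by (auto simp: abs_le_iff)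
    qed
    ultimately have "\<Phi> (st \<tau> ?z) \<le> \<Phi> ?z - \<tau> * s * \<epsilon> / 2" using decrease \<tau> by blast
    moreover have "\<bar>st \<tau> ?z k - S \<sigma> k\<bar> \<le> real (Suc m) * s" for k
    proof -
      have "\<bar>\<tau> * s * u ?z k\<bar> \<le> 1 * s * 1"
        unfolding abs_mult using \<tau> s ule[of ?z k] by (intro mult_mono) auto
      then show ?thesis using IH(1)[of k] by (simp add: st_def algebra_simps)
    qed
    moreover have "st \<tau> ?z k = 0" if "k \<notin> I" for k using IH(2)[of k] that by (simp add: st_def u_def)
    moreover have "real (Suc m) * (\<tau> * s * \<epsilon> / 2) = real m * (\<tau> * s * \<epsilon> / 2) + \<tau> * s * \<epsilon> / 2"
      by (simp add: algebra_simps)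
    ultimately have "\<Phi> (st \<tau> ?z) \<le> \<Phi> (S \<sigma>) - real (Suc m) * (\<tau> * s * \<epsilon> / 2)"
      "\<forall>k. \<bar>st \<tau> ?z k - S \<sigma> k\<bar> \<le> real (Suc m) * s" "\<forall>k. k \<notin> I \<longrightarrow> st \<tau> ?z k = 0"
      using IH3 by (linarith, blast, blast)
    then show ?case by simp
  qed
  have cont_n: "continuous_on UNIV n"
    unfolding n_def L2_set_def by (intro continuous_intros contg) auto
  have cont_u: "continuous_on UNIV (\<lambda>z. u z i)" for i
  proof (cases "i \<in> I")
    case True
    then show ?thesis unfolding u_def using eps
      by (simp, intro continuous_on_divide contg continuous_on_max continuous_on_const cont_n)
        (auto simp: max_def split: if_splits)
  qed (simp add: u_def)
  have cont_it: "continuous_on UNIV (\<lambda>p. (st (fst p) ^^ m) (snd p))" for m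
  proof (induction m)
    case (Suc m)
    show ?case
      unfolding funpow.simps o_def st_def[of "fst p" "(st (fst p) ^^ m) (snd p)" for p]
      by (rule continuous_on_coordinatewise_then_product)
        (intro continuous_on_diff continuous_on_mult continuous_on_const continuous_on_fst continuous_on_id
            continuous_on_coord[OF Suc] continuous_on_compose2[OF cont_u Suc] subset_UNIV)
  qed (simp add: continuous_on_snd)
  define cl where "cl x = max 0 (min 1 x)" for x :: real
  have cl: "0 \<le> cl x" "cl x \<le> 1" "x \<le> 0 \<Longrightarrow> cl x = 0" "x \<ge> 1 \<Longrightarrow> cl x = 1" for x by (auto simp: cl_def)
  have cont_cl: "continuous_on UNIV cl" unfolding cl_def
    by (intro continuous_on_max continuous_on_min continuous_on_const continuous_on_id)
  \<comment> \<open>A cut-off on the parameter cube: 1 where all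
    \<open>\<bar>\<sigma> i\<bar> \<le> R i\<close>, and 0 on the boundary. The faces never move, so
    the face conditions for \<open>S\<close> survive the deformation.\<close>
  define ch where "ch \<sigma> = (\<Prod>i\<in>A. cl (2 - \<bar>\<sigma> i\<bar> / R i))" for \<sigma>
  have ch: "0 \<le> ch \<sigma>" "ch \<sigma> \<le> 1" for \<sigma>
    unfolding ch_def by (rule prod_nonneg prod_le_1; simp add: cl)+
  have ch1: "ch \<sigma> = 1" if "\<And>i. i \<in> A \<Longrightarrow> \<bar>\<sigma> i\<bar> \<le> R i" for \<sigma>
    unfolding ch_def by (intro prod.neutral ballI cl(4)) (use that Rpos in \<open>auto simp: divide_le_eq\<close>)
  have finA: "finite A" using fin AI finite_subset by blast
  have ch0: "ch \<sigma> = 0" if "i \<in> A" "\<bar>\<sigma> i\<bar> = 2 * R i" for \<sigma> i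
    unfolding ch_def using that Rpos[of i] finA by (intro prod_zero bexI[of _ i] cl(3)) auto
  define pos where "pos x = (\<lambda>i. x (Some i))" for x :: "'i option \<Rightarrow> real"
  define Z where "Z x = (st (cl (x None) * ch (pos x)) ^^ K) (S (pos x))" for x
  \<comment> \<open>The extra coordinate \<open>None\<close> is the deformation time: on [-1, 0] the
    sheet rests, on [0, 1] the descent is switched on, then it runs in full. The \<open>None\<close>
    component of \<open>G\<close> is -1 at time -1, equals \<mu> on [0, 1] and is 1 at time 2, so
    that Poincare-Miranda applies to parameters and time together.\<close>
  define G where "G x k = (case k of Some i \<Rightarrow> F (Z x) i
     | None \<Rightarrow> (1 - cl (- x None) - cl (x None - 1)) * \<mu> (Z x) + cl (x None - 1) - cl (- x None))" for x k
  have cont_pos: "continuous_on UNIV pos" unfolding pos_def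
    by (rule continuous_on_coordinatewise_then_product) (rule continuous_on_coords)
  have cont_cl': "continuous_on UNIV (\<lambda>x. cl (h x))" if "continuous_on UNIV h" for h :: "('i option \<Rightarrow> real) \<Rightarrow> real"
    by (rule continuous_on_compose2[OF cont_cl that]) simp
  have cont_ch: "continuous_on UNIV (\<lambda>x. ch (pos x))"
    unfolding ch_def
    by (intro continuous_on_prod continuous_intros cont_cl' continuous_on_coord[OF cont_pos])
      (auto dest!: Rpos)
  have contSp: "continuous_on UNIV (\<lambda>x. S (pos x))"
    by (rule continuous_on_coordinatewise_then_product) (rule continuous_on_compose2[OF contS cont_pos], simp)
  have cont_Z: "continuous_on UNIV Z"
  proof -
    have "continuous_on UNIV (\<lambda>x. (cl (x None) * ch (pos x), S (pos x)))"
      by (intro continuous_on_Pair continuous_on_mult cont_cl' continuous_on_coords cont_ch contSp)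
    from continuous_on_compose2[OF cont_it this] show ?thesis by (simp add: Z_def)
  qed
  define lo' where "lo' k = (case k of Some i \<Rightarrow> lo i | None \<Rightarrow> - 1)" for k
  define hi' where "hi' k = (case k of Some i \<Rightarrow> hi i | None \<Rightarrow> 2)" for k
  have posQ: "pos x \<in> Q" if "x \<in> {lo'..hi'}" for x
  proof -
    have "lo i \<le> pos x i \<and> pos x i \<le> hi i" for i
    proof -
      have "lo' (Some i) \<le> x (Some i)" "x (Some i) \<le> hi' (Some i)" using that by (auto simp: le_fun_def)
      then show ?thesis by (simp add: lo'_def hi'_def pos_def)
    qed
    then show ?thesis unfolding Q by (auto simp: le_fun_def)
  qed
  have Z_face: "Z x = S (pos x)" if "i \<in> A" "\<bar>pos x i\<bar> = 2 * R i" for x i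
  proof -
    have "st 0 = id" by (simp add: st_def fun_eq_iff)
    then show ?thesis using ch0[of i "pos x", OF that] by (simp add: Z_def)
  qed
  have Z_neg: "Z x = S (pos x)" if "x None \<le> 0" for x
  proof -
    have "st 0 = id" by (simp add: st_def fun_eq_iff)
    then show ?thesis using cl(3)[OF that] by (simp add: Z_def)
  qed
  have contG: "continuous_on UNIV (\<lambda>x. G x k)" if "k \<in> insert None (Some ` A)" for k
  proof (cases k)
    case None
    then show ?thesis unfolding G_def
      by (simp, intro continuous_intros cont_cl' continuous_on_compose2[OF cont\<mu> cont_Z] subset_UNIV)
  next
    case (Some i)
    then have "i \<in> A" using that by auto
    then show ?thesis unfolding G_def Some
      by (simp, intro continuous_on_compose2[OF contF cont_Z] subset_UNIV)
  qed
  have "\<exists>x\<in>{lo'..hi'}. \<forall>k\<in>insert None (Some ` A). G x k = 0"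
  proof (rule poincare_miranda)
    show "finite (insert None (Some ` A))" using finA by simp
    show "lo' k < hi' k" if "k \<in> insert None (Some ` A)" for k
      using that Rpos by (auto simp: lo'_def hi'_def lo_def hi_def)
    show "lo' k = hi' k" if "k \<notin> insert None (Some ` A)" for k
      using that by (cases k) (auto simp: lo'_def hi'_def lo_def hi_def)
    show "continuous_on UNIV (\<lambda>x. G x k)" if "k \<in> insert None (Some ` A)" for k by (rule contG[OF that])
    fix x k assume x: "x \<in> {lo'..hi'}" and k: "k \<in> insert None (Some ` A)"
    show "G x k \<le> 0" if "x k = lo' k"
    proof (cases k)
      case None then show ?thesis using that by (simp add: G_def lo'_def cl_def)
    next
      case (Some i)
      then have i: "i \<in> A" "pos x i = - 2 * R i" using k that by (auto simp: pos_def lo'_def lo_def)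
      then show ?thesis using face_lo[OF posQ[OF x] i] Z_face[OF i(1)] Rpos[of i] by (simp add: G_def Some)
    qed
    show "G x k \<ge> 0" if "x k = hi' k"
    proof (cases k)
      case None then show ?thesis using that by (simp add: G_def hi'_def cl_def)
    next
      case (Some i)
      then have i: "i \<in> A" "pos x i = 2 * R i" using k that by (auto simp: pos_def hi'_def hi_def)
      then show ?thesis using face_hi[OF posQ[OF x] i] Z_face[OF i(1)] Rpos[of i] by (simp add: G_def Some)
    qed
  qed
  then obtain x where x: "x \<in> {lo'..hi'}" and Gx: "\<And>k. k \<in> insert None (Some ` A) \<Longrightarrow> G x k = 0" by blast
  define \<sigma> where "\<sigma> = pos x"
  have \<sigma>: "\<sigma> \<in> Q" using posQ[OF x] by (simp add: \<sigma>_def)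
  have FZ: "\<forall>i\<in>A. F (Z x) i = 0"
  proof
    fix i assume "i \<in> A"
    then show "F (Z x) i = 0" using Gx[of "Some i"] by (simp add: G_def)
  qed
  have mZ: "(1 - cl (- x None) - cl (x None - 1)) * \<mu> (Z x) + cl (x None - 1) - cl (- x None) = 0"
    using Gx[of None] by (simp add: G_def)
  define \<tau> where "\<tau> = cl (x None) * ch \<sigma>"
  have \<tau>: "0 \<le> \<tau>" "\<tau> \<le> 1" using cl[of "x None"] ch[of \<sigma>] by (auto simp: \<tau>_def mult_le_one)
  have Zx: "Z x = (st \<tau> ^^ K) (S \<sigma>)" by (simp add: Z_def \<tau>_def \<sigma>_def)
  have Zd: "\<bar>Z x k - S \<sigma> k\<bar> \<le> D" for k using iter[OF \<sigma> \<tau> order_refl] s(3) by (simp add: Zx)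
  have ZP: "\<Phi> (Z x) \<le> \<Phi> (S \<sigma>) - \<tau> * (D * \<epsilon> / 2)"
    using iter[OF \<sigma> \<tau> order_refl] unfolding Zx s(3)[symmetric] by (simp add: algebra_simps)
  have le1: "\<Phi> (Z x) \<le> c1"
    using ZP upper[OF \<sigma>] mult_nonneg_nonneg[OF \<tau>(1), of "D * \<epsilon> / 2"] D(1) eps by simp
  consider "x None < 0" | "0 \<le> x None" "x None \<le> 1" | "x None > 1" by linarith
  then show False
  proof cases
    case 1
    have "\<mu> (Z x) < 0" using init[OF \<sigma>] FZ Z_neg[of x] 1 by (simp add: \<sigma>_def)
    moreover have "cl (- x None) > 0" "cl (- x None) \<le> 1" "cl (x None - 1) = 0" using 1 by (auto simp: cl_def)
    moreover have "(1 - cl (- x None)) * \<mu> (Z x) \<le> 0"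
      using calculation by (intro mult_nonneg_nonpos) auto
    moreover have "(1 - cl (- x None)) * \<mu> (Z x) - cl (- x None) = 0"
      using mZ calculation by simp
    ultimately show False by linarith
  next
    case 2
    \<comment> \<open>While the descent is switched on, the zero found lies on the barrier, where
      \<Phi> exceeds \<open>c1\<close>; but \<Phi> never rises above its initial bound.\<close>
    then have "\<mu> (Z x) = 0" using mZ by (simp add: cl_def)
    then show False using Gam0[OF FZ] le1 by simp
  next
    case 3
    \<comment> \<open>Otherwise \<Phi> is at least \<open>c0\<close> at the moved point. On the
      inner cube the full descent costs more than \<open>c1 - c0\<close>; outside it, hypothesis
      \<open>low\<close> gives the contradiction.\<close>
    have "\<mu> (Z x) > 0"
    proof (rule ccontr)
      assume "\<not> ?thesis"
      then have c0: "c0 \<le> \<Phi> (Z x)" using Gam[OF FZ] by simp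
      show False
      proof (cases "\<forall>i\<in>A. \<bar>\<sigma> i\<bar> \<le> R i")
        case True
        then have "\<tau> = 1" using ch1 cl(4)[of "x None"] 3 by (simp add: \<tau>_def)
        then show False using ZP upper[OF \<sigma>] c0 D(2) by simp
      next
        case False
        then obtain i where i: "i \<in> A" "\<bar>\<sigma> i\<bar> > R i" by force
        from low[OF \<sigma> i] show False
        proof
          assume "\<Phi> (S \<sigma>) < c0"
          then show False using ZP c0 mult_nonneg_nonneg[OF \<tau>(1), of "D * \<epsilon> / 2"] D(1) eps by simp
        next
          assume "\<forall>z. (\<forall>k\<in>I. \<bar>z k - S \<sigma> k\<bar> \<le> D) \<longrightarrow> (\<exists>i\<in>A. F z i \<noteq> 0)"
          then show False using FZ Zd by blast
        qed
      qed
    qed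
    moreover have "cl (x None - 1) > 0" "cl (x None - 1) \<le> 1" "cl (- x None) = 0" using 3 by (auto simp: cl_def)
    moreover have "0 \<le> (1 - cl (x None - 1)) * \<mu> (Z x)"
      using calculation by (intro mult_nonneg_nonneg) auto
    moreover have "(1 - cl (x None - 1)) * \<mu> (Z x) + cl (x None - 1) = 0"
      using mZ calculation by simp
    ultimately show False by linarith
  qed
qed

section \<open>Trigonometric approximation\<close>

text \<open>Modes make half-integer numbers of turns over [0,1] and carry real coefficients. The
  real part is even and the imaginary part odd on [-1,1], so the values at both ends are real: the
  boundary condition for a path between rotated real subspaces.\<close>

inductive trig_real :: "(real \<Rightarrow> complex) \<Rightarrow> bool" where
  zero: "trig_real (\<lambda>t. 0)"
| step: "trig_real f \<Longrightarrow> trig_real (\<lambda>t. of_real c * cis (pi * of_int m * t) + f t)"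

lemma trig_real_add: "trig_real f \<Longrightarrow> trig_real g \<Longrightarrow> trig_real (\<lambda>t. f t + g t)"
proof (induction f rule: trig_real.induct)
  case (step f c m)
  from trig_real.step[OF step.IH[OF step.prems], of c m] show ?case by (simp add: add.assoc)
qed simp

lemma trig_real_scale: "trig_real f \<Longrightarrow> trig_real (\<lambda>t. of_real a * f t)"
proof (induction f rule: trig_real.induct)
  case (step f c m)
  from trig_real.step[OF step.IH, of "a * c" m] show ?case by (simp add: algebra_simps)
qed (simp add: trig_real.zero)

lemma trig_real_shift: "trig_real f \<Longrightarrow> trig_real (\<lambda>t. f t * cis (pi * of_int k * t))"
proof (induction f rule: trig_real.induct)
  case (step f c m)
  have "cis (pi * of_int m * t) * cis (pi * of_int k * t) = cis (pi * of_int (m + k) * t)" for t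
    by (simp add: cis_mult algebra_simps)
  with trig_real.step[OF step.IH, of c "m + k"] show ?case by (simp add: distrib_right mult.assoc)
qed (simp add: trig_real.zero)

lemma trig_real_const: "trig_real (\<lambda>t. of_real c)"
  using trig_real.step[OF trig_real.zero, of c 0] by simp

lemma trig_real_cos: assumes "trig_real f" shows "trig_real (\<lambda>t. f t * of_real (cos (pi * t)))"
proof -
  have "of_real (cos (pi * t)) = of_real (1/2) * cis (pi * of_int 1 * t) + of_real (1/2) * cis (pi * of_int (-1) * t)" for t
    by (simp add: complex_eq_iff)
  note h = this
  have "f t * of_real (cos (pi * t)) = of_real (1/2) * (f t * cis (pi * of_int 1 * t))
     + of_real (1/2) * (f t * cis (pi * of_int (-1) * t))" for t
    by (simp only: h distrib_left mult.left_commute[of "f t"])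
  then show ?thesis
    using trig_real_add[OF trig_real_scale[OF trig_real_shift[OF assms]] trig_real_scale[OF trig_real_shift[OF assms]], of "1/2" 1 "1/2" "-1"]
    by presburger
qed

lemma trig_real_isin: assumes "trig_real f" shows "trig_real (\<lambda>t. f t * (\<i> * of_real (sin (pi * t))))"
proof -
  have "\<i> * of_real (sin (pi * t)) = of_real (1/2) * cis (pi * of_int 1 * t) + of_real (-1/2) * cis (pi * of_int (-1) * t)" for t
    by (simp add: complex_eq_iff)
  note h = this
  have "f t * (\<i> * of_real (sin (pi * t))) = of_real (1/2) * (f t * cis (pi * of_int 1 * t))
     + of_real (-1/2) * (f t * cis (pi * of_int (-1) * t))" for t
    by (simp only: h distrib_left mult.left_commute[of "f t"])
  then show ?thesis
    using trig_real_add[OF trig_real_scale[OF trig_real_shift[OF assms]] trig_real_scale[OF trig_real_shift[OF assms]], of "1/2" 1 "-1/2" "-1"]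
    by presburger
qed

lemma trig_real_poly_cos:
  assumes "real_polynomial_function q" shows "trig_real (\<lambda>t. of_real (q (cos (pi * t))))"
proof -
  obtain a n where q: "q = (\<lambda>x. \<Sum>i\<le>n. a i * x ^ i)"
    using assms unfolding real_polynomial_function_iff_sum by blast
  have pw: "trig_real (\<lambda>t. of_real (cos (pi * t) ^ i))" for i
  proof (induction i)
    case 0 show ?case using trig_real_const[of 1] by simp
  next
    case (Suc i) show ?case using trig_real_cos[OF Suc] by (simp add: mult.commute)
  qed
  show ?thesis unfolding q
  proof (induction n)
    case 0 show ?case using trig_real_const[of "a 0"] by simp
  next
    case (Suc n)
    show ?case using trig_real_add[OF Suc trig_real_scale[OF pw, of "a (Suc n)" "Suc n"]] by simp
  qed
qed

lemma trig_real_sum: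
  assumes "trig_real f"
  obtains n :: nat and c where "f = (\<lambda>t. \<Sum>m\<in>{- int n..int n}. of_real (c m) * cis (pi * of_int m * t))"
    "\<And>m. m \<notin> {- int n..int n} \<Longrightarrow> c m = (0::real)"
proof -
  have "\<exists>n c. f = (\<lambda>t. \<Sum>m\<in>{- int n..int n}. of_real (c m) * cis (pi * of_int m * t))
      \<and> (\<forall>m. m \<notin> {- int n..int n} \<longrightarrow> c m = (0::real))"
    using assms
  proof (induction f rule: trig_real.induct)
    case zero show ?case by (rule exI[of _ 0], rule exI[of _ "\<lambda>_. 0"]) auto
  next
    case (step f a k)
    then obtain n c where f: "f = (\<lambda>t. \<Sum>m\<in>{- int n..int n}. of_real (c m) * cis (pi * of_int m * t))"
      and c: "\<And>m. m \<notin> {- int n..int n} \<Longrightarrow> c m = (0::real)" by blast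
    define N where "N = max n (nat \<bar>k\<bar>)"
    define c' where "c' m = c m + (if m = k then a else 0)" for m
    have k: "k \<in> {- int N..int N}" by (auto simp: N_def)
    have sub: "{- int n..int n} \<subseteq> {- int N..int N}" by (auto simp: N_def)
    have "of_real a * cis (pi * of_int k * t) + f t = (\<Sum>m\<in>{- int N..int N}. of_real (c' m) * cis (pi * of_int m * t))" for t
    proof -
      have "f t = (\<Sum>m\<in>{- int N..int N}. of_real (c m) * cis (pi * of_int m * t))"
        unfolding f using c by (intro sum.mono_neutral_left[OF _ sub]) auto
      moreover have "(\<Sum>m\<in>{- int N..int N}. of_real (if m = k then a else 0) * cis (pi * of_int m * t))
         = of_real a * cis (pi * of_int k * t)"
        using k by (subst sum.remove[OF _ k]) (auto intro!: sum.neutral)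
      ultimately show ?thesis by (simp add: c'_def distrib_right sum.distrib del: of_real_eq_0_iff)
    qed
    moreover have "\<forall>m. m \<notin> {- int N..int N} \<longrightarrow> c' m = 0" using c sub k by (auto simp: c'_def)
    ultimately show ?case by (intro exI[of _ N] exI[of _ c']) auto
  qed
  then show ?thesis using that by blast
qed

text \<open>The substitution \<open>s = cos (pi * t)\<close>, a homeomorphism from [0,1] to [-1,1],
  reduces this to Weierstrass' theorem.\<close>

lemma cos_poly_approx:
  assumes "continuous_on {0..1} (g :: real \<Rightarrow> real)" "e > 0"
  obtains q where "real_polynomial_function q" "\<And>t. t \<in> {0..1} \<Longrightarrow> \<bar>g t - q (cos (pi * t))\<bar> < e"
proof -
  have "continuous_on {-1..1} (\<lambda>s. g (arccos s / pi))"
    by (rule continuous_on_compose2[OF assms(1)])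
      (auto intro!: continuous_intros simp: arccos_lbound arccos_ubound)
  from Stone_Weierstrass_real_polynomial_function[OF compact_Icc this assms(2)]
  obtain q where q: "real_polynomial_function q" "\<And>s. s \<in> {-1..1} \<Longrightarrow> \<bar>g (arccos s / pi) - q s\<bar> < e"
    by blast
  show ?thesis
  proof (rule that[OF q(1)])
    fix t :: real assume t: "t \<in> {0..1}"
    have "arccos (cos (pi * t)) = pi * t" using t by (intro arccos_cos) auto
    then show "\<bar>g t - q (cos (pi * t))\<bar> < e" using q(2)[of "cos (pi * t)"] by simp
  qed
qed

text \<open>The real part is approximated by a cosine polynomial. The imaginary part has to be
  divided by \<open>sin (pi * t)\<close>, which vanishes at the ends; the quotient is truncated
  there. Since \<open>G\<close> need not be real at the ends, the resulting error is small only in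
  mean square.\<close>

lemma trig_real_dense:
  assumes G: "continuous_on {0..1} (G :: real \<Rightarrow> complex)" and e: "e > 0"
  obtains f where "trig_real f" "integral {0..1} (\<lambda>t. (cmod (G t - f t))\<^sup>2) < e"
proof -
  have "compact ((\<lambda>t. \<bar>Im (G t)\<bar>) ` {0..1})" using G by (intro compact_continuous_image continuous_intros) auto
  then obtain B where B: "\<And>t. t \<in> {0..1} \<Longrightarrow> \<bar>Im (G t)\<bar> \<le> B"
    unfolding compact_eq_bounded_closed bounded_iff by force
  have B0: "B \<ge> 0" using B[of 0] by simp
  \<comment> \<open>The squared relative error of replacing the denominator
    \<open>sin (pi * t)\<close> by its maximum with 1 / n. It tends to the indicator of the end
    points, whose integral is 0.\<close>
  define E where "E n t = (max 0 (1 - real n * sin (pi * t)))\<^sup>2" for n t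
  define g where "g t = (if sin (pi * t) = 0 then 1 else (0::real))" for t :: real
  have sin0: "0 \<le> sin (pi * t)" if "t \<in> {0..1}" for t
    using that by (intro sin_ge_zero) (auto simp: mult_left_le)
  have contE: "continuous_on {0..1} (E n)" for n unfolding E_def by (intro continuous_intros)
  have E1: "E n t \<le> 1" "0 \<le> E n t" if "t \<in> {0..1}" for n t
  proof -
    have "max 0 (1 - real n * sin (pi * t)) \<le> 1" using sin0[OF that] by simp
    then show "E n t \<le> 1" unfolding E_def by (intro power_le_one) auto
    show "0 \<le> E n t" by (simp add: E_def)
  qed
  have limE: "(\<lambda>n. E n t) \<longlonglongrightarrow> g t" if t: "t \<in> {0..1}" for t
  proof (cases "sin (pi * t) = 0")
    case True then show ?thesis by (simp add: E_def g_def)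
  next
    case False
    then have s: "sin (pi * t) > 0" using sin0[OF t] by simp
    obtain N :: nat where N: "1 / sin (pi * t) < real N" using reals_Archimedean2 by blast
    have "E n t = 0" if "n \<ge> N" for n
    proof -
      have "1 < real N * sin (pi * t)" using N s by (simp add: divide_less_eq)
      also have "\<dots> \<le> real n * sin (pi * t)" using that s by simp
      finally show ?thesis by (simp add: E_def)
    qed
    then have "\<forall>\<^sub>F n in sequentially. E n t = 0" by (auto simp: eventually_sequentially)
    then have "(\<lambda>n. E n t) \<longlonglongrightarrow> 0" by (rule tendsto_eventually)
    then show ?thesis using False by (simp add: g_def)
  qed
  have "(\<lambda>n. integral {0..1} (E n)) \<longlonglongrightarrow> integral {0..1} g"
  proof (rule dominated_convergence)
    show "E n integrable_on {0..1}" for n using contE by (rule integrable_continuous_real)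
    show "(\<lambda>t::real. 1::real) integrable_on {0..1}" by (intro integrable_continuous_real continuous_on_const)
    show "norm (E n t) \<le> 1" if "t \<in> {0..1}" for n t using E1[OF that] by simp
    show "(\<lambda>n. E n t) \<longlonglongrightarrow> g t" if "t \<in> {0..1}" for t by (rule limE[OF that])
  qed
  moreover have "integral {0..1} g = 0"
  proof -
    have "integral {0..1::real} (\<lambda>t. 0::real) = integral {0..1} g"
    proof (rule integral_spike[where S = "{0, 1 :: real}"])
      show "negligible {0, 1::real}" by simp
      fix t :: real assume t: "t \<in> {0..1} - {0, 1}"
      then have "sin (pi * t) > 0" by (intro sin_gt_zero) auto
      then show "g t = 0" by (simp add: g_def)
    qed
    then show ?thesis by simp
  qed
  ultimately have limI: "(\<lambda>n. integral {0..1} (E n)) \<longlonglongrightarrow> 0" by simp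
  define \<eta> where "\<eta> = min 1 (e / 8)"
  have \<eta>: "\<eta> > 0" "3 * \<eta>\<^sup>2 < e / 2"
  proof -
    show "\<eta> > 0" using e by (simp add: \<eta>_def)
    have "\<eta>\<^sup>2 \<le> \<eta> * 1" unfolding power2_eq_square using \<open>\<eta> > 0\<close> by (intro mult_left_mono) (auto simp: \<eta>_def)
    also have "\<dots> \<le> e / 8" by (simp add: \<eta>_def)
    finally show "3 * \<eta>\<^sup>2 < e / 2" using e by simp
  qed
  have "e / (4 * B\<^sup>2 + 4) > 0" using e by (intro divide_pos_pos) (auto intro: add_nonneg_pos)
  then have "\<forall>\<^sub>F n in sequentially. integral {0..1} (E n) < e / (4 * B\<^sup>2 + 4)"
    using limI order_tendstoD(2) by blast
  then obtain n0 where n0: "\<And>n. n \<ge> n0 \<Longrightarrow> integral {0..1} (E n) < e / (4 * B\<^sup>2 + 4)"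
    unfolding eventually_sequentially by blast
  define n where "n = max 1 n0"
  have n: "integral {0..1} (E n) < e / (4 * B\<^sup>2 + 4)" "n \<ge> 1" using n0 by (auto simp: n_def)
  define k where "k t = Im (G t) / max (1 / real n) (sin (pi * t))" for t
  have mx: "max (1 / real n) (sin (pi * t)) > 0" for t using n(2) by (simp add: less_max_iff_disj)
  have contk: "continuous_on {0..1} k"
    unfolding k_def using G mx by (intro continuous_intros) (auto simp: less_imp_neq[symmetric])
  obtain q1 where q1: "real_polynomial_function q1" "\<And>t. t \<in> {0..1} \<Longrightarrow> \<bar>Re (G t) - q1 (cos (pi * t))\<bar> < \<eta>"
    by (rule cos_poly_approx[of "\<lambda>t. Re (G t)" \<eta>]) (use G \<eta> in \<open>auto intro: continuous_intros\<close>)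
  obtain q2 where q2: "real_polynomial_function q2" "\<And>t. t \<in> {0..1} \<Longrightarrow> \<bar>k t - q2 (cos (pi * t))\<bar> < \<eta>"
    by (rule cos_poly_approx[OF contk \<eta>(1)]) blast
  define f where "f t = of_real (q1 (cos (pi * t))) + of_real (q2 (cos (pi * t))) * (\<i> * of_real (sin (pi * t)))" for t
  have tf: "trig_real f" unfolding f_def
    by (intro trig_real_add trig_real_isin trig_real_poly_cos q1 q2)
  have bound: "(cmod (G t - f t))\<^sup>2 \<le> 3 * \<eta>\<^sup>2 + 2 * B\<^sup>2 * E n t" if t: "t \<in> {0..1}" for t
  proof -
    define s where "s = sin (pi * t)"
    have s: "0 \<le> s" "s \<le> 1" using sin0[OF t] by (auto simp: s_def)
    have "(cmod (G t - f t))\<^sup>2 = (Re (G t) - q1 (cos (pi * t)))\<^sup>2 + (Im (G t) - q2 (cos (pi * t)) * s)\<^sup>2"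
      by (simp add: cmod_power2 f_def s_def)
    also have "(Re (G t) - q1 (cos (pi * t)))\<^sup>2 \<le> \<eta>\<^sup>2"
      using q1(2)[OF t] by (intro abs_le_square_iff[THEN iffD1]) simp
    also have "(Im (G t) - q2 (cos (pi * t)) * s)\<^sup>2 \<le> 2 * (B\<^sup>2 * E n t) + 2 * \<eta>\<^sup>2"
    proof -
      define a where "a = Im (G t) - k t * s"
      define b where "b = (k t - q2 (cos (pi * t))) * s"
      have "\<bar>b\<bar> \<le> \<eta> * 1" unfolding b_def abs_mult using q2(2)[OF t] s by (intro mult_mono) auto
      then have b: "b\<^sup>2 \<le> \<eta>\<^sup>2" using \<eta>(1) by (intro abs_le_square_iff[THEN iffD1]) simp
      have "a = Im (G t) * max 0 (1 - real n * s)"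
      proof (cases "s \<ge> 1 / real n")
        case True
        then have "real n * s \<ge> 1" "s > 0" using n(2) by (auto simp: divide_le_eq mult.commute intro: less_le_trans[of 0 "1 / real n"])
        then show ?thesis using True by (simp add: a_def k_def s_def[symmetric] max_def)
      next
        case False
        then have "real n * s \<le> 1" using n(2) by (simp add: field_simps)
        then show ?thesis using False n(2) by (simp add: a_def k_def s_def[symmetric] max_def algebra_simps)
      qed
      then have "a\<^sup>2 = (Im (G t))\<^sup>2 * E n t" by (simp add: E_def s_def power_mult_distrib)
      also have "\<dots> \<le> B\<^sup>2 * E n t" using B[OF t] B0 E1[OF t, of n]
        by (intro mult_right_mono abs_le_square_iff[THEN iffD1]) auto
      finally have a: "a\<^sup>2 \<le> B\<^sup>2 * E n t" .
      have "Im (G t) - q2 (cos (pi * t)) * s = a + b" by (simp add: a_def b_def algebra_simps)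
      moreover have "(a + b)\<^sup>2 \<le> 2 * a\<^sup>2 + 2 * b\<^sup>2" using sum_squares_bound[of a b] by (simp add: power2_sum)
      ultimately show ?thesis using a b by simp
    qed
    finally show ?thesis by simp
  qed
  have contf: "continuous_on {0..1} f"
  proof -
    have cq: "continuous_on {0..1} (\<lambda>t. q (cos (pi * t)))" if "real_polynomial_function q" for q :: "real \<Rightarrow> real"
    proof -
      have "continuous_on UNIV q" using that
        by (intro continuous_on_polymonial_function) (simp add: real_polynomial_function_eq)
      then show ?thesis by (rule continuous_on_compose2) (auto intro: continuous_intros)
    qed
    show ?thesis unfolding f_def by (intro continuous_intros cq[OF q1(1)] cq[OF q2(1)])
  qed
  have "integral {0..1} (\<lambda>t. (cmod (G t - f t))\<^sup>2) \<le> integral {0..1} (\<lambda>t. 3 * \<eta>\<^sup>2 + 2 * B\<^sup>2 * E n t)"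
    by (intro integral_le integrable_continuous_real continuous_intros G contf contE bound) auto
  also have "\<dots> = 3 * \<eta>\<^sup>2 + 2 * B\<^sup>2 * integral {0..1} (E n)"
    using integrable_continuous_real[OF contE[of n]] by (subst integral_add) (auto intro!: integrable_on_mult_right)
  also have "\<dots> < e"
  proof -
    have "2 * B\<^sup>2 * integral {0..1} (E n) \<le> 2 * B\<^sup>2 * (e / (4 * B\<^sup>2 + 4))"
      using n(1) by (intro mult_left_mono) auto
    also have "\<dots> \<le> e / 2"
    proof -
      have "4 * B\<^sup>2 + 4 > 0" by (intro add_nonneg_pos) auto
      then show ?thesis using e by (simp add: divide_le_eq algebra_simps)
    qed
    finally show ?thesis using \<eta>(2) by simp
  qed
  finally show ?thesis using that tf by blast
qed

section \<open>Orthogonality, Bessel's inequality and best approximation\<close>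

lemma integral_cos_int: "integral {0..1} (\<lambda>t. cos (pi * of_int k * t)) = (if k = 0 then 1 else (0::real))"
proof (cases "k = 0")
  case False
  have "((\<lambda>t. cos (pi * of_int k * t)) has_integral
      (sin (pi * of_int k * 1) / (pi * of_int k) - sin (pi * of_int k * 0) / (pi * of_int k))) {0..1::real}"
    using False by (intro fundamental_theorem_of_calculus)
      (auto intro!: derivative_eq_intros simp: has_real_derivative_iff_has_vector_derivative[symmetric])
  moreover have "sin (pi * of_int k) = 0" by (simp add: sin_zero_iff_int2)
  ultimately show ?thesis using False by (simp add: integral_unique)
qed simp

text \<open>The modes are orthonormal for the real inner product \<open>Re (cnj u * v)\<close>, by
  the integral of \<open>cos (pi * of_int (m - k) * t)\<close>. Complex orthogonality fails for odd
  \<open>m - k\<close>, hence the restriction to real coefficients. Parseval, Bessel and best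
  approximation are special cases.\<close>

lemma trig_norm_expand:
  fixes S :: "int set" and a :: "int \<Rightarrow> real" and G :: "real \<Rightarrow> complex"
  assumes S: "finite S" and G: "continuous_on {0..1} G"
  shows "integral {0..1} (\<lambda>t. (cmod (G t - (\<Sum>m\<in>S. of_real (a m) * cis (pi * of_int m * t))))\<^sup>2) =
    integral {0..1} (\<lambda>t. (cmod (G t))\<^sup>2)
      - 2 * (\<Sum>m\<in>S. a m * integral {0..1} (\<lambda>t. Re (cnj (G t) * cis (pi * of_int m * t)))) + (\<Sum>m\<in>S. (a m)\<^sup>2)"
proof -
  let ?e = "\<lambda>m t. cis (pi * of_int m * t)"
  have pt: "(cmod (G t - (\<Sum>m\<in>S. of_real (a m) * ?e m t)))\<^sup>2 = (cmod (G t))\<^sup>2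
      - 2 * (\<Sum>m\<in>S. a m * Re (cnj (G t) * ?e m t))
      + (\<Sum>m\<in>S. \<Sum>k\<in>S. a m * a k * cos (pi * of_int (m - k) * t))" for t
  proof -
    let ?T = "\<Sum>m\<in>S. of_real (a m) * ?e m t"
    have "(cmod (G t - ?T))\<^sup>2 = (cmod (G t))\<^sup>2 - 2 * Re (cnj (G t) * ?T) + ((Re ?T)\<^sup>2 + (Im ?T)\<^sup>2)"
      by (simp add: cmod_power2 power2_diff algebra_simps)
    also have "Re (cnj (G t) * ?T) = (\<Sum>m\<in>S. a m * Re (cnj (G t) * ?e m t))"
      by (simp add: sum_distrib_left Re_sum algebra_simps)
    also have "(Re ?T)\<^sup>2 + (Im ?T)\<^sup>2 = (\<Sum>m\<in>S. \<Sum>k\<in>S. a m * a k * cos (pi * of_int (m - k) * t))"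
    proof -
      have "(Re ?T)\<^sup>2 + (Im ?T)\<^sup>2 = (\<Sum>m\<in>S. \<Sum>k\<in>S. a m * a k *
         (cos (pi * of_int m * t) * cos (pi * of_int k * t) + sin (pi * of_int m * t) * sin (pi * of_int k * t)))"
        by (simp add: power2_eq_square sum_product sum.distrib[symmetric] algebra_simps)
      also have "\<dots> = (\<Sum>m\<in>S. \<Sum>k\<in>S. a m * a k * cos (pi * of_int (m - k) * t))"
        by (intro sum.cong refl) (simp add: cos_diff[symmetric] algebra_simps)
      finally show ?thesis .
    qed
    finally show ?thesis .
  qed
  have i1: "(\<lambda>t. (cmod (G t))\<^sup>2) integrable_on {0..1}"
    by (intro integrable_continuous_real continuous_intros G)
  have i2: "(\<lambda>t. Re (cnj (G t) * ?e m t)) integrable_on {0..1}" for m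
    by (intro integrable_continuous_real continuous_intros G)
  have i3: "(\<lambda>t. cos (pi * of_int (m - k) * t)) integrable_on {0..1}" for m k :: int
    by (intro integrable_continuous_real continuous_intros)
  have e3: "integral {0..1} (\<lambda>t. \<Sum>m\<in>S. \<Sum>k\<in>S. a m * a k * cos (pi * of_int (m - k) * t)) = (\<Sum>m\<in>S. (a m)\<^sup>2)"
  proof -
    have "integral {0..1} (\<lambda>t. \<Sum>m\<in>S. \<Sum>k\<in>S. a m * a k * cos (pi * of_int (m - k) * t))
      = (\<Sum>m\<in>S. \<Sum>k\<in>S. a m * a k * (if m - k = 0 then 1 else 0))"
      by (simp only: integral_sum[OF S integrable_sum[OF S integrable_on_mult_right[OF i3]]]
         integral_sum[OF S integrable_on_mult_right[OF i3]] integral_mult_right integral_cos_int)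
    also have "\<dots> = (\<Sum>m\<in>S. (a m)\<^sup>2)"
      using S by (intro sum.cong refl) (simp add: power2_eq_square if_distrib[of "(*) _"] sum.delta cong: if_cong)
    finally show ?thesis .
  qed
  have e2: "integral {0..1} (\<lambda>t. \<Sum>m\<in>S. a m * Re (cnj (G t) * ?e m t))
     = (\<Sum>m\<in>S. a m * integral {0..1} (\<lambda>t. Re (cnj (G t) * ?e m t)))"
    by (simp only: integral_sum[OF S integrable_on_mult_right[OF i2]] integral_mult_right)
  have j2: "(\<lambda>t. 2 * (\<Sum>m\<in>S. a m * Re (cnj (G t) * ?e m t))) integrable_on {0..1}"
    by (intro integrable_on_mult_right integrable_sum S i2)
  have j3: "(\<lambda>t. \<Sum>m\<in>S. \<Sum>k\<in>S. a m * a k * cos (pi * of_int (m - k) * t)) integrable_on {0..1}"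
    by (intro integrable_on_mult_right integrable_sum S i3)
  show ?thesis unfolding pt
    by (simp only: integral_add[OF integrable_diff[OF i1 j2] j3] integral_diff[OF i1 j2] integral_mult_right e2 e3)
qed

definition trig_coeff :: "(real \<Rightarrow> complex) \<Rightarrow> int \<Rightarrow> real" where
  "trig_coeff G m = integral {0..1} (\<lambda>t. Re (cnj (G t) * cis (pi * of_int m * t)))"

lemma trig_parseval:
  assumes "finite S"
  shows "integral {0..1} (\<lambda>t. (cmod (\<Sum>m\<in>S. of_real (a m) * cis (pi * of_int m * t)))\<^sup>2) = (\<Sum>m\<in>S. (a m)\<^sup>2)"
  using trig_norm_expand[OF assms, of "\<lambda>t. 0" a] by simp

lemma trig_projection:
  assumes "finite S" "continuous_on {0..1} G"
  shows "integral {0..1} (\<lambda>t. (cmod (G t - (\<Sum>m\<in>S. of_real (trig_coeff G m) * cis (pi * of_int m * t))))\<^sup>2)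
    = integral {0..1} (\<lambda>t. (cmod (G t))\<^sup>2) - (\<Sum>m\<in>S. (trig_coeff G m)\<^sup>2)"
  using trig_norm_expand[OF assms, of "trig_coeff G"]
  unfolding trig_coeff_def[of G, symmetric] by (simp add: power2_eq_square)

lemma trig_bessel:
  assumes "finite S" "continuous_on {0..1} G"
  shows "(\<Sum>m\<in>S. (trig_coeff G m)\<^sup>2) \<le> integral {0..1} (\<lambda>t. (cmod (G t))\<^sup>2)"
proof -
  have "0 \<le> integral {0..1} (\<lambda>t. (cmod (G t - (\<Sum>m\<in>S. of_real (trig_coeff G m) * cis (pi * of_int m * t))))\<^sup>2)"
    by (intro integral_nonneg integrable_continuous_real continuous_intros assms) auto
  then show ?thesis by (simp add: trig_projection[OF assms])
qed

lemma trig_best_approx: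
  assumes "finite S" "continuous_on {0..1} G"
  shows "integral {0..1} (\<lambda>t. (cmod (G t - (\<Sum>m\<in>S. of_real (trig_coeff G m) * cis (pi * of_int m * t))))\<^sup>2)
    \<le> integral {0..1} (\<lambda>t. (cmod (G t - (\<Sum>m\<in>S. of_real (a m) * cis (pi * of_int m * t))))\<^sup>2)"
proof -
  have "0 \<le> (\<Sum>m\<in>S. (a m - trig_coeff G m)\<^sup>2)" by (intro sum_nonneg) auto
  also have "\<dots> = (\<Sum>m\<in>S. (a m)\<^sup>2) - 2 * (\<Sum>m\<in>S. a m * trig_coeff G m) + (\<Sum>m\<in>S. (trig_coeff G m)\<^sup>2)"
    by (simp add: power2_diff sum.distrib sum_subtractf sum_distrib_left mult.assoc)
  finally show ?thesis
    unfolding trig_projection[OF assms] trig_norm_expand[OF assms, of a] trig_coeff_def[symmetric] by simp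
qed

section \<open>The Galerkin action functional\<close>

text \<open>Turns gradients into Hamiltonian vector fields of \<open>omega0\<close>. With z = q + ip
  it is multiplication by -i, and \<open>rot\<close> is its one-parameter group.\<close>

definition J :: "'a::real_inner \<times> 'a \<Rightarrow> 'a \<times> 'a" where "J v = (snd v, - fst v)"

lemma J_linear: "linear J" by (auto simp: J_def linear_iff)
lemma J_bounded_linear [intro]: "bounded_linear (J :: 'a::euclidean_space \<times> 'a \<Rightarrow> _)"
  using J_linear linear_conv_bounded_linear by blast
lemma J_simps [simp]: "J (J v) = - v" "J 0 = 0" "J (- v) = - J v" "norm (J v) = norm v" "J u \<bullet> J v = u \<bullet> v"
  by (simp_all add: J_def inner_prod_def norm_prod_def add.commute prod_eq_iff)
lemma J_self [simp]: "v \<bullet> J v = 0" by (simp add: J_def inner_prod_def inner_commute)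
lemma J_add: "J (u + v) = J u + J v" and J_diff: "J (u - v) = J u - J v" and J_scale: "J (c *\<^sub>R v) = c *\<^sub>R J v"
  by (simp_all add: J_def)
lemma J_sum: "J (sum f S) = (\<Sum>x\<in>S. J (f x))" using linear_sum[OF J_linear] by metis

lemma continuous_on_J [continuous_intros]:
  "continuous_on S f \<Longrightarrow> continuous_on S (\<lambda>x. J (f x :: 'a::euclidean_space \<times> 'a))"
  by (rule bounded_linear.continuous_on[OF J_bounded_linear])

definition rot :: "real \<Rightarrow> 'a::real_inner \<times> 'a \<Rightarrow> 'a \<times> 'a" where
  "rot \<phi> v = cos \<phi> *\<^sub>R v + sin \<phi> *\<^sub>R J v"

text \<open>The unknowns of the Galerkin problem are real Fourier coefficients, and for each block a
  Lagrange multiplier \<open>Lam j\<close> together with a phase \<open>Del j\<close>.\<close>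

datatype ('b, 'k) coord = Coef int 'b | Lam 'k | Del 'k

text \<open>\<open>frame\<close> is Parseval's identity over the complex numbers; the
  \<open>l b\<close> may be dependent, and real combinations of them may fill complex lines.\<close>

locale symplectic_frame =
  fixes l :: "'b \<Rightarrow> 'a::euclidean_space \<times> 'a" and B :: "'b set" and blk :: "'b \<Rightarrow> 'k::finite"
    and r :: "'k \<Rightarrow> real"
  assumes finB: "finite B"
    and frame: "\<And>f. (\<Sum>b\<in>B. (f \<bullet> l b) *\<^sub>R l b + (f \<bullet> J (l b)) *\<^sub>R J (l b)) = f"
    and rpos: "\<And>j. r j > 0"
    and blk_surj: "\<And>j. \<exists>b\<in>B. blk b = j"
begin

definition blkset :: "'k \<Rightarrow> 'b set" where "blkset j = {b \<in> B. blk b = j}"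

text \<open>The angle is \<open>\<pi>(Lam - Del)\<close> at \<open>t = 0\<close> and \<open>\<pi>(m - Del)\<close> at \<open>t = 1\<close>, so for all values of the
  unknowns each block of a trajectory starts and ends in a common rotation of the real span of its
  frame vectors.\<close>

definition ang :: "(('b, 'k) coord \<Rightarrow> real) \<Rightarrow> int \<Rightarrow> 'b \<Rightarrow> real \<Rightarrow> real" where
  "ang z m b t = pi * ((of_int m - z (Lam (blk b))) * t + z (Lam (blk b)) - z (Del (blk b)))"

definition traj :: "nat \<Rightarrow> 'b set \<Rightarrow> (('b, 'k) coord \<Rightarrow> real) \<Rightarrow> real \<Rightarrow> 'a \<times> 'a" where
  "traj M A z t = (\<Sum>b\<in>A. \<Sum>m\<in>{- int M..int M}. z (Coef m b) *\<^sub>R rot (ang z m b t) (l b))"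

definition coords :: "nat \<Rightarrow> ('b, 'k) coord set" where
  "coords M = (\<lambda>(b, m). Coef m b) ` (B \<times> {- int M..int M}) \<union> range Lam \<union> range Del"

lemma finite_coords: "finite (coords M)" using finB by (simp add: coords_def)

lemma sum_coords: "(\<Sum>i\<in>coords M. f i) = (\<Sum>b\<in>B. \<Sum>m\<in>{- int M..int M}. f (Coef m b)) + (\<Sum>j\<in>UNIV. f (Lam j)) + (\<Sum>j\<in>UNIV. f (Del j))"
proof -
  have "(\<Sum>i\<in>coords M. f i) = (\<Sum>i\<in>(\<lambda>(b, m). Coef m b) ` (B \<times> {- int M..int M}). f i)
      + (\<Sum>i\<in>range Lam. f i) + (\<Sum>i\<in>range Del. f i)"
    unfolding coords_def using finB
    by (subst sum.union_disjoint, simp, simp, force, subst sum.union_disjoint) auto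
  also have "(\<Sum>i\<in>(\<lambda>(b, m). Coef m b) ` (B \<times> {- int M..int M}). f i) = (\<Sum>b\<in>B. \<Sum>m\<in>{- int M..int M}. f (Coef m b))"
    by (subst sum.reindex) (auto simp: inj_on_def sum.cartesian_product case_prod_beta' intro!: sum.cong)
  also have "(\<Sum>i\<in>range Lam. f i) = (\<Sum>j\<in>UNIV. f (Lam j))" by (subst sum.reindex) (auto simp: inj_on_def)
  also have "(\<Sum>i\<in>range Del. f i) = (\<Sum>j\<in>UNIV. f (Del j))" by (subst sum.reindex) (auto simp: inj_on_def)
  finally show ?thesis .
qed

lemma sum_blocks: "(\<Sum>j\<in>UNIV. \<Sum>b\<in>blkset j. f b) = (\<Sum>b\<in>B. f b)"
  using sum.group[OF finB finite, of blk UNIV f] unfolding blkset_def by simp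

lemma sum_blocks': "(\<Sum>b\<in>B. f (blk b) b) = (\<Sum>j\<in>UNIV. \<Sum>b\<in>blkset j. f j b)"
proof -
  have "(\<Sum>j\<in>UNIV. \<Sum>b\<in>blkset j. f j b) = (\<Sum>j\<in>UNIV. \<Sum>b\<in>blkset j. f (blk b) b)"
    by (intro sum.cong refl) (simp add: blkset_def)
  then show ?thesis by (simp add: sum_blocks)
qed

text \<open>Symplectic area with the sphere constraints \<open>\<Sum> z\<^sup>2 = r\<^sub>j\<^sup>2\<close> built in through the multipliers.\<close>

definition action0 :: "nat \<Rightarrow> (('b, 'k) coord \<Rightarrow> real) \<Rightarrow> real" where
  "action0 M z = (\<Sum>b\<in>B. \<Sum>m\<in>{- int M..int M}. pi / 2 * (of_int m - z (Lam (blk b))) * (z (Coef m b))\<^sup>2)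
     + (\<Sum>j\<in>UNIV. pi / 2 * z (Lam j) * (r j)\<^sup>2)"

end

locale frame_hamiltonian = symplectic_frame l B blk r
  for l :: "'b \<Rightarrow> 'a::euclidean_space \<times> 'a" and B and blk :: "'b \<Rightarrow> 'k::finite" and r +
  fixes H :: "real \<Rightarrow> 'a \<times> 'a \<Rightarrow> real" and gH :: "real \<Rightarrow> 'a \<times> 'a \<Rightarrow> 'a \<times> 'a"
  assumes H_deriv: "\<And>t x. t \<in> {0..1} \<Longrightarrow> (H t has_derivative (\<lambda>v. gH t x \<bullet> v)) (at x)"
    and H_cont: "continuous_on ({0..1} \<times> UNIV) (\<lambda>(t, x). H t x)"
    and gH_cont: "continuous_on ({0..1} \<times> UNIV) (\<lambda>(t, x). gH t x)"
begin

definition action :: "nat \<Rightarrow> (('b, 'k) coord \<Rightarrow> real) \<Rightarrow> real" where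
  "action M z = action0 M z - integral {0..1} (\<lambda>t. H t (traj M B z t))"

definition force :: "nat \<Rightarrow> (('b, 'k) coord \<Rightarrow> real) \<Rightarrow> real \<Rightarrow> 'a \<times> 'a" where
  "force M z t = gH t (traj M B z t)"

text \<open>The gradient of \<open>action\<close>, see \<open>action_deriv\<close>. The
  \<open>Coef\<close> entries are the Fourier coefficients of the orbit equation. The
  \<open>Lam\<close> and \<open>Del\<close> entries control the size of a block at its two ends,
  through the weighted and the plain work of the force against rotating the block.\<close>

definition grad :: "nat \<Rightarrow> ('b, 'k) coord \<Rightarrow> (('b, 'k) coord \<Rightarrow> real) \<Rightarrow> real" where
  "grad M i z = (case i of
     Coef m b \<Rightarrow> pi * (of_int m - z (Lam (blk b))) * z (Coef m b)
        - integral {0..1} (\<lambda>t. force M z t \<bullet> rot (ang z m b t) (l b))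
   | Lam j \<Rightarrow> pi / 2 * ((r j)\<^sup>2 - (\<Sum>b\<in>blkset j. \<Sum>m\<in>{- int M..int M}. (z (Coef m b))\<^sup>2))
        - pi * integral {0..1} (\<lambda>t. (1 - t) * (force M z t \<bullet> J (traj M (blkset j) z t)))
   | Del j \<Rightarrow> pi * integral {0..1} (\<lambda>t. force M z t \<bullet> J (traj M (blkset j) z t)))"

lemma cont_ang [continuous_intros]: "continuous_on T (\<lambda>p. ang (fst p) m b (snd p))"
  unfolding ang_def by (intro continuous_intros)

lemma cont_rot [continuous_intros]:
  "continuous_on T f \<Longrightarrow> continuous_on T (\<lambda>p. rot (f p) v)" for v :: "'a \<times> 'a" and T :: "'c::topological_space set"
  unfolding rot_def
  using continuous_on_compose2[OF continuous_on_cos[OF continuous_on_id, of "UNIV :: real set"], of T f]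
    continuous_on_compose2[OF continuous_on_sin[OF continuous_on_id, of "UNIV :: real set"], of T f]
  by (intro continuous_on_add continuous_on_scaleR continuous_on_const) auto

lemma cont_path [continuous_intros]: "continuous_on T (\<lambda>p. traj M A (fst p) (snd p))"
  unfolding traj_def by (intro continuous_intros)

lemma cont_force [continuous_intros]:
  "T \<subseteq> UNIV \<times> {0..1} \<Longrightarrow> continuous_on T (\<lambda>p. force M (fst p) (snd p))"
  unfolding force_def
  using continuous_on_compose2[OF gH_cont continuous_on_Pair[OF continuous_on_snd[OF continuous_on_id] cont_path[of T M B]]]
  by fastforce

lemma cont_H_path [continuous_intros]:
  "T \<subseteq> UNIV \<times> {0..1} \<Longrightarrow> continuous_on T (\<lambda>p. H (snd p) (traj M B (fst p) (snd p)))"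
  using continuous_on_compose2[OF H_cont continuous_on_Pair[OF continuous_on_snd[OF continuous_on_id] cont_path[of T M B]]]
  by fastforce

lemma slice_cont:
  assumes "\<And>T. T \<subseteq> UNIV \<times> {0..1} \<Longrightarrow> continuous_on T (\<lambda>p. F (fst p) (snd p))"
  shows "continuous_on {0..1} (F z)"
proof -
  have "continuous_on {0..1} (\<lambda>t. F (fst (z, t)) (snd (z, t)))"
    by (rule continuous_on_compose2[OF assms[OF order_refl] continuous_on_Pair[OF continuous_on_const continuous_on_id]]) auto
  then show ?thesis by simp
qed

lemma param_cont:
  fixes F :: "(('b, 'k) coord \<Rightarrow> real) \<Rightarrow> real \<Rightarrow> real"
  assumes "\<And>T. T \<subseteq> UNIV \<times> {0..1} \<Longrightarrow> continuous_on T (\<lambda>p. F (fst p) (snd p))"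
  shows "continuous_on UNIV (\<lambda>z. integral {0..1} (F z))"
  using integral_continuous_on_param[of UNIV 0 1 F] assms[OF order_refl]
  by (simp add: case_prod_beta')

lemma grad_cont: "continuous_on UNIV (grad M i)"
proof (cases i)
  case (Coef m b)
  have "continuous_on UNIV (\<lambda>z. integral {0..1} (\<lambda>t. force M z t \<bullet> rot (ang z m b t) (l b)))"
    by (rule param_cont) (intro continuous_intros)
  then show ?thesis unfolding grad_def Coef by (simp, intro continuous_intros)
next
  case (Lam j)
  have "continuous_on UNIV (\<lambda>z. integral {0..1} (\<lambda>t. (1 - t) * (force M z t \<bullet> J (traj M (blkset j) z t))))"
    by (rule param_cont) (intro continuous_intros)
  then show ?thesis unfolding grad_def Lam by (simp, intro continuous_intros) auto
next
  case (Del j)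
  have "continuous_on UNIV (\<lambda>z. integral {0..1} (\<lambda>t. force M z t \<bullet> J (traj M (blkset j) z t)))"
    by (rule param_cont) (intro continuous_intros)
  then show ?thesis unfolding grad_def Del by (simp, intro continuous_intros)
qed

text \<open>The Hamiltonian term is differentiated under the integral sign. Varying a coefficient
  adds a multiple of its mode; varying \<open>Lam j\<close> or \<open>Del j\<close> rotates block
  \<open>j\<close> at speed \<open>pi * (1 - t)\<close> or \<open>- pi\<close>, which produces
  \<open>J (traj ...)\<close>.\<close>

lemma action_deriv:
  "((\<lambda>x. action M (\<lambda>i. z i + x * w i)) has_real_derivative
     (\<Sum>i\<in>coords M. grad M i (\<lambda>i. z i + x * w i) * w i)) (at x)"
proof -
  define Z where "Z x = (\<lambda>i. z i + x * w i)" for x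
  let ?W = "{- int M..int M}"
  \<comment> \<open>The speed of the angle under the variation \<open>w\<close>, common to all modes
    of a block.\<close>
  define wj where "wj b t = pi * ((1 - t) * w (Lam (blk b)) - w (Del (blk b)))" for b t
  define DX where "DX x t = (\<Sum>b\<in>B. \<Sum>m\<in>?W. w (Coef m b) *\<^sub>R rot (ang (Z x) m b t) (l b)
      + (Z x (Coef m b) * wj b t) *\<^sub>R J (rot (ang (Z x) m b t) (l b)))" for x t
  have Zc: "continuous_on T (\<lambda>p. Z (fst p) i)" for T :: "(real \<times> real) set" and i
    unfolding Z_def by (intro continuous_intros)
  have contZ: "continuous_on T (\<lambda>p. (Z (fst p), snd p))" for T :: "(real \<times> real) set"
    by (intro continuous_on_Pair continuous_on_coordinatewise_then_product Zc continuous_on_snd continuous_on_id)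
  have cont_ang': "continuous_on T (\<lambda>p. ang (Z (fst p)) m b (snd p))" for T :: "(real \<times> real) set" and m b
    using continuous_on_compose2[OF cont_ang[of UNIV m b] contZ] by simp
  have contDX: "continuous_on T (\<lambda>p. DX (fst p) (snd p))" for T :: "(real \<times> real) set"
    unfolding DX_def wj_def by (intro continuous_intros Zc cont_ang')
  have cont_f': "continuous_on (UNIV \<times> {0..1}) (\<lambda>p. force M (Z (fst p)) (snd p))"
    using continuous_on_compose2[OF cont_force[of "UNIV \<times> {0..1}" M] contZ[of "UNIV \<times> {0..1}"]] by fastforce
  have dZ: "((\<lambda>x. Z x i) has_real_derivative w i) (at x)" for i x
    unfolding Z_def by (auto intro!: derivative_eq_intros)
  have dang: "((\<lambda>x. ang (Z x) m b t) has_real_derivative wj b t) (at x)" for m b t x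
    unfolding ang_def by (rule derivative_eq_intros dZ refl)+ (simp add: wj_def algebra_simps)
  have dpath: "((\<lambda>x. traj M B (Z x) t) has_vector_derivative DX x t) (at x)" for t x
  proof -
    have drot: "((\<lambda>x. rot (ang (Z x) m b t) (l b)) has_vector_derivative (wj b t *\<^sub>R J (rot (ang (Z x) m b t) (l b)))) (at x)" for m b
      unfolding rot_def J_add J_scale
      by (rule derivative_eq_intros has_vector_derivative_scaleR has_vector_derivative_add dang DERIV_fun_cos DERIV_fun_sin has_vector_derivative_const refl)+
        (simp add: algebra_simps)
    have "((\<lambda>x. Z x (Coef m b) *\<^sub>R rot (ang (Z x) m b t) (l b)) has_vector_derivative
       (w (Coef m b) *\<^sub>R rot (ang (Z x) m b t) (l b) + (Z x (Coef m b) * wj b t) *\<^sub>R J (rot (ang (Z x) m b t) (l b)))) (at x)" for m b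
      using has_vector_derivative_scaleR[OF dZ drot] by (simp add: add.commute)
    then show ?thesis unfolding traj_def DX_def by (intro has_vector_derivative_sum)
  qed
  have dH: "((\<lambda>x. H t (traj M B (Z x) t)) has_real_derivative (force M (Z x) t \<bullet> DX x t)) (at x)" if "t \<in> {0..1}" for t x
  proof -
    have "((\<lambda>x. H t (traj M B (Z x) t)) has_derivative (\<lambda>h. gH t (traj M B (Z x) t) \<bullet> (h *\<^sub>R DX x t))) (at x)"
      using has_derivative_compose[OF dpath[unfolded has_vector_derivative_def] H_deriv[OF that]] .
    then show ?thesis by (simp add: has_field_derivative_def force_def mult.commute[of _ "_ \<bullet> _"])
  qed
  have dint: "((\<lambda>x. integral {0..1} (\<lambda>t. H t (traj M B (Z x) t))) has_real_derivative
      integral {0..1} (\<lambda>t. force M (Z x) t \<bullet> DX x t)) (at x)" for x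
  proof -
    have "((\<lambda>x. integral (cbox 0 1) (\<lambda>t. H t (traj M B (Z x) t))) has_real_derivative
      integral (cbox 0 1) (\<lambda>t. force M (Z x) t \<bullet> DX x t)) (at x within UNIV)"
    proof (rule leibniz_rule_field_derivative)
      show "((\<lambda>x. H t (traj M B (Z x) t)) has_real_derivative (force M (Z x) t \<bullet> DX x t)) (at x within UNIV)"
        if "t \<in> cbox 0 1" for x t using dH[of t x] that by simp
      show "(\<lambda>t. H t (traj M B (Z x) t)) integrable_on cbox 0 1" for x
        using slice_cont[of "\<lambda>z t. H t (traj M B z t)" "Z x"] cont_H_path by (simp add: integrable_continuous_real)
      show "continuous_on (UNIV \<times> cbox 0 1) (\<lambda>(x, t). force M (Z x) t \<bullet> DX x t)"
        using continuous_on_inner[OF cont_f' contDX] by (simp add: case_prod_beta')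
    qed auto
    then show ?thesis by simp
  qed
  have c1: "continuous_on {0..1} (force M (Z x))" for x
    by (rule slice_cont[where F = "force M"]) (intro continuous_intros)
  have c2: "continuous_on {0..1} (\<lambda>t. rot (ang (Z x) m b t) (l b))" for x m b
    by (rule slice_cont[where F = "\<lambda>z t. rot (ang z m b t) (l b)"]) (intro continuous_intros)
  have c3: "continuous_on {0..1} (traj M A (Z x))" for x A
    by (rule slice_cont[where F = "traj M A"]) (intro continuous_intros)
  define f where "f = force M (Z x)"
  define c where "c m b = integral {0..1} (\<lambda>t. f t \<bullet> rot (ang (Z x) m b t) (l b))" for m b
  define pl where "pl j = integral {0..1} (\<lambda>t. (1 - t) * (f t \<bullet> J (traj M (blkset j) (Z x) t)))" for j
  define pd where "pd j = integral {0..1} (\<lambda>t. f t \<bullet> J (traj M (blkset j) (Z x) t))" for j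
  have DXsplit: "f t \<bullet> DX x t = (\<Sum>b\<in>B. \<Sum>m\<in>?W. w (Coef m b) * (f t \<bullet> rot (ang (Z x) m b t) (l b)))
     + (\<Sum>j\<in>UNIV. pi * w (Lam j) * ((1 - t) * (f t \<bullet> J (traj M (blkset j) (Z x) t))))
     - (\<Sum>j\<in>UNIV. pi * w (Del j) * (f t \<bullet> J (traj M (blkset j) (Z x) t)))" for t
  proof -
    have "f t \<bullet> DX x t = (\<Sum>b\<in>B. \<Sum>m\<in>?W. w (Coef m b) * (f t \<bullet> rot (ang (Z x) m b t) (l b)))
      + (\<Sum>b\<in>B. wj b t * (f t \<bullet> J (\<Sum>m\<in>?W. Z x (Coef m b) *\<^sub>R rot (ang (Z x) m b t) (l b))))"
      unfolding DX_def by (simp add: inner_sum_right inner_add_right sum.distrib J_sum J_scale sum_distrib_left mult_ac)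
    also have "(\<Sum>b\<in>B. wj b t * (f t \<bullet> J (\<Sum>m\<in>?W. Z x (Coef m b) *\<^sub>R rot (ang (Z x) m b t) (l b))))
      = (\<Sum>j\<in>UNIV. \<Sum>b\<in>blkset j. pi * ((1 - t) * w (Lam j) - w (Del j)) * (f t \<bullet> J (\<Sum>m\<in>?W. Z x (Coef m b) *\<^sub>R rot (ang (Z x) m b t) (l b))))"
      unfolding wj_def by (rule sum_blocks')
    also have "\<dots> = (\<Sum>j\<in>UNIV. pi * ((1 - t) * w (Lam j) - w (Del j)) * (f t \<bullet> J (traj M (blkset j) (Z x) t)))"
      unfolding traj_def by (simp add: J_sum[of _ "blkset _"] inner_sum_right sum_distrib_left)
    also have "\<dots> = (\<Sum>j\<in>UNIV. pi * w (Lam j) * ((1 - t) * (f t \<bullet> J (traj M (blkset j) (Z x) t))))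
     - (\<Sum>j\<in>UNIV. pi * w (Del j) * (f t \<bullet> J (traj M (blkset j) (Z x) t)))"
      unfolding sum_subtractf[symmetric] by (intro sum.cong refl) (simp add: algebra_simps)
    finally show ?thesis by simp
  qed
  have cf: "continuous_on {0..1} f" unfolding f_def by (rule c1)
  have i1: "(\<lambda>t. f t \<bullet> rot (ang (Z x) m b t) (l b)) integrable_on {0..1}" for m b
    by (intro integrable_continuous_real continuous_on_inner cf c2)
  have i2: "(\<lambda>t. (1 - t) * (f t \<bullet> J (traj M (blkset j) (Z x) t))) integrable_on {0..1}" for j
    by (intro integrable_continuous_real continuous_intros cf c3)
  have i3: "(\<lambda>t. f t \<bullet> J (traj M (blkset j) (Z x) t)) integrable_on {0..1}" for j
    by (intro integrable_continuous_real continuous_intros cf c3)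
  have s1: "((\<lambda>t. \<Sum>b\<in>B. \<Sum>m\<in>?W. w (Coef m b) * (f t \<bullet> rot (ang (Z x) m b t) (l b))) has_integral (\<Sum>b\<in>B. \<Sum>m\<in>?W. w (Coef m b) * c m b)) {0..1}"
    unfolding c_def by (intro has_integral_sum finB has_integral_mult_right integrable_integral i1) auto
  have s2: "((\<lambda>t. \<Sum>j\<in>UNIV. pi * w (Lam j) * ((1 - t) * (f t \<bullet> J (traj M (blkset j) (Z x) t)))) has_integral (\<Sum>j\<in>UNIV. pi * w (Lam j) * pl j)) {0..1}"
    unfolding pl_def by (intro has_integral_sum has_integral_mult_right integrable_integral i2) auto
  have s3: "((\<lambda>t. \<Sum>j\<in>UNIV. pi * w (Del j) * (f t \<bullet> J (traj M (blkset j) (Z x) t))) has_integral (\<Sum>j\<in>UNIV. pi * w (Del j) * pd j)) {0..1}"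
    unfolding pd_def by (intro has_integral_sum has_integral_mult_right integrable_integral i3) auto
  have intDX: "integral {0..1} (\<lambda>t. f t \<bullet> DX x t) = (\<Sum>b\<in>B. \<Sum>m\<in>?W. w (Coef m b) * c m b)
     + (\<Sum>j\<in>UNIV. pi * w (Lam j) * pl j) - (\<Sum>j\<in>UNIV. pi * w (Del j) * pd j)"
    unfolding DXsplit by (intro integral_unique has_integral_diff has_integral_add s1 s2 s3)
  have d0: "((\<lambda>x. action0 M (Z x)) has_real_derivative
     (\<Sum>b\<in>B. \<Sum>m\<in>?W. pi * (of_int m - Z x (Lam (blk b))) * Z x (Coef m b) * w (Coef m b)
         - pi / 2 * w (Lam (blk b)) * (Z x (Coef m b))\<^sup>2) + (\<Sum>j\<in>UNIV. pi / 2 * w (Lam j) * (r j)\<^sup>2)) (at x)"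
    unfolding action0_def
    by (rule derivative_eq_intros dZ refl)+ (simp add: algebra_simps)
  have lamsum: "(\<Sum>b\<in>B. \<Sum>m\<in>?W. pi / 2 * w (Lam (blk b)) * (Z x (Coef m b))\<^sup>2)
     = (\<Sum>j\<in>UNIV. pi / 2 * w (Lam j) * (\<Sum>b\<in>blkset j. \<Sum>m\<in>?W. (Z x (Coef m b))\<^sup>2))"
    by (subst sum_blocks'[where f = "\<lambda>j b. \<Sum>m\<in>?W. pi / 2 * w (Lam j) * (Z x (Coef m b))\<^sup>2"]) (simp add: sum_distrib_left)
  have total: "(\<Sum>b\<in>B. \<Sum>m\<in>?W. pi * (of_int m - Z x (Lam (blk b))) * Z x (Coef m b) * w (Coef m b)
         - pi / 2 * w (Lam (blk b)) * (Z x (Coef m b))\<^sup>2) + (\<Sum>j\<in>UNIV. pi / 2 * w (Lam j) * (r j)\<^sup>2)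
       - integral {0..1} (\<lambda>t. f t \<bullet> DX x t) = (\<Sum>i\<in>coords M. grad M i (Z x) * w i)"
    unfolding sum_coords intDX sum_subtractf lamsum
    by (simp add: grad_def c_def pl_def pd_def f_def left_diff_distrib right_diff_distrib sum_subtractf sum_negf mult_ac)
  have "((\<lambda>x. action M (Z x)) has_real_derivative (\<Sum>i\<in>coords M. grad M i (Z x) * w i)) (at x)"
    unfolding action_def total[symmetric] f_def by (intro DERIV_diff d0 dint)
  then show ?thesis unfolding Z_def .
qed

end

section \<open>Almost critical points\<close>

lemma continuous_on_if_const:
  "continuous_on S f \<Longrightarrow> continuous_on S g \<Longrightarrow> continuous_on S (\<lambda>x. if P then f x else g x)"
  by (cases P) auto

context symplectic_frame begin

lemma blkset_simps: "finite (blkset j)" "b \<in> blkset j \<Longrightarrow> b \<in> B" "b \<in> blkset j \<Longrightarrow> blk b = j" "b \<in> B \<Longrightarrow> b \<in> blkset (blk b)"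
  using finB by (auto simp: blkset_def)

definition blockact :: "nat \<Rightarrow> (('b, 'k) coord \<Rightarrow> real) \<Rightarrow> 'k \<Rightarrow> real" where
  "blockact M z j = (\<Sum>b\<in>blkset j. \<Sum>m\<in>{- int M..int M}. (of_int m - z (Lam j)) * (z (Coef m b))\<^sup>2) + z (Lam j) * (r j)\<^sup>2"

lemma action0_blocks: "action0 M z = pi / 2 * (\<Sum>j\<in>UNIV. blockact M z j)"
proof -
  have "(\<Sum>b\<in>B. \<Sum>m\<in>{- int M..int M}. pi / 2 * (of_int m - z (Lam (blk b))) * (z (Coef m b))\<^sup>2)
     = (\<Sum>j\<in>UNIV. \<Sum>b\<in>blkset j. \<Sum>m\<in>{- int M..int M}. pi / 2 * (of_int m - z (Lam j)) * (z (Coef m b))\<^sup>2)"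
    by (rule sum_blocks')
  then show ?thesis
    unfolding action0_def blockact_def by (simp add: sum.distrib sum_distrib_left distrib_left mult.assoc)
qed

text \<open>On the sheet the multiplier is tied to the zero modes by \<open>lam\<close>, so that
  together they contribute exactly \<open>- (r j)\<^sup>2 * (z (Lam j))\<^sup>2\<close>. With
  \<open>P = z (Lam j) + 1\<close>, a mode \<open>m < 0\<close> has a factor at most
  \<open>- P\<close>. One large coefficient then costs at least \<open>(r j)\<^sup>2\<close>: a zero
  mode forces \<open>z (Lam j) \<ge> 1\<close>, and for a negative mode
  \<open>(P - 1)\<^sup>2 + 2 * P \<ge> 1\<close>.\<close>

lemma block_upper:
  assumes pos: "\<And>m b. m > 0 \<Longrightarrow> b \<in> blkset j \<Longrightarrow> z (Coef m b) = 0"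
    and lam: "z (Lam j) = (\<Sum>b\<in>blkset j. (z (Coef 0 b))\<^sup>2) / (r j)\<^sup>2 - 1"
  shows "blockact M z j \<le> - (r j)\<^sup>2 * (z (Lam j))\<^sup>2"
    and "m0 \<in> {- int M..0} \<Longrightarrow> b0 \<in> blkset j \<Longrightarrow> (z (Coef m0 b0))\<^sup>2 \<ge> 2 * (r j)\<^sup>2 \<Longrightarrow> blockact M z j \<le> - (r j)\<^sup>2"
proof -
  define P where "P = z (Lam j) + 1"
  have r2: "(r j)\<^sup>2 > 0" using rpos[of j] by simp
  have P: "(\<Sum>b\<in>blkset j. (z (Coef 0 b))\<^sup>2) = P * (r j)\<^sup>2" using lam r2 by (simp add: P_def)
  have "0 \<le> P * (r j)\<^sup>2" unfolding P[symmetric] by (intro sum_nonneg) auto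
  then have P0: "P \<ge> 0" using r2 by (simp add: zero_le_mult_iff)
  have gen: "blockact M z j \<le> - (r j)\<^sup>2 * (z (Lam j))\<^sup>2 - (if m0 < 0 \<and> b0 \<in> blkset j \<and> m0 \<in> {- int M..int M} then P * (z (Coef m0 b0))\<^sup>2 else 0)" for m0 b0
  proof -
    define c where "c = (if m0 < 0 \<and> b0 \<in> blkset j \<and> m0 \<in> {- int M..int M} then P * (z (Coef m0 b0))\<^sup>2 else 0)"
    have "(of_int m - z (Lam j)) * (z (Coef m b))\<^sup>2 \<le> (if m = 0 then - z (Lam j) * (z (Coef 0 b))\<^sup>2 else 0)
        - (if b = b0 then (if m = m0 then c else 0) else 0)" if b: "b \<in> blkset j" and m: "m \<in> {- int M..int M}" for m b
    proof -
      consider "m = 0" | "m > 0" | "m < 0" by linarith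
      then show ?thesis
      proof cases
        case 1 then show ?thesis by (simp add: c_def)
      next
        case 2 then show ?thesis using pos[OF 2 b] by (simp add: c_def)
      next
        case 3
        then have "of_int m \<le> (-1::real)" by linarith
        then have "of_int m - z (Lam j) \<le> - P" by (simp add: P_def)
        then have le: "(of_int m - z (Lam j)) * (z (Coef m b))\<^sup>2 \<le> - P * (z (Coef m b))\<^sup>2"
          by (rule mult_right_mono) simp
        have "0 \<le> P * (z (Coef m b))\<^sup>2" using P0 by simp
        then show ?thesis using le 3 b m by (auto simp: c_def)
      qed
    qed
    then have "(\<Sum>b\<in>blkset j. \<Sum>m\<in>{- int M..int M}. (of_int m - z (Lam j)) * (z (Coef m b))\<^sup>2) \<le>
       (\<Sum>b\<in>blkset j. \<Sum>m\<in>{- int M..int M}. (if m = 0 then - z (Lam j) * (z (Coef 0 b))\<^sup>2 else 0)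
        - (if b = b0 then (if m = m0 then c else 0) else 0))"
      by (intro sum_mono) auto
    also have "\<dots> = (\<Sum>b\<in>blkset j. - z (Lam j) * (z (Coef 0 b))\<^sup>2 - (if b = b0 then (if m0 \<in> {- int M..int M} then c else 0) else 0))"
      by (intro sum.cong refl) (simp add: sum_subtractf)
    also have "\<dots> = - z (Lam j) * (P * (r j)\<^sup>2) - (if b0 \<in> blkset j then (if m0 \<in> {- int M..int M} then c else 0) else 0)"
      by (simp add: sum_subtractf blkset_simps sum_distrib_left[symmetric] P[symmetric] sum_negf)
    also have "(if b0 \<in> blkset j then (if m0 \<in> {- int M..int M} then c else 0) else 0) = c" by (auto simp: c_def)
    finally have "(\<Sum>b\<in>blkset j. \<Sum>m\<in>{- int M..int M}. (of_int m - z (Lam j)) * (z (Coef m b))\<^sup>2)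
       \<le> - z (Lam j) * (P * (r j)\<^sup>2) - c" .
    moreover have "- z (Lam j) * (P * (r j)\<^sup>2) + z (Lam j) * (r j)\<^sup>2 = - (r j)\<^sup>2 * (z (Lam j))\<^sup>2"
      by (simp add: P_def algebra_simps power2_eq_square)
    ultimately show ?thesis unfolding blockact_def c_def[symmetric] by linarith
  qed
  show "blockact M z j \<le> - (r j)\<^sup>2 * (z (Lam j))\<^sup>2" using gen[of 0] by simp
  assume m0: "m0 \<in> {- int M..0}" "b0 \<in> blkset j" and big: "(z (Coef m0 b0))\<^sup>2 \<ge> 2 * (r j)\<^sup>2"
  show "blockact M z j \<le> - (r j)\<^sup>2"
  proof (cases "m0 = 0")
    case True
    have "(z (Coef 0 b0))\<^sup>2 \<le> (\<Sum>b\<in>blkset j. (z (Coef 0 b))\<^sup>2)"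
      using m0 by (intro member_le_sum blkset_simps) auto
    then have "2 * (r j)\<^sup>2 \<le> P * (r j)\<^sup>2" using big True P by simp
    then have "1 \<le> z (Lam j)" using r2 by (simp add: P_def)
    then have "1 \<le> (z (Lam j))\<^sup>2" by (simp add: one_le_power)
    then have "(r j)\<^sup>2 * 1 \<le> (r j)\<^sup>2 * (z (Lam j))\<^sup>2" by (intro mult_left_mono) auto
    then show ?thesis using gen[of 0 b0] by simp
  next
    case False
    then have "blockact M z j \<le> - (r j)\<^sup>2 * (z (Lam j))\<^sup>2 - P * (z (Coef m0 b0))\<^sup>2" using gen[of m0 b0] m0 by auto
    also have "\<dots> \<le> - (r j)\<^sup>2 * (z (Lam j))\<^sup>2 - P * (2 * (r j)\<^sup>2)" using big P0 by (simp add: mult_left_mono)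
    also have "\<dots> = - (r j)\<^sup>2 - (r j)\<^sup>2 * P\<^sup>2" by (simp add: P_def power2_eq_square algebra_simps)
    also have "\<dots> \<le> - (r j)\<^sup>2" by simp
    finally show ?thesis .
  qed
qed

text \<open>Positive modes contribute nonnegative amounts because \<open>z (Lam j) \<le> 1\<close>.
  The zero mode of \<open>e\<close> is chosen so that its contribution and the multiplier term add
  up to \<open>(r j)\<^sup>2 * (z (Lam j))\<^sup>2\<close>. Its value \<open>(r j)\<^sup>2\<close>
  at \<open>z (Lam j) = 1\<close> is the origin of the energy bound
  \<open>pi / 2 * (r j)\<^sup>2\<close>.\<close>

lemma block_lower:
  assumes neg: "\<And>m b. m \<in> {- int M..0} \<Longrightarrow> b \<in> blkset j \<Longrightarrow> (m, b) \<noteq> (0, e) \<Longrightarrow> z (Coef m b) = 0"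
    and e: "e \<in> blkset j" "z (Coef 0 e) = r j * sqrt (1 - z (Lam j))" and lam: "z (Lam j) \<le> 1"
  shows "blockact M z j \<ge> (r j)\<^sup>2 * (z (Lam j))\<^sup>2"
proof -
  define c where "c = - z (Lam j) * ((r j)\<^sup>2 * (1 - z (Lam j)))"
  have z0: "(z (Coef 0 e))\<^sup>2 = (r j)\<^sup>2 * (1 - z (Lam j))" using e lam by (simp add: power_mult_distrib)
  have "(if b = e then (if m = 0 then c else 0) else 0) \<le> (of_int m - z (Lam j)) * (z (Coef m b))\<^sup>2"
    if b: "b \<in> blkset j" and m: "m \<in> {- int M..int M}" for m b
  proof (cases "m > 0")
    case True
    then have "of_int m - z (Lam j) \<ge> 0" using lam by linarith
    then show ?thesis using True by simp
  next
    case False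
    show ?thesis
    proof (cases "(m, b) = (0, e)")
      case True then show ?thesis using z0 by (simp add: c_def)
    next
      case nz: False
      then have "z (Coef m b) = 0" using neg b m False by auto
      then show ?thesis using nz by auto
    qed
  qed
  then have "(\<Sum>b\<in>blkset j. \<Sum>m\<in>{- int M..int M}. (if b = e then (if m = 0 then c else 0) else 0)) \<le>
      (\<Sum>b\<in>blkset j. \<Sum>m\<in>{- int M..int M}. (of_int m - z (Lam j)) * (z (Coef m b))\<^sup>2)"
    by (intro sum_mono) auto
  moreover have "(\<Sum>b\<in>blkset j. \<Sum>m\<in>{- int M..int M}. (if b = e then (if m = 0 then c else 0) else 0)) = c"
  proof -
    have "(\<Sum>m\<in>{- int M..int M}. (if b = e then (if m = 0 then c else 0) else 0)) = (if b = e then c else 0)" for b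
      by simp
    then show ?thesis using e(1) by (simp add: blkset_simps)
  qed
  ultimately show ?thesis unfolding blockact_def by (simp add: c_def algebra_simps power2_eq_square)
qed

end

context frame_hamiltonian begin

text \<open>The sheet \<open>S\<close>, parametrised by nonpositive modes and phases, is linked with
  the barrier given by \<open>F = 0\<close> and \<open>\<mu> = 0\<close>: the action is at most
  \<open>c1\<close> on the sheet and, by \<open>gap\<close>, above \<open>c1\<close> on the barrier.
  It is essential that \<Lambda> is chosen before \<open>M\<close>, since the later shift of modes
  must stay bounded while their number grows.\<close>

lemma almost_critical:
  assumes bounds: "\<And>M z. c0 \<le> - integral {0..1} (\<lambda>t. H t (traj M B z t))"
      "\<And>M z. - integral {0..1} (\<lambda>t. H t (traj M B z t)) \<le> c1"
    and gap: "\<And>j. c1 - c0 < pi / 2 * (r j)\<^sup>2" and eps: "\<epsilon> > 0"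
  shows "\<exists>\<Lambda>. \<forall>M. \<exists>z. (\<forall>j. \<bar>z (Lam j)\<bar> \<le> \<Lambda>) \<and> L2_set (\<lambda>i. grad M i z) (coords M) < \<epsilon>"
proof -
  have c01: "c0 \<le> c1" using bounds[of 0 "\<lambda>_. 0"] by linarith
  define D where "D = 2 * (c1 - c0) / \<epsilon> + 1"
  have D: "D > 0" "D * \<epsilon> > 2 * (c1 - c0)" using c01 eps by (auto simp: D_def field_simps intro: add_nonneg_pos)
  \<comment> \<open>On the sheet a multiplier is at most \<open>8 * card B + 1\<close> in absolute
    value, and the point found lies within \<open>D\<close> of the sheet.\<close>
  define \<Lambda> where "\<Lambda> = 8 * real (card B) + 1 + D"
  obtain e where e: "\<And>j. e j \<in> B" "\<And>j. blk (e j) = j" using blk_surj by metis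
  have e': "e j \<in> blkset j" for j using e blkset_simps(4)[of "e j"] by simp
  have "\<exists>z. (\<forall>j. \<bar>z (Lam j)\<bar> \<le> \<Lambda>) \<and> L2_set (\<lambda>i. grad M i z) (coords M) < \<epsilon>" for M
  proof -
    define A :: "('b, 'k) coord set" where "A = (\<lambda>(b, m). Coef m b) ` (B \<times> {- int M..0}) \<union> range Del"
    \<comment> \<open>Beyond \<open>sqrt 2 * r\<close> a coefficient pushes the action below
      \<open>c0\<close>, by \<open>block_upper\<close>; beyond \<open>D + 1\<close> a phase cannot
      come back to 0 within distance \<open>D\<close>. These are the two alternatives of
      \<open>low\<close>.\<close>
    define R where "R i = (case i of Coef m b \<Rightarrow> sqrt 2 * r (blk b) | Lam j \<Rightarrow> 1 | Del j \<Rightarrow> D + 1)" for i :: "('b, 'k) coord"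
    define S where "S \<sigma> i = (case i of Coef m b \<Rightarrow> if i \<in> A then \<sigma> i else 0
       | Lam j \<Rightarrow> (\<Sum>b\<in>blkset j. (\<sigma> (Coef 0 b))\<^sup>2) / (r j)\<^sup>2 - 1 | Del j \<Rightarrow> \<sigma> i)" for \<sigma> i
    \<comment> \<open>At the zero mode of \<open>e\<close> this is the equation of
      \<open>block_lower\<close>, extended continuously by \<open>max 0\<close> to multipliers above
      1.\<close>
    define F where "F z i = (case i of Coef m b \<Rightarrow>
         if m = 0 \<and> b = e (blk b) then z i - r (blk b) * sqrt (max 0 (1 - z (Lam (blk b)))) else z i
       | Lam j \<Rightarrow> 0 | Del j \<Rightarrow> z i)" for z :: "('b, 'k) coord \<Rightarrow> real" and i
    \<comment> \<open>A continuous function that is nonpositive only if every multiplier is at most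
      1, and zero only if moreover one of them equals 1.\<close>
    define \<mu> where "\<mu> z = (\<Sum>j\<in>UNIV. max 0 (z (Lam j) - 1)) - (\<Prod>j\<in>UNIV. max 0 (1 - z (Lam j)))"
      for z :: "('b, 'k) coord \<Rightarrow> real"
    define Q where "Q = {\<sigma>. \<forall>i. if i \<in> A then \<bar>\<sigma> i\<bar> \<le> 2 * R i else \<sigma> i = 0}"
    have AC: "Coef m b \<in> A \<longleftrightarrow> b \<in> B \<and> m \<in> {- int M..0}" "Del j \<in> A" "Lam j \<notin> A" for m b j
      by (auto simp: A_def)
    have r2: "(r j)\<^sup>2 > 0" for j using rpos[of j] by simp
    have Slam: "S \<sigma> (Lam j) = (\<Sum>b\<in>blkset j. (S \<sigma> (Coef 0 b))\<^sup>2) / (r j)\<^sup>2 - 1" for \<sigma> j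
      using blkset_simps by (simp add: S_def AC)
    have Spos: "S \<sigma> (Coef m b) = 0" if "m > 0" for \<sigma> m b using that by (simp add: S_def AC)
    have blk_up: "blockact M (S \<sigma>) j \<le> - (r j)\<^sup>2 * (S \<sigma> (Lam j))\<^sup>2" for \<sigma> j
      by (rule block_upper(1)[OF Spos Slam])
    have blk_up0: "blockact M (S \<sigma>) j \<le> 0" for \<sigma> j
      by (rule order_trans[OF blk_up]) simp
    have \<mu>le: "z (Lam j) \<le> 1" if "\<mu> z \<le> 0" for z j
    proof (rule ccontr)
      assume n: "\<not> ?thesis"
      have "(\<Prod>j\<in>UNIV. max 0 (1 - z (Lam j))) = 0" using n by (intro prod_zero bexI[of _ j]) auto
      moreover have "max 0 (z (Lam j) - 1) \<le> (\<Sum>j\<in>UNIV. max 0 (z (Lam j) - 1))" by (intro member_le_sum) auto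
      ultimately show False using that n unfolding \<mu>_def by linarith
    qed
    have \<mu>0: "\<exists>j. z (Lam j) = 1" if "\<mu> z = 0" for z
    proof -
      have le: "z (Lam j) \<le> 1" for j using \<mu>le that by simp
      have "(\<Sum>j\<in>UNIV. max 0 (z (Lam j) - 1)) = 0" using le by (intro sum.neutral ballI) (simp add: max_absorb1)
      then have "(\<Prod>j\<in>UNIV. max 0 (1 - z (Lam j))) = 0" using that unfolding \<mu>_def by linarith
      then obtain j where "max 0 (1 - z (Lam j)) = 0" unfolding prod_zero_iff[OF finite] by blast
      then show ?thesis using le[of j] by (intro exI[of _ j]) linarith
    qed
    have low_blk: "blockact M z j \<ge> (r j)\<^sup>2 * (z (Lam j))\<^sup>2" if Fz: "\<forall>i\<in>A. F z i = 0" and "\<mu> z \<le> 0" for z j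
    proof (rule block_lower[where e = "e j"])
      show "z (Lam j) \<le> 1" by (rule \<mu>le[OF that(2)])
      then show "z (Coef 0 (e j)) = r j * sqrt (1 - z (Lam j))"
        using Fz[rule_format, of "Coef 0 (e j)"] e by (simp add: AC F_def max_def)
      show "e j \<in> blkset j" by (rule e')
      show "z (Coef m b) = 0" if "m \<in> {- int M..0}" "b \<in> blkset j" "(m, b) \<noteq> (0, e j)" for m b
        using Fz[rule_format, of "Coef m b"] that blkset_simps(2,3)[OF that(2)] by (auto simp: AC F_def)
    qed
    have "\<exists>\<sigma>\<in>Q. \<exists>z. (\<forall>k\<in>coords M. \<bar>z k - S \<sigma> k\<bar> \<le> D) \<and> L2_set (\<lambda>i. grad M i z) (coords M) < \<epsilon>"
    proof (rule linking_descent[where A = A and R = R and \<Phi> = "action M" and F = F and \<mu> = \<mu> and ?c0.0 = c0 and ?c1.0 = c1])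
      show "finite (coords M)" by (rule finite_coords)
      show "A \<subseteq> coords M" by (force simp: A_def coords_def)
      show "R i > 0" if "i \<in> A" for i using that rpos D(1) by (cases i) (auto simp: R_def AC)
      show "((\<lambda>x. action M (\<lambda>i. z i + x * w i)) has_real_derivative
         (\<Sum>i\<in>coords M. grad M i (\<lambda>i. z i + x * w i) * w i)) (at x)" for z w x by (rule action_deriv)
      show "continuous_on UNIV (grad M i)" for i by (rule grad_cont)
      show "continuous_on UNIV (\<lambda>\<sigma>. S \<sigma> i)" for i
      proof (cases i)
        case (Coef m b)
        show ?thesis unfolding S_def Coef
          unfolding coord.case by (intro continuous_on_if_const continuous_intros)
      next
        case (Lam j)
        have "(r j)\<^sup>2 \<noteq> 0" using r2[of j] by simp
        then show ?thesis unfolding S_def Lam coord.case by (intro continuous_intros) auto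
      next
        case (Del j) show ?thesis unfolding S_def Del coord.case by (intro continuous_intros)
      qed
      show "continuous_on UNIV (\<lambda>z. F z i)" for i
      proof (cases i)
        case (Coef m b)
        show ?thesis unfolding F_def Coef
          unfolding coord.case by (intro continuous_on_if_const continuous_intros)
      next
        case (Del j) show ?thesis unfolding F_def Del coord.case by (intro continuous_intros)
      qed (simp add: F_def)
      show "continuous_on UNIV \<mu>" unfolding \<mu>_def by (intro continuous_intros)
      show "S \<sigma> i = 0" if "i \<notin> coords M" for \<sigma> i
        using that by (cases i) (auto simp: S_def A_def coords_def)
      show "Q = {\<sigma>. \<forall>i. if i \<in> A then \<bar>\<sigma> i\<bar> \<le> 2 * R i else \<sigma> i = 0}" by (rule Q_def)
      show "\<epsilon> > 0" "D > 0" "D * \<epsilon> > 2 * (c1 - c0)" by (fact eps, fact D, fact D)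
      show "action M (S \<sigma>) \<le> c1" for \<sigma>
      proof -
        have "action0 M (S \<sigma>) \<le> 0" unfolding action0_blocks
          by (intro mult_nonneg_nonpos sum_nonpos blk_up0) auto
        then show ?thesis using bounds(2)[of M "S \<sigma>"] by (simp add: action_def)
      qed
      show "c0 \<le> action M z" if "\<forall>i\<in>A. F z i = 0" "\<mu> z \<le> 0" for z
      proof -
        have "0 \<le> blockact M z j" for j by (rule order_trans[OF _ low_blk[OF that]]) simp
        then have "0 \<le> action0 M z" unfolding action0_blocks by (intro mult_nonneg_nonneg sum_nonneg) auto
        then show ?thesis using bounds(1)[of M z] by (simp add: action_def)
      qed
      show "c1 < action M z" if F0: "\<forall>i\<in>A. F z i = 0" and z0: "\<mu> z = 0" for z
      proof -
        have \<mu>l: "\<mu> z \<le> 0" using z0 by simp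
        obtain j where j: "z (Lam j) = 1" using \<mu>0[OF z0] by blast
        have nn: "0 \<le> blockact M z j" for j by (rule order_trans[OF _ low_blk[OF F0 \<mu>l]]) simp
        have "(r j)\<^sup>2 \<le> blockact M z j" using low_blk[OF F0 \<mu>l, of j] j by simp
        also have "\<dots> \<le> (\<Sum>j\<in>UNIV. blockact M z j)" by (intro member_le_sum nn) auto
        finally have "pi / 2 * (r j)\<^sup>2 \<le> action0 M z" unfolding action0_blocks by (intro mult_left_mono) auto
        then show ?thesis using bounds(1)[of M z] gap[of j] by (simp add: action_def)
      qed
      fix \<sigma> i assume \<sigma>: "\<sigma> \<in> Q" and i: "i \<in> A"
      have SA: "S \<sigma> i = \<sigma> i" using i by (cases i) (auto simp: S_def AC)
      show "F (S \<sigma>) i \<ge> 0" if hi: "\<sigma> i = 2 * R i"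
      proof (cases i)
        case (Coef m b)
        have Rp: "R i > 0" using rpos by (simp add: R_def Coef)
        show ?thesis
        proof (cases "m = 0 \<and> b = e (blk b)")
          case True
          \<comment> \<open>A zero mode of size \<open>2 * R i\<close> forces the multiplier to be
            at least 1, so that the square root in \<open>F\<close> vanishes.\<close>
          have "(\<sigma> i)\<^sup>2 = 8 * (r (blk b))\<^sup>2" using hi by (simp add: R_def Coef power_mult_distrib)
          moreover have "(\<sigma> i)\<^sup>2 \<le> (\<Sum>b\<in>blkset (blk b). (\<sigma> (Coef 0 b))\<^sup>2)"
            using True i by (intro order_trans[OF _ member_le_sum[of b]]) (auto simp: Coef AC blkset_simps)
          ultimately have "2 * (r (blk b))\<^sup>2 \<le> (\<Sum>b\<in>blkset (blk b). (\<sigma> (Coef 0 b))\<^sup>2)"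
            using r2[of "blk b"] by linarith
          then have "S \<sigma> (Lam (blk b)) \<ge> 1"
            using r2[of "blk b"] by (simp add: S_def le_divide_eq)
          then show ?thesis using True SA hi Rp by (simp add: F_def Coef max_def)
        next
          case False
          then show ?thesis using SA hi Rp by (auto simp: F_def Coef)
        qed
      next
        case (Del j) then show ?thesis using SA hi D(1) by (simp add: F_def R_def)
      qed (simp add: F_def)
      show "F (S \<sigma>) i \<le> 0" if lo: "\<sigma> i = - 2 * R i"
      proof (cases i)
        case (Coef m b)
        have "R i > 0" using rpos by (simp add: R_def Coef)
        moreover have "r (blk b) * sqrt (max 0 (1 - S \<sigma> (Lam (blk b)))) \<ge> 0" using rpos[of "blk b"] by simp
        ultimately show ?thesis using SA lo unfolding F_def Coef by (auto simp: Coef)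
      next
        case (Del j) then show ?thesis using SA lo D(1) by (simp add: F_def R_def)
      qed (simp add: F_def)
      show "action M (S \<sigma>) < c0 \<or> (\<forall>z. (\<forall>k\<in>coords M. \<bar>z k - S \<sigma> k\<bar> \<le> D) \<longrightarrow> (\<exists>i\<in>A. F z i \<noteq> 0))"
        if big: "\<bar>\<sigma> i\<bar> > R i"
      proof (cases i)
        case (Coef m b)
        have b: "b \<in> B" "m \<in> {- int M..0}" using i by (auto simp: Coef AC)
        have "2 * (r (blk b))\<^sup>2 = (R i)\<^sup>2" by (simp add: R_def Coef power_mult_distrib)
        also have "\<dots> \<le> (\<sigma> i)\<^sup>2" using big rpos[of "blk b"]
          by (intro abs_le_square_iff[THEN iffD1]) (simp add: R_def Coef)
        finally have sq: "2 * (r (blk b))\<^sup>2 \<le> (S \<sigma> (Coef m b))\<^sup>2" using SA by (simp add: Coef)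
        have "blockact M (S \<sigma>) (blk b) \<le> - (r (blk b))\<^sup>2"
          by (rule block_upper(2)[OF Spos Slam b(2) blkset_simps(4)[OF b(1)] sq])
        moreover have "(\<Sum>j\<in>UNIV. blockact M (S \<sigma>) j) = blockact M (S \<sigma>) (blk b) + (\<Sum>j\<in>UNIV - {blk b}. blockact M (S \<sigma>) j)"
          by (rule sum.remove) auto
        moreover have "(\<Sum>j\<in>UNIV - {blk b}. blockact M (S \<sigma>) j) \<le> 0" by (intro sum_nonpos blk_up0)
        ultimately have "(\<Sum>j\<in>UNIV. blockact M (S \<sigma>) j) \<le> - (r (blk b))\<^sup>2" by linarith
        then have "action0 M (S \<sigma>) \<le> pi / 2 * (- (r (blk b))\<^sup>2)" unfolding action0_blocks by (intro mult_left_mono) auto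
        then have "action M (S \<sigma>) < c0" using bounds(2)[of M "S \<sigma>"] gap[of "blk b"] by (simp add: action_def)
        then show ?thesis ..
      next
        case (Del j)
        have "F z i \<noteq> 0" if "\<forall>k\<in>coords M. \<bar>z k - S \<sigma> k\<bar> \<le> D" for z
          using that[rule_format, of i] big D(1) SA by (auto simp: F_def Del R_def coords_def)
        then show ?thesis using i by blast
      qed (use i in \<open>simp add: AC\<close>)
    next
      fix \<sigma> assume \<sigma>: "\<sigma> \<in> Q" and F0: "\<forall>i\<in>A. F (S \<sigma>) i = 0"
      \<comment> \<open>Sheet and barrier meet where the chosen zero mode satisfies
        \<open>?s\<^sup>2 / (r j)\<^sup>2 = 2 - ?s\<^sup>2 / (r j)\<^sup>2\<close>. Hence
        \<open>?s\<^sup>2 = (r j)\<^sup>2\<close>, all multipliers vanish, and \<mu> is -1.\<close>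
      have "S \<sigma> (Lam j) = 0" for j
      proof -
        let ?s = "\<sigma> (Coef 0 (e j))"
        have inA: "Coef 0 b \<in> A" if "b \<in> blkset j" for b using blkset_simps(2)[OF that] by (simp add: AC)
        have z: "\<sigma> (Coef 0 b) = 0" if "b \<in> blkset j - {e j}" for b
          using F0[rule_format, OF inA, of b] that inA[of b] by (auto simp: F_def S_def blkset_simps)
        have sum: "(\<Sum>b\<in>blkset j. (\<sigma> (Coef 0 b))\<^sup>2) = ?s\<^sup>2"
          using z by (subst sum.remove[OF blkset_simps(1) e']) simp
        have lam: "S \<sigma> (Lam j) = ?s\<^sup>2 / (r j)\<^sup>2 - 1" by (simp add: S_def sum)
        have Se: "S \<sigma> (Coef 0 (e j)) = ?s" using inA[OF e'[of j]] by (simp add: S_def)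
        have s: "?s = r j * sqrt (max 0 (2 - ?s\<^sup>2 / (r j)\<^sup>2))"
          using F0[rule_format, OF inA[OF e'[of j]]] Se e lam by (simp add: F_def)
        have "?s\<^sup>2 = (r j)\<^sup>2 * max 0 (2 - ?s\<^sup>2 / (r j)\<^sup>2)"
          by (subst s) (simp add: power_mult_distrib)
        then have "?s\<^sup>2 / (r j)\<^sup>2 = max 0 (2 - ?s\<^sup>2 / (r j)\<^sup>2)" using r2[of j] by (simp add: field_simps)
        then have h: "?s\<^sup>2 / (r j)\<^sup>2 = 1" by linarith
        show ?thesis unfolding lam h by simp
      qed
      then show "\<mu> (S \<sigma>) < 0" by (simp add: \<mu>_def)
    qed
    then obtain \<sigma> z where \<sigma>: "\<sigma> \<in> Q" and z: "\<And>k. k \<in> coords M \<Longrightarrow> \<bar>z k - S \<sigma> k\<bar> \<le> D"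
      "L2_set (\<lambda>i. grad M i z) (coords M) < \<epsilon>" by blast
    have "\<bar>z (Lam j)\<bar> \<le> \<Lambda>" for j
    proof -
      have "(\<sigma> (Coef 0 b))\<^sup>2 \<le> 8 * (r j)\<^sup>2" if "b \<in> blkset j" for b
      proof -
        have "Coef 0 b \<in> A" using blkset_simps(2)[OF that] by (simp add: AC)
        then have "\<bar>\<sigma> (Coef 0 b)\<bar> \<le> 2 * R (Coef 0 b)" using \<sigma> unfolding Q_def by (auto dest: spec[of _ "Coef 0 b"])
        then have "\<bar>\<sigma> (Coef 0 b)\<bar> \<le> \<bar>2 * (sqrt 2 * r j)\<bar>" using blkset_simps(3)[OF that] by (simp add: R_def)
        then have "(\<sigma> (Coef 0 b))\<^sup>2 \<le> (2 * (sqrt 2 * r j))\<^sup>2" by (rule abs_le_square_iff[THEN iffD1])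
        then show ?thesis by (simp add: power_mult_distrib)
      qed
      then have "(\<Sum>b\<in>blkset j. (\<sigma> (Coef 0 b))\<^sup>2) \<le> real (card (blkset j)) * (8 * (r j)\<^sup>2)"
        by (rule sum_bounded_above)
      also have "\<dots> \<le> real (card B) * (8 * (r j)\<^sup>2)"
        using card_mono[OF finB, of "blkset j"] by (intro mult_right_mono) (auto simp: blkset_def)
      finally have "(\<Sum>b\<in>blkset j. (\<sigma> (Coef 0 b))\<^sup>2) / (r j)\<^sup>2 \<le> 8 * real (card B)"
        using r2[of j] by (simp add: divide_le_eq)
      moreover have "0 \<le> (\<Sum>b\<in>blkset j. (\<sigma> (Coef 0 b))\<^sup>2) / (r j)\<^sup>2" by (intro divide_nonneg_nonneg sum_nonneg) auto
      ultimately have "\<bar>S \<sigma> (Lam j)\<bar> \<le> 8 * real (card B) + 1" by (simp add: S_def)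
      then show ?thesis using z(1)[of "Lam j"] by (simp add: \<Lambda>_def coords_def)
    qed
    then show ?thesis using z(2) by blast
  qed
  then show ?thesis by blast
qed

end

section \<open>Passage to the limit\<close>

text \<open>The bound on the force gives all a priori estimates below; in the application it is
  produced by cutting the Hamiltonian off.\<close>

locale bounded_frame_hamiltonian = frame_hamiltonian l B blk r H gH
  for l :: "'b::finite \<Rightarrow> 'a::euclidean_space \<times> 'a" and B and blk :: "'b \<Rightarrow> 'k::finite" and r H gH +
  fixes C :: real
  assumes gH_bdd: "\<And>t x. t \<in> {0..1} \<Longrightarrow> norm (gH t x) \<le> C"
begin

definition trigsum :: "('b \<Rightarrow> int set) \<Rightarrow> ('b \<Rightarrow> int \<Rightarrow> real) \<Rightarrow> 'b \<Rightarrow> real \<Rightarrow> complex" where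
  "trigsum S a b t = (\<Sum>m\<in>S b. of_real (a b m) * cis (pi * of_int m * t))"

definition phase :: "('k \<Rightarrow> real) \<Rightarrow> ('k \<Rightarrow> real) \<Rightarrow> 'b \<Rightarrow> real \<Rightarrow> complex" where
  "phase \<alpha> \<theta> b t = cis (pi * (\<theta> (blk b) - \<alpha> (blk b) * t))"

text \<open>Synthesis map of the frame, under which multiplication by the imaginary unit becomes
  \<open>J\<close>. Its adjoint, applied to the gradient, is \<open>frc\<close>; so the frame
  coordinates follow the Hamiltonian system pulled back along \<open>pnt\<close>.\<close>

definition pnt :: "('b \<Rightarrow> complex) \<Rightarrow> 'a \<times> 'a" where
  "pnt w = (\<Sum>b\<in>B. Re (w b) *\<^sub>R l b + Im (w b) *\<^sub>R J (l b))"

definition frc :: "real \<Rightarrow> ('b \<Rightarrow> complex) \<Rightarrow> 'b \<Rightarrow> complex" where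
  "frc t w b = Complex (gH t (pnt w) \<bullet> l b) (gH t (pnt w) \<bullet> J (l b))"

definition wave where "wave \<alpha> \<theta> u t b = phase \<alpha> \<theta> b t * u b t"

text \<open>The force seen from the frame rotating with \<open>phase\<close>; its Fourier
  coefficients enter the coefficient equations.\<close>

definition twist where "twist \<alpha> \<theta> u b t = cnj (phase \<alpha> \<theta> b t) * frc t (wave \<alpha> \<theta> u t) b"

text \<open>Along an orbit, minus twice the flux is the time derivative of the squared size of block
  \<open>j\<close>.\<close>

definition flux :: "real \<Rightarrow> ('b \<Rightarrow> complex) \<Rightarrow> 'k \<Rightarrow> real" where
  "flux t w j = (\<Sum>b\<in>blkset j. Im (cnj (w b) * frc t w b))"

text \<open>The three residuals are the \<open>Coef\<close>, \<open>Lam\<close> and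
  \<open>Del\<close> parts of \<open>grad\<close> after gauge fixing. The window \<open>S b\<close>
  of modes depends on the shift of its block but always contains \<open>{- int N..int N}\<close>, as
  the limit requires.\<close>

definition approx_sol where
  "approx_sol N \<epsilon> S a \<alpha> \<theta> \<longleftrightarrow>
     (\<forall>j. 0 \<le> \<alpha> j \<and> \<alpha> j \<le> 1 \<and> 0 \<le> \<theta> j \<and> \<theta> j \<le> 2) \<and>
     (\<forall>b. finite (S b) \<and> {- int N..int N} \<subseteq> S b) \<and>
     (\<Sum>b\<in>B. \<Sum>m\<in>S b. (pi * (of_int m - \<alpha> (blk b)) * a b m - trig_coeff (twist \<alpha> \<theta> (trigsum S a) b) m)\<^sup>2) \<le> \<epsilon>\<^sup>2 \<and>
     (\<forall>j. \<bar>pi / 2 * ((r j)\<^sup>2 - (\<Sum>b\<in>blkset j. \<Sum>m\<in>S b. (a b m)\<^sup>2))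
        - pi * integral {0..1} (\<lambda>t. (1 - t) * flux t (wave \<alpha> \<theta> (trigsum S a) t) j)\<bar> \<le> \<epsilon>) \<and>
     (\<forall>j. \<bar>pi * integral {0..1} (\<lambda>t. flux t (wave \<alpha> \<theta> (trigsum S a) t) j)\<bar> \<le> \<epsilon>)"

text \<open>Gauge fixing: the integer part of a multiplier is absorbed by shifting the Fourier modes, and even
  phases are trivial. The remaining parameters \<open>\<alpha>\<close>, \<open>\<theta>\<close> lie in a compact set independent of the degree.\<close>

lemma normal_form:
  assumes lam: "\<And>j. \<bar>z (Lam j)\<bar> \<le> \<Lambda>" and M: "\<Lambda> + 1 + real N \<le> real M"
    and small: "L2_set (\<lambda>i. grad M i z) (coords M) < \<epsilon>"
  shows "\<exists>S a \<alpha> \<theta>. approx_sol N \<epsilon> S a \<alpha> \<theta>"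
proof -
  define \<nu> where "\<nu> b = \<lfloor>z (Lam (blk b))\<rfloor>" for b :: 'b
  define \<alpha> where "\<alpha> j = frac (z (Lam j))" for j
  define k where "k j = \<lfloor>(z (Lam j) - z (Del j)) / 2\<rfloor>" for j
  define \<theta> where "\<theta> j = z (Lam j) - z (Del j) - 2 * of_int (k j)" for j
  define S where "S b = {- int M - \<nu> b..int M - \<nu> b}" for b
  define a where "a b m = z (Coef (m + \<nu> b) b)" for b m
  let ?w = "wave \<alpha> \<theta> (trigsum S a)"
  have reidx: "(\<Sum>m\<in>{- int M..int M}. f m) = (\<Sum>m\<in>S b. f (m + \<nu> b))" for f :: "int \<Rightarrow> 'z::comm_monoid_add" and b
    unfolding S_def by (rule sum.reindex_bij_witness[of _ "\<lambda>m. m + \<nu> b" "\<lambda>m. m - \<nu> b"]) auto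
  have cisang: "cis (ang z (m + \<nu> b) b t) = phase \<alpha> \<theta> b t * cis (pi * of_int m * t)" for m b t
  proof -
    have "ang z (m + \<nu> b) b t = pi * (\<theta> (blk b) - \<alpha> (blk b) * t) + pi * of_int m * t + 2 * pi * of_int (k (blk b))"
      by (simp add: ang_def \<theta>_def \<alpha>_def frac_def \<nu>_def algebra_simps)
    then show ?thesis by (simp add: phase_def cis_mult[symmetric] cis_multiple_2pi)
  qed
  have wsum: "(\<Sum>m\<in>{- int M..int M}. of_real (z (Coef m b)) * cis (ang z m b t)) = ?w t b" for b t
    unfolding reidx[of _ b] cisang wave_def trigsum_def a_def sum_distrib_left
    by (intro sum.cong refl) (simp add: mult_ac)
  have trajA: "traj M A z t = (\<Sum>b\<in>A. Re (?w t b) *\<^sub>R l b + Im (?w t b) *\<^sub>R J (l b))" for A t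
    unfolding traj_def wsum[symmetric] rot_def
    by (intro sum.cong refl) (simp add: Re_sum Im_sum scaleR_sum_left scaleR_add_right sum.distrib)
  have trajB: "traj M B z t = pnt (?w t)" for t unfolding trajA pnt_def ..
  have coef: "force M z t \<bullet> rot (ang z (m + \<nu> b) b t) (l b) = Re (cnj (twist \<alpha> \<theta> (trigsum S a) b t) * cis (pi * of_int m * t))" for t m b
  proof -
    have "force M z t \<bullet> rot (ang z (m + \<nu> b) b t) (l b) = Re (cnj (frc t (?w t) b) * cis (ang z (m + \<nu> b) b t))"
      by (simp add: force_def trajB frc_def rot_def inner_add_right)
    then show ?thesis unfolding cisang twist_def by (simp add: mult_ac)
  qed
  have fl: "force M z t \<bullet> J (traj M (blkset j) z t) = flux t (?w t) j" for t j
    unfolding flux_def force_def trajB unfolding trajA J_sum inner_sum_right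
    by (intro sum.cong refl) (simp add: frc_def J_add J_scale inner_add_right algebra_simps)
  have gC: "grad M (Coef (m + \<nu> b) b) z = pi * (of_int m - \<alpha> (blk b)) * a b m - trig_coeff (twist \<alpha> \<theta> (trigsum S a) b) m" for m b
    unfolding grad_def coord.case coef trig_coeff_def a_def by (simp add: \<alpha>_def frac_def \<nu>_def)
  have gL: "grad M (Lam j) z = pi / 2 * ((r j)\<^sup>2 - (\<Sum>b\<in>blkset j. \<Sum>m\<in>S b. (a b m)\<^sup>2))
        - pi * integral {0..1} (\<lambda>t. (1 - t) * flux t (?w t) j)" for j
  proof -
    have "(\<Sum>m\<in>{- int M..int M}. (z (Coef m b))\<^sup>2) = (\<Sum>m\<in>S b. (a b m)\<^sup>2)" for b
      unfolding a_def by (rule reidx)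
    then show ?thesis unfolding grad_def coord.case fl by simp
  qed
  have gD: "grad M (Del j) z = pi * integral {0..1} (\<lambda>t. flux t (?w t) j)" for j
    unfolding grad_def coord.case fl ..
  have eps: "\<epsilon> > 0" using small L2_set_nonneg le_less_trans by blast
  have sq: "(\<Sum>i\<in>coords M. (grad M i z)\<^sup>2) \<le> \<epsilon>\<^sup>2"
  proof -
    have "(L2_set (\<lambda>i. grad M i z) (coords M))\<^sup>2 \<le> \<epsilon>\<^sup>2" using small by (intro power_mono) (auto simp: L2_set_nonneg)
    then show ?thesis by (simp add: L2_set_def sum_nonneg)
  qed
  have one: "\<bar>grad M i z\<bar> \<le> \<epsilon>" if "i \<in> coords M" for i
  proof -
    have "(grad M i z)\<^sup>2 \<le> (\<Sum>i\<in>coords M. (grad M i z)\<^sup>2)" using that by (intro member_le_sum finite_coords) auto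
    then have "(grad M i z)\<^sup>2 \<le> \<epsilon>\<^sup>2" using sq by simp
    then show ?thesis using eps by (simp add: abs_le_square_iff[symmetric])
  qed
  have "approx_sol N \<epsilon> S a \<alpha> \<theta>"
    unfolding approx_sol_def
  proof (intro conjI allI)
    fix j
    show "0 \<le> \<alpha> j" "\<alpha> j \<le> 1" by (simp_all add: \<alpha>_def less_imp_le frac_lt_1)
    have "0 \<le> frac ((z (Lam j) - z (Del j)) / 2)" "frac ((z (Lam j) - z (Del j)) / 2) < 1" by (simp_all add: frac_lt_1)
    moreover have "\<theta> j = 2 * frac ((z (Lam j) - z (Del j)) / 2)"
      unfolding \<theta>_def k_def frac_def by (simp add: right_diff_distrib)
    ultimately have "0 \<le> \<theta> j \<and> \<theta> j \<le> 2" by linarith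
    then show "0 \<le> \<theta> j" "\<theta> j \<le> 2" by simp_all
    show "\<bar>pi / 2 * ((r j)\<^sup>2 - (\<Sum>b\<in>blkset j. \<Sum>m\<in>S b. (a b m)\<^sup>2))
        - pi * integral {0..1} (\<lambda>t. (1 - t) * flux t (?w t) j)\<bar> \<le> \<epsilon>"
      using one[of "Lam j"] unfolding gL by (simp add: coords_def)
    show "\<bar>pi * integral {0..1} (\<lambda>t. flux t (?w t) j)\<bar> \<le> \<epsilon>"
      using one[of "Del j"] unfolding gD by (simp add: coords_def)
  next
    fix b
    show "finite (S b)" by (simp add: S_def)
    \<comment> \<open>The shift is bounded by \<open>\<Lambda> + 1\<close>, and \<open>M\<close>
      exceeds this by at least \<open>N\<close>, so the shifted window still contains the prescribed
      modes.\<close>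
    have "\<bar>of_int (\<nu> b)\<bar> \<le> \<Lambda> + 1" using lam[of "blk b"] unfolding \<nu>_def by linarith
    then have "\<bar>real_of_int (\<nu> b)\<bar> + real N \<le> real M" using M by linarith
    then have "\<bar>\<nu> b\<bar> + int N \<le> int M" by linarith
    then show "{- int N..int N} \<subseteq> S b" unfolding S_def by auto
  next
    have "(\<Sum>b\<in>B. \<Sum>m\<in>S b. (pi * (of_int m - \<alpha> (blk b)) * a b m - trig_coeff (twist \<alpha> \<theta> (trigsum S a) b) m)\<^sup>2)
       = (\<Sum>b\<in>B. \<Sum>m\<in>{- int M..int M}. (grad M (Coef m b) z)\<^sup>2)"
      unfolding gC[symmetric] by (intro sum.cong refl reidx[of "\<lambda>m. (grad M (Coef m _) z)\<^sup>2", symmetric])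
    also have "\<dots> \<le> (\<Sum>i\<in>coords M. (grad M i z)\<^sup>2)" unfolding sum_coords by (simp add: sum_nonneg)
    finally show "(\<Sum>b\<in>B. \<Sum>m\<in>S b. (pi * (of_int m - \<alpha> (blk b)) * a b m - trig_coeff (twist \<alpha> \<theta> (trigsum S a) b) m)\<^sup>2) \<le> \<epsilon>\<^sup>2"
      using sq by simp
  qed
  then show ?thesis by blast
qed

section \<open>Estimates independent of the number of modes\<close>

lemma cont_pnt: "(\<And>b. b \<in> B \<Longrightarrow> continuous_on T (\<lambda>t. w t b)) \<Longrightarrow> continuous_on T (\<lambda>t. pnt (w t))"
  for T :: "real set"
  unfolding pnt_def by (intro continuous_intros)

lemma cont_frc:
  assumes "\<And>b. b \<in> B \<Longrightarrow> continuous_on {0..1} (\<lambda>t. w t b)"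
  shows "continuous_on {0..1} (\<lambda>t. frc t (w t) b)"
proof -
  have "continuous_on {0..1} (\<lambda>t. gH t (pnt (w t)))"
  proof -
    have "continuous_on {0..1} (\<lambda>t. (t, pnt (w t)))"
      by (intro continuous_on_Pair continuous_on_id cont_pnt assms)
    from continuous_on_compose2[OF gH_cont this] show ?thesis by auto
  qed
  then show ?thesis unfolding frc_def Complex_eq by (intro continuous_intros)
qed

lemma cont_phase [continuous_intros]: "continuous_on T (phase \<alpha> \<theta> b)"
  unfolding phase_def by (intro continuous_intros)

lemma cont_wave: "continuous_on T (u b) \<Longrightarrow> continuous_on T (\<lambda>t. wave \<alpha> \<theta> u t b)"
  unfolding wave_def by (intro continuous_intros)

lemma cont_twist:
  assumes "\<And>b. b \<in> B \<Longrightarrow> continuous_on {0..1} (u b)"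
  shows "continuous_on {0..1} (twist \<alpha> \<theta> u b)"
  unfolding twist_def by (intro continuous_intros cont_frc cont_wave assms)

lemma cont_flux:
  assumes "\<And>b. b \<in> B \<Longrightarrow> continuous_on {0..1} (\<lambda>t. w t b)"
  shows "continuous_on {0..1} (\<lambda>t. flux t (w t) j)"
  unfolding flux_def by (intro continuous_intros cont_frc assms) (auto dest: blkset_simps(2))

lemma cont_trigsum: "continuous_on T (trigsum S a b)"
  unfolding trigsum_def by (intro continuous_intros)

lemma frc_bound: "t \<in> {0..1} \<Longrightarrow> cmod (frc t w b) \<le> 2 * C * norm (l b)"
proof -
  assume t: "t \<in> {0..1}"
  let ?f = "gH t (pnt w)"
  have "cmod (frc t w b) \<le> \<bar>?f \<bullet> l b\<bar> + \<bar>?f \<bullet> J (l b)\<bar>"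
    unfolding frc_def using cmod_le[of "Complex (?f \<bullet> l b) (?f \<bullet> J (l b))"] by simp
  also have "\<dots> \<le> norm ?f * norm (l b) + norm ?f * norm (l b)"
    using add_mono[OF Cauchy_Schwarz_ineq2[of ?f "l b"] Cauchy_Schwarz_ineq2[of ?f "J (l b)"]] unfolding J_simps .
  also have "\<dots> \<le> C * norm (l b) + C * norm (l b)"
    using gH_bdd[OF t] by (intro add_mono mult_right_mono) auto
  finally show ?thesis by simp
qed

lemma norm_phase [simp]: "cmod (phase \<alpha> \<theta> b t) = 1" by (simp add: phase_def)

lemma twist_bound: "t \<in> {0..1} \<Longrightarrow> cmod (twist \<alpha> \<theta> u b t) \<le> 2 * C * norm (l b)"
  using frc_bound by (simp add: twist_def norm_mult)

text \<open>The time derivative of \<open>trigsum\<close> up to the factor \<i>; taking that factor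
  out leaves real coefficients, to which Parseval's identity applies.\<close>

definition dtrig :: "('b \<Rightarrow> int set) \<Rightarrow> ('b \<Rightarrow> int \<Rightarrow> real) \<Rightarrow> 'b \<Rightarrow> real \<Rightarrow> complex" where
  "dtrig S a = trigsum S (\<lambda>b m. pi * of_int m * a b m)"

lemma trigsum_deriv: "(trigsum S a b has_vector_derivative \<i> * dtrig S a b t) (at t within T)"
proof -
  have "((\<lambda>t. cis (pi * of_int m * t)) has_vector_derivative (pi * of_int m) *\<^sub>R (\<i> * cis (pi * of_int m * t))) (at t within T)" for m
  proof -
    have cis: "cis x = of_real (cos x) + \<i> * of_real (sin x)" for x by (simp add: complex_eq_iff)
    have k: "k *\<^sub>R (\<i> * cis x) = of_real (- sin x * k) + \<i> * of_real (cos x * k)" for x k :: real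
      by (simp add: complex_eq_iff)
    show ?thesis unfolding k unfolding cis
      by (intro has_vector_derivative_add has_vector_derivative_mult_right has_vector_derivative_of_real)
        (auto intro!: derivative_eq_intros simp: has_real_derivative_iff_has_vector_derivative[symmetric])
  qed
  then have "((\<lambda>t. of_real (a b m) * cis (pi * of_int m * t)) has_vector_derivative
      of_real (a b m) * ((pi * of_int m) *\<^sub>R (\<i> * cis (pi * of_int m * t)))) (at t within T)" for m
    by (intro has_vector_derivative_mult_right)
  then have "(trigsum S a b has_vector_derivative (\<Sum>m\<in>S b. of_real (a b m) * ((pi * of_int m) *\<^sub>R (\<i> * cis (pi * of_int m * t))))) (at t within T)"
    unfolding trigsum_def[abs_def] by (intro has_vector_derivative_sum)
  moreover have "(\<Sum>m\<in>S b. of_real (a b m) * ((pi * of_int m) *\<^sub>R (\<i> * cis (pi * of_int m * t)))) = \<i> * dtrig S a b t"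
    unfolding dtrig_def trigsum_def sum_distrib_left by (intro sum.cong refl) (simp add: scaleR_conv_of_real mult_ac)
  ultimately show ?thesis by simp
qed

lemma trigsum_diff:
  assumes "s \<le> t" shows "((\<lambda>x. \<i> * dtrig S a b x) has_integral (trigsum S a b t - trigsum S a b s)) {s..t}"
  by (rule fundamental_theorem_of_calculus[OF assms trigsum_deriv])

text \<open>Read off from \<open>approx_bounds\<close>: \<open>K1\<close> bounds the mean square of
  a frame coordinate and \<open>K2\<close> that of its derivative, whatever the window of
  modes.\<close>

definition K1 where "K1 = (\<Sum>j\<in>UNIV. 2 * ((r j)\<^sup>2 + 1 + 2 * (\<Sum>b\<in>B. (2 * C * norm (l b))\<^sup>2)))"
definition K2 where "K2 = 3 * (1 + (\<Sum>b\<in>B. (2 * C * norm (l b))\<^sup>2) + pi\<^sup>2 * K1)"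

lemma sum_c: "b \<in> B \<Longrightarrow> (2 * C * norm (l b))\<^sup>2 \<le> (\<Sum>b\<in>B. (2 * C * norm (l b))\<^sup>2)"
  using finB by (intro member_le_sum) auto

text \<open>The \<open>Lam\<close> equation bounds the coefficients: the work of a bounded force is
  linear in the size of the block and is absorbed by the quadratic term. The \<open>Coef\<close>
  equations then express the derivative by the residual, the force and the coefficients, all bounded
  in mean square.\<close>

lemma approx_bounds:
  assumes ap: "approx_sol N \<epsilon> S a \<alpha> \<theta>" and eps: "\<epsilon> \<le> 1" "\<epsilon> \<ge> 0" and b: "b \<in> B"
  shows "(\<Sum>m\<in>S b. (a b m)\<^sup>2) \<le> K1" "integral {0..1} (\<lambda>t. (cmod (dtrig S a b t))\<^sup>2) \<le> K2"
proof -
  note ap' = ap[unfolded approx_sol_def]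
  have fS: "finite (S b)" for b using ap' by blast
  let ?u = "trigsum S a" let ?w = "wave \<alpha> \<theta> ?u"
  define j where "j = blk b"
  define n where "n = (\<Sum>b\<in>blkset j. \<Sum>m\<in>S b. (a b m)\<^sup>2)"
  have n0: "n \<ge> 0" unfolding n_def by (intro sum_nonneg) auto
  have pars: "integral {0..1} (\<lambda>t. (cmod (?u b t))\<^sup>2) = (\<Sum>m\<in>S b. (a b m)\<^sup>2)" for b
    unfolding trigsum_def by (rule trig_parseval[OF fS])
  define c where "c = (\<Sum>b\<in>B. (2 * C * norm (l b))\<^sup>2)"
  have fb: "\<bar>(1 - t) * flux t (?w t) j\<bar> \<le> (\<Sum>b\<in>blkset j. (cmod (?u b t))\<^sup>2 / 4 + (2 * C * norm (l b))\<^sup>2)" if t: "t \<in> {0..1}" for t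
  proof -
    have "\<bar>(1 - t) * flux t (?w t) j\<bar> \<le> 1 * \<bar>flux t (?w t) j\<bar>" unfolding abs_mult using t by (intro mult_right_mono) auto
    also have "\<bar>flux t (?w t) j\<bar> \<le> (\<Sum>b\<in>blkset j. \<bar>Im (cnj (?w t b) * frc t (?w t) b)\<bar>)" unfolding flux_def by (rule sum_abs)
    also have "\<dots> \<le> (\<Sum>b\<in>blkset j. (cmod (?u b t))\<^sup>2 / 4 + (2 * C * norm (l b))\<^sup>2)"
    proof (rule sum_mono)
      fix b
      let ?x = "cmod (?u b t)" and ?y = "2 * C * norm (l b)"
      have "\<bar>Im (cnj (?w t b) * frc t (?w t) b)\<bar> \<le> cmod (cnj (?w t b) * frc t (?w t) b)" by (rule abs_Im_le_cmod)
      also have "\<dots> \<le> ?x * ?y" using frc_bound[OF t] by (simp add: norm_mult wave_def mult_left_mono)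
      \<comment> \<open>The weight 1/4 leaves \<open>pi / 4 * n\<close> on the right, which
        \<open>pi / 2 * n\<close> on the left absorbs.\<close>
      also have "\<dots> \<le> ?x\<^sup>2 / 4 + ?y\<^sup>2" using zero_le_power2[of "?x / 2 - ?y"] by (simp add: power2_diff power_divide)
      finally show "\<bar>Im (cnj (?w t b) * frc t (?w t) b)\<bar> \<le> ?x\<^sup>2 / 4 + ?y\<^sup>2" .
    qed
    finally show ?thesis by simp
  qed
  have cflux: "continuous_on {0..1} (\<lambda>t. flux t (?w t) j)" by (intro cont_flux cont_wave cont_trigsum)
  have "\<bar>integral {0..1} (\<lambda>t. (1 - t) * flux t (?w t) j)\<bar> \<le> integral {0..1} (\<lambda>t. \<Sum>b\<in>blkset j. (cmod (?u b t))\<^sup>2 / 4 + (2 * C * norm (l b))\<^sup>2)"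
    unfolding real_norm_def[symmetric]
    by (rule integral_norm_bound_integral)
      ((intro integrable_continuous_real continuous_intros cflux cont_trigsum; simp)+, use fb in simp)
  also have "\<dots> = (\<Sum>b\<in>blkset j. (\<Sum>m\<in>S b. (a b m)\<^sup>2) / 4 + (2 * C * norm (l b))\<^sup>2)"
  proof -
    have "((\<lambda>t. (cmod (?u b t))\<^sup>2 / 4 + (2 * C * norm (l b))\<^sup>2) has_integral ((\<Sum>m\<in>S b. (a b m)\<^sup>2) / 4 + (2 * C * norm (l b))\<^sup>2)) {0..1}" for b
    proof -
      have "((\<lambda>t. (cmod (?u b t))\<^sup>2) has_integral (\<Sum>m\<in>S b. (a b m)\<^sup>2)) {0..1}"
        unfolding pars[symmetric] by (intro integrable_integral integrable_continuous_real continuous_intros cont_trigsum)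
      from has_integral_add[OF has_integral_divide[OF this, of 4] has_integral_const_real[of "(2 * C * norm (l b))\<^sup>2" 0 1]]
      show ?thesis by simp
    qed
    then show ?thesis by (intro integral_unique has_integral_sum blkset_simps)
  qed
  also have "\<dots> \<le> n / 4 + c"
    unfolding sum.distrib n_def c_def sum_divide_distrib[symmetric]
    by (intro add_mono order_refl sum_mono2 finB) (auto simp: blkset_def)
  finally have q: "\<bar>integral {0..1} (\<lambda>t. (1 - t) * flux t (?w t) j)\<bar> \<le> n / 4 + c" .
  have "\<bar>pi / 2 * ((r j)\<^sup>2 - n) - pi * integral {0..1} (\<lambda>t. (1 - t) * flux t (?w t) j)\<bar> \<le> 1"
  proof -
    have "\<bar>pi / 2 * ((r j)\<^sup>2 - n) - pi * integral {0..1} (\<lambda>t. (1 - t) * flux t (?w t) j)\<bar> \<le> \<epsilon>"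
      using ap' unfolding n_def by (elim conjE) (erule allE[of _ j], assumption)
    then show ?thesis using eps by linarith
  qed
  moreover have "pi * - integral {0..1} (\<lambda>t. (1 - t) * flux t (?w t) j) \<le> pi * (n / 4 + c)"
    using q by (intro mult_left_mono) auto
  moreover have "pi / 2 * ((r j)\<^sup>2 - n) = pi / 2 * (r j)\<^sup>2 - pi / 2 * n" by (simp add: right_diff_distrib)
  ultimately have "pi / 2 * n \<le> pi / 2 * (r j)\<^sup>2 + 1 + pi * (n / 4 + c)" by linarith
  then have "pi * n \<le> pi * (2 * (r j)\<^sup>2 + 4 * c) + 4" by (simp add: algebra_simps)
  also have "\<dots> \<le> pi * (2 * (r j)\<^sup>2 + 4 * c) + pi * 2" using pi_gt3 by simp
  finally have "pi * n \<le> pi * (2 * (r j)\<^sup>2 + 4 * c + 2)" by (simp add: algebra_simps)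
  then have "n \<le> 2 * ((r j)\<^sup>2 + 1 + 2 * c)" by simp
  also have "\<dots> \<le> K1" unfolding K1_def c_def
    by (rule member_le_sum) (auto intro!: add_nonneg_nonneg sum_nonneg mult_nonneg_nonneg)
  finally have nK: "n \<le> K1" .
  have "(\<Sum>m\<in>S b. (a b m)\<^sup>2) \<le> n" unfolding n_def j_def
    using blkset_simps(1,4) b by (intro member_le_sum[of b]) (auto intro!: sum_nonneg)
  then show a2: "(\<Sum>m\<in>S b. (a b m)\<^sup>2) \<le> K1" using nK by simp
  define G where "G = twist \<alpha> \<theta> ?u b"
  have cG: "continuous_on {0..1} G" unfolding G_def by (intro cont_twist cont_trigsum)
  define \<rho> where "\<rho> m = pi * (of_int m - \<alpha> (blk b)) * a b m - trig_coeff G m" for m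
  have rho: "(\<Sum>m\<in>S b. (\<rho> m)\<^sup>2) \<le> 1"
  proof -
    have "(\<Sum>m\<in>S b. (\<rho> m)\<^sup>2) \<le> (\<Sum>b\<in>B. \<Sum>m\<in>S b. (pi * (of_int m - \<alpha> (blk b)) * a b m - trig_coeff (twist \<alpha> \<theta> ?u b) m)\<^sup>2)"
      unfolding \<rho>_def G_def using b finB by (intro member_le_sum[of b]) (auto intro!: sum_nonneg)
    also have "\<dots> \<le> \<epsilon>\<^sup>2" using ap' by blast
    also have "\<dots> \<le> 1" using eps by (simp add: power_le_one)
    finally show ?thesis .
  qed
  have tc: "(\<Sum>m\<in>S b. (trig_coeff G m)\<^sup>2) \<le> c"
  proof -
    have "(\<Sum>m\<in>S b. (trig_coeff G m)\<^sup>2) \<le> integral {0..1} (\<lambda>t. (cmod (G t))\<^sup>2)" by (rule trig_bessel[OF fS cG])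
    also have "\<dots> \<le> integral {0..1} (\<lambda>t::real. (2 * C * norm (l b))\<^sup>2)"
      using twist_bound unfolding G_def
      by (intro integral_le power_mono integrable_continuous_real continuous_intros cont_twist cont_trigsum) auto
    also have "\<dots> \<le> c" using sum_c[OF b] by (simp add: c_def)
    finally show ?thesis .
  qed
  have "integral {0..1} (\<lambda>t. (cmod (dtrig S a b t))\<^sup>2) = (\<Sum>m\<in>S b. (pi * of_int m * a b m)\<^sup>2)"
    unfolding dtrig_def trigsum_def by (rule trig_parseval[OF fS])
  also have "\<dots> \<le> (\<Sum>m\<in>S b. 3 * ((\<rho> m)\<^sup>2 + (trig_coeff G m)\<^sup>2 + pi\<^sup>2 * (a b m)\<^sup>2))"
  proof (rule sum_mono)
    fix m
    have al: "0 \<le> \<alpha> (blk b)" "\<alpha> (blk b) \<le> 1" using ap' by blast+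
    define x where "x = pi * \<alpha> (blk b) * a b m"
    have "x\<^sup>2 = (\<alpha> (blk b))\<^sup>2 * (pi\<^sup>2 * (a b m)\<^sup>2)" by (simp add: x_def power_mult_distrib)
    also have "\<dots> \<le> 1 * (pi\<^sup>2 * (a b m)\<^sup>2)" using al by (intro mult_right_mono power_le_one) auto
    finally have x: "x\<^sup>2 \<le> pi\<^sup>2 * (a b m)\<^sup>2" by simp
    have "pi * of_int m * a b m = \<rho> m + trig_coeff G m + x" by (simp add: \<rho>_def x_def algebra_simps)
    moreover have "(p + q + s)\<^sup>2 \<le> 3 * (p\<^sup>2 + q\<^sup>2 + s\<^sup>2)" for p q s :: real
      using zero_le_power2[of "p - q"] zero_le_power2[of "q - s"] zero_le_power2[of "p - s"]
      by (simp add: power2_eq_square algebra_simps)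
    ultimately have "(pi * of_int m * a b m)\<^sup>2 \<le> 3 * ((\<rho> m)\<^sup>2 + (trig_coeff G m)\<^sup>2 + x\<^sup>2)" by simp
    then show "(pi * of_int m * a b m)\<^sup>2 \<le> 3 * ((\<rho> m)\<^sup>2 + (trig_coeff G m)\<^sup>2 + pi\<^sup>2 * (a b m)\<^sup>2)"
      by (rule order_trans) (use x in simp)
  qed
  also have "\<dots> = 3 * ((\<Sum>m\<in>S b. (\<rho> m)\<^sup>2) + (\<Sum>m\<in>S b. (trig_coeff G m)\<^sup>2) + pi\<^sup>2 * (\<Sum>m\<in>S b. (a b m)\<^sup>2))"
    by (simp add: sum.distrib sum_distrib_left)
  also have "\<dots> \<le> K2" unfolding K2_def c_def[symmetric] using rho tc a2 by (intro mult_left_mono add_mono) auto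
  finally show "integral {0..1} (\<lambda>t. (cmod (dtrig S a b t))\<^sup>2) \<le> K2" .
qed

lemma K12_nonneg: "K1 \<ge> 0" "K2 \<ge> 0"
proof -
  show "K1 \<ge> 0" unfolding K1_def by (intro sum_nonneg mult_nonneg_nonneg add_nonneg_nonneg) auto
  then show "K2 \<ge> 0" unfolding K2_def by (intro mult_nonneg_nonneg add_nonneg_nonneg sum_nonneg) auto
qed

text \<open>A mean-square bound on the derivative gives equicontinuity. The inequality
  \<open>d \<le> \<eta> * d\<^sup>2 + 1 / \<eta>\<close> takes the place of Cauchy-Schwarz and
  leaves \<eta> free.\<close>

lemma approx_equicont:
  assumes ap: "approx_sol N \<epsilon> S a \<alpha> \<theta>" and eps: "\<epsilon> \<le> 1" "\<epsilon> \<ge> 0" and b: "b \<in> B"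
    and st: "s \<in> {0..1}" "t \<in> {0..1}" and \<eta>: "\<eta> > 0"
  shows "cmod (trigsum S a b t - trigsum S a b s) \<le> \<eta> * K2 + \<bar>t - s\<bar> / \<eta>"
proof -
  have main: "cmod (trigsum S a b t - trigsum S a b s) \<le> \<eta> * K2 + (t - s) / \<eta>" if "0 \<le> s" "s \<le> t" "t \<le> 1" for s t
  proof -
    have ci: "continuous_on T (dtrig S a b)" for T unfolding dtrig_def by (rule cont_trigsum)
    have "trigsum S a b t - trigsum S a b s = integral {s..t} (\<lambda>x. \<i> * dtrig S a b x)"
      by (rule integral_unique[OF trigsum_diff[OF that(2)], symmetric])
    also have "cmod \<dots> \<le> integral {s..t} (\<lambda>x. \<eta> * (cmod (dtrig S a b x))\<^sup>2 + 1 / \<eta>)"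
    proof (rule integral_norm_bound_integral)
      fix x
      let ?d = "cmod (dtrig S a b x)"
      have "?d * 1 \<le> \<eta> * ?d\<^sup>2 + 1 / \<eta>"
      proof -
        have "0 \<le> (\<eta> * ?d - 1)\<^sup>2 + \<eta> * ?d" using \<eta> by simp
        then have "\<eta> * ?d \<le> \<eta> * (\<eta> * ?d\<^sup>2) + 1" by (simp add: power2_eq_square algebra_simps)
        then show ?thesis using \<eta> by (simp add: field_simps)
      qed
      then show "cmod (\<i> * dtrig S a b x) \<le> \<eta> * ?d\<^sup>2 + 1 / \<eta>" by (simp add: norm_mult)
    qed (intro integrable_continuous_real continuous_intros ci)+
    also have "\<dots> = \<eta> * integral {s..t} (\<lambda>x. (cmod (dtrig S a b x))\<^sup>2) + (t - s) / \<eta>"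
    proof -
      have i: "(\<lambda>x. (cmod (dtrig S a b x))\<^sup>2) integrable_on {s..t}"
        by (intro integrable_continuous_real continuous_intros ci)
      show ?thesis
        using integral_unique[OF has_integral_add[OF has_integral_mult_right[OF integrable_integral[OF i], of \<eta>]
              has_integral_const_real[of "1 / \<eta>" s t]]] that by simp
    qed
    also have "integral {s..t} (\<lambda>x. (cmod (dtrig S a b x))\<^sup>2) \<le> integral {0..1} (\<lambda>x. (cmod (dtrig S a b x))\<^sup>2)"
      using that by (intro integral_subset_le integrable_continuous_real continuous_on_power continuous_on_norm ci) auto
    also have "\<dots> \<le> K2" by (rule approx_bounds(2)[OF ap eps b])
    finally show ?thesis using \<eta> by simp
  qed
  show ?thesis
  proof (cases "s \<le> t")
    case True then show ?thesis using main[of s t] st by auto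
  next
    case False then show ?thesis using main[of t s] st by (auto simp: norm_minus_commute)
  qed
qed

text \<open>A path of bounded mean square and bounded oscillation is bounded: compare with its value
  at every \<open>s\<close> and average.\<close>

lemma approx_sup:
  assumes ap: "approx_sol N \<epsilon> S a \<alpha> \<theta>" and eps: "\<epsilon> \<le> 1" "\<epsilon> \<ge> 0" and b: "b \<in> B" and t: "t \<in> {0..1}"
  shows "cmod (trigsum S a b t) \<le> 2 * K1 + 2 * (K2 + 1)\<^sup>2 + 1"
proof -
  have fS: "finite (S b)" using ap unfolding approx_sol_def by blast
  have pt: "(cmod (trigsum S a b t))\<^sup>2 \<le> 2 * (cmod (trigsum S a b s))\<^sup>2 + 2 * (K2 + 1)\<^sup>2" if s: "s \<in> {0..1}" for s
  proof -
    have "cmod (trigsum S a b t - trigsum S a b s) \<le> 1 * K2 + \<bar>t - s\<bar> / 1"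
      by (rule approx_equicont[OF ap eps b s t]) simp
    also have "\<dots> \<le> K2 + 1" using s t by auto
    finally have d: "cmod (trigsum S a b t - trigsum S a b s) \<le> K2 + 1" .
    have "cmod (trigsum S a b t) \<le> cmod (trigsum S a b s) + cmod (trigsum S a b t - trigsum S a b s)"
      by (rule norm_triangle_sub)
    also have "\<dots> \<le> cmod (trigsum S a b s) + (K2 + 1)" using d by simp
    finally have "(cmod (trigsum S a b t))\<^sup>2 \<le> (cmod (trigsum S a b s) + (K2 + 1))\<^sup>2" by (intro power_mono) auto
    also have "\<dots> \<le> 2 * (cmod (trigsum S a b s))\<^sup>2 + 2 * (K2 + 1)\<^sup>2"
      using sum_squares_bound[of "cmod (trigsum S a b s)" "K2 + 1"] by (simp add: power2_sum)
    finally show ?thesis .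
  qed
  have "(cmod (trigsum S a b t))\<^sup>2 = integral {0..1} (\<lambda>s::real. (cmod (trigsum S a b t))\<^sup>2)" by simp
  also have "\<dots> \<le> integral {0..1} (\<lambda>s. 2 * (cmod (trigsum S a b s))\<^sup>2 + 2 * (K2 + 1)\<^sup>2)"
    by (rule integral_le) (use pt in \<open>simp_all add: integrable_continuous_real continuous_on_power continuous_on_norm
        continuous_on_add continuous_on_mult cont_trigsum\<close>)
  also have "\<dots> = 2 * integral {0..1} (\<lambda>s. (cmod (trigsum S a b s))\<^sup>2) + 2 * (K2 + 1)\<^sup>2"
  proof -
    have i: "(\<lambda>x. (cmod (trigsum S a b x))\<^sup>2) integrable_on {0..1}"
      by (intro integrable_continuous_real continuous_intros cont_trigsum)
    show ?thesis
      using integral_unique[OF has_integral_add[OF has_integral_mult_right[OF integrable_integral[OF i], of 2]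
            has_integral_const_real[of "2 * (K2 + 1)\<^sup>2" 0 1]]] by simp
  qed
  also have "integral {0..1} (\<lambda>s. (cmod (trigsum S a b s))\<^sup>2) = (\<Sum>m\<in>S b. (a b m)\<^sup>2)"
    unfolding trigsum_def by (rule trig_parseval[OF fS])
  also have "\<dots> \<le> K1" by (rule approx_bounds(1)[OF ap eps b])
  finally have sq: "(cmod (trigsum S a b t))\<^sup>2 \<le> 2 * K1 + 2 * (K2 + 1)\<^sup>2" by simp
  have "x \<le> x\<^sup>2 + 1" for x :: real using zero_le_power2[of "x - 1/2"] by (simp add: power2_eq_square algebra_simps)
  from this[of "cmod (trigsum S a b t)"] show ?thesis using sq by linarith
qed

end

text \<open>The mean square of \<open>f - c\<close> is nonnegative, where \<open>c\<close> is the
  mean of \<open>f\<close>.\<close>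

lemma integral_sq_ge:
  fixes f :: "real \<Rightarrow> real"
  assumes "continuous_on {0..1} f"
  shows "(integral {0..1} f)\<^sup>2 \<le> integral {0..1} (\<lambda>t. (f t)\<^sup>2)"
proof -
  define c where "c = integral {0..1} f"
  have i1: "f integrable_on {0..1}" and i2: "(\<lambda>t. (f t)\<^sup>2) integrable_on {0..1}"
    by (intro integrable_continuous_real continuous_intros assms)+
  have "((\<lambda>t. (f t)\<^sup>2 - (2 * c) * f t + c\<^sup>2) has_integral (integral {0..1} (\<lambda>t. (f t)\<^sup>2) - (2 * c) * c + c\<^sup>2)) {0..1}"
    using has_integral_add[OF has_integral_diff[OF integrable_integral[OF i2] has_integral_mult_right[OF integrable_integral[OF i1], of "2 * c"]]
      has_integral_const_real[of "c\<^sup>2" 0 1]] by (simp add: c_def)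
  moreover have "0 \<le> (f t)\<^sup>2 - (2 * c) * f t + c\<^sup>2" for t
    using zero_le_power2[of "f t - c"] by (simp add: power2_diff algebra_simps)
  ultimately have "0 \<le> integral {0..1} (\<lambda>t. (f t)\<^sup>2) - (2 * c) * c + c\<^sup>2"
    by (meson has_integral_nonneg)
  then show ?thesis by (simp add: c_def power2_eq_square)
qed

section \<open>The limit orbit and its ends\<close>

context symplectic_frame begin

text \<open>Phase rotations, one angle per block, of the images of real spheres. A block of doubled
  planes gives a full sphere in these planes.\<close>

definition reduced_set :: "('a \<times> 'a) set" where
  "reduced_set = {\<Sum>b\<in>B. a b *\<^sub>R rot (\<phi> (blk b)) (l b) | a \<phi>. \<forall>j. (\<Sum>b\<in>blkset j. (a b)\<^sup>2) = (r j)\<^sup>2}"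

end

context bounded_frame_hamiltonian begin

text \<open>Along a subsequence the paths converge uniformly and the parameters converge.
  Derivatives need not converge, so the equation passes to the limit in integral form. The ends are
  real because every mode is, and the remaining two residuals fix the block sizes at times 0 and
  1.\<close>

lemma limit_solution:
  assumes ap: "\<And>i::nat. approx_sol i (1 / (real i + 1)) (S i) (a i) (\<alpha> i) (\<theta> i)"
  shows "\<exists>x. (\<forall>t\<in>{0..1}. (x has_vector_derivative J (gH t (x t))) (at t within {0..1})) \<and>
     x 0 \<in> reduced_set \<and> x 1 \<in> reduced_set"
proof -
  define u where "u i b = trigsum (S i) (a i) b" for i b
  have eps: "1 / (real i + 1) \<le> 1" "1 / (real i + 1) \<ge> 0" for i by auto
  define K where "K = 2 * K1 + 2 * (K2 + 1)\<^sup>2 + 1"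
  have K0: "K \<ge> 0" using K12_nonneg by (simp add: K_def)
  have uK: "cmod (u i b t) \<le> K" if "b \<in> B" "t \<in> {0..1}" for i b t
    unfolding u_def K_def by (rule approx_sup[OF ap eps that])
  have cu: "continuous_on T (u i b)" for T i b unfolding u_def by (rule cont_trigsum)
  have fS: "finite (S i b)" "{- int i..int i} \<subseteq> S i b" for i b using ap[of i] unfolding approx_sol_def by blast+
  have ath: "0 \<le> \<alpha> i j" "\<alpha> i j \<le> 1" "0 \<le> \<theta> i j" "\<theta> i j \<le> 2" for i j
    using ap[of i] unfolding approx_sol_def by blast+
  \<comment> \<open>Padding by 0 outside \<open>B\<close> puts all coordinates into one curve, for
    Arzela-Ascoli.\<close>
  define \<F> :: "nat \<Rightarrow> real \<Rightarrow> complex ^ 'b" where "\<F> i t = (\<chi> b. if b \<in> B then u i b t else 0)" for i t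
  have normF: "norm v \<le> (\<Sum>b\<in>UNIV. cmod (v $ b))" for v :: "complex ^ 'b"
    unfolding norm_vec_def by (rule L2_set_le_sum) auto
  define n where "n = real CARD('b)"
  have n: "n > 0" by (simp add: n_def)
  obtain g k1 where g: "continuous_on {0..1} g" "strict_mono (k1 :: nat \<Rightarrow> nat)"
      "\<And>e. 0 < e \<Longrightarrow> \<exists>N. \<forall>i t. i \<ge> N \<and> t \<in> {0..1} \<longrightarrow> norm (\<F> (k1 i) t - g t) < e"
  proof -
    note ob = that
    show thesis
    proof (rule Arzela_Ascoli[of "{0..1}" \<F> "n * K"])
    show thesis if "continuous_on {0..1} g" "strict_mono k"
      "\<And>e. 0 < e \<Longrightarrow> \<exists>N. \<forall>n x. N \<le> n \<and> x \<in> {0..1} \<longrightarrow> norm (\<F> (k n) x - g x) < e" for g and k :: "nat \<Rightarrow> nat"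
      by (rule ob[OF that(1,2)]) (rule that(3))
    show "compact {0..1::real}" by simp
    show "norm (\<F> i t) \<le> n * K" if "t \<in> {0..1}" for i t
    proof -
      have "norm (\<F> i t) \<le> (\<Sum>b\<in>UNIV. cmod (\<F> i t $ b))" by (rule normF)
      also have "\<dots> \<le> (\<Sum>b\<in>(UNIV :: 'b set). K)" using uK that K0 by (intro sum_mono) (auto simp: \<F>_def)
      finally show ?thesis by (simp add: n_def)
    qed
    fix s e :: real assume s: "s \<in> {0..1}" and e: "0 < e"
    \<comment> \<open>With this \<eta> and the \<open>d\<close> below, both terms of
      \<open>approx_equicont\<close> are at most \<open>e / (4 * n)\<close>; summed over the
      \<open>n\<close> coordinates they stay below \<open>e\<close>.\<close>
    define \<eta> where "\<eta> = e / (4 * n * (K2 + 1))"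
    have K2: "K2 + 1 > 0" using K12_nonneg by simp
    have \<eta>: "\<eta> > 0" unfolding \<eta>_def using e n K2 by simp
    define d where "d = \<eta> * (e / (4 * n))"
    have d: "d > 0" unfolding d_def using \<eta> e n by simp
    show "\<exists>d>0. \<forall>i t. t \<in> {0..1} \<and> norm (s - t) < d \<longrightarrow> norm (\<F> i s - \<F> i t) < e"
    proof (intro exI[of _ d] conjI d allI impI)
      fix i t assume t: "t \<in> {0..1} \<and> norm (s - t) < d"
      have eb: "cmod ((\<F> i s - \<F> i t) $ b) \<le> e / (2 * n)" for b
      proof (cases "b \<in> B")
        case True
        have "cmod (u i b s - u i b t) \<le> \<eta> * K2 + \<bar>s - t\<bar> / \<eta>"
          unfolding u_def using t s by (intro approx_equicont[OF ap eps True _ _ \<eta>]) auto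
        also have "\<bar>s - t\<bar> / \<eta> \<le> e / (4 * n)"
          using t \<eta> by (simp add: d_def divide_le_eq mult.commute)
        also have "\<eta> * K2 \<le> \<eta> * (K2 + 1)" using \<eta> by simp
        also have "\<eta> * (K2 + 1) = e / (4 * n)" unfolding \<eta>_def using K2 by simp
        finally show ?thesis using True n by (simp add: \<F>_def field_simps)
      next
        case False then show ?thesis using e n by (simp add: \<F>_def)
      qed
      have "norm (\<F> i s - \<F> i t) \<le> (\<Sum>b\<in>UNIV. cmod ((\<F> i s - \<F> i t) $ b))" by (rule normF)
      also have "\<dots> \<le> (\<Sum>b\<in>(UNIV :: 'b set). e / (2 * n))" by (intro sum_mono eb)
      also have "\<dots> < e" using e n by (simp add: n_def)
      finally show "norm (\<F> i s - \<F> i t) < e" .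
    qed
  qed
  qed
  define P :: "nat \<Rightarrow> (real ^ 'k) \<times> (real ^ 'k)" where "P i = ((\<chi> j. \<alpha> (k1 i) j), (\<chi> j. \<theta> (k1 i) j))" for i
  have "seq_compact (cbox 0 (\<chi> j. 1) \<times> cbox 0 (\<chi> j. 2) :: ((real ^ 'k) \<times> (real ^ 'k)) set)"
    by (intro compact_imp_seq_compact compact_Times compact_cbox)
  moreover have "P i \<in> cbox 0 (\<chi> j. 1) \<times> cbox 0 (\<chi> j. 2)" for i
    using ath by (simp add: P_def mem_box_cart)
  ultimately obtain p k2 where k2: "strict_mono (k2 :: nat \<Rightarrow> nat)" and p: "(P \<circ> k2) \<longlonglongrightarrow> p"
    unfolding seq_compact_def by (elim allE[of _ P]) blast
  define k where "k i = k1 (k2 i)" for i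
  have "strict_mono k" unfolding k_def using g(2) k2 by (simp add: strict_mono_def)
  then have ki: "i \<le> k i" for i by (rule seq_suble)
  define A where "A j = fst p $ j" for j
  define Th where "Th j = snd p $ j" for j
  define U where "U b t = g t $ b" for b t
  have lim_al: "(\<lambda>i. \<alpha> (k i) j) \<longlonglongrightarrow> A j" and lim_th: "(\<lambda>i. \<theta> (k i) j) \<longlonglongrightarrow> Th j" for j
    using tendsto_vec_nth[OF tendsto_fst[OF p], of j] tendsto_vec_nth[OF tendsto_snd[OF p], of j]
    by (simp_all add: P_def A_def Th_def k_def o_def)
  have lim_u: "(\<lambda>i. u (k i) b t) \<longlonglongrightarrow> U b t" if b: "b \<in> B" and t: "t \<in> {0..1}" for b t
  proof -
    have "(\<lambda>i. \<F> (k1 i) t) \<longlonglongrightarrow> g t"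
      using g(3) t by (subst LIMSEQ_iff) blast
    from LIMSEQ_subseq_LIMSEQ[OF tendsto_vec_nth[OF this, of b] k2] show ?thesis
      using b by (simp add: \<F>_def o_def k_def U_def)
  qed
  have cU: "continuous_on {0..1} (U b)" for b
    unfolding U_def using g(1) by (intro continuous_intros)
  define w where "w i t = wave (\<alpha> (k i)) (\<theta> (k i)) (u (k i)) t" for i t
  define W where "W t = wave A Th U t" for t
  define G where "G i b = twist (\<alpha> (k i)) (\<theta> (k i)) (u (k i)) b" for i b
  define Gs where "Gs b = twist A Th U b" for b
  have lim_ph: "(\<lambda>i. phase (\<alpha> (k i)) (\<theta> (k i)) b t) \<longlonglongrightarrow> phase A Th b t" for b t
    unfolding phase_def cis_conv_exp by (intro tendsto_intros lim_al lim_th)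
  have lim_w: "(\<lambda>i. w i t b) \<longlonglongrightarrow> W t b" if "b \<in> B" "t \<in> {0..1}" for b t
    unfolding w_def W_def wave_def by (intro tendsto_intros lim_ph lim_u that)
  have lim_f: "(\<lambda>i. gH t (pnt (w i t))) \<longlonglongrightarrow> gH t (pnt (W t))" if t: "t \<in> {0..1}" for t
  proof -
    have "continuous_on UNIV (\<lambda>x. gH t x)"
    proof -
      have "continuous_on UNIV (\<lambda>x :: 'a \<times> 'a. (t, x))" by (intro continuous_intros)
      moreover have "(\<lambda>x :: 'a \<times> 'a. (t, x)) ` UNIV \<subseteq> {0..1} \<times> UNIV" using t by auto
      ultimately have "continuous_on UNIV (\<lambda>x. (\<lambda>(t, x). gH t x) (t, x))"
        by (rule continuous_on_compose2[OF gH_cont])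
      then show ?thesis by simp
    qed
    then have "isCont (gH t) (pnt (W t))" using continuous_on_eq_continuous_at[OF open_UNIV] by blast
    moreover have "(\<lambda>i. pnt (w i t)) \<longlonglongrightarrow> pnt (W t)"
      unfolding pnt_def by (intro tendsto_intros lim_w t)
    ultimately show ?thesis by (rule isCont_tendsto_compose)
  qed
  have lim_frc: "(\<lambda>i. frc t (w i t) b) \<longlonglongrightarrow> frc t (W t) b" if "t \<in> {0..1}" for t b
    unfolding frc_def by (intro tendsto_Complex tendsto_inner lim_f that tendsto_const)
  have lim_G: "(\<lambda>i. G i b t) \<longlonglongrightarrow> Gs b t" if "t \<in> {0..1}" for t b
    unfolding G_def Gs_def twist_def w_def[symmetric] W_def[symmetric]
    by (intro tendsto_mult tendsto_cnj lim_ph lim_frc that)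
  have lim_flux: "(\<lambda>i. flux t (w i t) j) \<longlonglongrightarrow> flux t (W t) j" if "t \<in> {0..1}" for t j
    unfolding flux_def
    by (intro tendsto_sum tendsto_Im tendsto_mult tendsto_cnj lim_w lim_frc that blkset_simps(2))
  have cW: "continuous_on {0..1} (\<lambda>t. W t b)" for b unfolding W_def by (intro cont_wave cU)
  have cw: "continuous_on {0..1} (\<lambda>t. w i t b)" for i b unfolding w_def by (intro cont_wave cu)
  have cG: "continuous_on {0..1} (G i b)" for i b unfolding G_def by (intro cont_twist cu)
  have cGs: "continuous_on {0..1} (Gs b)" for b unfolding Gs_def by (intro cont_twist cU)
  have GK: "cmod (G i b t) \<le> 2 * C * norm (l b)" if "t \<in> {0..1}" for i b t
    unfolding G_def by (rule twist_bound[OF that])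
  have e0: "(\<lambda>i. 1 / (real (k i) + 1)) \<longlonglongrightarrow> 0"
  proof (rule tendsto_sandwich[OF _ _ tendsto_const LIMSEQ_inverse_real_of_nat])
    show "\<forall>\<^sub>F i in sequentially. 1 / (real (k i) + 1) \<le> inverse (real (Suc i))"
      using ki by (intro always_eventually allI) (simp add: field_simps)
  qed auto
  \<comment> \<open>The Galerkin error of the force tends to 0 because the window of modes exhausts all integers.\<close>
  define Pr where "Pr i b t = (\<Sum>m\<in>S (k i) b. of_real (trig_coeff (G i b) m) * cis (pi * of_int m * t))" for i b t
  have cPr: "continuous_on T (Pr i b)" for T i b unfolding Pr_def by (intro continuous_intros)
  have proj: "(\<lambda>i. integral {0..1} (\<lambda>t. (cmod (G i b t - Pr i b t))\<^sup>2)) \<longlonglongrightarrow> 0" for b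
  proof (rule LIMSEQ_I)
    fix e :: real assume e: "e > 0"
    obtain f where f: "trig_real f" "integral {0..1} (\<lambda>t. (cmod (Gs b t - f t))\<^sup>2) < e"
      by (rule trig_real_dense[OF cGs e])
    obtain n' c where c: "f = (\<lambda>t. \<Sum>m\<in>{- int n'..int n'}. of_real (c m) * cis (pi * of_int m * t))"
      "\<And>m. m \<notin> {- int n'..int n'} \<Longrightarrow> c m = 0" by (rule trig_real_sum[OF f(1)]) blast
    have cf: "continuous_on {0..1} f" unfolding c by (intro continuous_intros)
    have "compact (f ` {0..1})" using cf by (intro compact_continuous_image) auto
    then have "bounded (f ` {0..1})" by (rule compact_imp_bounded)
    then obtain L where "\<forall>y\<in>f ` {0..1}. cmod y \<le> L" unfolding bounded_iff by blast
    then have L: "\<And>t. t \<in> {0..1} \<Longrightarrow> cmod (f t) \<le> L" by simp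
    have "(\<lambda>i. integral {0..1} (\<lambda>t. (cmod (G i b t - f t))\<^sup>2)) \<longlonglongrightarrow> integral {0..1} (\<lambda>t. (cmod (Gs b t - f t))\<^sup>2)"
    proof (rule dominated_convergence(2))
      show "(\<lambda>t. (cmod (G i b t - f t))\<^sup>2) integrable_on {0..1}" for i
        by (intro integrable_continuous_real continuous_intros cG cf)
      show "(\<lambda>t. (2 * C * norm (l b) + L)\<^sup>2) integrable_on {0..1::real}" by (intro integrable_continuous_real continuous_on_const)
      show "norm ((cmod (G i b t - f t))\<^sup>2) \<le> (2 * C * norm (l b) + L)\<^sup>2" if t: "t \<in> {0..1}" for i t
      proof -
        have "cmod (G i b t - f t) \<le> 2 * C * norm (l b) + L"
          using norm_triangle_ineq4[of "G i b t" "f t"] GK[OF t, of i b] L[OF t] by linarith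
        then show ?thesis by (simp add: power_mono)
      qed
      show "(\<lambda>i. (cmod (G i b t - f t))\<^sup>2) \<longlonglongrightarrow> (cmod (Gs b t - f t))\<^sup>2" if "t \<in> {0..1}" for t
        by (intro tendsto_intros lim_G that)
    qed
    then have "\<forall>\<^sub>F i in sequentially. integral {0..1} (\<lambda>t. (cmod (G i b t - f t))\<^sup>2) < e"
      using f(2) order_tendstoD(2) by blast
    then obtain N where N: "\<And>i. i \<ge> N \<Longrightarrow> integral {0..1} (\<lambda>t. (cmod (G i b t - f t))\<^sup>2) < e"
      unfolding eventually_sequentially by blast
    have "norm (integral {0..1} (\<lambda>t. (cmod (G i b t - Pr i b t))\<^sup>2) - 0) < e" if i: "i \<ge> max N n'" for i
    proof -
      have sub: "{- int n'..int n'} \<subseteq> S (k i) b" using fS(2)[of "k i" b] ki[of i] i by fastforce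
      have fe: "f t = (\<Sum>m\<in>S (k i) b. of_real (c m) * cis (pi * of_int m * t))" for t
        unfolding c(1) using c(2) fS(1) by (intro sum.mono_neutral_left[OF _ sub]) auto
      \<comment> \<open>Projection is at least as good as the fixed polynomial \<open>f\<close>,
        even though the projected function changes with \<open>i\<close>.\<close>
      have "integral {0..1} (\<lambda>t. (cmod (G i b t - Pr i b t))\<^sup>2) \<le> integral {0..1} (\<lambda>t. (cmod (G i b t - f t))\<^sup>2)"
        unfolding Pr_def fe by (rule trig_best_approx[OF fS(1) cG])
      also have "\<dots> < e" using N i by simp
      finally have "integral {0..1} (\<lambda>t. (cmod (G i b t - Pr i b t))\<^sup>2) < e" .
      moreover have "0 \<le> integral {0..1} (\<lambda>t. (cmod (G i b t - Pr i b t))\<^sup>2)"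
        by (intro integral_nonneg integrable_continuous_real continuous_intros cG cPr) auto
      ultimately show ?thesis by simp
    qed
    then show "\<exists>N. \<forall>i\<ge>N. norm (integral {0..1} (\<lambda>t. (cmod (G i b t - Pr i b t))\<^sup>2) - 0) < e" by blast
  qed
  define \<rho> where "\<rho> i b m = pi * (of_int m - \<alpha> (k i) (blk b)) * a (k i) b m - trig_coeff (G i b) m" for i b m
  define Rs where "Rs i b t = (\<Sum>m\<in>S (k i) b. of_real (\<rho> i b m) * cis (pi * of_int m * t))" for i b t
  have cRs: "continuous_on T (Rs i b)" for T i b unfolding Rs_def by (intro continuous_intros)
  \<comment> \<open>Residual, projected force and drift: the coefficient equation summed over the
    modes.\<close>
  have dsplit: "dtrig (S (k i)) (a (k i)) b t = Rs i b t + Pr i b t + of_real (pi * \<alpha> (k i) (blk b)) * u (k i) b t" for i b t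
    unfolding dtrig_def trigsum_def Rs_def Pr_def u_def sum_distrib_left sum.distrib[symmetric]
    by (intro sum.cong refl) (simp add: \<rho>_def algebra_simps)
  have res: "(\<lambda>i. integral {0..1} (\<lambda>t. (cmod (Rs i b t))\<^sup>2)) \<longlonglongrightarrow> 0" if b: "b \<in> B" for b
  proof (rule tendsto_sandwich[OF _ _ tendsto_const])
    have "(\<lambda>i. (1 / (real (k i) + 1))\<^sup>2) \<longlonglongrightarrow> 0\<^sup>2" by (intro tendsto_intros e0)
    then show "(\<lambda>i. (1 / (real (k i) + 1))\<^sup>2) \<longlonglongrightarrow> 0" by simp
    have eq: "integral {0..1} (\<lambda>t. (cmod (Rs i b t))\<^sup>2) = (\<Sum>m\<in>S (k i) b. (\<rho> i b m)\<^sup>2)" for i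
      unfolding Rs_def by (rule trig_parseval[OF fS(1)])
    show "\<forall>\<^sub>F i in sequentially. 0 \<le> integral {0..1} (\<lambda>t. (cmod (Rs i b t))\<^sup>2)"
      unfolding eq by (intro always_eventually allI sum_nonneg) auto
    show "\<forall>\<^sub>F i in sequentially. integral {0..1} (\<lambda>t. (cmod (Rs i b t))\<^sup>2) \<le> (1 / (real (k i) + 1))\<^sup>2"
    proof (intro always_eventually allI)
      fix i
      have "(\<Sum>m\<in>S (k i) b. (\<rho> i b m)\<^sup>2) \<le> (\<Sum>b\<in>B. \<Sum>m\<in>S (k i) b. (\<rho> i b m)\<^sup>2)"
        using b finB by (intro member_le_sum[of b]) (auto intro!: sum_nonneg)
      also have "\<dots> \<le> (1 / (real (k i) + 1))\<^sup>2"
        using ap[of "k i"] unfolding approx_sol_def \<rho>_def G_def u_def[abs_def] by (elim conjE)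
      finally show "integral {0..1} (\<lambda>t. (cmod (Rs i b t))\<^sup>2) \<le> (1 / (real (k i) + 1))\<^sup>2" unfolding eq .
    qed
  qed
  have l1: "(\<lambda>i. integral {0..1} (\<lambda>t. cmod (f i t))) \<longlonglongrightarrow> 0"
    if f: "\<And>i. continuous_on {0..1} (f i)" "(\<lambda>i. integral {0..1} (\<lambda>t. (cmod (f i t))\<^sup>2)) \<longlonglongrightarrow> 0" for f :: "nat \<Rightarrow> real \<Rightarrow> complex"
  proof (rule tendsto_sandwich[OF _ _ tendsto_const])
    show "(\<lambda>i. sqrt (integral {0..1} (\<lambda>t. (cmod (f i t))\<^sup>2))) \<longlonglongrightarrow> 0" using tendsto_real_sqrt[OF f(2)] by simp
    have nn: "0 \<le> integral {0..1} (\<lambda>t. cmod (f i t))" for i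
      by (intro integral_nonneg integrable_continuous_real continuous_intros f) auto
    then show "\<forall>\<^sub>F i in sequentially. 0 \<le> integral {0..1} (\<lambda>t. cmod (f i t))" by simp
    show "\<forall>\<^sub>F i in sequentially. integral {0..1} (\<lambda>t. cmod (f i t)) \<le> sqrt (integral {0..1} (\<lambda>t. (cmod (f i t))\<^sup>2))"
      by (intro always_eventually allI real_le_rsqrt integral_sq_ge continuous_intros f)
  qed
  \<comment> \<open>The orbit equation in the rotating frame, whose drift comes from the limit
    \<open>A\<close> of the fractional multipliers.\<close>
  have Ueq: "U b t = U b 0 + \<i> * integral {0..t} (\<lambda>s. Gs b s + of_real (pi * A (blk b)) * U b s)"
    if b: "b \<in> B" and t: "t \<in> {0..1}" for b t
  proof -
    define Q where "Q i s = G i b s + of_real (pi * \<alpha> (k i) (blk b)) * u (k i) b s" for i s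
    have cQ: "continuous_on {0..1} (Q i)" for i unfolding Q_def by (intro continuous_intros cG cu)
    have sub: "{0..t} \<subseteq> {0..1}" using t by auto
    have "(\<lambda>i. integral {0..t} (Q i)) \<longlonglongrightarrow> integral {0..t} (\<lambda>s. Gs b s + of_real (pi * A (blk b)) * U b s)"
    proof (rule dominated_convergence(2))
      show "Q i integrable_on {0..t}" for i
        by (intro integrable_continuous_real continuous_on_subset[OF cQ sub])
      show "(\<lambda>s. 2 * C * norm (l b) + pi * K) integrable_on {0..t}" by (intro integrable_continuous_real continuous_on_const)
      show "norm (Q i s) \<le> 2 * C * norm (l b) + pi * K" if s: "s \<in> {0..t}" for i s
      proof -
        have s': "s \<in> {0..1}" using s sub by blast
        have "norm (of_real (pi * \<alpha> (k i) (blk b)) * u (k i) b s) \<le> pi * K"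
          unfolding norm_mult norm_of_real using uK[OF b s', of "k i"] ath[of "k i" "blk b"] K0
          by (intro mult_mono) (auto simp: abs_mult mult_left_le)
        then show ?thesis unfolding Q_def
          using norm_triangle_ineq[of "G i b s" "of_real (pi * \<alpha> (k i) (blk b)) * u (k i) b s"] GK[OF s', of i b] by linarith
      qed
      show "(\<lambda>i. Q i s) \<longlonglongrightarrow> Gs b s + of_real (pi * A (blk b)) * U b s" if "s \<in> {0..t}" for s
        unfolding Q_def using that sub by (intro tendsto_intros lim_G lim_al lim_u b) auto
    qed
    then have r: "(\<lambda>i. u (k i) b 0 + \<i> * integral {0..t} (Q i)) \<longlonglongrightarrow> U b 0 + \<i> * integral {0..t} (\<lambda>s. Gs b s + of_real (pi * A (blk b)) * U b s)"
      by (intro tendsto_intros lim_u b) auto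
    have z: "(\<lambda>i. u (k i) b t - (u (k i) b 0 + \<i> * integral {0..t} (Q i))) \<longlonglongrightarrow> 0"
    proof (rule Lim_null_comparison)
      have "(\<lambda>i. integral {0..1} (\<lambda>t. cmod (Rs i b t)) + integral {0..1} (\<lambda>t. cmod (G i b t - Pr i b t))) \<longlonglongrightarrow> 0 + 0"
        by (intro tendsto_add l1 cRs res b proj continuous_intros cG cPr)
      then show "(\<lambda>i. integral {0..1} (\<lambda>t. cmod (Rs i b t)) + integral {0..1} (\<lambda>t. cmod (G i b t - Pr i b t))) \<longlonglongrightarrow> 0" by simp
      show "\<forall>\<^sub>F i in sequentially. norm (u (k i) b t - (u (k i) b 0 + \<i> * integral {0..t} (Q i)))
          \<le> integral {0..1} (\<lambda>t. cmod (Rs i b t)) + integral {0..1} (\<lambda>t. cmod (G i b t - Pr i b t))"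
      proof (intro always_eventually allI)
        fix i
        have "((\<lambda>s. \<i> * dtrig (S (k i)) (a (k i)) b s) has_integral (u (k i) b t - u (k i) b 0)) {0..t}"
          unfolding u_def using t by (intro trigsum_diff) auto
        moreover have "((\<lambda>s. \<i> * Q i s) has_integral (\<i> * integral {0..t} (Q i))) {0..t}"
          by (intro has_integral_mult_right integrable_integral integrable_continuous_real continuous_on_subset[OF cQ sub])
        ultimately have "((\<lambda>s. \<i> * dtrig (S (k i)) (a (k i)) b s - \<i> * Q i s) has_integral
            (u (k i) b t - u (k i) b 0 - \<i> * integral {0..t} (Q i))) {0..t}" by (rule has_integral_diff)
        moreover have "\<i> * dtrig (S (k i)) (a (k i)) b s - \<i> * Q i s = \<i> * (Rs i b s - (G i b s - Pr i b s))" for s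
          by (simp add: dsplit Q_def algebra_simps)
        ultimately have hi: "((\<lambda>s. \<i> * (Rs i b s - (G i b s - Pr i b s))) has_integral
            (u (k i) b t - u (k i) b 0 - \<i> * integral {0..t} (Q i))) {0..t}" by simp
        have ic: "(\<lambda>s. cmod (Rs i b s) + cmod (G i b s - Pr i b s)) integrable_on {0..1}"
          by (intro integrable_continuous_real continuous_intros cRs cG cPr)
        have ic': "(\<lambda>s. cmod (Rs i b s) + cmod (G i b s - Pr i b s)) integrable_on {0..t}"
          by (intro integrable_continuous_real continuous_on_subset[OF _ sub] continuous_intros cRs cG cPr)
        have "norm (u (k i) b t - (u (k i) b 0 + \<i> * integral {0..t} (Q i))) =
            norm (integral {0..t} (\<lambda>s. \<i> * (Rs i b s - (G i b s - Pr i b s))))"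
          by (simp only: integral_unique[OF hi] diff_diff_add)
        also have "\<dots> \<le> integral {0..t} (\<lambda>s. cmod (Rs i b s) + cmod (G i b s - Pr i b s))"
        proof (rule integral_norm_bound_integral[OF _ ic'])
          show "(\<lambda>s. \<i> * (Rs i b s - (G i b s - Pr i b s))) integrable_on {0..t}" using hi by blast
          show "norm (\<i> * (Rs i b s - (G i b s - Pr i b s))) \<le> cmod (Rs i b s) + cmod (G i b s - Pr i b s)" for s
            using norm_triangle_ineq4[of "Rs i b s" "G i b s - Pr i b s"] by (simp add: norm_mult)
        qed
        also have "\<dots> \<le> integral {0..1} (\<lambda>s. cmod (Rs i b s) + cmod (G i b s - Pr i b s))"
          by (rule integral_subset_le[OF sub ic' ic]) auto
        also have "\<dots> = integral {0..1} (\<lambda>t. cmod (Rs i b t)) + integral {0..1} (\<lambda>t. cmod (G i b t - Pr i b t))"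
          by (intro integral_add integrable_continuous_real continuous_intros cRs cG cPr)
        finally show "norm (u (k i) b t - (u (k i) b 0 + \<i> * integral {0..t} (Q i)))
          \<le> integral {0..1} (\<lambda>t. cmod (Rs i b t)) + integral {0..1} (\<lambda>t. cmod (G i b t - Pr i b t))" .
      qed
    qed
    have "(\<lambda>i. u (k i) b t - (u (k i) b 0 + \<i> * integral {0..t} (Q i))) \<longlonglongrightarrow>
       U b t - (U b 0 + \<i> * integral {0..t} (\<lambda>s. Gs b s + of_real (pi * A (blk b)) * U b s))"
      by (intro tendsto_diff lim_u b t r)
    from LIMSEQ_unique[OF this z] show ?thesis by (simp only: right_minus_eq)
  qed
  \<comment> \<open>Multiplying by the phase cancels the drift and leaves the Hamiltonian system in
    frame coordinates.\<close>
  have dW: "((\<lambda>t. W t b) has_vector_derivative \<i> * frc t (W t) b) (at t within {0..1})" if b: "b \<in> B" and t: "t \<in> {0..1}" for b t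
  proof -
    have int: "((\<lambda>t. integral {0..t} (\<lambda>s. Gs b s + of_real (pi * A (blk b)) * U b s)) has_vector_derivative
        (Gs b t + of_real (pi * A (blk b)) * U b t)) (at t within {0..1})"
      by (intro integral_has_vector_derivative continuous_intros cGs cU t)
    have dU: "(U b has_vector_derivative (0 + \<i> * (Gs b t + of_real (pi * A (blk b)) * U b t))) (at t within {0..1})"
      by (rule has_vector_derivative_transform[OF t Ueq[OF b]
            has_vector_derivative_add[OF has_vector_derivative_const has_vector_derivative_mult_right[OF int]]])
    have dph: "(phase A Th b has_vector_derivative (- \<i> * of_real (pi * A (blk b)) * phase A Th b t)) (at t within {0..1})"
    proof -
      let ?c = "pi * A (blk b)" and ?x = "\<lambda>t. pi * (Th (blk b) - A (blk b) * t)"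
      have cis: "cis y = of_real (cos y) + \<i> * of_real (sin y)" for y by (simp add: complex_eq_iff)
      have k: "- \<i> * of_real c * cis y = of_real (- sin y * - c) + \<i> * of_real (cos y * - c)" for y c :: real
        by (simp add: complex_eq_iff)
      show ?thesis unfolding phase_def[abs_def] k unfolding cis
        by (intro has_vector_derivative_add has_vector_derivative_mult_right has_vector_derivative_of_real)
          (auto intro!: derivative_eq_intros simp: has_real_derivative_iff_has_vector_derivative[symmetric])
    qed
    have pp: "phase A Th b t * cnj (phase A Th b t) = 1" by (simp add: phase_def cis_cnj cis_mult)
    have "((\<lambda>t. W t b) has_vector_derivative (phase A Th b t * (0 + \<i> * (Gs b t + of_real (pi * A (blk b)) * U b t))
         + (- \<i> * of_real (pi * A (blk b)) * phase A Th b t) * U b t)) (at t within {0..1})"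
      unfolding W_def wave_def by (rule has_vector_derivative_mult[OF dph dU])
    moreover have "phase A Th b t * (0 + \<i> * (Gs b t + of_real (pi * A (blk b)) * U b t))
         + (- \<i> * of_real (pi * A (blk b)) * phase A Th b t) * U b t = \<i> * (phase A Th b t * Gs b t)"
      by (simp add: algebra_simps)
    moreover have "phase A Th b t * Gs b t = frc t (W t) b"
      unfolding Gs_def twist_def W_def[symmetric] using pp by (simp add: mult.assoc[symmetric])
    ultimately show ?thesis by simp
  qed
  define x where "x t = pnt (W t)" for t
  have dx: "(x has_vector_derivative J (gH t (x t))) (at t within {0..1})" if t: "t \<in> {0..1}" for t
  proof -
    have "(x has_vector_derivative (\<Sum>b\<in>B. Re (\<i> * frc t (W t) b) *\<^sub>R l b + Im (\<i> * frc t (W t) b) *\<^sub>R J (l b))) (at t within {0..1})"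
      unfolding x_def[abs_def] pnt_def
    proof (intro has_vector_derivative_sum has_vector_derivative_add)
      fix b assume b: "b \<in> B"
      have dR: "((\<lambda>t. Re (W t b)) has_real_derivative Re (\<i> * frc t (W t) b)) (at t within {0..1})"
        and dI: "((\<lambda>t. Im (W t b)) has_real_derivative Im (\<i> * frc t (W t) b)) (at t within {0..1})"
        using bounded_linear.has_vector_derivative[OF bounded_linear_Re dW[OF b t]]
          bounded_linear.has_vector_derivative[OF bounded_linear_Im dW[OF b t]]
        by (simp_all add: has_real_derivative_iff_has_vector_derivative)
      show "((\<lambda>t. Re (W t b) *\<^sub>R l b) has_vector_derivative Re (\<i> * frc t (W t) b) *\<^sub>R l b) (at t within {0..1})"
        using has_vector_derivative_scaleR[OF dR has_vector_derivative_const[of "l b"]] by simp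
      show "((\<lambda>t. Im (W t b) *\<^sub>R J (l b)) has_vector_derivative Im (\<i> * frc t (W t) b) *\<^sub>R J (l b)) (at t within {0..1})"
        using has_vector_derivative_scaleR[OF dI has_vector_derivative_const[of "J (l b)"]] by simp
    qed
    moreover have "(\<Sum>b\<in>B. Re (\<i> * frc t (W t) b) *\<^sub>R l b + Im (\<i> * frc t (W t) b) *\<^sub>R J (l b)) = J (gH t (x t))"
    proof -
      \<comment> \<open>Here the frame identity rebuilds the gradient from its coefficients, so the
        image under \<open>pnt\<close> solves the original equation.\<close>
      have "J (gH t (x t)) = J (\<Sum>b\<in>B. (gH t (x t) \<bullet> l b) *\<^sub>R l b + (gH t (x t) \<bullet> J (l b)) *\<^sub>R J (l b))"
        by (simp only: frame)
      also have "\<dots> = (\<Sum>b\<in>B. (gH t (x t) \<bullet> l b) *\<^sub>R J (l b) - (gH t (x t) \<bullet> J (l b)) *\<^sub>R l b)"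
        by (simp add: J_sum J_add J_scale)
      also have "\<dots> = (\<Sum>b\<in>B. Re (\<i> * frc t (W t) b) *\<^sub>R l b + Im (\<i> * frc t (W t) b) *\<^sub>R J (l b))"
        by (intro sum.cong refl) (simp add: frc_def x_def)
      finally show ?thesis by simp
    qed
    ultimately show ?thesis by simp
  qed
  define nj where "nj j t = (\<Sum>b\<in>blkset j. (cmod (W t b))\<^sup>2)" for j t
  have dn: "(nj j has_real_derivative - 2 * flux t (W t) j) (at t within {0..1})" if t: "t \<in> {0..1}" for t j
  proof -
    have "((\<lambda>t. (Re (W t b))\<^sup>2 + (Im (W t b))\<^sup>2) has_real_derivative - 2 * Im (cnj (W t b) * frc t (W t) b)) (at t within {0..1})" if "b \<in> blkset j" for b
    proof -
      have b: "b \<in> B" by (rule blkset_simps(2)[OF that])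
      have dR: "((\<lambda>t. Re (W t b)) has_real_derivative Re (\<i> * frc t (W t) b)) (at t within {0..1})"
        and dI: "((\<lambda>t. Im (W t b)) has_real_derivative Im (\<i> * frc t (W t) b)) (at t within {0..1})"
        using bounded_linear.has_vector_derivative[OF bounded_linear_Re dW[OF b t]]
          bounded_linear.has_vector_derivative[OF bounded_linear_Im dW[OF b t]]
        by (simp_all add: has_real_derivative_iff_has_vector_derivative)
      show ?thesis by (rule derivative_eq_intros dR dI refl)+ (simp add: algebra_simps)
    qed
    then have "((\<lambda>t. \<Sum>b\<in>blkset j. (Re (W t b))\<^sup>2 + (Im (W t b))\<^sup>2) has_real_derivative (\<Sum>b\<in>blkset j. - 2 * Im (cnj (W t b) * frc t (W t) b))) (at t within {0..1})"
      by (rule DERIV_sum)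
    then show ?thesis unfolding nj_def[abs_def] flux_def cmod_power2 by (simp add: sum_distrib_left)
  qed
  have cfl: "continuous_on {0..1} (\<lambda>t. flux t (W t) j)" for j by (intro cont_flux cW)
  have cflw: "continuous_on {0..1} (\<lambda>t. flux t (w i t) j)" for i j by (intro cont_flux cw)
  have cn: "continuous_on {0..1} (nj j)" for j unfolding nj_def by (intro continuous_intros cW)
  have flK: "\<bar>flux t (w i t) j\<bar> \<le> (\<Sum>b\<in>blkset j. K * (2 * C * norm (l b)))" if t: "t \<in> {0..1}" for t i j
    unfolding flux_def
  proof (rule order_trans[OF sum_abs sum_mono])
    fix b assume "b \<in> blkset j"
    then have b: "b \<in> B" by (rule blkset_simps(2))
    have "\<bar>Im (cnj (w i t b) * frc t (w i t) b)\<bar> \<le> cmod (w i t b) * cmod (frc t (w i t) b)"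
      using abs_Im_le_cmod[of "cnj (w i t b) * frc t (w i t) b"] by (simp add: norm_mult)
    also have "\<dots> \<le> K * (2 * C * norm (l b))"
      using uK[OF b t] frc_bound[OF t] K0 by (intro mult_mono) (auto simp: w_def wave_def norm_mult)
    finally show "\<bar>Im (cnj (w i t b) * frc t (w i t) b)\<bar> \<le> K * (2 * C * norm (l b))" .
  qed
  have limF: "(\<lambda>i. integral {0..1} (\<lambda>t. h t * flux t (w i t) j)) \<longlonglongrightarrow> integral {0..1} (\<lambda>t. h t * flux t (W t) j)"
    if h: "continuous_on {0..1} h" "\<And>t. t \<in> {0..1} \<Longrightarrow> \<bar>h t\<bar> \<le> 1" for h j
  proof (rule dominated_convergence(2))
    show "(\<lambda>t. h t * flux t (w i t) j) integrable_on {0..1}" for i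
      by (intro integrable_continuous_real continuous_intros h cflw)
    show "(\<lambda>t. (\<Sum>b\<in>blkset j. K * (2 * C * norm (l b)))) integrable_on {0..1::real}" by (intro integrable_continuous_real continuous_on_const)
    show "norm (h t * flux t (w i t) j) \<le> (\<Sum>b\<in>blkset j. K * (2 * C * norm (l b)))" if t: "t \<in> {0..1}" for t i
    proof -
      have "\<bar>h t * flux t (w i t) j\<bar> \<le> 1 * \<bar>flux t (w i t) j\<bar>" unfolding abs_mult using h(2)[OF t] by (intro mult_right_mono) auto
      then show ?thesis using flK[OF t, of i j] by simp
    qed
    show "(\<lambda>i. h t * flux t (w i t) j) \<longlonglongrightarrow> h t * flux t (W t) j" if "t \<in> {0..1}" for t
      by (intro tendsto_intros lim_flux that)
  qed
  have limN: "(\<lambda>i. \<Sum>b\<in>blkset j. \<Sum>m\<in>S (k i) b. (a (k i) b m)\<^sup>2) \<longlonglongrightarrow> integral {0..1} (nj j)" for j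
  proof -
    have h: "(\<lambda>i. integral {0..1} (\<lambda>t. (cmod (u (k i) b t))\<^sup>2)) \<longlonglongrightarrow> integral {0..1} (\<lambda>t. (cmod (W t b))\<^sup>2)" if b: "b \<in> blkset j" for b
    proof (rule dominated_convergence(2))
      have bB: "b \<in> B" by (rule blkset_simps(2)[OF b])
      show "(\<lambda>t. (cmod (u (k i) b t))\<^sup>2) integrable_on {0..1}" for i
        by (intro integrable_continuous_real continuous_intros cu)
      show "(\<lambda>t. K\<^sup>2) integrable_on {0..1::real}" by (intro integrable_continuous_real continuous_on_const)
      show "norm ((cmod (u (k i) b t))\<^sup>2) \<le> K\<^sup>2" if "t \<in> {0..1}" for i t
        using uK[OF bB that, of "k i"] by (simp add: power_mono)
      have WU: "cmod (W t b) = cmod (U b t)" for t by (simp add: W_def wave_def norm_mult)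
      show "(\<lambda>i. (cmod (u (k i) b t))\<^sup>2) \<longlonglongrightarrow> (cmod (W t b))\<^sup>2" if "t \<in> {0..1}" for t
        unfolding WU by (intro tendsto_power tendsto_norm lim_u that bB)
    qed
    have "(\<lambda>i. \<Sum>b\<in>blkset j. integral {0..1} (\<lambda>t. (cmod (u (k i) b t))\<^sup>2)) \<longlonglongrightarrow> (\<Sum>b\<in>blkset j. integral {0..1} (\<lambda>t. (cmod (W t b))\<^sup>2))"
      by (intro tendsto_sum h)
    moreover have "integral {0..1} (\<lambda>t. (cmod (u (k i) b t))\<^sup>2) = (\<Sum>m\<in>S (k i) b. (a (k i) b m)\<^sup>2)" for i b
      unfolding u_def trigsum_def by (rule trig_parseval[OF fS(1)])
    moreover have "(\<Sum>b\<in>blkset j. integral {0..1} (\<lambda>t. (cmod (W t b))\<^sup>2)) = integral {0..1} (nj j)"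
      unfolding nj_def by (intro integral_sum[symmetric] blkset_simps integrable_continuous_real continuous_intros cW)
    ultimately show ?thesis by simp
  qed
  have n0: "nj j 0 = (r j)\<^sup>2" and n1: "nj j 1 = (r j)\<^sup>2" for j
  proof -
    define e where "e i = pi / 2 * ((r j)\<^sup>2 - (\<Sum>b\<in>blkset j. \<Sum>m\<in>S (k i) b. (a (k i) b m)\<^sup>2))
        - pi * integral {0..1} (\<lambda>t. (1 - t) * flux t (w i t) j)" for i
    have "e \<longlonglongrightarrow> pi / 2 * ((r j)\<^sup>2 - integral {0..1} (nj j)) - pi * integral {0..1} (\<lambda>t. (1 - t) * flux t (W t) j)"
      unfolding e_def[abs_def] by (intro tendsto_intros limN limF continuous_intros) auto
    moreover have "e \<longlonglongrightarrow> 0"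
    proof (rule Lim_null_comparison[OF _ e0])
      have "\<bar>e i\<bar> \<le> 1 / (real (k i) + 1)" for i
        using ap[of "k i"] unfolding approx_sol_def e_def w_def u_def[abs_def] by (elim conjE) (erule allE[of _ j], assumption)
      then show "\<forall>\<^sub>F i in sequentially. norm (e i) \<le> 1 / (real (k i) + 1)" by simp
    qed
    ultimately have "pi / 2 * ((r j)\<^sup>2 - integral {0..1} (nj j)) - pi * integral {0..1} (\<lambda>t. (1 - t) * flux t (W t) j) = 0"
      by (rule LIMSEQ_unique)
    then have "pi / 2 * ((r j)\<^sup>2 - integral {0..1} (nj j) - 2 * integral {0..1} (\<lambda>t. (1 - t) * flux t (W t) j)) = 0"
      by (simp add: algebra_simps)
    then have e1: "(r j)\<^sup>2 = integral {0..1} (nj j) + 2 * integral {0..1} (\<lambda>t. (1 - t) * flux t (W t) j)"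
      by simp
    \<comment> \<open>Integrating this derivative turns the weighted flux of the \<open>Lam\<close>
      equation into the block size at time 0; the vanishing total flux then transports it to time
      1.\<close>
    have "((\<lambda>t. (1 - t) * nj j t) has_real_derivative - (nj j t + 2 * ((1 - t) * flux t (W t) j))) (at t within {0..1})" if "t \<in> {0..1}" for t
      by (rule derivative_eq_intros dn that refl)+ (simp add: algebra_simps)
    then have "((\<lambda>t. - (nj j t + 2 * ((1 - t) * flux t (W t) j))) has_integral ((1 - 1) * nj j 1 - (1 - 0) * nj j 0)) {0..1}"
      by (intro fundamental_theorem_of_calculus) (auto simp: has_real_derivative_iff_has_vector_derivative[symmetric])
    then have "- nj j 0 = integral {0..1} (\<lambda>t. - (nj j t + 2 * ((1 - t) * flux t (W t) j)))"
      by (simp add: integral_unique)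
    also have "\<dots> = - (integral {0..1} (nj j) + 2 * integral {0..1} (\<lambda>t. (1 - t) * flux t (W t) j))"
      unfolding integral_neg
      by (subst integral_add) (auto intro!: integrable_continuous_real continuous_on_mult continuous_on_diff continuous_on_const continuous_on_id cn cfl)
    finally show n0: "nj j 0 = (r j)\<^sup>2" using e1 by simp
    have "(\<lambda>i. pi * integral {0..1} (\<lambda>t. flux t (w i t) j)) \<longlonglongrightarrow> pi * integral {0..1} (\<lambda>t. flux t (W t) j)"
      using limF[of "\<lambda>t. 1" j] by (intro tendsto_intros) (simp add: continuous_on_const)
    moreover have "(\<lambda>i. pi * integral {0..1} (\<lambda>t. flux t (w i t) j)) \<longlonglongrightarrow> 0"
    proof (rule Lim_null_comparison[OF _ e0])
      have "\<bar>pi * integral {0..1} (\<lambda>t. flux t (w i t) j)\<bar> \<le> 1 / (real (k i) + 1)" for i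
        using ap[of "k i"] unfolding approx_sol_def w_def u_def[abs_def] by (elim conjE) (erule allE[of _ j], erule allE[of _ j], assumption)
      then show "\<forall>\<^sub>F i in sequentially. norm (pi * integral {0..1} (\<lambda>t. flux t (w i t) j)) \<le> 1 / (real (k i) + 1)" by simp
    qed
    ultimately have "pi * integral {0..1} (\<lambda>t. flux t (W t) j) = 0" by (rule LIMSEQ_unique)
    then have z: "integral {0..1} (\<lambda>t. flux t (W t) j) = 0" by simp
    have "((\<lambda>t. - 2 * flux t (W t) j) has_integral (nj j 1 - nj j 0)) {0..1}"
      using dn by (intro fundamental_theorem_of_calculus) (auto simp: has_real_derivative_iff_has_vector_derivative[symmetric])
    from integral_unique[OF this] have "nj j 1 - nj j 0 = - 2 * integral {0..1} (\<lambda>t. flux t (W t) j)"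
      unfolding integral_mult_right by simp
    then show "nj j 1 = (r j)\<^sup>2" using z n0 by simp
  qed
  have real_end: "Im (U b t) = 0" if b: "b \<in> B" and t: "t = 0 \<or> t = 1" for b t
  proof -
    have "Im (u i b t) = 0" for i
    proof -
      have "sin (pi * of_int m * t) = 0" for m :: int
        using t by (auto simp: sin_zero_iff_int2 mult.commute)
      then show ?thesis by (simp add: u_def trigsum_def Im_sum)
    qed
    then have "(\<lambda>i. 0) \<longlonglongrightarrow> Im (U b t)" using tendsto_Im[OF lim_u[OF b, of t]] t by auto
    then show ?thesis by (simp add: LIMSEQ_const_iff)
  qed
  have ends: "x t \<in> reduced_set" if t: "t = 0 \<or> t = 1" for t
  proof -
    define \<phi> where "\<phi> j = pi * (Th j - A j * t)" for j
    define c where "c b = Re (U b t)" for b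
    have W: "W t b = of_real (c b) * cis (\<phi> (blk b))" if "b \<in> B" for b
      using real_end[OF that t] by (simp add: W_def wave_def phase_def \<phi>_def c_def complex_eq_iff)
    have "x t = (\<Sum>b\<in>B. c b *\<^sub>R rot (\<phi> (blk b)) (l b))"
      unfolding x_def pnt_def by (intro sum.cong refl) (simp add: W rot_def scaleR_add_right)
    moreover have "(\<Sum>b\<in>blkset j. (c b)\<^sup>2) = (r j)\<^sup>2" for j
    proof -
      have "nj j t = (\<Sum>b\<in>blkset j. (c b)\<^sup>2)"
        unfolding nj_def by (intro sum.cong refl) (simp add: W blkset_simps norm_mult)
      then show ?thesis using n0 n1 t by auto
    qed
    ultimately show ?thesis unfolding reduced_set_def by blast
  qed
  show ?thesis using dx ends by blast
qed

text \<open>One almost critical point is chosen for each tolerance 1 / (i + 1), with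
  \<open>M\<close> so large that the modes from -i to i survive the gauge shift.\<close>

theorem intersection_solution:
  assumes bounds: "\<And>M z. c0 \<le> - integral {0..1} (\<lambda>t. H t (traj M B z t))"
      "\<And>M z. - integral {0..1} (\<lambda>t. H t (traj M B z t)) \<le> c1"
    and gap: "\<And>j. c1 - c0 < pi / 2 * (r j)\<^sup>2"
  shows "\<exists>x. (\<forall>t\<in>{0..1}. (x has_vector_derivative J (gH t (x t))) (at t within {0..1})) \<and>
     x 0 \<in> reduced_set \<and> x 1 \<in> reduced_set"
proof -
  have "\<exists>S a \<alpha> \<theta>. approx_sol i (1 / (real i + 1)) S a \<alpha> \<theta>" for i :: nat
  proof -
    have "1 / (real i + 1) > 0" by simp
    from almost_critical[OF bounds gap this] obtain \<Lambda> where
      *: "\<And>M. \<exists>z. (\<forall>j. \<bar>z (Lam j)\<bar> \<le> \<Lambda>) \<and> L2_set (\<lambda>i. grad M i z) (coords M) < 1 / (real i + 1)" by blast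
    obtain M :: nat where M: "\<Lambda> + 1 + real i \<le> real M" using real_arch_simple by blast
    from *[of M] obtain z where "\<And>j. \<bar>z (Lam j)\<bar> \<le> \<Lambda>" "L2_set (\<lambda>i. grad M i z) (coords M) < 1 / (real i + 1)" by blast
    then show ?thesis using normal_form[OF _ M] by blast
  qed
  then have "\<forall>i::nat. \<exists>p. approx_sol i (1 / (real i + 1)) (fst p) (fst (snd p)) (fst (snd (snd p))) (snd (snd (snd p)))"
    by simp
  from choice[OF this] obtain p where "\<And>i::nat. approx_sol i (1 / (real i + 1)) (fst (p i)) (fst (snd (p i)))
      (fst (snd (snd (p i)))) (snd (snd (snd (p i))))" by blast
  then show ?thesis by (rule limit_solution)
qed

end

section \<open>Flows of smooth families\<close>

definition smooth_family :: "(real \<Rightarrow> 'a::euclidean_space \<Rightarrow> real) \<Rightarrow> bool" where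
  "smooth_family F \<longleftrightarrow> smooth_on ({0..1} \<times> UNIV) (\<lambda>(t, x). F t x)"

lemma smooth_on_imp_continuous_on:
  assumes "smooth_on S f" shows "continuous_on S f"
proof (unfold continuous_on_eq_continuous_within, intro ballI)
  fix x assume x: "x \<in> S"
  then obtain U g where U: "open U" "x \<in> U" "\<forall>k. Ck_open k g U" "\<forall>y\<in>S \<inter> U. g y = f y"
    using assms unfolding smooth_on_def by blast
  have "continuous_on U g" using U(3) Ck_open.simps(1) by blast
  then have "continuous (at x) g" using U(1,2) continuous_on_eq_continuous_at by blast
  then have "continuous (at x within S) g" by (rule continuous_at_imp_continuous_at_within)
  moreover obtain d where "d > 0" "ball x d \<subseteq> U" using U(1,2) openE by blast
  ultimately show "continuous (at x within S) f"
    by (intro continuous_transform_within[of x S g d f]) (use U(4) x in \<open>auto simp: subset_eq dist_commute\<close>)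
qed

lemma smooth_family_continuous:
  "smooth_family F \<Longrightarrow> continuous_on ({0..1} \<times> UNIV) (\<lambda>(t, x). F t x)"
  unfolding smooth_family_def by (rule smooth_on_imp_continuous_on)

text \<open>The derivative of a local smooth extension in direction \<open>(0, w)\<close> is a local
  smooth extension of the spatial derivative.\<close>

lemma smooth_family_partial:
  assumes F: "smooth_family F"
  shows "t \<in> {0..1} \<Longrightarrow> F t differentiable (at x)"
    and "smooth_family (\<lambda>t x. frechet_derivative (F t) (at x) w)"
proof -
  have main: "F s differentiable (at y) \<and> frechet_derivative (F s) (at y) w = frechet_derivative g (at (s, y)) (0, w)"
    if U: "open U" "\<forall>k. Ck_open k g U" "\<forall>p\<in>({0..1} \<times> UNIV) \<inter> U. g p = (case p of (t, x) \<Rightarrow> F t x)"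
      and sy: "(s, y) \<in> U" "s \<in> {0..1}" for U g s y
  proof -
    have "Ck_open (Suc 0) g U" using U(2) by blast
    then have "g differentiable (at (s, y))" using sy(1) by simp
    then have dg: "(g has_derivative frechet_derivative g (at (s, y))) (at (s, y))" by (rule frechet_derivative_works[THEN iffD1])
    have "((\<lambda>z. (s, z)) has_derivative (\<lambda>h. (0, h))) (at y)" by (auto intro!: derivative_eq_intros)
    from has_derivative_compose[OF this dg]
    have dc: "((\<lambda>z. g (s, z)) has_derivative (\<lambda>h. frechet_derivative g (at (s, y)) (0, h))) (at y)" .
    have "open ((\<lambda>z. (s, z)) -` U)" using U(1) by (intro open_vimage continuous_intros)
    then have "(F s has_derivative (\<lambda>h. frechet_derivative g (at (s, y)) (0, h))) (at y)"
      by (rule has_derivative_transform_within_open[OF dc]) (use U(3) sy in auto)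
    then show ?thesis using frechet_derivative_at[symmetric] by (auto simp: differentiable_def fun_eq_iff)
  qed
  show "F t differentiable (at x)" if t: "t \<in> {0..1}"
  proof -
    have "(t, x) \<in> {0..1} \<times> UNIV" using t by simp
    then obtain U g where "open U" "(t, x) \<in> U" "\<forall>k. Ck_open k g U"
       "\<forall>p\<in>({0..1} \<times> UNIV) \<inter> U. g p = (case p of (t, x) \<Rightarrow> F t x)"
      using F unfolding smooth_family_def smooth_on_def by blast
    then show ?thesis using main t by blast
  qed
  show "smooth_family (\<lambda>t x. frechet_derivative (F t) (at x) w)"
    unfolding smooth_family_def smooth_on_def
  proof
    fix p :: "real \<times> 'a" assume "p \<in> {0..1} \<times> UNIV"
    then obtain U g where U: "open U" "p \<in> U" "\<forall>k. Ck_open k g U"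
       "\<forall>p\<in>({0..1} \<times> UNIV) \<inter> U. g p = (case p of (t, x) \<Rightarrow> F t x)"
      using F unfolding smooth_family_def smooth_on_def by blast
    have "Ck_open k (\<lambda>q. frechet_derivative g (at q) (0, w)) U" for k
    proof -
      have "Ck_open (Suc k) g U" using U(3) by blast
      then show ?thesis by simp
    qed
    moreover have "\<forall>q\<in>({0..1} \<times> UNIV) \<inter> U. frechet_derivative g (at q) (0, w) = (case q of (t, x) \<Rightarrow> frechet_derivative (F t) (at x) w)"
      using main[OF U(1,3,4)] by auto
    ultimately show "\<exists>U g. open U \<and> p \<in> U \<and> (\<forall>k. Ck_open k g U) \<and>
       (\<forall>q\<in>({0..1} \<times> UNIV) \<inter> U. g q = (case q of (t, x) \<Rightarrow> frechet_derivative (F t) (at x) w))"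
      using U(1,2) by blast
  qed
qed

lemma continuous_bounded_on_cball:
  fixes F :: "real \<Rightarrow> 'a::euclidean_space \<Rightarrow> 'b::real_normed_vector"
  assumes "continuous_on ({0..1} \<times> UNIV) (\<lambda>(t, x). F t x)"
  obtains K where "K \<ge> 0" "\<And>t x. t \<in> {0..1} \<Longrightarrow> x \<in> cball 0 R \<Longrightarrow> norm (F t x) \<le> K"
proof -
  have "compact ((\<lambda>(t, x). F t x) ` ({0..1} \<times> cball 0 R))"
    by (intro compact_continuous_image continuous_on_subset[OF assms] compact_Times) auto
  then have "bounded ((\<lambda>(t, x). F t x) ` ({0..1} \<times> cball 0 R))" by (rule compact_imp_bounded)
  then obtain K where "K > 0" "\<forall>y\<in>(\<lambda>(t, x). F t x) ` ({0..1} \<times> cball 0 R). norm y \<le> K"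
    unfolding bounded_pos by blast
  then show ?thesis using that[of K] by force
qed

lemma linear_basis_bound:
  fixes f :: "'a::euclidean_space \<Rightarrow> real"
  assumes "linear f" shows "\<bar>f h\<bar> \<le> (\<Sum>i\<in>Basis. \<bar>f i\<bar>) * norm h"
proof -
  have "f h = (\<Sum>i\<in>Basis. (h \<bullet> i) * f i)"
    using linear_sum[OF assms, of "\<lambda>i. (h \<bullet> i) *\<^sub>R i" Basis] linear_scale[OF assms]
    by (simp add: euclidean_representation)
  also have "\<bar>\<dots>\<bar> \<le> (\<Sum>i\<in>Basis. norm h * \<bar>f i\<bar>)"
    by (rule order_trans[OF sum_abs sum_mono]) (simp add: abs_mult mult_right_mono Basis_le_norm)
  finally show ?thesis by (simp add: sum_distrib_left[symmetric] mult.commute)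
qed

lemma smooth_family_lipschitz:
  assumes F: "smooth_family F"
  obtains L where "L \<ge> 0" "\<And>t x y. t \<in> {0..1} \<Longrightarrow> x \<in> cball 0 R \<Longrightarrow> y \<in> cball 0 R \<Longrightarrow> \<bar>F t x - F t y\<bar> \<le> L * norm (x - y)"
proof -
  have "\<forall>i\<in>Basis. \<exists>K\<ge>0. \<forall>t\<in>{0..1::real}. \<forall>x\<in>cball 0 R. \<bar>frechet_derivative (F t) (at x) i\<bar> \<le> K"
  proof
    fix i
    obtain K where "K \<ge> 0" "\<And>t x. t \<in> {0..1} \<Longrightarrow> x \<in> cball 0 R \<Longrightarrow> norm (frechet_derivative (F t) (at x) i) \<le> K"
      by (rule continuous_bounded_on_cball[OF smooth_family_continuous[OF smooth_family_partial(2)[OF F, of i]]]) blast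
    then show "\<exists>K\<ge>0. \<forall>t\<in>{0..1::real}. \<forall>x\<in>cball 0 R. \<bar>frechet_derivative (F t) (at x) i\<bar> \<le> K" by auto
  qed
  then obtain K where "\<forall>i\<in>Basis. 0 \<le> K i \<and> (\<forall>t\<in>{0..1::real}. \<forall>x\<in>cball 0 R. \<bar>frechet_derivative (F t) (at x) i\<bar> \<le> K i)"
    unfolding Bex_def by (rule bchoice[THEN exE])
  then have K: "\<And>i. i \<in> Basis \<Longrightarrow> K i \<ge> 0" "\<And>i t x. i \<in> Basis \<Longrightarrow> t \<in> {0..1} \<Longrightarrow> x \<in> cball 0 R \<Longrightarrow> \<bar>frechet_derivative (F t) (at x) i\<bar> \<le> K i"
    by blast+
  show ?thesis
  proof (rule that[of "\<Sum>i\<in>Basis. K i"])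
    show "(\<Sum>i\<in>Basis. K i) \<ge> 0" using K by (intro sum_nonneg)
    fix t :: real and x y :: 'a assume t: "t \<in> {0..1}" and x: "x \<in> cball 0 R" and y: "y \<in> cball 0 R"
    have "norm (F t x - F t y) \<le> (\<Sum>i\<in>Basis. K i) * norm (x - y)"
    proof (rule differentiable_bound[OF convex_cball _ _ x y])
      fix z :: 'a assume z: "z \<in> cball 0 R"
      have d: "(F t has_derivative frechet_derivative (F t) (at z)) (at z)"
        using smooth_family_partial(1)[OF F t] frechet_derivative_works by blast
      then show "(F t has_derivative frechet_derivative (F t) (at z)) (at z within cball 0 R)"
        by (rule has_derivative_at_withinI)
      show "onorm (frechet_derivative (F t) (at z)) \<le> (\<Sum>i\<in>Basis. K i)"
      proof (rule onorm_bound)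
        show "0 \<le> (\<Sum>i\<in>Basis. K i)" using K by (intro sum_nonneg)
        fix h
        have "\<bar>frechet_derivative (F t) (at z) h\<bar> \<le> (\<Sum>i\<in>Basis. \<bar>frechet_derivative (F t) (at z) i\<bar>) * norm h"
          by (rule linear_basis_bound[OF has_derivative_linear[OF d]])
        also have "\<dots> \<le> (\<Sum>i\<in>Basis. K i) * norm h" using K(2)[OF _ t z] by (intro mult_right_mono sum_mono) auto
        finally show "norm (frechet_derivative (F t) (at z) h) \<le> (\<Sum>i\<in>Basis. K i) * norm h" by simp
      qed
    qed
    then show "\<bar>F t x - F t y\<bar> \<le> (\<Sum>i\<in>Basis. K i) * norm (x - y)" by simp
  qed
qed

definition grad_of :: "('a::euclidean_space \<Rightarrow> real) \<Rightarrow> 'a \<Rightarrow> 'a" where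
  "grad_of h x = (\<Sum>i\<in>Basis. frechet_derivative h (at x) i *\<^sub>R i)"

lemma grad_of_has_derivative:
  assumes "h differentiable (at x)" shows "(h has_derivative (\<lambda>v. grad_of h x \<bullet> v)) (at x)"
proof -
  have d: "(h has_derivative frechet_derivative h (at x)) (at x)" using assms frechet_derivative_works by blast
  note lin = has_derivative_linear[OF d]
  have "frechet_derivative h (at x) v = grad_of h x \<bullet> v" for v
  proof -
    have "frechet_derivative h (at x) (\<Sum>i\<in>Basis. (v \<bullet> i) *\<^sub>R i) = (\<Sum>i\<in>Basis. (v \<bullet> i) * frechet_derivative h (at x) i)"
      by (simp add: linear_sum[OF lin] linear_scale[OF lin])
    then show ?thesis
      by (simp add: euclidean_representation grad_of_def inner_sum_left) (simp add: inner_commute mult.commute)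
  qed
  then have "frechet_derivative h (at x) = (\<lambda>v. grad_of h x \<bullet> v)" by blast
  then show ?thesis using d by simp
qed

lemma smooth_family_grad:
  assumes F: "smooth_family F"
  shows "continuous_on ({0..1} \<times> UNIV) (\<lambda>(t, x). grad_of (F t) x)"
    and "\<And>t x. t \<in> {0..1} \<Longrightarrow> (F t has_derivative (\<lambda>v. grad_of (F t) x \<bullet> v)) (at x)"
proof -
  show "continuous_on ({0..1} \<times> UNIV) (\<lambda>(t, x). grad_of (F t) x)"
    unfolding grad_of_def case_prod_beta'
    by (intro continuous_intros) (use smooth_family_continuous[OF smooth_family_partial(2)[OF F]] in \<open>simp add: case_prod_beta'\<close>)
  show "(F t has_derivative (\<lambda>v. grad_of (F t) x \<bullet> v)) (at x)" if "t \<in> {0..1}" for t x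
    by (rule grad_of_has_derivative[OF smooth_family_partial(1)[OF F that]])
qed

lemma smooth_family_grad_lipschitz:
  assumes F: "smooth_family F"
  obtains L where "L \<ge> 0" "\<And>t x y. t \<in> {0..1} \<Longrightarrow> x \<in> cball 0 R \<Longrightarrow> y \<in> cball 0 R \<Longrightarrow>
     norm (grad_of (F t) x - grad_of (F t) y) \<le> L * norm (x - y)"
proof -
  have "\<forall>i\<in>Basis. \<exists>K\<ge>0. \<forall>t\<in>{0..1::real}. \<forall>x\<in>cball 0 R. \<forall>y\<in>cball 0 R.
     \<bar>frechet_derivative (F t) (at x) i - frechet_derivative (F t) (at y) i\<bar> \<le> K * norm (x - y)"
  proof
    fix i
    obtain K where "K \<ge> 0" "\<And>t x y. t \<in> {0..1} \<Longrightarrow> x \<in> cball 0 R \<Longrightarrow> y \<in> cball 0 R \<Longrightarrow>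
      \<bar>frechet_derivative (F t) (at x) i - frechet_derivative (F t) (at y) i\<bar> \<le> K * norm (x - y)"
      by (rule smooth_family_lipschitz[OF smooth_family_partial(2)[OF F, of i]]) blast
    then show "\<exists>K\<ge>0. \<forall>t\<in>{0..1::real}. \<forall>x\<in>cball 0 R. \<forall>y\<in>cball 0 R.
     \<bar>frechet_derivative (F t) (at x) i - frechet_derivative (F t) (at y) i\<bar> \<le> K * norm (x - y)" by blast
  qed
  then obtain K where "\<forall>i\<in>Basis. 0 \<le> K i \<and> (\<forall>t\<in>{0..1::real}. \<forall>x\<in>cball 0 R. \<forall>y\<in>cball 0 R.
     \<bar>frechet_derivative (F t) (at x) i - frechet_derivative (F t) (at y) i\<bar> \<le> K i * norm (x - y))"
    unfolding Bex_def by (rule bchoice[THEN exE])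
  then have K: "\<And>i. i \<in> Basis \<Longrightarrow> K i \<ge> 0" "\<And>i t x y. i \<in> Basis \<Longrightarrow> t \<in> {0..1} \<Longrightarrow> x \<in> cball 0 R \<Longrightarrow> y \<in> cball 0 R \<Longrightarrow>
     \<bar>frechet_derivative (F t) (at x) i - frechet_derivative (F t) (at y) i\<bar> \<le> K i * norm (x - y)"
    by blast+
  show ?thesis
  proof (rule that[of "\<Sum>i\<in>Basis. K i"])
    show "(\<Sum>i\<in>Basis. K i) \<ge> 0" using K by (intro sum_nonneg)
    fix t :: real and x y :: 'a assume a: "t \<in> {0..1}" "x \<in> cball 0 R" "y \<in> cball 0 R"
    have "norm (grad_of (F t) x - grad_of (F t) y) = norm (\<Sum>i\<in>Basis. (frechet_derivative (F t) (at x) i - frechet_derivative (F t) (at y) i) *\<^sub>R i)"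
      by (simp add: grad_of_def sum_subtractf scaleR_diff_left)
    also have "\<dots> \<le> (\<Sum>i\<in>Basis. K i * norm (x - y))"
      by (rule order_trans[OF norm_sum sum_mono]) (use K(2)[OF _ a] in simp)
    finally show "norm (grad_of (F t) x - grad_of (F t) y) \<le> (\<Sum>i\<in>Basis. K i) * norm (x - y)"
      by (simp add: sum_distrib_right)
  qed
qed

text \<open>The squared distance times \<open>exp (- 2 * L * t)\<close> is nonincreasing. The
  Lipschitz bound is asked at interior times only, so that it can be applied up to a first exit
  time.\<close>

lemma gronwall_difference:
  fixes x y :: "real \<Rightarrow> 'a::real_inner"
  assumes T: "0 \<le> T" "T \<le> b" and L: "L \<ge> 0"
    and x: "\<And>t. t \<in> {0..b} \<Longrightarrow> (x has_vector_derivative x' t) (at t within {0..b})"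
    and y: "\<And>t. t \<in> {0..b} \<Longrightarrow> (y has_vector_derivative y' t) (at t within {0..b})"
    and lip: "\<And>t. 0 < t \<Longrightarrow> t < T \<Longrightarrow> norm (x' t - y' t) \<le> L * norm (x t - y t)"
  shows "norm (x T - y T) \<le> norm (x 0 - y 0) * exp (L * T)"
proof -
  define u where "u t = ((x t - y t) \<bullet> (x t - y t)) * exp (- 2 * L * t)" for t
  have cont: "continuous_on {0..b} x" "continuous_on {0..b} y"
    unfolding continuous_on_eq_continuous_within
    using has_vector_derivative_continuous[OF x] has_vector_derivative_continuous[OF y] by blast+
  have "u T \<le> u 0"
  proof (rule DERIV_nonpos_imp_decreasing_open[OF T(1)])
    show "continuous_on {0..T} u" unfolding u_def using T
      by (intro continuous_intros continuous_on_subset[OF cont(1)] continuous_on_subset[OF cont(2)]) auto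
    fix t assume t: "0 < t" "t < T"
    have int: "at t within {0..b} = at t" using t T by (intro at_within_interior) auto
    have d: "((\<lambda>t. x t - y t) has_derivative (\<lambda>h. h *\<^sub>R (x' t - y' t))) (at t)"
      using has_vector_derivative_diff[OF x y, of t] t T unfolding int has_vector_derivative_def by auto
    define p q where "p = x t - y t" and "q = x' t - y' t"
    have "(\<lambda>h. p \<bullet> (h *\<^sub>R q) + (h *\<^sub>R q) \<bullet> p) = (*) (2 * (p \<bullet> q))"
      by (rule ext) (simp add: inner_commute[of q p])
    then have d2: "((\<lambda>t. (x t - y t) \<bullet> (x t - y t)) has_real_derivative 2 * ((x t - y t) \<bullet> (x' t - y' t))) (at t)"
      unfolding has_field_derivative_def p_def q_def using has_derivative_inner[OF d d] by (simp only:)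
    have "((\<lambda>t. exp (- 2 * L * t)) has_real_derivative exp (- 2 * L * t) * (- 2 * L)) (at t)"
      by (auto intro!: derivative_eq_intros)
    from DERIV_mult[OF d2 this]
    have du: "(u has_real_derivative (2 * ((x t - y t) \<bullet> (x' t - y' t)) - 2 * L * ((x t - y t) \<bullet> (x t - y t))) * exp (- 2 * L * t)) (at t)"
      unfolding u_def[abs_def] by (simp add: algebra_simps)
    have "(x t - y t) \<bullet> (x' t - y' t) \<le> norm (x t - y t) * norm (x' t - y' t)" by (rule norm_cauchy_schwarz)
    also have "\<dots> \<le> norm (x t - y t) * (L * norm (x t - y t))" using lip[OF t] by (rule mult_left_mono) simp
    also have "\<dots> = L * ((x t - y t) \<bullet> (x t - y t))" by (simp add: power2_norm_eq_inner[symmetric] power2_eq_square)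
    finally have "(2 * ((x t - y t) \<bullet> (x' t - y' t)) - 2 * L * ((x t - y t) \<bullet> (x t - y t))) * exp (- 2 * L * t) \<le> 0"
      by (intro mult_nonpos_nonneg) auto
    then show "\<exists>z. (u has_real_derivative z) (at t) \<and> z \<le> 0" using du by blast
  qed
  then have "(norm (x T - y T))\<^sup>2 * exp (- 2 * L * T) \<le> (norm (x 0 - y 0))\<^sup>2" by (simp add: u_def power2_norm_eq_inner)
  then have "(norm (x T - y T))\<^sup>2 * exp (- 2 * L * T) * exp (2 * L * T) \<le> (norm (x 0 - y 0))\<^sup>2 * exp (2 * L * T)"
    by (rule mult_right_mono) simp
  then have "(norm (x T - y T))\<^sup>2 \<le> (norm (x 0 - y 0))\<^sup>2 * exp (2 * L * T)"
    by (simp add: mult.assoc exp_add[symmetric])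
  also have "\<dots> = (norm (x 0 - y 0) * exp (L * T))\<^sup>2"
    by (simp add: power_mult_distrib power2_eq_square exp_add[symmetric] mult.assoc)
  finally show ?thesis by (rule power2_le_imp_le) simp
qed

text \<open>A continuity argument: while the distance is below 1, \<open>y\<close> stays in the
  \<open>R\<close>-ball, where the fields agree and are Lipschitz, and Gronwall keeps the distance
  below 1. So there is no first time at which it reaches 1.\<close>

lemma solution_tube:
  fixes x y :: "real \<Rightarrow> 'a::euclidean_space"
  assumes L: "L \<ge> 0" and lip: "\<And>t u v. t \<in> {0..1} \<Longrightarrow> u \<in> cball 0 R \<Longrightarrow> v \<in> cball 0 R \<Longrightarrow> norm (V t u - V t v) \<le> L * norm (u - v)"
    and x: "\<And>t. t \<in> {0..1} \<Longrightarrow> (x has_vector_derivative V t (x t)) (at t within {0..1})"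
    and xR: "\<And>t. t \<in> {0..1} \<Longrightarrow> norm (x t) \<le> R - 1"
    and y: "\<And>t. t \<in> {0..1} \<Longrightarrow> (y has_vector_derivative W t (y t)) (at t within {0..1})"
    and VW: "\<And>t u. t \<in> {0..1} \<Longrightarrow> u \<in> cball 0 R \<Longrightarrow> V t u = W t u"
    and close: "norm (x 0 - y 0) * exp L < 1" and t: "t \<in> {0..1}"
  shows "norm (x t - y t) \<le> norm (x 0 - y 0) * exp L"
proof -
  have cont: "continuous_on {0..1} x" "continuous_on {0..1} y"
    unfolding continuous_on_eq_continuous_within
    using has_vector_derivative_continuous[OF x] has_vector_derivative_continuous[OF y] by blast+
  have step: "norm (x T - y T) \<le> norm (x 0 - y 0) * exp L"
    if T: "T \<in> {0..1}" and near: "\<And>s. 0 < s \<Longrightarrow> s < T \<Longrightarrow> norm (x s - y s) < 1" for T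
  proof -
    have "norm (x T - y T) \<le> norm (x 0 - y 0) * exp (L * T)"
    proof (rule gronwall_difference[OF _ _ L x y])
      fix s assume s: "0 < s" "s < T"
      then have s1: "s \<in> {0..1}" using T by auto
      have "norm (y s) \<le> norm (x s) + norm (x s - y s)" by (metis norm_minus_commute norm_triangle_sub)
      then have yR: "y s \<in> cball 0 R" using near[OF s] xR[OF s1] by simp
      have xR': "x s \<in> cball 0 R" using xR[OF s1] by simp
      show "norm (V s (x s) - W s (y s)) \<le> L * norm (x s - y s)"
        using lip[OF s1 xR' yR] VW[OF s1 yR] by simp
    qed (use T in auto)
    also have "\<dots> \<le> norm (x 0 - y 0) * exp L"
      using L T by (intro mult_left_mono) (auto simp: mult_left_le)
    finally show ?thesis .
  qed
  define E where "E = {s \<in> {0..1}. 1 \<le> norm (x s - y s)}"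
  have "E = {}"
  proof (rule ccontr)
    assume ne: "E \<noteq> {}"
    have "closed E" unfolding E_def
      by (rule continuous_on_closed_Collect_le[OF continuous_on_const continuous_on_norm[OF continuous_on_diff[OF cont]]]) auto
    moreover have bb: "bdd_below E" unfolding E_def by (intro bdd_belowI[of _ 0]) auto
    ultimately have inE: "Inf E \<in> E" using ne closed_contains_Inf by blast
    have "norm (x s - y s) < 1" if "0 < s" "s < Inf E" for s
    proof (rule ccontr)
      assume "\<not> ?thesis"
      then have "s \<in> E" using that inE by (auto simp: E_def)
      then show False using cInf_lower[OF _ bb] that by fastforce
    qed
    then have "norm (x (Inf E) - y (Inf E)) \<le> norm (x 0 - y 0) * exp L"
      using inE by (intro step) (auto simp: E_def)
    then show False using close inE by (auto simp: E_def)
  qed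
  have "norm (x s - y s) < 1" if "0 < s" "s < t" for s
  proof (rule ccontr)
    assume "\<not> ?thesis"
    then have "s \<in> E" using that t by (simp add: E_def)
    then show False using \<open>E = {}\<close> by blast
  qed
  then show ?thesis by (rule step[OF t])
qed

section \<open>Intersections under Hamiltonian diffeomorphisms\<close>

text \<open>Building block of a cut-off of class C^1, the regularity that
  \<open>frame_hamiltonian\<close> asks for.\<close>

definition sq_pos :: "real \<Rightarrow> real" where "sq_pos u = (max 0 u)\<^sup>2"

lemma sq_pos_deriv: "(sq_pos has_real_derivative 2 * max 0 u) (at u)"
proof -
  consider "u > 0" | "u < 0" | "u = 0" by linarith
  then show ?thesis
  proof cases
    case 1
    have "((\<lambda>u. u\<^sup>2) has_real_derivative 2 * u) (at u)" by (auto intro!: derivative_eq_intros)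
    then have "(sq_pos has_real_derivative 2 * u) (at u)"
      by (rule DERIV_cong_ev[THEN iffD1, OF refl _ refl, rotated])
        (use 1 in \<open>auto simp: sq_pos_def eventually_nhds intro!: exI[of _ "{0<..}"]\<close>)
    then show ?thesis using 1 by simp
  next
    case 2
    have "((\<lambda>u. 0) has_real_derivative 0) (at u)" by simp
    then have "(sq_pos has_real_derivative 0) (at u)"
      by (rule DERIV_cong_ev[THEN iffD1, OF refl _ refl, rotated])
        (use 2 in \<open>auto simp: sq_pos_def eventually_nhds intro!: exI[of _ "{..<0}"]\<close>)
    then show ?thesis using 2 by simp
  next
    case 3
    have "((\<lambda>h. (sq_pos (0 + h) - sq_pos 0) / h) \<longlongrightarrow> 0) (at 0)"
    proof (rule Lim_null_comparison)
      show "\<forall>\<^sub>F h in at 0. norm ((sq_pos (0 + h) - sq_pos 0) / h) \<le> \<bar>h\<bar>"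
        by (rule always_eventually) (auto simp: sq_pos_def max_def power2_eq_square)
      show "((\<lambda>h::real. \<bar>h\<bar>) \<longlongrightarrow> 0) (at 0)" using tendsto_rabs[OF tendsto_ident_at[of "0::real" UNIV]] by simp
    qed
    then show ?thesis using 3 by (simp add: DERIV_def)
  qed
qed

text \<open>To be evaluated at the squared norm: it is 1 up to \<open>R\<^sup>2\<close> and 0 from
  \<open>R\<^sup>2 + 1\<close> on.\<close>

definition bump :: "real \<Rightarrow> real \<Rightarrow> real" where "bump R s = sq_pos (1 - sq_pos (s - R\<^sup>2))"
definition bump' :: "real \<Rightarrow> real \<Rightarrow> real" where
  "bump' R s = 2 * max 0 (1 - sq_pos (s - R\<^sup>2)) * - (2 * max 0 (s - R\<^sup>2))"

lemma bump_deriv: "(bump R has_real_derivative bump' R s) (at s)"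
proof -
  have d1: "((\<lambda>s. s - R\<^sup>2) has_real_derivative 1) (at s)" by (auto intro!: derivative_eq_intros)
  have d2: "((\<lambda>s. 1 - sq_pos (s - R\<^sup>2)) has_real_derivative - (2 * max 0 (s - R\<^sup>2))) (at s)"
    using DERIV_diff[OF DERIV_const DERIV_chain2[OF sq_pos_deriv d1], of 1] by simp
  show ?thesis unfolding bump_def[abs_def] bump'_def by (rule DERIV_chain2[OF sq_pos_deriv d2])
qed

lemma bump_cont: "continuous_on UNIV (bump R)" "continuous_on UNIV (bump' R)"
  unfolding bump_def bump'_def sq_pos_def by (intro continuous_intros)+

lemma bump_range: "0 \<le> bump R s" "bump R s \<le> 1"
proof -
  have "max 0 (1 - sq_pos (s - R\<^sup>2)) \<le> 1" by (simp add: sq_pos_def)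
  then show "0 \<le> bump R s" "bump R s \<le> 1"
    unfolding bump_def sq_pos_def[of "1 - _"] by (auto intro!: power_le_one)
qed

lemma bump_inside: "s \<le> R\<^sup>2 \<Longrightarrow> bump R s = 1" "s \<le> R\<^sup>2 \<Longrightarrow> bump' R s = 0"
  by (simp_all add: bump_def bump'_def sq_pos_def)

lemma bump_outside: "s \<ge> R\<^sup>2 + 1 \<Longrightarrow> bump R s = 0" "s \<ge> R\<^sup>2 + 1 \<Longrightarrow> bump' R s = 0"
proof -
  assume "s \<ge> R\<^sup>2 + 1"
  then have "1 \<le> (max 0 (s - R\<^sup>2))\<^sup>2" by (intro one_le_power) simp
  then have "1 - sq_pos (s - R\<^sup>2) \<le> 0" by (simp add: sq_pos_def)
  then show "bump R s = 0" "bump' R s = 0" by (simp_all add: bump_def bump'_def sq_pos_def[of "1 - _"] max_def)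
qed

lemma cutoff_deriv:
  fixes h :: "'a::euclidean_space \<Rightarrow> real"
  assumes "(h has_derivative (\<lambda>v. g \<bullet> v)) (at x)"
  shows "((\<lambda>x. bump R (x \<bullet> x) * (h x - c)) has_derivative
    (\<lambda>v. (bump R (x \<bullet> x) *\<^sub>R g + ((h x - c) * (2 * bump' R (x \<bullet> x))) *\<^sub>R x) \<bullet> v)) (at x)"
proof -
  have n: "((\<lambda>x. x \<bullet> x) has_derivative (\<lambda>v. x \<bullet> v + v \<bullet> x)) (at x)"
    by (rule has_derivative_inner[OF has_derivative_ident has_derivative_ident])
  have b: "((\<lambda>x. bump R (x \<bullet> x)) has_derivative (\<lambda>v. bump' R (x \<bullet> x) * (x \<bullet> v + v \<bullet> x))) (at x)"
    using has_derivative_compose[OF n bump_deriv[unfolded has_field_derivative_def]] .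
  have h: "((\<lambda>x. h x - c) has_derivative (\<lambda>v. g \<bullet> v)) (at x)"
    using has_derivative_diff[OF assms has_derivative_const[of c]] by simp
  show ?thesis
    by (rule has_derivative_eq_rhs[OF has_derivative_mult[OF b h]])
      (simp add: fun_eq_iff inner_add_left inner_commute algebra_simps)
qed

text \<open>\<open>F\<close> stands for the oscillation in \<open>hofer_length\<close>, whose
  measurability is not established. It enters only through monotonicity; the evaluation is made for
  the continuous function \<open>max 0 (d t)\<close>.\<close>

lemma integral_le_nn_integral:
  fixes d :: "real \<Rightarrow> real"
  assumes d: "continuous_on {0..1} d" and le: "\<And>t. t \<in> {0..1} \<Longrightarrow> ennreal (d t) \<le> F t"
  shows "ennreal (integral {0..1} d) \<le> (\<integral>\<^sup>+t\<in>{0..1}. F t \<partial>lborel)"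
proof -
  have c: "continuous_on {0..1} (\<lambda>t. max 0 (d t))" using d by (intro continuous_intros)
  have "integral {0..1} d \<le> integral {0..1} (\<lambda>t. max 0 (d t))"
    by (intro integral_le integrable_continuous_real d c) auto
  then have "ennreal (integral {0..1} d) \<le> ennreal (integral {0..1} (\<lambda>t. max 0 (d t)))" by (rule ennreal_leI)
  also have "\<dots> = (\<integral>\<^sup>+t. ennreal (max 0 (d t)) * indicator {0..1} t \<partial>lborel)"
    by (rule nn_integral_has_integral_lebesgue'[symmetric])
      (auto intro!: integrable_integral integrable_continuous_real c)
  also have "\<dots> \<le> (\<integral>\<^sup>+t\<in>{0..1}. F t \<partial>lborel)"
    using le by (intro nn_integral_mono) (auto simp: indicator_def max_def ennreal_neg)
  finally show ?thesis .
qed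

text \<open>Subtracting \<open>h 0\<close> before cutting off is the point: a factor in [0,1] moves
  values towards 0, which \<open>h - h 0\<close> attains at the origin. So every value after the
  cut-off lies between two values before it.\<close>

lemma cutoff_osc_le:
  fixes h :: "'a::euclidean_space \<Rightarrow> real"
  shows "ennreal (bump R (y \<bullet> y) * (h y - h 0) - bump R (z \<bullet> z) * (h z - h 0))
    \<le> e2ennreal ((SUP x\<in>UNIV. ereal (h x)) - (INF x\<in>UNIV. ereal (h x)))"
proof -
  have "\<exists>u. bump R (y \<bullet> y) * (h y - h 0) \<le> h u - h 0"
  proof (cases "h y \<ge> h 0")
    case True
    then have "bump R (y \<bullet> y) * (h y - h 0) \<le> 1 * (h y - h 0)" by (intro mult_right_mono bump_range) auto
    then show ?thesis by (intro exI[of _ y]) simp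
  next
    case False
    then have "bump R (y \<bullet> y) * (h y - h 0) \<le> 0" by (intro mult_nonneg_nonpos bump_range) auto
    then show ?thesis by (intro exI[of _ 0]) simp
  qed
  then obtain u where u: "bump R (y \<bullet> y) * (h y - h 0) \<le> h u - h 0" by blast
  have "\<exists>v. h v - h 0 \<le> bump R (z \<bullet> z) * (h z - h 0)"
  proof (cases "h z \<le> h 0")
    case True
    then have "1 * (h z - h 0) \<le> bump R (z \<bullet> z) * (h z - h 0)" by (intro mult_right_mono_neg bump_range) auto
    then show ?thesis by (intro exI[of _ z]) simp
  next
    case False
    then have "0 \<le> bump R (z \<bullet> z) * (h z - h 0)" by (intro mult_nonneg_nonneg bump_range) auto
    then show ?thesis by (intro exI[of _ 0]) simp
  qed
  then obtain v where v: "h v - h 0 \<le> bump R (z \<bullet> z) * (h z - h 0)" by blast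
  have "ereal (h u) - ereal (h v) \<le> (SUP x\<in>UNIV. ereal (h x)) - (INF x\<in>UNIV. ereal (h x))"
    by (intro ereal_minus_mono SUP_upper INF_lower) auto
  then have "e2ennreal (ereal (h u - h v)) \<le> e2ennreal ((SUP x\<in>UNIV. ereal (h x)) - (INF x\<in>UNIV. ereal (h x)))"
    by (intro e2ennreal_mono) simp
  moreover have "ennreal (bump R (y \<bullet> y) * (h y - h 0) - bump R (z \<bullet> z) * (h z - h 0)) \<le> ennreal (h u - h v)"
    using u v by (intro ennreal_leI) linarith
  ultimately show ?thesis by (simp add: e2ennreal_ereal)
qed

lemma J_lipschitz: "norm (J u - J v) = norm (u - v)"
  using J_simps(4)[of "u - v"] by (simp add: J_diff)

lemma ham_vf_grad:
  fixes H :: "real \<Rightarrow> (real ^ 'n) \<times> (real ^ 'n) \<Rightarrow> real"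
  assumes "smooth_family H" "t \<in> {0..1}"
  shows "ham_vf omega0 (H t) x = J (grad_of (H t) x)"
  using ham_vf_omega0[OF smooth_family_grad(2)[OF assms]] by (simp add: J_def)

lemma smooth_hamiltonian_flow_unique:
  fixes H :: "real \<Rightarrow> (real ^ 'n) \<times> (real ^ 'n) \<Rightarrow> real"
  assumes H: "smooth_family H"
    and x: "\<And>t. t \<in> {0..1} \<Longrightarrow> (x has_vector_derivative J (grad_of (H t) (x t))) (at t within {0..1})"
    and y: "\<And>t. t \<in> {0..1} \<Longrightarrow> (y has_vector_derivative J (grad_of (H t) (y t))) (at t within {0..1})"
    and xy: "x 0 = y 0" and t: "t \<in> {0..1}"
  shows "x t = y t"
proof -
  have "continuous_on {0..1} x" unfolding continuous_on_eq_continuous_within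
    using has_vector_derivative_continuous[OF x] by blast
  then have "compact (x ` {0..1})" by (intro compact_continuous_image) auto
  then have "bounded (x ` {0..1})" by (rule compact_imp_bounded)
  then obtain b where "\<forall>y\<in>x ` {0..1}. norm y \<le> b" unfolding bounded_iff by blast
  then have b: "norm (x t) \<le> b + 1 - 1" if "t \<in> {0..1}" for t using that by simp
  obtain L where L: "L \<ge> 0" "\<And>t u v. t \<in> {0..1} \<Longrightarrow> u \<in> cball 0 (b + 1) \<Longrightarrow> v \<in> cball 0 (b + 1) \<Longrightarrow>
     norm (grad_of (H t) u - grad_of (H t) v) \<le> L * norm (u - v)"
    by (rule smooth_family_grad_lipschitz[OF H, of "b + 1"]) blast
  have "norm (x t - y t) \<le> norm (x 0 - y 0) * exp L"
    by (rule solution_tube[where V = "\<lambda>t u. J (grad_of (H t) u)" and W = "\<lambda>t u. J (grad_of (H t) u)", OF L(1) _ x b y _ _ t])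
      (use L(2) xy in \<open>simp_all add: J_lipschitz\<close>)
  then show ?thesis using xy by simp
qed

text \<open>\<open>ode_solution\<close> demands a smooth curve, whereas the orbit of the variational
  argument is only known to be differentiable. The smooth solution \<open>z\<close> with the same
  start exists by completeness in the application, and uniqueness identifies the two.\<close>

lemma ham_flow_eq:
  fixes H :: "real \<Rightarrow> (real ^ 'n) \<times> (real ^ 'n) \<Rightarrow> real"
  assumes H: "smooth_family H" and sol: "ode_solution (\<lambda>t. ham_vf omega0 (H t)) 1 p z"
    and x: "\<And>t. t \<in> {0..1} \<Longrightarrow> (x has_vector_derivative J (grad_of (H t) (x t))) (at t within {0..1})"
    and x0: "x 0 = p"
  shows "ham_flow omega0 H 1 p = x 1"
proof -
  have eq: "u 1 = x 1" if u: "ode_solution (\<lambda>t. ham_vf omega0 (H t)) 1 p u" for u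
  proof (rule smooth_hamiltonian_flow_unique[OF H _ x])
    show "(u has_vector_derivative J (grad_of (H t) (u t))) (at t within {0..1})" if "t \<in> {0..1}" for t
    proof -
      have "(u has_vector_derivative ham_vf omega0 (H t) (u t)) (at t within {0..1})"
        using u that unfolding ode_solution_def by blast
      then show ?thesis by (simp only: ham_vf_grad[OF H that])
    qed
    show "u 0 = x 0" using u x0 unfolding ode_solution_def by simp
  qed auto
  show ?thesis unfolding ham_flow_def flow_def
  proof (rule the_equality)
    show "\<exists>u. ode_solution (\<lambda>t. ham_vf omega0 (H t)) 1 p u \<and> u 1 = x 1" using sol eq by blast
    show "y = x 1" if "\<exists>u. ode_solution (\<lambda>t. ham_vf omega0 (H t)) 1 p u \<and> u 1 = y" for y using that eq by blast
  qed
qed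

text \<open>The radius \<open>R\<close> serves every field that agrees with that of \<open>H\<close> on the \<open>R\<close>-ball, so cutting \<open>H\<close> off
  outside this ball creates no new orbits starting in the \<open>r0\<close>-ball.\<close>

lemma smooth_hamiltonian_trace_bounded:
  fixes H :: "real \<Rightarrow> (real ^ 'n) \<times> (real ^ 'n) \<Rightarrow> real"
  assumes H: "smooth_family H" and complete: "UNIV \<subseteq> flow_domain (\<lambda>t. ham_vf omega0 (H t)) 1"
  obtains R where "R > 0" "\<And>y W t. norm (y 0) \<le> r0 \<Longrightarrow>
      (\<And>t. t \<in> {0..1} \<Longrightarrow> (y has_vector_derivative J (W t (y t))) (at t within {0..1})) \<Longrightarrow>
      (\<And>t u. t \<in> {0..1} \<Longrightarrow> u \<in> cball 0 R \<Longrightarrow> W t u = grad_of (H t) u) \<Longrightarrow> t \<in> {0..1} \<Longrightarrow> norm (y t) \<le> R"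
proof -
  \<comment> \<open>Each starting point has a neighbourhood all of whose orbits stay in one ball, by
    comparison with the orbit of the centre. Finitely many such neighbourhoods cover the
    \<open>r0\<close>-ball.\<close>
  have "\<exists>\<rho> b. \<rho> > 0 \<and> b > 0 \<and> (\<forall>y W. norm (p - y 0) < \<rho> \<longrightarrow>
      (\<forall>t\<in>{0..1}. (y has_vector_derivative J (W t (y t))) (at t within {0..1})) \<longrightarrow>
      (\<forall>t\<in>{0..1::real}. \<forall>u\<in>cball 0 b. W t u = grad_of (H t) u) \<longrightarrow> (\<forall>t\<in>{0..1}. norm (y t) \<le> b))" for p
  proof -
    obtain x where sol: "ode_solution (\<lambda>t. ham_vf omega0 (H t)) 1 p x"
      using complete unfolding flow_domain_def by blast
    have x0: "x 0 = p" and x: "\<And>t. t \<in> {0..1} \<Longrightarrow> (x has_vector_derivative J (grad_of (H t) (x t))) (at t within {0..1})"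
      using sol ham_vf_grad[OF H] unfolding ode_solution_def by auto
    have "continuous_on {0..1} x" unfolding continuous_on_eq_continuous_within
      using has_vector_derivative_continuous[OF x] by blast
    then have "compact (x ` {0..1})" by (intro compact_continuous_image) auto
    then have "bounded (x ` {0..1})" by (rule compact_imp_bounded)
    then obtain b0 where b0: "b0 > 0" "\<forall>y\<in>x ` {0..1}. norm y \<le> b0" unfolding bounded_pos by blast
    then have b: "norm (x t) \<le> b0 + 1 - 1" if "t \<in> {0..1}" for t using that by simp
    obtain L where L: "L \<ge> 0" "\<And>t u v. t \<in> {0..1} \<Longrightarrow> u \<in> cball 0 (b0 + 1) \<Longrightarrow> v \<in> cball 0 (b0 + 1) \<Longrightarrow>
       norm (grad_of (H t) u - grad_of (H t) v) \<le> L * norm (u - v)"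
      by (rule smooth_family_grad_lipschitz[OF H, of "b0 + 1"]) blast
    have "norm (y t) \<le> b0 + 1"
      if near: "norm (p - y 0) < 1 / exp L"
        and y: "\<forall>t\<in>{0..1}. (y has_vector_derivative J (W t (y t))) (at t within {0..1})"
        and W: "\<forall>t\<in>{0..1::real}. \<forall>u\<in>cball 0 (b0 + 1). W t u = grad_of (H t) u" and t: "t \<in> {0..1}" for y W t
    proof -
      have close: "norm (x 0 - y 0) * exp L < 1" using near by (simp add: x0 field_simps)
      have "norm (x t - y t) \<le> norm (x 0 - y 0) * exp L"
      proof (rule solution_tube[where V = "\<lambda>t u. J (grad_of (H t) u)" and W = "\<lambda>t u. J (W t u)"])
        show "L \<ge> 0" by (rule L(1))
        show "norm (J (grad_of (H t) u) - J (grad_of (H t) v)) \<le> L * norm (u - v)"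
          if "t \<in> {0..1}" "u \<in> cball 0 (b0 + 1)" "v \<in> cball 0 (b0 + 1)" for t u v
          unfolding J_lipschitz by (rule L(2)[OF that])
        show "J (grad_of (H t) u) = J (W t u)" if "t \<in> {0..1}" "u \<in> cball 0 (b0 + 1)" for t u
          using W that by simp
      qed (use x b y close t in auto)
      also have "\<dots> < 1" by (rule close)
      finally show ?thesis using b[OF t] norm_triangle_sub[of "y t" "x t"] by (simp add: norm_minus_commute)
    qed
    then show ?thesis using b0(1) by (intro exI[of _ "1 / exp L"] exI[of _ "b0 + 1"]) auto
  qed
  then obtain \<rho> b where rb: "\<And>p. \<rho> p > 0" "\<And>p. b p > 0" "\<And>p y W. norm (p - y 0) < \<rho> p \<Longrightarrow>
      (\<forall>t\<in>{0..1}. (y has_vector_derivative J (W t (y t))) (at t within {0..1})) \<Longrightarrow>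
      (\<forall>t\<in>{0..1::real}. \<forall>u\<in>cball 0 (b p). W t u = grad_of (H t) u) \<Longrightarrow> (\<forall>t\<in>{0..1}. norm (y t) \<le> b p)"
    by (metis (no_types, lifting))
  have "compact (cball (0 :: (real ^ 'n) \<times> (real ^ 'n)) r0)" by simp
  moreover have "cball 0 r0 \<subseteq> (\<Union>p\<in>UNIV. ball p (\<rho> p))"
  proof
    fix q :: "(real ^ 'n) \<times> (real ^ 'n)"
    have "q \<in> ball q (\<rho> q)" using rb(1) by simp
    then show "q \<in> (\<Union>p\<in>UNIV. ball p (\<rho> p))" by blast
  qed
  ultimately obtain P where P: "finite P" "cball (0 :: (real ^ 'n) \<times> (real ^ 'n)) r0 \<subseteq> (\<Union>p\<in>P. ball p (\<rho> p))"
    by (elim compactE_image[of _ UNIV "\<lambda>p. ball p (\<rho> p)"]) auto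
  define R where "R = (\<Sum>p\<in>P. b p) + 1"
  have bR: "b p \<le> R" if "p \<in> P" for p
    using member_le_sum[OF that _ P(1), of b] rb(2) by (force simp: R_def less_imp_le)
  show ?thesis
  proof (rule that[of R])
    show "R > 0" unfolding R_def using rb(2) by (intro add_nonneg_pos sum_nonneg) (auto simp: less_imp_le)
    fix y W and t :: real
    assume y0: "norm (y 0) \<le> r0" and y: "\<And>t. t \<in> {0..1} \<Longrightarrow> (y has_vector_derivative J (W t (y t))) (at t within {0..1})"
      and W: "\<And>t u. t \<in> {0..1} \<Longrightarrow> u \<in> cball 0 R \<Longrightarrow> W t u = grad_of (H t) u" and t: "t \<in> {0..1}"
    obtain p where p: "p \<in> P" "norm (p - y 0) < \<rho> p" using y0 P(2) by (force simp: dist_norm)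
    have "norm (y t) \<le> b p"
      by (rule rb(3)[where W = W, rule_format, OF p(2) y _ t]) (use W bR[OF p(1)] in auto)
    then show "norm (y t) \<le> R" using bR[OF p(1)] by simp
  qed
qed

context symplectic_frame begin

lemma reduced_set_bounded: "x \<in> reduced_set \<Longrightarrow> norm x \<le> (\<Sum>b\<in>B. r (blk b) * (2 * norm (l b)))"
proof -
  assume "x \<in> reduced_set"
  then obtain a \<phi> where x: "x = (\<Sum>b\<in>B. a b *\<^sub>R rot (\<phi> (blk b)) (l b))" and a: "\<And>j. (\<Sum>b\<in>blkset j. (a b)\<^sup>2) = (r j)\<^sup>2"
    unfolding reduced_set_def by blast
  show ?thesis unfolding x
  proof (rule order_trans[OF norm_sum sum_mono])
    fix b assume b: "b \<in> B"
    have "(a b)\<^sup>2 \<le> (r (blk b))\<^sup>2" unfolding a[symmetric]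
      using blkset_simps(1,4) b by (intro member_le_sum[of b]) auto
    then have "\<bar>a b\<bar> \<le> r (blk b)" using rpos[of "blk b"] by (simp add: abs_le_square_iff[symmetric])
    moreover have "norm (rot (\<phi> (blk b)) (l b)) \<le> 2 * norm (l b)"
    proof -
      have "norm (rot (\<phi> (blk b)) (l b)) \<le> \<bar>cos (\<phi> (blk b))\<bar> * norm (l b) + \<bar>sin (\<phi> (blk b))\<bar> * norm (l b)"
        unfolding rot_def by (rule order_trans[OF norm_triangle_ineq]) simp
      also have "\<dots> \<le> 1 * norm (l b) + 1 * norm (l b)" by (intro add_mono mult_right_mono) auto
      finally show ?thesis by simp
    qed
    ultimately show "norm (a b *\<^sub>R rot (\<phi> (blk b)) (l b)) \<le> r (blk b) * (2 * norm (l b))"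
      unfolding norm_scaleR using rpos[of "blk b"] by (intro mult_mono) auto
  qed
qed

end

text \<open>Cutting \<open>H\<close> off gives a bounded force without increasing the oscillation.
  The means of \<open>- K\<close> along any two trajectories differ by at most the Hofer length,
  which provides the gap for \<open>intersection_solution\<close>. The orbit found starts in the
  reduced set, hence stays in the \<open>R\<close>-ball and is an orbit of \<open>H\<close>.\<close>

theorem hamiltonian_intersection:
  fixes l :: "'b::finite \<Rightarrow> (real ^ 'n) \<times> (real ^ 'n)" and blk :: "'b \<Rightarrow> 'k::finite"
  assumes frame: "symplectic_frame l B blk r"
    and H: "H \<in> hamiltonians omega0 UNIV"
    and len: "\<And>j. hofer_length UNIV H < ennreal (pi / 2 * (r j)\<^sup>2)"
  shows "\<exists>p \<in> symplectic_frame.reduced_set l B blk r. ham_flow omega0 H 1 p \<in> symplectic_frame.reduced_set l B blk r"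
proof -
  interpret symplectic_frame l B blk r by (rule frame)
  have sm: "smooth_family H" and complete: "UNIV \<subseteq> flow_domain (\<lambda>t. ham_vf omega0 (H t)) 1"
    using H unfolding hamiltonians_def smooth_family_def compatible_def by auto
  define r0 where "r0 = (\<Sum>b\<in>B. r (blk b) * (2 * norm (l b)))"
  obtain R where R: "R > 0" "\<And>y W t. norm (y 0) \<le> r0 \<Longrightarrow>
      (\<And>t. t \<in> {0..1} \<Longrightarrow> (y has_vector_derivative J (W t (y t))) (at t within {0..1})) \<Longrightarrow>
      (\<And>t u. t \<in> {0..1} \<Longrightarrow> u \<in> cball 0 R \<Longrightarrow> W t u = grad_of (H t) u) \<Longrightarrow> t \<in> {0..1} \<Longrightarrow> norm (y t) \<le> R"
    by (rule smooth_hamiltonian_trace_bounded[OF sm complete]) blast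
  define K where "K t x = bump R (x \<bullet> x) * (H t x - H t 0)" for t x
  define gK where "gK t x = bump R (x \<bullet> x) *\<^sub>R grad_of (H t) x + ((H t x - H t 0) * (2 * bump' R (x \<bullet> x))) *\<^sub>R x" for t x
  have contH: "continuous_on ({0..1} \<times> UNIV) (\<lambda>p. H (fst p) (snd p))"
    using smooth_family_continuous[OF sm] by (simp add: case_prod_beta')
  have contH0: "continuous_on ({0..1} \<times> UNIV) (\<lambda>p :: real \<times> (real ^ 'n) \<times> (real ^ 'n). H (fst p) 0)"
  proof -
    have "continuous_on ({0..1} \<times> UNIV) (\<lambda>p :: real \<times> (real ^ 'n) \<times> (real ^ 'n). (fst p, 0 :: (real ^ 'n) \<times> (real ^ 'n)))"
      by (intro continuous_intros)
    from continuous_on_compose2[OF contH this] show ?thesis by (simp add: image_subset_iff)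
  qed
  have contg: "continuous_on ({0..1} \<times> UNIV) (\<lambda>p. grad_of (H (fst p)) (snd p))"
    using smooth_family_grad(1)[OF sm] by (simp add: case_prod_beta')
  have contb: "continuous_on ({0..1} \<times> UNIV) (\<lambda>p :: real \<times> (real ^ 'n) \<times> (real ^ 'n). bump R (snd p \<bullet> snd p))"
    "continuous_on ({0..1} \<times> UNIV) (\<lambda>p :: real \<times> (real ^ 'n) \<times> (real ^ 'n). bump' R (snd p \<bullet> snd p))"
    by (rule continuous_on_compose2[OF bump_cont(1)] continuous_on_compose2[OF bump_cont(2)]; (intro continuous_intros)?; simp)+
  have contK: "continuous_on ({0..1} \<times> UNIV) (\<lambda>(t, x). K t x)"
    unfolding K_def case_prod_beta' by (intro continuous_intros contb contH contH0)
  have contgK: "continuous_on ({0..1} \<times> UNIV) (\<lambda>(t, x). gK t x)"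
    unfolding gK_def case_prod_beta' by (intro continuous_intros contb contH contH0 contg)
  \<comment> \<open>Outside radius \<open>R + 1\<close> the squared norm exceeds
    \<open>R\<^sup>2 + 1\<close>, so the cut-off and its derivative vanish.\<close>
  have out: "K t x = 0 \<and> gK t x = 0" if "x \<notin> cball 0 (R + 1)" for t x
  proof -
    have "R + 1 < norm x" using that by simp
    then have "(R + 1)\<^sup>2 \<le> (norm x)\<^sup>2" using R(1) by (intro power_mono) auto
    then have "x \<bullet> x \<ge> R\<^sup>2 + 1" using R(1) by (simp add: power2_norm_eq_inner power2_sum)
    then show ?thesis by (simp add: K_def gK_def bump_outside)
  qed
  obtain C where C: "C \<ge> 0" "\<And>t x. t \<in> {0..1} \<Longrightarrow> x \<in> cball 0 (R + 1) \<Longrightarrow> norm (gK t x) \<le> C"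
    by (rule continuous_bounded_on_cball[OF contgK]) blast
  obtain C2 where C2: "C2 \<ge> 0" "\<And>t x. t \<in> {0..1} \<Longrightarrow> x \<in> cball 0 (R + 1) \<Longrightarrow> norm (K t x) \<le> C2"
    by (rule continuous_bounded_on_cball[OF contK]) blast
  have KC: "\<bar>K t x\<bar> \<le> C2" if "t \<in> {0..1}" for t x
    using C2(1) C2(2)[OF that, of x] out[of x t] by (cases "x \<in> cball 0 (R + 1)") auto
  interpret bounded_frame_hamiltonian l B blk r K gK C
  proof
    show "(K t has_derivative (\<lambda>v. gK t x \<bullet> v)) (at x)" if "t \<in> {0..1}" for t x
      unfolding K_def[abs_def] gK_def by (rule cutoff_deriv[OF smooth_family_grad(2)[OF sm that]])
    show "continuous_on ({0..1} \<times> UNIV) (\<lambda>(t, x). K t x)" by (rule contK)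
    show "continuous_on ({0..1} \<times> UNIV) (\<lambda>(t, x). gK t x)" by (rule contgK)
    show "norm (gK t x) \<le> C" if "t \<in> {0..1}" for t x
      using C(1) C(2)[OF that, of x] out[of x t] by (cases "x \<in> cball 0 (R + 1)") auto
  qed
  define h where "h p = - integral {0..1} (\<lambda>t. K t (traj (fst p) B (snd p) t))" for p
  have contKt: "continuous_on {0..1} (\<lambda>t. K t (traj M B z t))" for M z
    by (rule slice_cont[where F = "\<lambda>z t. K t (traj M B z t)"]) (rule cont_H_path)
  have hC: "\<bar>h p\<bar> \<le> C2" for p
  proof -
    have "norm (integral {0..1} (\<lambda>t. K t (traj (fst p) B (snd p) t))) \<le> integral {0..1} (\<lambda>t::real. C2)"
      by (intro integral_norm_bound_integral integrable_continuous_real contKt continuous_on_const) (use KC in auto)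
    then show ?thesis by (simp add: h_def)
  qed
  \<comment> \<open>\<open>undefined\<close> serves as an arbitrary block index.\<close>
  have E: "hofer_length UNIV H < \<infinity>" using len[of undefined] order_less_trans ennreal_less_top by (metis infinity_ennreal_def)
  define L where "L = enn2real (hofer_length UNIV H)"
  have L: "hofer_length UNIV H = ennreal L" "L \<ge> 0" using E by (simp_all add: L_def ennreal_enn2real_if less_top[symmetric])
  have Lj: "L < pi / 2 * (r j)\<^sup>2" for j
    using len[of j] L by (simp add: ennreal_less_iff)
  have osc: "h p - h q \<le> L" for p q
  proof -
    let ?d = "\<lambda>t. K t (traj (fst q) B (snd q) t) - K t (traj (fst p) B (snd p) t)"
    have "h p - h q = integral {0..1} ?d"
      unfolding h_def by (simp add: integral_diff integrable_continuous_real contKt)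
    also have "ennreal \<dots> \<le> hofer_length UNIV H"
      unfolding hofer_length_def
      by (rule integral_le_nn_integral[OF continuous_on_diff[OF contKt contKt]]) (simp only: K_def cutoff_osc_le)
    finally show ?thesis using L by simp
  qed
  define c0 where "c0 = Inf (range h)"
  define c1 where "c1 = Sup (range h)"
  have bdd: "bdd_below (range h)" "bdd_above (range h)"
    using hC by (auto intro!: bdd_belowI[of _ "- C2"] bdd_aboveI[of _ C2] simp: abs_le_iff minus_le_iff)
  have "h p \<le> L + c0" for p
  proof -
    have "h p - L \<le> c0" unfolding c0_def using osc[of p] by (intro cInf_greatest) (auto simp: algebra_simps)
    then show ?thesis by simp
  qed
  then have "c1 \<le> L + c0" unfolding c1_def by (intro cSup_least) auto
  then have gap: "c1 - c0 < pi / 2 * (r j)\<^sup>2" for j using Lj[of j] by linarith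
  have "c0 \<le> h p" "h p \<le> c1" for p
    unfolding c0_def c1_def using bdd by (auto intro!: cInf_lower cSup_upper)
  then have bounds: "c0 \<le> - integral {0..1} (\<lambda>t. K t (traj M B z t))" "- integral {0..1} (\<lambda>t. K t (traj M B z t)) \<le> c1" for M z
    unfolding h_def by (metis fst_conv snd_conv)+
  from intersection_solution[OF bounds gap] obtain x where
    x: "\<And>t. t \<in> {0..1} \<Longrightarrow> (x has_vector_derivative J (gK t (x t))) (at t within {0..1})"
    and x01: "x 0 \<in> reduced_set" "x 1 \<in> reduced_set" by blast
  have gKin: "gK t u = grad_of (H t) u" if "u \<in> cball 0 R" for t u
  proof -
    have "(norm u)\<^sup>2 \<le> R\<^sup>2" using that by (intro power_mono) auto
    then have "u \<bullet> u \<le> R\<^sup>2" by (simp add: power2_norm_eq_inner)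
    then show ?thesis by (simp add: gK_def bump_inside)
  qed
  have xR: "norm (x t) \<le> R" if "t \<in> {0..1}" for t
    using reduced_set_bounded[OF x01(1)] unfolding r0_def[symmetric] by (rule R(2)[where W = gK, OF _ x _ that]) (use gKin in auto)
  have xH: "(x has_vector_derivative J (grad_of (H t) (x t))) (at t within {0..1})" if "t \<in> {0..1}" for t
    using x[OF that] gKin[of "x t" t] xR[OF that] by simp
  obtain z where "ode_solution (\<lambda>t. ham_vf omega0 (H t)) 1 (x 0) z"
    using complete unfolding flow_domain_def by blast
  from ham_flow_eq[OF sm this xH refl] have "ham_flow omega0 H 1 (x 0) = x 1" .
  then show ?thesis using x01 by (intro bexI[of _ "x 0"]) auto
qed

section \<open>Relative diameters of rotation-invariant sets\<close>

lemma Ck_open_const: "Ck_open k (\<lambda>x. c) U"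
  by (induction k arbitrary: c) auto

lemma Ck_open_linear: "bounded_linear f \<Longrightarrow> Ck_open k f U"
proof (cases k)
  case (Suc m)
  assume f: "bounded_linear f"
  have d: "(f has_derivative f) (at x)" for x by (rule bounded_linear_imp_has_derivative[OF f])
  then have "frechet_derivative f (at x) = f" for x by (rule frechet_derivative_at[symmetric])
  then show ?thesis using d Suc Ck_open_const by (auto simp: differentiable_def)
qed (simp add: linear_continuous_on)

text \<open>The first derivative is linear in the base point, so the higher ones fall under
  \<open>Ck_open_linear\<close>.\<close>

lemma Ck_open_quadratic:
  assumes d: "\<And>x. (f has_derivative b x) (at x)" and b: "\<And>v. bounded_linear (\<lambda>x. b x v)"
  shows "Ck_open k f U"
proof (cases k)
  case 0
  have "continuous_on U f" using has_derivative_continuous[OF d] by (simp add: continuous_at_imp_continuous_on)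
  then show ?thesis using 0 by simp
next
  case (Suc m)
  have "frechet_derivative f (at x) = b x" for x using d by (rule frechet_derivative_at[symmetric])
  then show ?thesis using d Suc Ck_open_linear[OF b] by (auto simp: differentiable_def)
qed

text \<open>This family is closed under differentiation; the three free vectors make the induction
  go through.\<close>

lemma Ck_open_trig: "Ck_open k (\<lambda>s::real. u + cos (c * s) *\<^sub>R v + sin (c * s) *\<^sub>R w) U"
proof (induction k arbitrary: u v w)
  case 0 show ?case by (auto intro!: continuous_intros)
next
  case (Suc k)
  let ?f = "\<lambda>s::real. u + cos (c * s) *\<^sub>R v + sin (c * s) *\<^sub>R w"
  have d: "(?f has_derivative (\<lambda>h. 0 + cos (c * s) *\<^sub>R ((h * c) *\<^sub>R w) + sin (c * s) *\<^sub>R (- ((h * c) *\<^sub>R v)))) (at s)" for s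
    by (auto intro!: derivative_eq_intros simp: fun_eq_iff algebra_simps)
  have fr: "frechet_derivative ?f (at s) = (\<lambda>h. 0 + cos (c * s) *\<^sub>R ((h * c) *\<^sub>R w) + sin (c * s) *\<^sub>R (- ((h * c) *\<^sub>R v)))" for s
    by (rule frechet_derivative_at[OF d, symmetric])
  show ?case unfolding Ck_open.simps
  proof (intro conjI ballI allI)
    show "?f differentiable (at s)" for s using d unfolding differentiable_def by blast
    show "Ck_open k (\<lambda>x. frechet_derivative ?f (at x) h) U" for h unfolding fr by (rule Suc)
  qed
qed

lemma smooth_onI: "(\<And>k. Ck_open k f UNIV) \<Longrightarrow> smooth_on S f"
  unfolding smooth_on_def by (intro ballI exI[of _ UNIV] exI[of _ f]) auto

text \<open>The one-parameter group of simultaneous rotations of the \<open>(q\<^sub>a, q\<^sub>b)\<close> and \<open>(p\<^sub>a, p\<^sub>b)\<close> planes.\<close>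

locale plane_rotation =
  fixes a b :: "'n::finite"
  assumes ab: "a \<noteq> b"
begin

definition gen1 :: "real ^ 'n \<Rightarrow> real ^ 'n" where "gen1 q = q $ a *\<^sub>R axis b 1 - q $ b *\<^sub>R axis a 1"
definition pr1 :: "real ^ 'n \<Rightarrow> real ^ 'n" where "pr1 q = q $ a *\<^sub>R axis a 1 + q $ b *\<^sub>R axis b 1"
definition gen where "gen x = (gen1 (fst x), gen1 (snd x))"
definition pr where "pr x = (pr1 (fst x), pr1 (snd x))"
definition turn :: "real \<Rightarrow> (real ^ 'n) \<times> (real ^ 'n) \<Rightarrow> (real ^ 'n) \<times> (real ^ 'n)" where
  "turn s x = (x - pr x) + cos s *\<^sub>R pr x + sin s *\<^sub>R gen x"

lemma bl_gen: "bounded_linear gen" and bl_pr: "bounded_linear pr"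
  by (intro linear_conv_bounded_linear[THEN iffD1];
      auto simp: linear_iff gen_def pr_def gen1_def pr1_def algebra_simps)+

lemma turn_nth:
  "fst (turn s x) $ i = (if i = a then cos s * fst x $ a - sin s * fst x $ b
     else if i = b then sin s * fst x $ a + cos s * fst x $ b else fst x $ i)"
  "snd (turn s x) $ i = (if i = a then cos s * snd x $ a - sin s * snd x $ b
     else if i = b then sin s * snd x $ a + cos s * snd x $ b else snd x $ i)"
  using ab by (auto simp: turn_def pr_def gen_def pr1_def gen1_def axis_def)

lemma turn_add: "turn s (turn t x) = turn (s + t) x"
  by (rule prod_eqI; simp add: vec_eq_iff turn_nth ab ab[symmetric] cos_add sin_add algebra_simps)

lemma turn_0: "turn 0 x = x"
  by (simp add: turn_def)

lemma sum_split2: "(\<Sum>i\<in>UNIV. f i) = f a + f b + (\<Sum>i\<in>UNIV - {a, b}. f i)" for f :: "'n \<Rightarrow> real"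
proof -
  have "(\<Sum>i\<in>UNIV. f i) = (\<Sum>i\<in>{a, b}. f i) + (\<Sum>i\<in>UNIV - {a, b}. f i)"
    by (rule sum.subset_diff[THEN trans]) (auto simp: add.commute)
  then show ?thesis using ab by simp
qed

lemma norm_turn: "norm (turn s x) = norm x"
proof -
  have sq: "(cos s * u - sin s * v)\<^sup>2 + (sin s * u + cos s * v)\<^sup>2 = u\<^sup>2 + v\<^sup>2" for u v
  proof -
    have "(cos s)\<^sup>2 + (sin s)\<^sup>2 = 1" by simp
    then show ?thesis by algebra
  qed
  have "(norm (fst (turn s x)))\<^sup>2 = (norm (fst x))\<^sup>2" "(norm (snd (turn s x)))\<^sup>2 = (norm (snd x))\<^sup>2"
    unfolding power2_norm_eq_inner inner_vec_def inner_real_def power2_eq_square[symmetric] sum_split2 turn_nth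
    using ab by (simp_all add: sq)
  then show ?thesis by (simp add: norm_prod_def)
qed

text \<open>Angular momentum, which generates \<open>turn\<close>, as a constant family in
  time.\<close>

definition angular :: "real \<Rightarrow> real \<Rightarrow> (real ^ 'n) \<times> (real ^ 'n) \<Rightarrow> real" where
  "angular c t x = c * (fst x $ a * snd x $ b - fst x $ b * snd x $ a)"

lemma angular_deriv: "(angular c t has_derivative (\<lambda>v. (c *\<^sub>R (- gen1 (snd x), gen1 (fst x))) \<bullet> v)) (at x)"
proof -
  have nth: "((\<lambda>x. fst x $ i) has_derivative (\<lambda>v. fst v $ i)) (at x)" "((\<lambda>x. snd x $ i) has_derivative (\<lambda>v. snd v $ i)) (at x)"
    for i and x :: "(real ^ 'n) \<times> (real ^ 'n)"
    by (auto intro!: bounded_linear_imp_has_derivative bounded_linear_compose[OF bounded_linear_vec_nth] bounded_linear_fst bounded_linear_snd)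
  show ?thesis unfolding angular_def[abs_def]
    by (rule derivative_eq_intros nth refl)+
      (auto simp: fun_eq_iff gen1_def inner_prod_def inner_diff_left inner_axis' algebra_simps)
qed

lemma angular_vf: "ham_vf omega0 (angular c t) x = c *\<^sub>R gen x"
  using ham_vf_omega0[OF angular_deriv] by (simp add: gen_def)

lemma angular_smooth: "smooth_family (angular c)"
  unfolding smooth_family_def
proof (rule smooth_onI)
  fix k
  let ?d = "\<lambda>(p :: real \<times> (real ^ 'n) \<times> (real ^ 'n)) (v :: real \<times> (real ^ 'n) \<times> (real ^ 'n)). (c *\<^sub>R (- gen1 (snd (snd p)), gen1 (fst (snd p)))) \<bullet> snd v" 
  have "((\<lambda>(t, x). angular c t x) has_derivative ?d p) (at p)" for p
  proof -
    have "(snd has_derivative snd) (at p)" by (rule bounded_linear_imp_has_derivative[OF bounded_linear_snd])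
    from has_derivative_compose[OF this angular_deriv[of c 0]] show ?thesis
      by (simp add: case_prod_beta' angular_def)
  qed
  moreover have "bounded_linear (\<lambda>p. ?d p v)" for v
    by (intro linear_conv_bounded_linear[THEN iffD1])
      (auto simp: linear_iff gen1_def inner_prod_def inner_simps algebra_simps)
  ultimately show "Ck_open k (\<lambda>(t, x). angular c t x) UNIV" by (rule Ck_open_quadratic)
qed

lemma turn_ode: "ode_solution (\<lambda>t. ham_vf omega0 (angular c t)) t x (\<lambda>s. turn (c * s) x)"
  unfolding ode_solution_def
proof (intro conjI ballI)
  show "smooth_on {0..t} (\<lambda>s. turn (c * s) x)" unfolding turn_def by (intro smooth_onI Ck_open_trig)
  show "turn (c * 0) x = x" by (simp add: turn_0)
  fix s
  have g: "gen (x - pr x) = 0" "gen (gen x) = - pr x" "gen (pr x) = gen x"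
    using ab by (auto simp: gen_def pr_def gen1_def pr1_def axis_def vec_eq_iff zero_prod_def)
  note lin = bounded_linear.linear[OF bl_gen]
  have "c *\<^sub>R gen (turn (c * s) x) = (- (sin (c * s) * c)) *\<^sub>R pr x + (cos (c * s) * c) *\<^sub>R gen x"
    by (simp only: turn_def linear_add[OF lin] linear_scale[OF lin] g) (simp add: algebra_simps)
  moreover have "((\<lambda>s. turn (c * s) x) has_vector_derivative ((- (sin (c * s) * c)) *\<^sub>R pr x + (cos (c * s) * c) *\<^sub>R gen x)) (at s within {0..t})"
    unfolding turn_def
    by (auto intro!: derivative_eq_intros simp: has_vector_derivative_def fun_eq_iff algebra_simps)
  ultimately show "((\<lambda>s. turn (c * s) x) has_vector_derivative ham_vf omega0 (angular c s) (turn (c * s) x)) (at s within {0..t})"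
    unfolding angular_vf by simp
qed

lemma angular_flow:
  assumes t: "t \<ge> 0"
  shows "ham_flow omega0 (angular c) t x = turn (c * t) x"
  unfolding ham_flow_def flow_def
proof (rule the_equality)
  show "\<exists>y. ode_solution (\<lambda>t. ham_vf omega0 (angular c t)) t x y \<and> y t = turn (c * t) x" using turn_ode by blast
  fix z assume "\<exists>y. ode_solution (\<lambda>t. ham_vf omega0 (angular c t)) t x y \<and> y t = z"
  then obtain y where y: "ode_solution (\<lambda>t. ham_vf omega0 (angular c t)) t x y" "y t = z" by blast
  obtain L where L: "L > 0" "\<And>v. norm (gen v) \<le> norm v * L" using bounded_linear.pos_bounded[OF bl_gen] by blast
  have "norm (turn (c * t) x - y t) \<le> norm (turn (c * 0) x - y 0) * exp (\<bar>c\<bar> * L * t)"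
  proof (rule gronwall_difference[OF t order_refl])
    show "\<bar>c\<bar> * L \<ge> 0" using L by simp
    show "((\<lambda>s. turn (c * s) x) has_vector_derivative c *\<^sub>R gen (turn (c * s) x)) (at s within {0..t})" if "s \<in> {0..t}" for s
      using turn_ode[of c t x] that unfolding ode_solution_def angular_vf by blast
    show "(y has_vector_derivative c *\<^sub>R gen (y s)) (at s within {0..t})" if "s \<in> {0..t}" for s
      using y that unfolding ode_solution_def angular_vf by blast
    fix s
    have "c *\<^sub>R gen (turn (c * s) x) - c *\<^sub>R gen (y s) = c *\<^sub>R gen (turn (c * s) x - y s)"
      by (simp add: linear_diff[OF bounded_linear.linear[OF bl_gen]] scaleR_diff_right)
    then show "norm (c *\<^sub>R gen (turn (c * s) x) - c *\<^sub>R gen (y s)) \<le> \<bar>c\<bar> * L * norm (turn (c * s) x - y s)"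
      using mult_left_mono[OF L(2), of "\<bar>c\<bar>"] by (simp add: mult_ac)
  qed
  moreover have "y 0 = x" using y unfolding ode_solution_def by blast
  ultimately show "z = turn (c * t) x" using y(2) by (simp add: turn_0)
qed

lemma angular_hamiltonian:
  assumes X: "\<And>s x. x \<in> X \<Longrightarrow> turn s x \<in> X"
  shows "angular c \<in> hamiltonians omega0 X"
proof -
  have "X \<subseteq> flow_domain (\<lambda>t. ham_vf omega0 (angular c t)) 1"
    unfolding flow_domain_def using turn_ode by blast
  moreover have "flow (\<lambda>t. ham_vf omega0 (angular c t)) t ` X = X" if "t \<in> {0..1}" for t
  proof -
    have fl: "flow (\<lambda>t. ham_vf omega0 (angular c t)) t x = turn (c * t) x" for x
      using angular_flow[of t c x] that by (simp add: ham_flow_def)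
    have "x \<in> turn (c * t) ` X" if "x \<in> X" for x
      using X[OF that, of "- (c * t)"] turn_add[of "c * t" "- (c * t)" x] by (intro image_eqI[of _ _ "turn (- (c * t)) x"]) (auto simp: turn_0)
    then show ?thesis unfolding fl using X by auto
  qed
  ultimately show ?thesis using angular_smooth unfolding hamiltonians_def compatible_def smooth_family_def by auto
qed

text \<open>The quarter turn restricted to \<open>X\<close> belongs to \<open>Ham omega0 X\<close>
  because \<open>X\<close> is invariant. Any Hamiltonian inducing it on \<open>X\<close> displaces
  the reduced set, which lies in \<open>X\<close>, so \<open>hamiltonian_intersection\<close>
  forbids a length below all the block bounds.\<close>

theorem rel_hofer_diam_lower:
  fixes l :: "'b::finite \<Rightarrow> (real ^ 'n) \<times> (real ^ 'n)" and blk :: "'b \<Rightarrow> 'k::finite"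
  assumes frame: "symplectic_frame l B blk r"
    and X: "\<And>s x. x \<in> X \<Longrightarrow> turn s x \<in> X"
    and sub: "symplectic_frame.reduced_set l B blk r \<subseteq> X"
    and displace: "\<And>x. x \<in> symplectic_frame.reduced_set l B blk r \<Longrightarrow> turn (pi / 2) x \<notin> symplectic_frame.reduced_set l B blk r"
    and E: "\<And>j. E \<le> pi / 2 * (r j)\<^sup>2"
  shows "ennreal E \<le> rel_hofer_diam X UNIV omega0"
proof -
  let ?N = "symplectic_frame.reduced_set l B blk r"
  define \<phi> where "\<phi> = restrict (ham_flow omega0 (angular (pi / 2)) 1) X"
  have \<phi>: "\<phi> \<in> Ham omega0 X" unfolding Ham_def \<phi>_def using angular_hamiltonian[OF X] by blast
  have "ennreal E \<le> rel_hofer_norm omega0 X UNIV \<phi>"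
    unfolding rel_hofer_norm_def hofer_norm_def
  proof (rule Inf_greatest)
    fix e assume "e \<in> {Inf {hofer_length UNIV H | H. H \<in> hamiltonians omega0 UNIV \<and> restrict (ham_flow omega0 H 1) UNIV = \<psi>} | \<psi>.
       \<psi> \<in> Ham omega0 UNIV \<and> restrict \<psi> X = \<phi>}"
    then obtain \<psi> where \<psi>: "restrict \<psi> X = \<phi>" and e: "e = Inf {hofer_length UNIV H | H. H \<in> hamiltonians omega0 UNIV \<and> restrict (ham_flow omega0 H 1) UNIV = \<psi>}"
      by blast
    have "ennreal E \<le> e'" if mem: "e' \<in> {hofer_length UNIV H | H. H \<in> hamiltonians omega0 UNIV \<and> restrict (ham_flow omega0 H 1) UNIV = \<psi>}" for e'
    proof -
      obtain H where H: "H \<in> hamiltonians omega0 UNIV" and e': "e' = hofer_length UNIV H"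
        and \<psi>': "restrict (ham_flow omega0 H 1) UNIV = \<psi>" using mem by blast
      have re: "restrict (ham_flow omega0 H 1) X = \<phi>"
        unfolding \<psi>[symmetric] \<psi>'[symmetric] by (simp add: restrict_def fun_eq_iff)
      show ?thesis
      proof (rule ccontr)
        assume "\<not> ?thesis"
        then have "hofer_length UNIV H < ennreal E" unfolding e' by (simp only: not_le)
        then have "hofer_length UNIV H < ennreal (pi / 2 * (r j)\<^sup>2)" for j
          by (rule order.strict_trans2) (rule ennreal_leI[OF E])
        from hamiltonian_intersection[OF frame H this] obtain p where p: "p \<in> ?N" "ham_flow omega0 H 1 p \<in> ?N" by blast
        have pX: "p \<in> X" using sub p(1) by (rule subsetD)
        then have "ham_flow omega0 H 1 p = \<phi> p" unfolding re[symmetric] by simp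
        also have "\<dots> = turn (pi / 2) p" using pX by (simp add: \<phi>_def angular_flow)
        finally show False using displace[OF p(1)] p(2) by simp
      qed
    qed
    then show "ennreal E \<le> e" unfolding e by (rule Inf_greatest)
  qed
  also have "\<dots> \<le> rel_hofer_diam X UNIV omega0" unfolding rel_hofer_diam_def using \<phi> by (rule SUP_upper)
  finally show ?thesis .
qed

end

section \<open>Displaced products of spheres\<close>

lemma rot_nth:
  fixes v :: "(real ^ 'n) \<times> (real ^ 'n)"
  shows "fst (rot \<phi> v) $ i = cos \<phi> * fst v $ i + sin \<phi> * snd v $ i"
    "snd (rot \<phi> v) $ i = cos \<phi> * snd v $ i - sin \<phi> * fst v $ i"
  by (simp_all add: rot_def J_def)

definition modsq :: "(real ^ 'n) \<times> (real ^ 'n) \<Rightarrow> 'n \<Rightarrow> real" where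
  "modsq x i = (fst x $ i)\<^sup>2 + (snd x $ i)\<^sup>2"

lemma modsq_rot: "modsq (rot \<phi> v) i = modsq v i"
proof -
  have "(cos \<phi>)\<^sup>2 + (sin \<phi>)\<^sup>2 = 1" by simp
  then show ?thesis unfolding modsq_def rot_nth by algebra
qed

lemma norm_modsq: "(norm x)\<^sup>2 = (\<Sum>i\<in>UNIV. modsq x i)"
  unfolding power2_norm_eq_inner inner_prod_def inner_vec_def modsq_def by (simp add: power2_eq_square sum.distrib)

definition Ebasis :: "'n \<Rightarrow> (real ^ 'n) \<times> (real ^ 'n)" where "Ebasis i = (axis i 1, 0)"

lemma Ebasis_nth: "fst (Ebasis i) $ k = (if k = i then 1 else 0)" "snd (Ebasis i) $ k = 0"
  "fst (J (Ebasis i)) $ k = 0" "snd (J (Ebasis i)) $ k = (if k = i then - 1 else 0)"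
  by (auto simp: Ebasis_def J_def axis_def)

text \<open>For a unit vector this is the projection to its complex line. It is quadratic in
  \<open>v\<close>, and the frame identities are checked by adding such terms.\<close>

definition plane_proj :: "'a::real_inner \<times> 'a \<Rightarrow> 'a \<times> 'a \<Rightarrow> 'a \<times> 'a" where
  "plane_proj v f = (f \<bullet> v) *\<^sub>R v + (f \<bullet> J v) *\<^sub>R J v"

lemma plane_proj_Ebasis: "(\<Sum>i\<in>UNIV. plane_proj (Ebasis i) f) = f"
proof -
  have p: "plane_proj (Ebasis i) f = (axis i (fst f $ i), axis i (snd f $ i))" for i
    by (cases f) (simp add: plane_proj_def Ebasis_def J_def inner_axis, simp add: axis_def vec_eq_iff)
  show ?thesis unfolding p
    by (cases f) (simp add: prod_eq_iff fst_sum snd_sum vec_eq_iff axis_def)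
qed

lemma plane_proj_scale: "plane_proj (c *\<^sub>R v) f = c\<^sup>2 *\<^sub>R plane_proj v f"
  by (simp add: plane_proj_def J_scale scaleR_add_right power2_eq_square mult_ac)

lemma plane_proj_J: "plane_proj (J v) f = plane_proj v f"
  by (simp add: plane_proj_def)

text \<open>The parallelogram law for a quadratic map: scaled by 1 / sqrt 2, the vectors
  \<open>u + v\<close> and \<open>u - v\<close> may replace \<open>u\<close> and \<open>v\<close> in
  a frame.\<close>

lemma plane_proj_parallelogram:
  "plane_proj (u + v) f + plane_proj (u - v) f = 2 *\<^sub>R (plane_proj u f + plane_proj v f)"
proof -
  have "(2 * c) *\<^sub>R w = c *\<^sub>R w + c *\<^sub>R w" for c and w :: "'a \<times> 'a"
    by (simp add: scaleR_left_distrib[symmetric])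
  then show ?thesis
    by (simp add: plane_proj_def J_add J_diff inner_simps scaleR_add_left scaleR_add_right scaleR_diff_left scaleR_diff_right)
qed

text \<open>If only block \<open>j\<close> meets the coordinate plane \<open>i\<close>, that
  coordinate undergoes a single rotation, and its modulus can be read off from the unrotated real
  combination.\<close>

lemma block_component:
  fixes l :: "'b \<Rightarrow> (real ^ 'n) \<times> (real ^ 'n)"
  assumes "\<And>p. p \<in> B \<Longrightarrow> blk p \<noteq> j \<Longrightarrow> fst (l p) $ i = 0 \<and> snd (l p) $ i = 0"
  shows "fst (\<Sum>p\<in>B. \<alpha> p *\<^sub>R rot (\<phi> (blk p)) (l p)) $ i = fst (rot (\<phi> j) (\<Sum>p\<in>B. \<alpha> p *\<^sub>R l p)) $ i"
    and "snd (\<Sum>p\<in>B. \<alpha> p *\<^sub>R rot (\<phi> (blk p)) (l p)) $ i = snd (rot (\<phi> j) (\<Sum>p\<in>B. \<alpha> p *\<^sub>R l p)) $ i"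
proof -
  have "fst (\<alpha> p *\<^sub>R rot (\<phi> (blk p)) (l p)) $ i = cos (\<phi> j) * fst (\<alpha> p *\<^sub>R l p) $ i + sin (\<phi> j) * snd (\<alpha> p *\<^sub>R l p) $ i"
    "snd (\<alpha> p *\<^sub>R rot (\<phi> (blk p)) (l p)) $ i = cos (\<phi> j) * snd (\<alpha> p *\<^sub>R l p) $ i - sin (\<phi> j) * fst (\<alpha> p *\<^sub>R l p) $ i"
    if "p \<in> B" for p
    using assms[OF that] by (cases "blk p = j"; simp add: rot_nth algebra_simps)+
  then show "fst (\<Sum>p\<in>B. \<alpha> p *\<^sub>R rot (\<phi> (blk p)) (l p)) $ i = fst (rot (\<phi> j) (\<Sum>p\<in>B. \<alpha> p *\<^sub>R l p)) $ i"
    "snd (\<Sum>p\<in>B. \<alpha> p *\<^sub>R rot (\<phi> (blk p)) (l p)) $ i = snd (rot (\<phi> j) (\<Sum>p\<in>B. \<alpha> p *\<^sub>R l p)) $ i"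
    unfolding rot_nth fst_sum snd_sum sum_component by (simp_all only: sum_distrib_left sum.distrib sum_subtractf cong: sum.cong)
qed

text \<open>Index set of a frame that covers the planes in \<open>T\<close> twice;
  \<open>True\<close> marks the second vector.\<close>

definition doubled :: "'n set \<Rightarrow> ('n \<times> bool) set" where
  "doubled T = range (\<lambda>i. (i, False)) \<union> (\<lambda>i. (i, True)) ` T"

lemma doubled_iff: "(i, t) \<in> doubled T \<longleftrightarrow> (t \<longrightarrow> i \<in> T)"
  by (cases t) (simp_all add: doubled_def image_iff)

lemma sum_doubled: "(\<Sum>p\<in>doubled T. f p) = (\<Sum>i\<in>UNIV. f (i, False)) + (\<Sum>i\<in>T. f (i, True))"
  for f :: "'n::finite \<times> bool \<Rightarrow> 'a::comm_monoid_add"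
  unfolding doubled_def
  by (subst sum.union_disjoint) (auto simp: sum.reindex inj_on_def finite_subset)

lemma ennreal_le_of_tendsto:
  assumes "f \<longlonglongrightarrow> l" "\<And>k. ennreal (f k) \<le> D" shows "ennreal l \<le> D"
  using tendsto_ennrealI[OF assms(1)] assms(2) by (intro LIMSEQ_le_const2[of "\<lambda>k. ennreal (f k)"]) auto

context plane_rotation begin

lemma modsq_turn: "modsq (turn (pi / 2) x) a = modsq x b"
  by (simp add: modsq_def turn_nth)

definition sphere_frame :: "'n \<times> bool \<Rightarrow> (real ^ 'n) \<times> (real ^ 'n)" where
  "sphere_frame p = (1 / sqrt 2) *\<^sub>R (if snd p then J (Ebasis (fst p)) else Ebasis (fst p))"

text \<open>Each plane is covered twice with weight 1/2. The factor 2 in the squared radii undoes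
  the scaling of \<open>sphere_frame\<close>, so the blocks are spheres of squared radius \<rho> and
  1 - \<rho>.\<close>

lemma sphere_symplectic_frame:
  assumes "0 < \<rho>" "\<rho> < 1"
  shows "symplectic_frame sphere_frame (doubled UNIV) (\<lambda>p. fst p = a) (\<lambda>j. sqrt (2 * (if j then \<rho> else 1 - \<rho>)))"
proof
  show "finite (doubled (UNIV :: 'n set))" by (simp add: doubled_def)
  show "\<exists>p\<in>doubled UNIV. (fst p = a) = j" for j
    using ab by (cases j; intro bexI[of _ "(if j then a else b, False)"]) (auto simp: doubled_def)
  show "0 < sqrt (2 * (if j then \<rho> else 1 - \<rho>))" for j using assms by simp
  fix f :: "(real ^ 'n) \<times> (real ^ 'n)"
  have half: "plane_proj (sphere_frame p) f = (1 / 2) *\<^sub>R plane_proj (Ebasis (fst p)) f" for p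
    by (simp add: sphere_frame_def plane_proj_scale plane_proj_J power_divide)
  have "(\<Sum>p\<in>doubled UNIV. plane_proj (sphere_frame p) f) = f"
    unfolding sum_doubled half fst_conv scaleR_sum_right[symmetric] plane_proj_Ebasis
    by (simp add: scaleR_left_distrib[symmetric])
  then show "(\<Sum>p\<in>doubled UNIV. (f \<bullet> sphere_frame p) *\<^sub>R sphere_frame p + (f \<bullet> J (sphere_frame p)) *\<^sub>R J (sphere_frame p)) = f"
    unfolding plane_proj_def .
qed

lemma sphere_reduced:
  assumes \<rho>: "0 < \<rho>" "\<rho> < 1" and x: "x \<in> symplectic_frame.reduced_set sphere_frame (doubled UNIV) (\<lambda>p. fst p = a) (\<lambda>j. sqrt (2 * (if j then \<rho> else 1 - \<rho>)))"
  shows "norm x = 1" "modsq x a = \<rho>" "modsq x b \<le> 1 - \<rho>"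
proof -
  interpret F: symplectic_frame sphere_frame "doubled UNIV" "\<lambda>p. fst p = a" "\<lambda>j. sqrt (2 * (if j then \<rho> else 1 - \<rho>))"
    by (rule sphere_symplectic_frame[OF \<rho>])
  obtain \<alpha> \<phi> where xeq: "x = (\<Sum>p\<in>doubled UNIV. \<alpha> p *\<^sub>R rot (\<phi> (fst p = a)) (sphere_frame p))"
    and \<alpha>: "\<And>j. (\<Sum>p\<in>F.blkset j. (\<alpha> p)\<^sup>2) = (sqrt (2 * (if j then \<rho> else 1 - \<rho>)))\<^sup>2"
    using x unfolding F.reduced_set_def by blast
  have \<alpha>': "(\<Sum>p\<in>F.blkset True. (\<alpha> p)\<^sup>2) = 2 * \<rho>" "(\<Sum>p\<in>F.blkset False. (\<alpha> p)\<^sup>2) = 2 * (1 - \<rho>)"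
    unfolding \<alpha> using \<rho> by auto
  define x0 where "x0 = (\<Sum>p\<in>doubled UNIV. \<alpha> p *\<^sub>R sphere_frame p)"
  have x0: "fst x0 $ i = \<alpha> (i, False) / sqrt 2" "snd x0 $ i = - \<alpha> (i, True) / sqrt 2" for i
    unfolding x0_def sum_doubled
    by (simp_all add: fst_sum snd_sum sphere_frame_def Ebasis_nth if_distrib[of "\<lambda>x. _ * x"] cong: if_cong)
  have m: "modsq x i = ((\<alpha> (i, False))\<^sup>2 + (\<alpha> (i, True))\<^sup>2) / 2" for i
  proof -
    have z: "fst (sphere_frame p) $ i = 0 \<and> snd (sphere_frame p) $ i = 0" if "(fst p = a) \<noteq> (i = a)" for p
      using that by (auto simp: sphere_frame_def Ebasis_nth)
    have "fst x $ i = fst (rot (\<phi> (i = a)) x0) $ i" "snd x $ i = snd (rot (\<phi> (i = a)) x0) $ i"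
      unfolding xeq x0_def by (rule block_component[where blk = "\<lambda>p. fst p = a"], rule z, assumption)+
    then have "modsq x i = modsq (rot (\<phi> (i = a)) x0) i" by (simp add: modsq_def)
    also have "\<dots> = modsq x0 i" by (rule modsq_rot)
    also have "\<dots> = ((\<alpha> (i, False))\<^sup>2 + (\<alpha> (i, True))\<^sup>2) / 2"
      unfolding modsq_def x0 by (simp add: power_divide add_divide_distrib)
    finally show ?thesis .
  qed
  have bl: "F.blkset True = {(a, False), (a, True)}" "{(b, False), (b, True)} \<subseteq> F.blkset False"
    unfolding F.blkset_def using ab by (auto simp: doubled_def)
  show "modsq x a = \<rho>" using \<alpha>'(1) unfolding m bl by simp
  have "(\<Sum>p\<in>{(b, False), (b, True)}. (\<alpha> p)\<^sup>2) \<le> 2 * (1 - \<rho>)"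
    unfolding \<alpha>'(2)[symmetric] by (rule sum_mono2) (use bl in auto)
  then show "modsq x b \<le> 1 - \<rho>" unfolding m by simp
  have "(norm x)\<^sup>2 = (\<Sum>p\<in>doubled UNIV. (\<alpha> p)\<^sup>2) / 2"
    unfolding norm_modsq m sum_doubled by (simp add: sum_divide_distrib[symmetric] sum.distrib)
  also have "\<dots> = 1" unfolding F.sum_blocks[symmetric] by (simp add: UNIV_bool \<alpha>')
  finally show "norm x = 1" using power2_eq_imp_eq[of "norm x" 1] by simp
qed

theorem rel_hofer_diam_sphere: "ennreal (pi / 2) \<le> rel_hofer_diam (sphere 0 1) UNIV (omega0 :: (real ^ 'n) \<times> (real ^ 'n) \<Rightarrow> _)"
proof (rule ennreal_le_of_tendsto)
  show "(\<lambda>k. pi * (1 / 2 - 1 / (real k + 3))) \<longlonglongrightarrow> pi / 2"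
    by real_asymp
  fix k
  \<comment> \<open>Slightly above 1/2: after the quarter turn the squared modulus at
    \<open>a\<close> is at most 1 - \<rho>, which is less than \<rho>, so the point has left the
    set.\<close>
  define \<rho> where "\<rho> = 1 / 2 + 1 / (real k + 3)"
  have "1 / (real k + 3) > 0" "1 / (real k + 3) < 1 / 2" by (auto simp: field_simps)
  then have \<rho>: "0 < \<rho>" "\<rho> < 1" "\<rho> > 1 / 2" unfolding \<rho>_def by linarith+
  have E: "pi * (1 / 2 - 1 / (real k + 3)) = pi * (1 - \<rho>)" by (simp add: \<rho>_def)
  note red = sphere_reduced[OF \<rho>(1,2)]
  show "ennreal (pi * (1 / 2 - 1 / (real k + 3))) \<le> rel_hofer_diam (sphere 0 1) UNIV (omega0 :: (real ^ 'n) \<times> (real ^ 'n) \<Rightarrow> _)"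
    unfolding E
  proof (rule rel_hofer_diam_lower[OF sphere_symplectic_frame[OF \<rho>(1,2)]])
    show "turn s x \<in> sphere 0 1" if "x \<in> sphere 0 1" for s x using that by (simp add: norm_turn)
    show "symplectic_frame.reduced_set sphere_frame (doubled UNIV) (\<lambda>p. fst p = a) (\<lambda>j. sqrt (2 * (if j then \<rho> else 1 - \<rho>))) \<subseteq> sphere 0 1"
      using red(1) by auto
    show "pi * (1 - \<rho>) \<le> pi / 2 * (sqrt (2 * (if j then \<rho> else 1 - \<rho>)))\<^sup>2" for j using \<rho> by (cases j) auto
    show "turn (pi / 2) x \<notin> symplectic_frame.reduced_set sphere_frame (doubled UNIV) (\<lambda>p. fst p = a) (\<lambda>j. sqrt (2 * (if j then \<rho> else 1 - \<rho>)))"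
      if "x \<in> symplectic_frame.reduced_set sphere_frame (doubled UNIV) (\<lambda>p. fst p = a) (\<lambda>j. sqrt (2 * (if j then \<rho> else 1 - \<rho>)))" for x
      using red(3)[OF that] red(2)[of "turn (pi / 2) x"] \<rho>(3) by (auto simp: modsq_turn)
  qed
qed

end

section \<open>A circle times rotations of a balanced real sphere\<close>

locale plane_rotation_3 = plane_rotation a b for a b :: "'n::finite" +
  fixes c :: 'n
  assumes ca: "c \<noteq> a" and cb: "c \<noteq> b"
begin

lemmas neqs = ab ca cb ab[symmetric] ca[symmetric] cb[symmetric]

lemma sum_split3: "(\<Sum>i\<in>UNIV. f i) = f a + f b + f c + (\<Sum>i\<in>UNIV - {a, b, c}. f i)"
  for f :: "'n \<Rightarrow> 'c::comm_monoid_add"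
proof -
  have "(\<Sum>i\<in>UNIV. f i) = (\<Sum>i\<in>{a, b, c}. f i) + (\<Sum>i\<in>UNIV - {a, b, c}. f i)"
    by (rule sum.subset_diff[THEN trans]) (auto simp: add.commute)
  then show ?thesis using neqs by (simp add: add.assoc)
qed

text \<open>On the planes \<open>b\<close> and \<open>c\<close> the real frame vectors span a Lagrangian plane in which the moduli of the
  two complex coordinates agree; each modulus squared is then at most half of the block's total.\<close>

definition balanced_frame :: "'n \<times> bool \<Rightarrow> (real ^ 'n) \<times> (real ^ 'n)" where
  "balanced_frame p =
     (if fst p = a then (1 / sqrt 2) *\<^sub>R (if snd p then J (Ebasis a) else Ebasis a)
      else if fst p = b then (1 / sqrt 2) *\<^sub>R (Ebasis b + Ebasis c)
      else if fst p = c then (1 / sqrt 2) *\<^sub>R J (Ebasis b - Ebasis c)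
      else Ebasis (fst p))"

text \<open>The factor 2 belongs to the doubled plane \<open>a\<close>. The other block is
  undoubled, so its energy bound is only pi / 2 times 1 - \<rho>.\<close>

definition balanced_radius :: "real \<Rightarrow> bool \<Rightarrow> real" where
  "balanced_radius \<rho> j = sqrt (if j then 2 * \<rho> else 1 - \<rho>)"

lemma balanced_symplectic_frame:
  assumes "0 < \<rho>" "\<rho> < 1"
  shows "symplectic_frame balanced_frame (doubled {a}) (\<lambda>p. fst p = a) (balanced_radius \<rho>)"
proof
  show "finite (doubled {a})" by (simp add: doubled_def)
  show "\<exists>p\<in>doubled {a}. (fst p = a) = j" for j
    using ab by (cases j; intro bexI[of _ "(if j then a else b, False)"]) (auto simp: doubled_def)
  show "0 < balanced_radius \<rho> j" for j using assms by (simp add: balanced_radius_def)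
  fix f :: "(real ^ 'n) \<times> (real ^ 'n)"
  have "plane_proj (balanced_frame (a, t)) f = (1 / 2) *\<^sub>R plane_proj (Ebasis a) f" for t
    by (simp add: balanced_frame_def plane_proj_scale plane_proj_J power_divide)
  moreover have "plane_proj (balanced_frame (b, False)) f = (1 / 2) *\<^sub>R plane_proj (Ebasis b + Ebasis c) f"
    "plane_proj (balanced_frame (c, False)) f = (1 / 2) *\<^sub>R plane_proj (Ebasis b - Ebasis c) f"
    using neqs by (simp_all add: balanced_frame_def plane_proj_scale plane_proj_J power_divide)
  moreover have "(\<Sum>i\<in>UNIV - {a, b, c}. plane_proj (balanced_frame (i, False)) f) = (\<Sum>i\<in>UNIV - {a, b, c}. plane_proj (Ebasis i) f)"
    by (intro sum.cong refl) (simp add: balanced_frame_def)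
  ultimately have "(\<Sum>p\<in>doubled {a}. plane_proj (balanced_frame p) f)
      = (1 / 2) *\<^sub>R plane_proj (Ebasis a) f + (1 / 2) *\<^sub>R plane_proj (Ebasis a) f
        + (1 / 2) *\<^sub>R (plane_proj (Ebasis b + Ebasis c) f + plane_proj (Ebasis b - Ebasis c) f)
        + (\<Sum>i\<in>UNIV - {a, b, c}. plane_proj (Ebasis i) f)"
    unfolding sum_doubled sum_split3 by (simp add: scaleR_add_right add_ac)
  also have "\<dots> = (\<Sum>i\<in>UNIV. plane_proj (Ebasis i) f)"
    unfolding plane_proj_parallelogram sum_split3 by (simp add: scaleR_left_distrib[symmetric] add_ac)
  finally have "(\<Sum>p\<in>doubled {a}. plane_proj (balanced_frame p) f) = f" unfolding plane_proj_Ebasis .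
  then show "(\<Sum>p\<in>doubled {a}. (f \<bullet> balanced_frame p) *\<^sub>R balanced_frame p + (f \<bullet> J (balanced_frame p)) *\<^sub>R J (balanced_frame p)) = f"
    unfolding plane_proj_def .
qed

text \<open>The real span of the second block of \<open>balanced_frame\<close> in coordinates;
  \<open>w $ b\<close> and \<open>w $ c\<close> are the coefficients of the two mixed
  vectors.\<close>

definition spread :: "real ^ 'n \<Rightarrow> (real ^ 'n) \<times> (real ^ 'n)" where
  "spread w = ((\<chi> i. if i = a then 0 else if i = b \<or> i = c then w $ b / sqrt 2 else w $ i),
     (\<chi> i. if i = b then - (w $ c) / sqrt 2 else if i = c then w $ c / sqrt 2 else 0))"

lemma bl_spread: "bounded_linear spread"
  by (intro linear_conv_bounded_linear[THEN iffD1])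
    (auto simp: linear_iff spread_def vec_eq_iff add_divide_distrib diff_divide_distrib)

lemma norm_spread: assumes "w $ a = 0" shows "norm (spread w) = norm w"
proof -
  have "(norm (spread w))\<^sup>2 = (\<Sum>i\<in>UNIV. modsq (spread w) i)" by (rule norm_modsq)
  also have "\<dots> = (\<Sum>i\<in>UNIV. (w $ i)\<^sup>2)"
    unfolding sum_split3 modsq_def spread_def using neqs assms by (simp add: power_divide)
  also have "\<dots> = (norm w)\<^sup>2" unfolding power2_norm_eq_inner inner_vec_def by (simp add: power2_eq_square)
  finally show ?thesis by simp
qed

text \<open>Coordinates on the orbit of the reduced set under all turns: the turn, the phase of the
  circle, and the phase and real unit vector of the second block. For fixed \<rho> these are 3 + (n
  - 2) parameters.\<close>

definition balanced_point :: "real \<Rightarrow> real \<Rightarrow> real \<Rightarrow> real \<Rightarrow> real ^ 'n \<Rightarrow> (real ^ 'n) \<times> (real ^ 'n)" where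
  "balanced_point \<rho> s \<psi> \<phi> w = turn s (sqrt \<rho> *\<^sub>R rot \<psi> (Ebasis a) + sqrt (1 - \<rho>) *\<^sub>R rot \<phi> (spread w))"

lemma norm_rot: "norm (rot \<phi> v) = norm v" for v :: "(real ^ 'n) \<times> (real ^ 'n)"
proof -
  have "(norm (rot \<phi> v))\<^sup>2 = (norm v)\<^sup>2" unfolding norm_modsq modsq_rot ..
  then show ?thesis by simp
qed

lemma norm_balanced_point:
  assumes "0 \<le> \<rho>" "\<rho> \<le> 1" "w $ a = 0" "norm w = 1"
  shows "norm (balanced_point \<rho> s \<psi> \<phi> w) = 1"
proof -
  have "orthogonal (sqrt \<rho> *\<^sub>R rot \<psi> (Ebasis a)) (sqrt (1 - \<rho>) *\<^sub>R rot \<phi> (spread w))"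
    using neqs by (simp add: orthogonal_def rot_def Ebasis_def J_def spread_def inner_axis' inner_axis inner_simps)
  then have "(norm (sqrt \<rho> *\<^sub>R rot \<psi> (Ebasis a) + sqrt (1 - \<rho>) *\<^sub>R rot \<phi> (spread w)))\<^sup>2
     = (norm (sqrt \<rho> *\<^sub>R rot \<psi> (Ebasis a)))\<^sup>2 + (norm (sqrt (1 - \<rho>) *\<^sub>R rot \<phi> (spread w)))\<^sup>2"
    by (rule norm_add_Pythagorean)
  also have "\<dots> = 1" using assms by (simp add: norm_rot norm_spread Ebasis_def power_mult_distrib)
  finally show ?thesis using power2_eq_imp_eq[of "norm (balanced_point \<rho> s \<psi> \<phi> w)" 1] by (simp add: balanced_point_def norm_turn)
qed

text \<open>Confines the turn to a compact interval, so that \<open>balanced_set\<close> can be both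
  compact and invariant under all turns.\<close>

lemma turn_period: obtains s' where "s' \<in> {0..2 * pi}" "turn s = turn s'"
proof -
  obtain s' where "0 \<le> s'" "s' < 2 * pi" "cos s = cos s'" "sin s = sin s'"
    using sincos_total_2pi[of "cos s" "sin s"] sin_cos_squared_add2 by metis
  then show ?thesis using that[of s'] by (auto simp: turn_def fun_eq_iff)
qed

definition balanced_set :: "real set \<Rightarrow> ((real ^ 'n) \<times> (real ^ 'n)) set" where
  "balanced_set R = (\<lambda>(\<rho>, s, \<psi>, \<phi>, w). balanced_point \<rho> s \<psi> \<phi> w) `
     (R \<times> {0..2 * pi} \<times> {0..2 * pi} \<times> {0..2 * pi} \<times> {w. norm w = 1 \<and> w $ a = 0})"

lemma balanced_setE:
  assumes "x \<in> balanced_set R"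
  obtains \<rho> s \<psi> \<phi> w where "x = balanced_point \<rho> s \<psi> \<phi> w" "\<rho> \<in> R" "s \<in> {0..2 * pi}" "\<psi> \<in> {0..2 * pi}"
    "\<phi> \<in> {0..2 * pi}" "norm w = 1" "w $ a = 0"
proof -
  obtain p where p: "p \<in> R \<times> {0..2 * pi} \<times> {0..2 * pi} \<times> {0..2 * pi} \<times> {w. norm w = 1 \<and> w $ a = 0}"
    "x = (case p of (\<rho>, s, \<psi>, \<phi>, w) \<Rightarrow> balanced_point \<rho> s \<psi> \<phi> w)"
    using assms unfolding balanced_set_def by (rule imageE)
  obtain \<rho> s \<psi> \<phi> w where "p = (\<rho>, s, \<psi>, \<phi>, w)" by (rule prod_cases5)
  then show thesis using that[of \<rho> s \<psi> \<phi> w] p by simp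
qed

lemma turn_balanced_set: assumes "x \<in> balanced_set R" shows "turn t x \<in> balanced_set R"
  using assms
proof (rule balanced_setE)
  fix \<rho> s \<psi> \<phi> w
  assume x: "x = balanced_point \<rho> s \<psi> \<phi> w" and m: "\<rho> \<in> R" "s \<in> {0..2 * pi}" "\<psi> \<in> {0..2 * pi}"
    "\<phi> \<in> {0..2 * pi}" "norm w = 1" "w $ a = 0"
  obtain s' where s': "s' \<in> {0..2 * pi}" "turn (t + s) = turn s'" by (rule turn_period)
  have "turn t x = balanced_point \<rho> s' \<psi> \<phi> w" unfolding x balanced_point_def turn_add s'(2) ..
  then show ?thesis unfolding balanced_set_def using m s'(1)
    by (intro image_eqI[of _ _ "(\<rho>, s', \<psi>, \<phi>, w)"]) auto
qed

text \<open>The first claim provides the parametrisation from which the dimension is estimated. The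
  last one holds because the coordinates \<open>b\<close> and \<open>c\<close> share the weight of
  their two coefficients equally.\<close>

lemma balanced_reduced:
  assumes \<rho>: "0 < \<rho>" "\<rho> < 1"
    and x: "x \<in> symplectic_frame.reduced_set balanced_frame (doubled {a}) (\<lambda>p. fst p = a) (balanced_radius \<rho>)"
  shows "x \<in> balanced_set {\<rho>}" "modsq x a = \<rho>" "modsq x b \<le> (1 - \<rho>) / 2"
proof -
  interpret F: symplectic_frame balanced_frame "doubled {a}" "\<lambda>p. fst p = a" "balanced_radius \<rho>"
    by (rule balanced_symplectic_frame[OF \<rho>])
  obtain \<alpha> \<phi> where xeq: "x = (\<Sum>p\<in>doubled {a}. \<alpha> p *\<^sub>R rot (\<phi> (fst p = a)) (balanced_frame p))"
    and \<alpha>: "\<And>j. (\<Sum>p\<in>F.blkset j. (\<alpha> p)\<^sup>2) = (balanced_radius \<rho> j)\<^sup>2"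
    using x unfolding F.reduced_set_def by blast
  have bl: "F.blkset True = {(a, False), (a, True)}" "F.blkset False = (\<lambda>i. (i, False)) ` (UNIV - {a})"
    unfolding F.blkset_def set_eq_iff split_paired_All mem_Collect_eq doubled_iff fst_conv by (simp_all add: image_iff; blast)+
  have \<alpha>1: "(\<alpha> (a, False))\<^sup>2 + (\<alpha> (a, True))\<^sup>2 = 2 * \<rho>"
    using \<alpha>[of True] \<rho> unfolding bl by (simp add: balanced_radius_def)
  have \<alpha>2: "(\<Sum>i\<in>UNIV - {a}. (\<alpha> (i, False))\<^sup>2) = 1 - \<rho>"
    using \<alpha>[of False] \<rho> unfolding bl by (simp add: balanced_radius_def sum.reindex inj_on_def)
  define w where "w = (\<chi> i. if i = a then 0 else \<alpha> (i, False) / sqrt (1 - \<rho>))"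
  have wa: "w $ a = 0" by (simp add: w_def)
  have "(norm w)\<^sup>2 = (\<Sum>i\<in>UNIV. (w $ i)\<^sup>2)" unfolding power2_norm_eq_inner inner_vec_def by (simp add: power2_eq_square)
  also have "\<dots> = (\<Sum>i\<in>UNIV - {a}. (w $ i)\<^sup>2)" by (rule sum.mono_neutral_right) (auto simp: w_def)
  also have "\<dots> = (\<Sum>i\<in>UNIV - {a}. (\<alpha> (i, False))\<^sup>2 / (1 - \<rho>))"
    using \<rho> by (intro sum.cong refl) (simp add: w_def power_divide)
  also have "\<dots> = 1" using \<rho> by (simp add: sum_divide_distrib[symmetric] \<alpha>2)
  finally have wn: "norm w = 1" using power2_eq_imp_eq[of "norm w" 1] by simp
  define x0 where "x0 = (\<Sum>p\<in>doubled {a}. \<alpha> p *\<^sub>R balanced_frame p)"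
  have z: "fst (balanced_frame p) $ i = 0 \<and> snd (balanced_frame p) $ i = 0" if "(fst p = a) \<noteq> (i = a)" for p i
    using that neqs by (auto simp: balanced_frame_def Ebasis_nth J_diff)
  have xi: "fst x $ i = fst (rot (\<phi> (i = a)) x0) $ i" "snd x $ i = snd (rot (\<phi> (i = a)) x0) $ i" for i
    unfolding xeq x0_def by (rule block_component[where blk = "\<lambda>p. fst p = a"], rule z, assumption)+
  have rest: "(\<Sum>k\<in>UNIV - {a, b, c}. \<alpha> (k, False) * fst (balanced_frame (k, False)) $ i) = (if i \<in> {a, b, c} then 0 else \<alpha> (i, False))"
    "(\<Sum>k\<in>UNIV - {a, b, c}. \<alpha> (k, False) * snd (balanced_frame (k, False)) $ i) = 0" for i
  proof -
    have "(\<Sum>k\<in>UNIV - {a, b, c}. \<alpha> (k, False) * fst (balanced_frame (k, False)) $ i) = (\<Sum>k\<in>UNIV - {a, b, c}. if k = i then \<alpha> (k, False) else 0)"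
      by (intro sum.cong refl) (auto simp: balanced_frame_def Ebasis_nth)
    then show "(\<Sum>k\<in>UNIV - {a, b, c}. \<alpha> (k, False) * fst (balanced_frame (k, False)) $ i) = (if i \<in> {a, b, c} then 0 else \<alpha> (i, False))"
      by (simp add: sum.delta)
    show "(\<Sum>k\<in>UNIV - {a, b, c}. \<alpha> (k, False) * snd (balanced_frame (k, False)) $ i) = 0"
      by (intro sum.neutral) (auto simp: balanced_frame_def Ebasis_nth)
  qed
  have x0a: "fst x0 $ a = \<alpha> (a, False) / sqrt 2" "snd x0 $ a = - \<alpha> (a, True) / sqrt 2"
    using neqs unfolding x0_def sum_doubled fst_sum snd_sum sum_component fst_add snd_add vector_add_component fst_scaleR snd_scaleR vector_scaleR_component real_scaleR_def sum_split3 rest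
    by (simp_all add: balanced_frame_def Ebasis_nth J_diff)
  have x0i: "fst x0 $ i = sqrt (1 - \<rho>) * fst (spread w) $ i" "snd x0 $ i = sqrt (1 - \<rho>) * snd (spread w) $ i" if "i \<noteq> a" for i
    using neqs \<rho> that unfolding x0_def sum_doubled fst_sum snd_sum sum_component fst_add snd_add vector_add_component fst_scaleR snd_scaleR vector_scaleR_component real_scaleR_def sum_split3 rest
    by (auto simp: balanced_frame_def Ebasis_nth J_diff spread_def w_def)
  have m: "modsq x i = modsq x0 i" for i
    using modsq_rot[of "\<phi> (i = a)" x0 i] by (simp add: modsq_def xi)
  show ma: "modsq x a = \<rho>" using \<alpha>1 unfolding m unfolding modsq_def x0a by (simp add: power_divide field_simps)
  have "(w $ b)\<^sup>2 + (w $ c)\<^sup>2 \<le> (norm w)\<^sup>2"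
    unfolding power2_norm_eq_inner inner_vec_def sum_split3[of "\<lambda>i. inner (w $ i) (w $ i)"]
    by (simp add: power2_eq_square sum_nonneg)
  then have "(1 - \<rho>) * ((w $ b)\<^sup>2 + (w $ c)\<^sup>2) \<le> (1 - \<rho>) * 1" using \<rho> wn by (intro mult_left_mono) auto
  then show "modsq x b \<le> (1 - \<rho>) / 2"
    unfolding m unfolding modsq_def x0i[OF ab[symmetric]] using neqs \<rho> by (simp add: spread_def power_mult_distrib power_divide field_simps)
  have "(fst x $ a / sqrt \<rho>)\<^sup>2 + (- (snd x $ a) / sqrt \<rho>)\<^sup>2 = 1"
    using ma \<rho> by (simp add: modsq_def power_divide add_divide_distrib[symmetric])
  then obtain \<psi> where \<psi>: "0 \<le> \<psi>" "\<psi> < 2 * pi" "fst x $ a / sqrt \<rho> = cos \<psi>" "- (snd x $ a) / sqrt \<rho> = sin \<psi>"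
    by (rule sincos_total_2pi)
  have xa: "fst x $ a = sqrt \<rho> * cos \<psi>" "snd x $ a = - (sqrt \<rho> * sin \<psi>)" using \<psi>(3,4) \<rho> by (simp_all add: field_simps)
  obtain \<phi>' where \<phi>': "0 \<le> \<phi>'" "\<phi>' < 2 * pi" "cos (\<phi> False) = cos \<phi>'" "sin (\<phi> False) = sin \<phi>'"
    by (rule sincos_total_2pi[of "cos (\<phi> False)" "sin (\<phi> False)"]) auto
  have "x = balanced_point \<rho> 0 \<psi> \<phi>' w"
    unfolding balanced_point_def turn_0
  proof (intro prod_eqI vec_eq_iff[THEN iffD2] allI)
    fix i
    have "fst x $ i = fst (sqrt \<rho> *\<^sub>R rot \<psi> (Ebasis a) + sqrt (1 - \<rho>) *\<^sub>R rot \<phi>' (spread w)) $ i \<and>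
      snd x $ i = snd (sqrt \<rho> *\<^sub>R rot \<psi> (Ebasis a) + sqrt (1 - \<rho>) *\<^sub>R rot \<phi>' (spread w)) $ i"
    proof (cases "i = a")
      case True
      have "fst (spread w) $ a = 0" "snd (spread w) $ a = 0" using neqs by (auto simp: spread_def)
      then show ?thesis using True by (simp add: xa rot_nth Ebasis_nth)
    next
      case False
      then show ?thesis using xi[of i] x0i[of i] by (simp add: rot_nth Ebasis_nth \<phi>' algebra_simps)
    qed
    then show "fst x $ i = fst (sqrt \<rho> *\<^sub>R rot \<psi> (Ebasis a) + sqrt (1 - \<rho>) *\<^sub>R rot \<phi>' (spread w)) $ i"
      "snd x $ i = snd (sqrt \<rho> *\<^sub>R rot \<psi> (Ebasis a) + sqrt (1 - \<rho>) *\<^sub>R rot \<phi>' (spread w)) $ i" by auto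
  qed
  then show "x \<in> balanced_set {\<rho>}" unfolding balanced_set_def using \<psi> \<phi>' wa wn
    by (intro image_eqI[of _ _ "(\<rho>, 0, \<psi>, \<phi>', w)"]) auto
qed

lemma balanced_set_mono: "R \<subseteq> R' \<Longrightarrow> balanced_set R \<subseteq> balanced_set R'"
  unfolding balanced_set_def by (intro image_mono) auto

text \<open>The condition \<rho> > 1/3 acts twice: (1 - \<rho>) / 2 < \<rho> makes the quarter turn
  displace the reduced set, and it makes the bound pi \<rho> of the circle at least that of the
  second block.\<close>

lemma rel_hofer_diam_balanced:
  assumes \<rho>: "1 / 3 < \<rho>" "\<rho> < 1" and R: "\<rho> \<in> R"
  shows "ennreal (pi * (1 - \<rho>) / 2) \<le> rel_hofer_diam (balanced_set R) UNIV omega0"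
proof -
  have \<rho>0: "0 < \<rho>" using \<rho> by simp
  note red = balanced_reduced[OF \<rho>0 \<rho>(2)]
  show ?thesis
  proof (rule rel_hofer_diam_lower[OF balanced_symplectic_frame[OF \<rho>0 \<rho>(2)]])
    show "turn s x \<in> balanced_set R" if "x \<in> balanced_set R" for s x using that by (rule turn_balanced_set)
    show "symplectic_frame.reduced_set balanced_frame (doubled {a}) (\<lambda>p. fst p = a) (balanced_radius \<rho>) \<subseteq> balanced_set R"
      using red(1) balanced_set_mono[of "{\<rho>}" R] R by blast
    show "pi * (1 - \<rho>) / 2 \<le> pi / 2 * (balanced_radius \<rho> j)\<^sup>2" for j
      using \<rho> \<rho>0 by (cases j) (simp_all add: balanced_radius_def)
    show "turn (pi / 2) x \<notin> symplectic_frame.reduced_set balanced_frame (doubled {a}) (\<lambda>p. fst p = a) (balanced_radius \<rho>)"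
      if "x \<in> symplectic_frame.reduced_set balanced_frame (doubled {a}) (\<lambda>p. fst p = a) (balanced_radius \<rho>)" for x
      using red(3)[OF that] red(2)[of "turn (pi / 2) x"] \<rho>(1) by (auto simp: modsq_turn)
  qed
qed

lemma compact_balanced_set:
  assumes R: "compact R" shows "compact (balanced_set R)"
  unfolding balanced_set_def
proof (rule compact_continuous_image)
  have "closed {w :: real ^ 'n. norm w = 1 \<and> w $ a = 0}"
    by (intro closed_Collect_conj closed_Collect_eq continuous_intros)
  moreover have "bounded {w :: real ^ 'n. norm w = 1 \<and> w $ a = 0}" by (rule boundedI[of _ 1]) auto
  ultimately have "compact {w :: real ^ 'n. norm w = 1 \<and> w $ a = 0}" by (simp add: compact_eq_bounded_closed)
  then show "compact (R \<times> {0..2 * pi} \<times> {0..2 * pi} \<times> {0..2 * pi} \<times> {w :: real ^ 'n. norm w = 1 \<and> w $ a = 0})"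
    using R by (intro compact_Times compact_Icc)
  show "continuous_on (R \<times> {0..2 * pi} \<times> {0..2 * pi} \<times> {0..2 * pi} \<times> {w :: real ^ 'n. norm w = 1 \<and> w $ a = 0})
     (\<lambda>(\<rho>, s, \<psi>, \<phi>, w). balanced_point \<rho> s \<psi> \<phi> w)"
    unfolding balanced_point_def turn_def rot_def case_prod_beta'
    by (intro continuous_intros continuous_on_J bounded_linear.continuous_on[OF bl_pr] bounded_linear.continuous_on[OF bl_gen] bounded_linear.continuous_on[OF bl_spread])
qed

end

section \<open>Hausdorff dimension of Lipschitz images of cubes\<close>

text \<open>A small sum forces small diameters, hence no mesh size is needed for a vanishing Hausdorff measure.\<close>

definition dim_null :: "real \<Rightarrow> 'a::metric_space set \<Rightarrow> bool" where
  "dim_null s A \<longleftrightarrow> (\<forall>\<epsilon>>0. \<exists>C::nat \<Rightarrow> 'a set. A \<subseteq> (\<Union>i. C i) \<and> (\<forall>i. bounded (C i)) \<and>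
     (\<Sum>i. ennreal (diameter (C i) powr s)) \<le> ennreal \<epsilon>)"

lemma dim_null_hausdorff_measure:
  assumes s: "s > 0" and A: "dim_null s A" shows "hausdorff_measure s A = 0"
proof -
  have "hausdorff_content s \<delta> A = 0" if \<delta>: "\<delta> > 0" for \<delta>
  proof -
    have le: "hausdorff_content s \<delta> A \<le> ennreal e" if e: "e > 0" for e :: real
    proof -
      define \<epsilon> where "\<epsilon> = min e (\<delta> powr s)"
      have "\<epsilon> > 0" using e \<delta> by (simp add: \<epsilon>_def)
      then obtain C :: "nat \<Rightarrow> 'a set" where C: "A \<subseteq> (\<Union>i. C i)" "\<And>i. bounded (C i)" "(\<Sum>i. ennreal (diameter (C i) powr s)) \<le> ennreal \<epsilon>"
        using A unfolding dim_null_def by blast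
      have "diameter (C i) \<le> \<delta>" for i
      proof (rule ccontr)
        assume "\<not> ?thesis"
        then have "\<delta> powr s < diameter (C i) powr s" using \<delta> s by (intro powr_less_mono2) auto
        moreover
        have dle: "ennreal (diameter (C i) powr s) \<le> (\<Sum>i. ennreal (diameter (C i) powr s))"
        proof -
          have "(\<Sum>i\<in>{i}. ennreal (diameter (C i) powr s)) \<le> (\<Sum>i. ennreal (diameter (C i) powr s))"
            by (rule sum_le_suminf) (rule summableI, simp_all only: finite.intros zero_le)
          then show ?thesis by (simp only: sum.insert finite.emptyI empty_iff not_False_eq_True sum.empty add_0_right)
        qed
        have "ennreal (diameter (C i) powr s) \<le> ennreal (\<delta> powr s)"
        proof -
          have "ennreal \<epsilon> \<le> ennreal (\<delta> powr s)" by (simp add: \<epsilon>_def ennreal_leI)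
          then show ?thesis using order_trans[OF dle C(3)] order_trans by blast
        qed
        then have "diameter (C i) powr s \<le> \<delta> powr s" by (simp add: ennreal_le_iff)
        ultimately show False by simp
      qed
      then have "hausdorff_content s \<delta> A \<le> (\<Sum>i. ennreal (diameter (C i) powr s))"
        unfolding hausdorff_content_def using C by (intro Inf_lower) blast
      also have "\<dots> \<le> ennreal e" using C(3) by (rule order_trans) (simp add: \<epsilon>_def ennreal_leI)
      finally show ?thesis .
    qed
    have "hausdorff_content s \<delta> A \<le> 0"
      by (rule ennreal_le_epsilon) (simp only: add_0 le)
    then show ?thesis by simp
  qed
  then show ?thesis unfolding hausdorff_measure_def by (simp add: SUP_eq_const)
qed

lemma hausdorff_dim_le:
  assumes D: "D \<ge> 0" and A: "\<And>s. s > D \<Longrightarrow> dim_null s A" shows "hausdorff_dim A \<le> ennreal D"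
proof (rule ennreal_le_epsilon)
  fix e :: real assume "e > 0"
  then have "hausdorff_measure (D + e) A = 0" using D A[of "D + e"] by (intro dim_null_hausdorff_measure) auto
  then have "hausdorff_dim A \<le> ennreal (D + e)" unfolding hausdorff_dim_def using D \<open>e > 0\<close>
    by (intro Inf_lower CollectI exI[of _ "D + e"] conjI refl) auto
  then show "hausdorff_dim A \<le> ennreal D + ennreal e" using D \<open>e > 0\<close> by (simp add: ennreal_plus)
qed

lemma dim_null_subset: "dim_null s B \<Longrightarrow> A \<subseteq> B \<Longrightarrow> dim_null s A"
  unfolding dim_null_def by (meson order_trans)

text \<open>The n-th set receives the error \<open>\<epsilon> * (1 / 2) ^ Suc n\<close>. This
  countable stability allows infinitely many radii \<rho> in one set without raising its
  dimension.\<close>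

lemma dim_null_Union:
  assumes A: "\<And>n::nat. dim_null s (A n)" shows "dim_null s (\<Union>n. A n)"
  unfolding dim_null_def
proof (intro allI impI)
  fix \<epsilon> :: real assume \<epsilon>: "\<epsilon> > 0"
  have "\<forall>n. \<exists>C::nat \<Rightarrow> 'a set. A n \<subseteq> (\<Union>i. C i) \<and> (\<forall>i. bounded (C i)) \<and>
     (\<Sum>i. ennreal (diameter (C i) powr s)) \<le> ennreal (\<epsilon> * (1 / 2) ^ Suc n)"
    using A \<epsilon> unfolding dim_null_def by simp
  from choice[OF this] obtain C :: "nat \<Rightarrow> nat \<Rightarrow> 'a set" where C: "\<And>n. A n \<subseteq> (\<Union>i. C n i)" "\<And>n i. bounded (C n i)"
     "\<And>n. (\<Sum>i. ennreal (diameter (C n i) powr s)) \<le> ennreal (\<epsilon> * (1 / 2) ^ Suc n)" by blast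
  define D where "D k = C (fst (prod_decode k)) (snd (prod_decode k))" for k
  have "(\<Union>n. A n) \<subseteq> (\<Union>k. D k)"
  proof
    fix x assume "x \<in> (\<Union>n. A n)"
    then obtain n i where "x \<in> C n i" using C(1) by blast
    then have "x \<in> D (prod_encode (n, i))" by (simp add: D_def)
    then show "x \<in> (\<Union>k. D k)" by blast
  qed
  moreover have "(\<Sum>k. ennreal (diameter (D k) powr s)) \<le> ennreal \<epsilon>"
  proof -
    have "(\<Sum>k. ennreal (diameter (D k) powr s)) = (\<Sum>n. \<Sum>i. ennreal (diameter (C n i) powr s))"
      using suminf_ennreal_2dimen[where f = "\<lambda>p. ennreal (diameter (C (fst p) (snd p)) powr s)" and g = "\<lambda>n. \<Sum>i. ennreal (diameter (C n i) powr s)"]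
      unfolding D_def fst_conv snd_conv by blast
    also have "\<dots> \<le> (\<Sum>n. ennreal (\<epsilon> * (1 / 2) ^ Suc n))" by (intro suminf_le C) auto
    also have "\<dots> = ennreal (\<Sum>n. \<epsilon> * (1 / 2) ^ Suc n)"
      using \<epsilon> by (intro suminf_ennreal2 summable_mult) (auto intro!: sums_summable[OF power_half_series])
    also have "(\<Sum>n. \<epsilon> * (1 / 2) ^ Suc n) = \<epsilon>"
      using sums_mult[OF power_half_series, of \<epsilon>] by (simp add: sums_iff)
    finally show ?thesis .
  qed
  ultimately show "\<exists>C::nat \<Rightarrow> 'a set. (\<Union>n. A n) \<subseteq> (\<Union>i. C i) \<and> (\<forall>i. bounded (C i)) \<and>
     (\<Sum>i. ennreal (diameter (C i) powr s)) \<le> ennreal \<epsilon>"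
    using C(2) by (intro exI[of _ D]) (auto simp: D_def)
qed

lemma dim_null_finite_Union:
  assumes "finite I" "\<And>i. i \<in> I \<Longrightarrow> dim_null s (A i)" "I \<noteq> {}" shows "dim_null s (\<Union>i\<in>I. A i)"
proof -
  have "(\<Union>i\<in>I. A i) = (\<Union>n. A (from_nat_into I n))"
    unfolding image_image[symmetric, of _ "from_nat_into I"] by (simp add: range_from_nat_into[OF assms(3) countable_finite[OF assms(1)]])
  then show ?thesis using dim_null_Union[of s "\<lambda>n. A (from_nat_into I n)", OF assms(2)[OF from_nat_into[OF assms(3)]]] by simp
qed

text \<open>A cube in the coordinate subspace spanned by \<open>S\<close>: a domain of dimension
  \<open>card S\<close> inside a type of possibly larger dimension.\<close>

definition cube :: "'a::euclidean_space set \<Rightarrow> real \<Rightarrow> 'a set" where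
  "cube S R = {u. \<forall>i\<in>Basis. if i \<in> S then \<bar>u \<bullet> i\<bar> \<le> R else u \<bullet> i = 0}"

text \<open>Cut the cube into \<open>k ^ d\<close> cells whose images have diameter at most
  \<open>c / k\<close>; the sum is of order \<open>k powr (d - s)\<close> and tends to 0.\<close>

lemma dim_null_lipschitz_cube:
  fixes f :: "'a::euclidean_space \<Rightarrow> 'b::metric_space"
  assumes S: "S \<subseteq> Basis" and R: "R > 0" and K: "K \<ge> 0" and lip: "\<And>u v. u \<in> cube S R \<Longrightarrow> v \<in> cube S R \<Longrightarrow> dist (f u) (f v) \<le> K * norm (u - v)"
    and s: "s > real (card S)"
  shows "dim_null s (f ` cube S R)"
  unfolding dim_null_def
proof (intro allI impI)
  fix \<epsilon> :: real assume \<epsilon>: "\<epsilon> > 0"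
  define d where "d = card S"
  have fS: "finite S" using S finite_Basis finite_subset by blast
  define c where "c = K * (real d * (2 * R))"
  have c0: "c \<ge> 0" using K R by (simp add: c_def)
  have "((\<lambda>k. c powr s * real k powr (real d - s)) \<longlongrightarrow> c powr s * 0) sequentially"
    by (intro tendsto_intros tendsto_neg_powr filterlim_real_sequentially) (use s in \<open>simp add: d_def\<close>)
  then have "\<forall>\<^sub>F k in sequentially. c powr s * real k powr (real d - s) < \<epsilon>" using \<epsilon> by (intro order_tendstoD(2)) auto
  then obtain k0 where k0: "\<And>k. k \<ge> k0 \<Longrightarrow> c powr s * real k powr (real d - s) < \<epsilon>" unfolding eventually_sequentially by blast
  define k where "k = Suc k0"
  have k: "k > 0" "c powr s * real k powr (real d - s) < \<epsilon>" using k0[of k] by (auto simp: k_def)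
  define G where "G = PiE S (\<lambda>_. {..<k})"
  have fG: "finite G" "card G = k ^ d" unfolding G_def d_def using fS by (auto simp: card_PiE finite_PiE)
  define cell where "cell g = {u \<in> cube S R. \<forall>i\<in>S. - R + 2 * R * real (g i) / real k \<le> u \<bullet> i \<and> u \<bullet> i \<le> - R + 2 * R * (real (g i) + 1) / real k}" for g
  have cover: "cube S R \<subseteq> (\<Union>g\<in>G. cell g)"
  proof
    fix u assume u: "u \<in> cube S R"
    define t where "t i = (u \<bullet> i + R) * real k / (2 * R)" for i
    \<comment> \<open>The minimum with \<open>k - 1\<close> assigns the far face to the last
      cell.\<close>
    define g where "g = restrict (\<lambda>i. min (k - 1) (nat \<lfloor>t i\<rfloor>)) S"
    have "g \<in> G" using k(1) by (auto simp: G_def g_def)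
    moreover have "- R + 2 * R * real (g i) / real k \<le> u \<bullet> i \<and> u \<bullet> i \<le> - R + 2 * R * (real (g i) + 1) / real k" if i: "i \<in> S" for i
    proof -
      have ui: "\<bar>u \<bullet> i\<bar> \<le> R" using u i S by (auto simp: cube_def)
      have t0: "0 \<le> t i" using ui R by (simp add: t_def abs_le_iff)
      have tk: "t i \<le> real k"
      proof -
        have "(u \<bullet> i + R) * real k \<le> (2 * R) * real k" using ui by (intro mult_right_mono) auto
        then show ?thesis using R by (simp add: t_def divide_le_eq mult.commute)
      qed
      have gi: "real (g i) \<le> t i \<and> t i \<le> real (g i) + 1"
      proof (cases "nat \<lfloor>t i\<rfloor> \<le> k - 1")
        case True
        then have "real (g i) = of_int \<lfloor>t i\<rfloor>" using i t0 by (simp add: g_def)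
        then show ?thesis by linarith
      next
        case False
        then have "g i = k - 1" using i by (simp add: g_def)
        moreover have "real k - 1 \<le> t i" using False t0 k(1) by linarith
        ultimately show ?thesis using tk k(1) by (simp add: of_nat_diff)
      qed
      have ut: "u \<bullet> i = - R + 2 * R * t i / real k" using R k(1) by (simp add: t_def field_simps)
      show ?thesis unfolding ut using gi R k(1) by (auto intro!: divide_right_mono mult_left_mono)
    qed
    ultimately show "u \<in> (\<Union>g\<in>G. cell g)" using u by (auto simp: cell_def)
  qed
  have celldiam: "dist (f u) (f v) \<le> c / real k" if "u \<in> cell g" "v \<in> cell g" for u v g
  proof -
    have uv: "u \<in> cube S R" "v \<in> cube S R" using that by (auto simp: cell_def)
    have "norm (u - v) \<le> (\<Sum>i\<in>Basis. \<bar>(u - v) \<bullet> i\<bar>)" by (rule norm_le_l1)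
    also have "\<dots> = (\<Sum>i\<in>S. \<bar>(u - v) \<bullet> i\<bar>)"
      using uv S by (intro sum.mono_neutral_right) (auto simp: cube_def inner_diff_left)
    also have "\<dots> \<le> (\<Sum>i\<in>S. 2 * R / real k)"
    proof (rule sum_mono)
      fix i assume i: "i \<in> S"
      have "2 * R * (real (g i) + 1) / real k = 2 * R * real (g i) / real k + 2 * R / real k"
        by (simp add: distrib_left add_divide_distrib)
      then show "\<bar>(u - v) \<bullet> i\<bar> \<le> 2 * R / real k" using that i unfolding cell_def inner_diff_left mem_Collect_eq
        by (intro abs_leI) (smt (verit, best))+
    qed
    also have "\<dots> = real d * (2 * R) / real k" by (simp add: d_def)
    finally have "K * norm (u - v) \<le> K * (real d * (2 * R) / real k)" using K by (rule mult_left_mono)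
    then show ?thesis using lip[OF uv] by (simp add: c_def)
  qed
  obtain h where h: "bij_betw h {..<k ^ d} G" using ex_bij_betw_nat_finite[OF fG(1)] fG(2) by (auto simp: atLeast0LessThan)
  define C where "C n = (if n < k ^ d then f ` cell (h n) else {})" for n
  have "f ` cube S R \<subseteq> (\<Union>n. C n)"
  proof
    fix y assume "y \<in> f ` cube S R"
    then obtain g where g: "g \<in> G" "y \<in> f ` cell g" using cover by blast
    then obtain n where "n < k ^ d" "h n = g" using h by (metis bij_betw_imp_surj_on imageE lessThan_iff)
    then show "y \<in> (\<Union>n. C n)" using g by (auto simp: C_def)
  qed
  moreover have bC: "bounded (C n)" for n
    unfolding C_def bounded_two_points using celldiam by auto
  moreover have "(\<Sum>n. ennreal (diameter (C n) powr s)) \<le> ennreal \<epsilon>"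
  proof -
    have dC: "diameter (C n) powr s \<le> (c / real k) powr s" if "n < k ^ d" for n
    proof -
      have "diameter (C n) \<le> c / real k"
      proof (cases "C n = {}")
        case True then show ?thesis using c0 by simp
      next
        case False
        then show ?thesis unfolding diameter_def using celldiam that by (auto simp: C_def intro!: cSUP_least)
      qed
      then show ?thesis using s by (intro powr_mono2) (auto simp: diameter_ge_0[OF bC])
    qed
    have "(\<Sum>n. ennreal (diameter (C n) powr s)) = (\<Sum>n<k ^ d. ennreal (diameter (C n) powr s))"
      by (intro suminf_finite) (auto simp: C_def)
    also have "\<dots> \<le> (\<Sum>n<k ^ d. ennreal ((c / real k) powr s))" by (intro sum_mono ennreal_leI dC) auto
    also have "\<dots> = ennreal (real (k ^ d) * (c / real k) powr s)"
      by (simp add: ennreal_mult ennreal_of_nat_eq_real_of_nat)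
    also have "real (k ^ d) * (c / real k) powr s = c powr s * real k powr (real d - s)"
      using k(1) c0 by (simp add: powr_divide powr_diff powr_realpow)
    finally show ?thesis using k(2) by (simp add: ennreal_leI order_trans less_imp_le)
  qed
  ultimately show "\<exists>C::nat \<Rightarrow> 'b set. f ` cube S R \<subseteq> (\<Union>i. C i) \<and> (\<forall>i. bounded (C i)) \<and>
     (\<Sum>i. ennreal (diameter (C i) powr s)) \<le> ennreal \<epsilon>" by blast
qed

section \<open>Calculus of bounded Lipschitz maps\<close>

definition bdd_lip :: "'a::real_normed_vector set \<Rightarrow> ('a \<Rightarrow> 'b::real_normed_vector) \<Rightarrow> bool" where
  "bdd_lip T f \<longleftrightarrow> (\<exists>K\<ge>0. (\<forall>x\<in>T. norm (f x) \<le> K) \<and> (\<forall>x\<in>T. \<forall>y\<in>T. norm (f x - f y) \<le> K * norm (x - y)))"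

lemma bdd_lipI:
  assumes "\<And>x. x \<in> T \<Longrightarrow> norm (f x) \<le> K1" "\<And>x y. x \<in> T \<Longrightarrow> y \<in> T \<Longrightarrow> norm (f x - f y) \<le> K2 * norm (x - y)"
  shows "bdd_lip T f"
proof -
  let ?K = "max 0 (max K1 K2)"
  have "norm (f x - f y) \<le> ?K * norm (x - y)" if "x \<in> T" "y \<in> T" for x y
    by (rule order_trans[OF assms(2)[OF that]]) (intro mult_right_mono, auto)
  moreover have "norm (f x) \<le> ?K" if "x \<in> T" for x using assms(1)[OF that] by linarith
  ultimately show ?thesis unfolding bdd_lip_def by (intro exI[of _ ?K]) auto
qed

lemma bdd_lip_const: "bdd_lip T (\<lambda>x. c)"
  by (rule bdd_lipI[of _ _ "norm c" 0]) auto

lemma bdd_lip_add: assumes "bdd_lip T f" "bdd_lip T g" shows "bdd_lip T (\<lambda>x. f x + g x)"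
proof -
  obtain K L where K: "\<And>x. x \<in> T \<Longrightarrow> norm (f x) \<le> K" "\<And>x y. x \<in> T \<Longrightarrow> y \<in> T \<Longrightarrow> norm (f x - f y) \<le> K * norm (x - y)"
    and L: "\<And>x. x \<in> T \<Longrightarrow> norm (g x) \<le> L" "\<And>x y. x \<in> T \<Longrightarrow> y \<in> T \<Longrightarrow> norm (g x - g y) \<le> L * norm (x - y)"
    using assms unfolding bdd_lip_def by blast
  show ?thesis
  proof (rule bdd_lipI[of _ _ "K + L" "K + L"])
    show "norm (f x + g x) \<le> K + L" if "x \<in> T" for x using norm_triangle_mono[OF K(1) L(1)] that by blast
    fix x y assume xy: "x \<in> T" "y \<in> T"
    have "f x + g x - (f y + g y) = (f x - f y) + (g x - g y)" by simp
    also have "norm \<dots> \<le> K * norm (x - y) + L * norm (x - y)" by (rule norm_triangle_mono[OF K(2)[OF xy] L(2)[OF xy]])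
    finally show "norm (f x + g x - (f y + g y)) \<le> (K + L) * norm (x - y)" by (simp add: distrib_right)
  qed
qed

text \<open>Products are the reason why \<open>bdd_lip\<close> includes a bound on the
  values.\<close>

lemma bdd_lip_scaleR: assumes "bdd_lip T f" "bdd_lip T g" shows "bdd_lip T (\<lambda>x. f x *\<^sub>R g x)"
proof -
  obtain K L where K: "K \<ge> 0" "\<And>x. x \<in> T \<Longrightarrow> norm (f x) \<le> K" "\<And>x y. x \<in> T \<Longrightarrow> y \<in> T \<Longrightarrow> norm (f x - f y) \<le> K * norm (x - y)"
    and L: "L \<ge> 0" "\<And>x. x \<in> T \<Longrightarrow> norm (g x) \<le> L" "\<And>x y. x \<in> T \<Longrightarrow> y \<in> T \<Longrightarrow> norm (g x - g y) \<le> L * norm (x - y)"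
    using assms unfolding bdd_lip_def by blast
  show ?thesis
  proof (rule bdd_lipI[of _ _ "K * L" "K * L + K * L"])
    show "norm (f x *\<^sub>R g x) \<le> K * L" if "x \<in> T" for x
      using K(2)[OF that] L(2)[OF that] K(1) by (simp add: mult_mono)
    fix x y assume xy: "x \<in> T" "y \<in> T"
    have "f x *\<^sub>R g x - f y *\<^sub>R g y = (f x - f y) *\<^sub>R g x + f y *\<^sub>R (g x - g y)" by (simp add: algebra_simps)
    also have "norm \<dots> \<le> (K * norm (x - y)) * L + K * (L * norm (x - y))"
    proof (rule norm_triangle_mono)
      show "norm ((f x - f y) *\<^sub>R g x) \<le> (K * norm (x - y)) * L"
        using K(3)[OF xy] L(2)[OF xy(1)] K(1) by (simp add: mult_mono)
      show "norm (f y *\<^sub>R (g x - g y)) \<le> K * (L * norm (x - y))"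
        using L(3)[OF xy] K(2)[OF xy(2)] K(1) by (simp add: mult_mono)
    qed
    finally show "norm (f x *\<^sub>R g x - f y *\<^sub>R g y) \<le> (K * L + K * L) * norm (x - y)" by (simp add: algebra_simps)
  qed
qed

lemma bdd_lip_linear: assumes "bounded_linear h" "bdd_lip T f" shows "bdd_lip T (\<lambda>x. h (f x))"
proof -
  obtain K where K: "\<And>x. x \<in> T \<Longrightarrow> norm (f x) \<le> K" "\<And>x y. x \<in> T \<Longrightarrow> y \<in> T \<Longrightarrow> norm (f x - f y) \<le> K * norm (x - y)"
    using assms unfolding bdd_lip_def by blast
  obtain L where L: "L > 0" "\<And>v. norm (h v) \<le> norm v * L" using bounded_linear.pos_bounded[OF assms(1)] by blast
  show ?thesis
  proof (rule bdd_lipI[of _ _ "K * L" "K * L"])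
    show "norm (h (f x)) \<le> K * L" if "x \<in> T" for x
      by (rule order_trans[OF L(2)]) (use K(1)[OF that] L(1) in simp)
    fix x y assume xy: "x \<in> T" "y \<in> T"
    have "norm (h (f x) - h (f y)) \<le> norm (f x - f y) * L"
      using L(2)[of "f x - f y"] by (simp add: linear_diff[OF bounded_linear.linear[OF assms(1)]])
    also have "\<dots> \<le> K * norm (x - y) * L" using K(2)[OF xy] L(1) by simp
    finally show "norm (h (f x) - h (f y)) \<le> K * L * norm (x - y)" by (simp add: mult_ac)
  qed
qed

lemma bdd_lip_ident: "bounded T \<Longrightarrow> bdd_lip T (\<lambda>x. x)"
  unfolding bounded_iff by (auto intro: bdd_lipI[of _ _ _ 1])

lemma bdd_lip_norm: assumes "bdd_lip T f" shows "bdd_lip T (\<lambda>x. norm (f x))"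
proof -
  obtain K where K: "\<And>x. x \<in> T \<Longrightarrow> norm (f x) \<le> K" "\<And>x y. x \<in> T \<Longrightarrow> y \<in> T \<Longrightarrow> norm (f x - f y) \<le> K * norm (x - y)"
    using assms unfolding bdd_lip_def by blast
  show ?thesis
    by (rule bdd_lipI[of _ _ K K]) (use K norm_triangle_ineq3 order_trans in \<open>auto, blast\<close>)
qed

lemma bdd_lip_real_compose:
  fixes f :: "'a::real_normed_vector \<Rightarrow> real"
  assumes f: "bdd_lip T f" and h: "\<And>u v. u \<in> f ` T \<Longrightarrow> v \<in> f ` T \<Longrightarrow> \<bar>h u - h v\<bar> \<le> \<bar>u - v\<bar>"
    "\<And>u. u \<in> f ` T \<Longrightarrow> \<bar>h u\<bar> \<le> 1"
  shows "bdd_lip T (\<lambda>x. h (f x) :: real)"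
proof -
  obtain K where K: "\<And>x y. x \<in> T \<Longrightarrow> y \<in> T \<Longrightarrow> norm (f x - f y) \<le> K * norm (x - y)"
    using f unfolding bdd_lip_def by blast
  show ?thesis
  proof (rule bdd_lipI[of _ _ 1 K])
    show "norm (h (f x)) \<le> 1" if "x \<in> T" for x using h(2) that by simp
    show "norm (h (f x) - h (f y)) \<le> K * norm (x - y)" if "x \<in> T" "y \<in> T" for x y
      using h(1)[of "f x" "f y"] K[OF that] that by simp
  qed
qed

lemma abs_cos_diff_le: "\<bar>cos u - cos v\<bar> \<le> \<bar>u - v\<bar>" and abs_sin_diff_le: "\<bar>sin u - sin v\<bar> \<le> \<bar>u - v\<bar>" for u v :: real
proof -
  have "norm (cos u - cos v) \<le> 1 * norm (u - v)"
    by (rule field_differentiable_bound[of UNIV cos "\<lambda>x. - sin x"])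
      (auto intro!: derivative_eq_intros)
  then show "\<bar>cos u - cos v\<bar> \<le> \<bar>u - v\<bar>" by simp
  have "norm (sin u - sin v) \<le> 1 * norm (u - v)"
    by (rule field_differentiable_bound[of UNIV sin cos])
      (auto intro!: derivative_eq_intros)
  then show "\<bar>sin u - sin v\<bar> \<le> \<bar>u - v\<bar>" by simp
qed

lemma bdd_lip_cos: "bdd_lip T f \<Longrightarrow> bdd_lip T (\<lambda>x. cos (f x :: real))"
  and bdd_lip_sin: "bdd_lip T f \<Longrightarrow> bdd_lip T (\<lambda>x. sin (f x :: real))"
  by (erule bdd_lip_real_compose; simp add: abs_cos_diff_le abs_sin_diff_le)+

lemma bdd_lip_inverse:
  assumes "bdd_lip T f" "\<And>x. x \<in> T \<Longrightarrow> f x \<ge> (1::real)" shows "bdd_lip T (\<lambda>x. 1 / f x)"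
proof (rule bdd_lip_real_compose[OF assms(1)])
  fix u v assume "u \<in> f ` T" "v \<in> f ` T"
  then have u: "u \<ge> 1" and v: "v \<ge> 1" using assms(2) by auto
  have "1 / u - 1 / v = (v - u) / (u * v)" using u v by (simp add: field_simps)
  also have "\<bar>\<dots>\<bar> = \<bar>v - u\<bar> / (u * v)" using u v by simp
  also have "\<dots> \<le> \<bar>v - u\<bar> / 1" using u v mult_mono[of 1 u 1 v] by (intro divide_left_mono) auto
  finally show "\<bar>1 / u - 1 / v\<bar> \<le> \<bar>u - v\<bar>" by (simp add: abs_minus_commute)
  show "\<bar>1 / u\<bar> \<le> 1" using u by simp
qed

lemma cube_bounded: "bounded (cube S R)"
proof (rule boundedI)
  fix u :: 'a assume u: "u \<in> cube S R"
  have "norm u \<le> (\<Sum>i\<in>Basis. \<bar>u \<bullet> i\<bar>)" by (rule norm_le_l1)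
  also have "\<dots> \<le> (\<Sum>i\<in>(Basis :: 'a set). \<bar>R\<bar>)" 
  proof (rule sum_mono)
    fix i :: 'a assume "i \<in> Basis"
    then have "if i \<in> S then \<bar>u \<bullet> i\<bar> \<le> R else u \<bullet> i = 0" using u unfolding cube_def by blast
    then show "\<bar>u \<bullet> i\<bar> \<le> \<bar>R\<bar>" by (cases "i \<in> S") auto
  qed
  finally show "norm u \<le> (\<Sum>i\<in>(Basis :: 'a set). \<bar>R\<bar>)" .
qed

lemma dim_null_bdd_lip_cube:
  assumes "S \<subseteq> Basis" "R > 0" "bdd_lip (cube S R) f" "s > real (card S)"
  shows "dim_null s (f ` cube S R)"
proof -
  obtain K where "K \<ge> 0" "\<And>x y. x \<in> cube S R \<Longrightarrow> y \<in> cube S R \<Longrightarrow> norm (f x - f y) \<le> K * norm (x - y)"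
    using assms(3) unfolding bdd_lip_def by blast
  then show ?thesis using assms by (intro dim_null_lipschitz_cube[where K = K]) (auto simp: dist_norm)
qed

section \<open>Compact sets of low dimension\<close>

lemma bdd_lip_diff: "bdd_lip T f \<Longrightarrow> bdd_lip T g \<Longrightarrow> bdd_lip T (\<lambda>x. f x - g x)"
  using bdd_lip_add[of T f "\<lambda>x. - g x"] bdd_lip_linear[OF bounded_linear_minus[OF bounded_linear_ident], of T g] by simp

text \<open>Radial projection to the face of the cube on which the largest coordinate of
  \<open>x\<close> becomes \<sigma>. The factor \<open>k\<close> and
  \<open>x \<bullet> e \<noteq> 0\<close> are recorded to show that zero coordinates of
  \<open>x\<close> stay zero and never determine the face.\<close>

lemma sphere_chart:
  fixes x :: "'a::euclidean_space"
  assumes x: "norm x = 1"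
  obtains e \<sigma> u k where "e \<in> Basis" "\<sigma> \<in> {- 1, 1::real}" "u \<in> cube (Basis - {e}) 1"
    "\<sigma> *\<^sub>R e + u = k *\<^sub>R x" "x = (1 / norm (\<sigma> *\<^sub>R e + u)) *\<^sub>R (\<sigma> *\<^sub>R e + u)" "x \<bullet> e \<noteq> 0"
proof -
  have "finite ((\<lambda>i. \<bar>x \<bullet> i\<bar>) ` (Basis :: 'a set))" "(\<lambda>i. \<bar>x \<bullet> i\<bar>) ` (Basis :: 'a set) \<noteq> {}" by auto
  from Max_in[OF this] obtain e where e: "Max ((\<lambda>i. \<bar>x \<bullet> i\<bar>) ` Basis) = \<bar>x \<bullet> e\<bar>" "e \<in> Basis" by (rule imageE)
  have mx: "\<bar>x \<bullet> i\<bar> \<le> \<bar>x \<bullet> e\<bar>" if "i \<in> Basis" for i unfolding e(1)[symmetric] using that by (intro Max_ge) auto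
  have pos: "\<bar>x \<bullet> e\<bar> > 0"
  proof (rule ccontr)
    assume "\<not> ?thesis"
    then have z: "x \<bullet> i = 0" if "i \<in> Basis" for i using mx[OF that] by simp
    have "x = 0" by (rule euclidean_eqI) (simp add: z)
    then show False using x by simp
  qed
  define k where "k = 1 / \<bar>x \<bullet> e\<bar>"
  define \<sigma> where "\<sigma> = sgn (x \<bullet> e)"
  define u where "u = k *\<^sub>R x - \<sigma> *\<^sub>R e"
  have k: "k > 0" using pos by (simp add: k_def)
  have eq: "\<sigma> *\<^sub>R e + u = k *\<^sub>R x" by (simp add: u_def)
  show thesis
  proof (rule that[OF e(2) _ _ eq])
    show "\<sigma> \<in> {- 1, 1}" using pos by (auto simp: \<sigma>_def sgn_if)
    show "u \<in> cube (Basis - {e}) 1"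
      unfolding cube_def
    proof (intro CollectI ballI)
      fix i :: 'a assume i: "i \<in> Basis"
      show "if i \<in> Basis - {e} then \<bar>u \<bullet> i\<bar> \<le> 1 else u \<bullet> i = 0"
      proof (cases "i = e")
        case True
        have "k * (x \<bullet> e) = sgn (x \<bullet> e)" using pos by (simp add: k_def sgn_if abs_if)
        then show ?thesis using True e(2) by (simp add: u_def \<sigma>_def inner_diff_left)
      next
        case False
        have "\<bar>u \<bullet> i\<bar> = k * \<bar>x \<bullet> i\<bar>" using i e(2) False k by (simp add: u_def inner_diff_left inner_not_same_Basis abs_mult)
        also have "\<dots> \<le> k * \<bar>x \<bullet> e\<bar>" using mx[OF i] k by simp
        also have "\<dots> = 1" using pos by (simp add: k_def)
        finally show ?thesis using i False by simp
      qed
    qed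
    show "x = (1 / norm (\<sigma> *\<^sub>R e + u)) *\<^sub>R (\<sigma> *\<^sub>R e + u)" unfolding eq using k x by simp
    show "x \<bullet> e \<noteq> 0" using pos by simp
  qed
qed

lemma norm_chart_ge:
  assumes "e \<in> Basis" "\<sigma> \<in> {- 1, 1::real}" "u \<bullet> e = 0"
  shows "1 \<le> norm (\<sigma> *\<^sub>R e + u)"
  using Basis_le_norm[OF assms(1), of "\<sigma> *\<^sub>R e + u"] assms by (auto simp: inner_add_left)

lemma bdd_lip_normalize:
  assumes f: "bdd_lip T f" and "\<And>x. x \<in> T \<Longrightarrow> 1 \<le> norm (f x)"
  shows "bdd_lip T (\<lambda>x. (1 / norm (f x)) *\<^sub>R f x)"
  by (intro bdd_lip_scaleR bdd_lip_inverse bdd_lip_norm f assms(2))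

lemma hausdorff_dim_sphere: "hausdorff_dim (sphere 0 1 :: 'a::euclidean_space set) \<le> ennreal (real DIM('a) - 1)"
proof (rule hausdorff_dim_le)
  show "0 \<le> real DIM('a) - 1" using DIM_positive[where 'a='a] by linarith
  fix s assume s: "real DIM('a) - 1 < s"
  define F where "F e \<sigma> u = (1 / norm (\<sigma> *\<^sub>R e + u)) *\<^sub>R (\<sigma> *\<^sub>R e + u)" for e u :: 'a and \<sigma> :: real
  have "dim_null s (\<Union>p\<in>Basis \<times> {- 1, 1}. F (fst p) (snd p) ` cube (Basis - {fst p}) 1)"
  proof (rule dim_null_finite_Union)
    show "finite ((Basis :: 'a set) \<times> {- 1, 1 :: real})" "(Basis :: 'a set) \<times> {- 1, 1 :: real} \<noteq> {}" by auto
    fix p assume p: "p \<in> (Basis :: 'a set) \<times> {- 1, 1 :: real}"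
    then have e: "fst p \<in> Basis" "snd p \<in> {- 1, 1}" by auto
    show "dim_null s (F (fst p) (snd p) ` cube (Basis - {fst p}) 1)"
    proof (rule dim_null_bdd_lip_cube)
      show "real (card (Basis - {fst p})) < s" using s e(1) by (simp add: card_Diff_singleton DIM_positive of_nat_diff Suc_leI)
      show "bdd_lip (cube (Basis - {fst p}) 1) (F (fst p) (snd p))"
        unfolding F_def
      proof (intro bdd_lip_normalize bdd_lip_add bdd_lip_const bdd_lip_ident cube_bounded norm_chart_ge e)
        fix u :: 'a assume "u \<in> cube (Basis - {fst p}) 1"
        then have "if fst p \<in> Basis - {fst p} then \<bar>u \<bullet> fst p\<bar> \<le> 1 else u \<bullet> fst p = 0" unfolding cube_def using e(1) by blast
        then show "u \<bullet> fst p = 0" by simp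
      qed
    qed auto
  qed
  moreover have "sphere 0 1 \<subseteq> (\<Union>p\<in>Basis \<times> {- 1, 1}. F (fst p) (snd p) ` cube (Basis - {fst p}) 1)"
  proof
    fix x :: 'a assume "x \<in> sphere 0 1"
    then have "norm x = 1" by simp
    then obtain e \<sigma> u where "e \<in> Basis" "\<sigma> \<in> {- 1, 1::real}" "u \<in> cube (Basis - {e}) 1" "x = F e \<sigma> u"
      unfolding F_def by (rule sphere_chart)
    then show "x \<in> (\<Union>p\<in>Basis \<times> {- 1, 1}. F (fst p) (snd p) ` cube (Basis - {fst p}) 1)"
      by (intro UN_I[of "(e, \<sigma>)"]) auto
  qed
  ultimately show "dim_null s (sphere 0 1 :: 'a set)" by (rule dim_null_subset)
qed

context plane_rotation_3 begin

lemma bdd_lip_balanced_point: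
  assumes "bdd_lip T s" "bdd_lip T \<psi>" "bdd_lip T \<phi>" "bdd_lip T w"
  shows "bdd_lip T (\<lambda>x. balanced_point \<rho> (s x) (\<psi> x) (\<phi> x) (w x))"
proof -
  have rot: "bdd_lip T (\<lambda>x. rot (f x) (g x))" if "bdd_lip T f" "bdd_lip T g" for f and g :: "_ \<Rightarrow> (real ^ 'n) \<times> (real ^ 'n)"
    unfolding rot_def by (intro bdd_lip_add bdd_lip_scaleR bdd_lip_cos bdd_lip_sin bdd_lip_linear[OF J_bounded_linear] that)
  show ?thesis
    unfolding balanced_point_def turn_def
    by (intro bdd_lip_add bdd_lip_diff bdd_lip_scaleR bdd_lip_cos bdd_lip_sin bdd_lip_linear[OF bl_pr] bdd_lip_linear[OF bl_gen]
        rot bdd_lip_const bdd_lip_linear[OF bl_spread] assms)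
qed

text \<open>A point of \<^term>\<open>balanced_set\<close> is described by \<open>s\<close>, \<open>\<psi>\<close>, \<open>\<phi>\<close> and a unit vector \<open>w\<close> with
  \<open>w\<^sub>a = 0\<close>. On a face \<open>w\<^sub>i = \<plusminus>\<bar>w\<bar>\<^sub>\<infinity>\<close> the unused coordinates \<open>a\<close> and \<open>i\<close> of the cube are recycled for \<open>s\<close> and \<open>\<psi>\<close>.\<close>

definition balanced_chart :: "real \<Rightarrow> 'n \<Rightarrow> real \<Rightarrow> (real ^ 'n) \<times> real \<Rightarrow> (real ^ 'n) \<times> (real ^ 'n)" where
  "balanced_chart \<rho> i \<sigma> p =
     (let y = \<sigma> *\<^sub>R axis i 1 + (\<chi> k. if k \<in> {a, i} then 0 else fst p $ k)
      in balanced_point \<rho> (fst p $ a) (fst p $ i) (snd p) ((1 / norm y) *\<^sub>R y))"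

text \<open>The domain is a full cube of dimension n + 1. Its size \<open>2 * pi\<close> is dictated
  by the angles; the coordinates on the face are at most 1.\<close>

lemma dim_null_balanced_chart:
  assumes \<sigma>: "\<sigma> \<in> {- 1, 1::real}" and s: "s > real CARD('n) + 1"
  shows "dim_null s (balanced_chart \<rho> i \<sigma> ` cube Basis (2 * pi))"
proof (rule dim_null_bdd_lip_cube)
  show "real (card (Basis :: ((real ^ 'n) \<times> real) set)) < s" using s by simp
  let ?T = "cube (Basis :: ((real ^ 'n) \<times> real) set) (2 * pi)"
  have id: "bdd_lip ?T (\<lambda>p. p)" by (intro bdd_lip_ident cube_bounded)
  have fst: "bdd_lip ?T (\<lambda>p. fst p)" by (rule bdd_lip_linear[OF bounded_linear_fst id])
  have bl: "bounded_linear (\<lambda>v :: real ^ 'n. \<chi> k. if k \<in> {a, i} then 0 else v $ k)"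
    by (intro linear_conv_bounded_linear[THEN iffD1]) (auto simp: linear_iff vec_eq_iff)
  have "1 \<le> norm (\<sigma> *\<^sub>R axis i 1 + (\<chi> k. if k \<in> {a, i} then 0 else v $ k))" for v :: "real ^ 'n"
    using \<sigma> by (intro norm_chart_ge) (auto simp: inner_axis axis_in_Basis_iff)
  then show "bdd_lip ?T (balanced_chart \<rho> i \<sigma>)"
    unfolding balanced_chart_def[abs_def] Let_def
    by (intro bdd_lip_balanced_point bdd_lip_normalize bdd_lip_add bdd_lip_const bdd_lip_linear[OF bl fst]
        bdd_lip_linear[OF bounded_linear_vec_nth fst] bdd_lip_linear[OF bounded_linear_snd id])
qed auto

lemma balanced_set_subset_charts:
  "balanced_set {\<rho>} \<subseteq> (\<Union>q\<in>UNIV \<times> {- 1, 1}. balanced_chart \<rho> (fst q) (snd q) ` cube Basis (2 * pi))"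
proof
  fix x assume "x \<in> balanced_set {\<rho>}"
  then obtain s \<psi> \<phi> w where r: "s \<in> {0..2 * pi}" "\<psi> \<in> {0..2 * pi}" "\<phi> \<in> {0..2 * pi}" and w: "norm w = 1" "w $ a = 0"
    and x: "x = balanced_point \<rho> s \<psi> \<phi> w" by (rule balanced_setE) auto
  obtain e \<sigma> u k where e: "e \<in> Basis" "\<sigma> \<in> {- 1, 1::real}" "u \<in> cube (Basis - {e}) 1"
    "\<sigma> *\<^sub>R e + u = k *\<^sub>R w" "w = (1 / norm (\<sigma> *\<^sub>R e + u)) *\<^sub>R (\<sigma> *\<^sub>R e + u)" "w \<bullet> e \<noteq> 0"
    using w(1) by (rule sphere_chart)
  obtain i where i: "e = axis i 1" using e(1) by (auto simp: Basis_vec_def)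
  have u1: "\<bar>u $ j\<bar> \<le> 1" if "j \<noteq> i" for j
  proof -
    have "axis j 1 \<in> Basis - {e}" using that by (auto simp: i axis_in_Basis_iff axis_eq_axis)
    moreover from this have "if axis j 1 \<in> Basis - {e} then \<bar>u \<bullet> axis j 1\<bar> \<le> 1 else u \<bullet> axis j 1 = 0"
      using e(3) unfolding cube_def by blast
    ultimately show ?thesis by (simp add: inner_axis)
  qed
  have ui: "u $ i = 0"
  proof -
    have "if e \<in> Basis - {e} then \<bar>u \<bullet> e\<bar> \<le> 1 else u \<bullet> e = 0" using e(1,3) unfolding cube_def by blast
    then show ?thesis by (simp add: i inner_axis)
  qed
  have "w \<bullet> e = w $ i" by (simp add: i inner_axis)
  \<comment> \<open>As \<open>w $ a = 0\<close>, the face direction is never \<open>a\<close>, so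
    the slots \<open>a\<close> and \<open>i\<close> are distinct and both free for angles.\<close>
  then have ia: "i \<noteq> a" using e(6) w(2) by (intro notI) simp
  have "(\<sigma> *\<^sub>R e + u) $ a = (k *\<^sub>R w) $ a" by (simp only: e(4))
  then have ua: "u $ a = 0" using ia w(2) by (simp add: i axis_def)
  define p where "p = ((\<chi> j. if j = a then s else if j = i then \<psi> else u $ j), \<phi>)"
  have "(\<chi> j. if j \<in> {a, i} then 0 else fst p $ j) = u" using ui ua by (auto simp: vec_eq_iff p_def)
  then have "balanced_chart \<rho> i \<sigma> p = x"
    unfolding balanced_chart_def Let_def x using e(5) ia by (simp add: p_def i)
  moreover have "p \<in> cube Basis (2 * pi)"
  proof -
    have "\<bar>fst p $ j\<bar> \<le> 2 * pi" for j
      using r u1[of j] pi_ge_two by (auto simp: p_def)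
    moreover have "\<bar>snd p\<bar> \<le> 2 * pi" using r by (simp add: p_def)
    moreover have "(\<exists>j. v = (axis j 1, 0)) \<or> v = (0, 1)" if "v \<in> Basis" for v :: "(real ^ 'n) \<times> real"
      using that by (auto simp: Basis_prod_def Basis_vec_def)
    ultimately have "\<bar>p \<bullet> v\<bar> \<le> 2 * pi" if "v \<in> Basis" for v
      using that by (cases p) (fastforce simp: inner_axis)
    then show ?thesis unfolding cube_def by simp
  qed
  ultimately show "x \<in> (\<Union>q\<in>UNIV \<times> {- 1, 1}. balanced_chart \<rho> (fst q) (snd q) ` cube Basis (2 * pi))"
    using e(2) by (intro UN_I[of "(i, \<sigma>)"]) auto
qed

lemma hausdorff_dim_balanced_set:
  fixes f :: "nat \<Rightarrow> real"
  shows "hausdorff_dim (balanced_set (range f)) \<le> ennreal (real CARD('n) + 1)"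
proof (rule hausdorff_dim_le)
  fix s assume s: "real CARD('n) + 1 < s"
  have "dim_null s (balanced_set {f k})" for k
    by (rule dim_null_subset[OF dim_null_finite_Union balanced_set_subset_charts])
      (auto intro: dim_null_balanced_chart s)
  then have "dim_null s (\<Union>k. balanced_set {f k})" by (rule dim_null_Union)
  moreover have "balanced_set (range f) \<subseteq> (\<Union>k. balanced_set {f k})" unfolding balanced_set_def image_UN[symmetric] by (rule image_mono) auto
  ultimately show "dim_null s (balanced_set (range f))" by (rule dim_null_subset)
qed simp

text \<open>Each \<rho> > 1/3 has its own layer and a bound below pi / 3, so a sequence of layers
  with \<rho> tending to 1/3 is united. The limit layer \<rho> = 1/3 makes the union
  compact.\<close>

lemma low_dimensional_set:
  obtains X :: "((real ^ 'n) \<times> (real ^ 'n)) set"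
  where "compact X" "X \<subseteq> cball 0 1" "hausdorff_dim X \<le> ennreal (real CARD('n) + 1)"
    "ennreal (pi / 3) \<le> rel_hofer_diam X UNIV omega0"
proof -
  define f where "f k = (if k = 0 then 1 / 3 else 1 / 3 + 1 / (real k + 3))" for k :: nat
  have lim: "(\<lambda>k. 1 / 3 + 1 / (real k + 4)) \<longlonglongrightarrow> 1 / 3" by real_asymp
  have rf: "range f = insert (1 / 3) (range (\<lambda>k. 1 / 3 + 1 / (real k + 4)))"
  proof -
    have "range f = insert (f 0) (range (\<lambda>k. f (Suc k)))"
      by (subst UNIV_nat_eq) (simp only: image_insert image_image)
    moreover have "f (Suc k) = 1 / 3 + 1 / (real k + 4)" for k by (simp add: f_def add_ac)
    moreover have "f 0 = 1 / 3" by (simp add: f_def)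
    ultimately show ?thesis by (simp only:)
  qed
  have small: "0 < 1 / (real k + 4)" "1 / (real k + 4) \<le> 1 / 4" for k by (auto simp: field_simps)
  have b: "0 \<le> \<rho> \<and> \<rho> \<le> 1" if mem: "\<rho> \<in> range f" for \<rho>
  proof -
    consider "\<rho> = 1 / 3" | k where "\<rho> = 1 / 3 + 1 / (real k + 4)" using mem unfolding rf by blast
    then show ?thesis
    proof cases
      case (2 k)
      then show ?thesis using small[of k] by linarith
    qed simp
  qed
  show thesis
  proof (rule that)
    show "compact (balanced_set (range f))"
      unfolding rf by (intro compact_balanced_set compact_sequence_with_limit lim)
    show "balanced_set (range f) \<subseteq> cball 0 1"
    proof
      fix x assume "x \<in> balanced_set (range f)"
      then show "x \<in> cball 0 1" 
      proof (rule balanced_setE)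
        fix \<rho> s \<psi> \<phi> w
        assume x: "x = balanced_point \<rho> s \<psi> \<phi> w" and m: "\<rho> \<in> range f" "norm w = 1" "w $ a = 0"
        show ?thesis unfolding x using norm_balanced_point[OF _ _ m(3,2)] b[OF m(1)] by simp
      qed
    qed
    show "hausdorff_dim (balanced_set (range f)) \<le> ennreal (real CARD('n) + 1)" by (rule hausdorff_dim_balanced_set)
    show "ennreal (pi / 3) \<le> rel_hofer_diam (balanced_set (range f)) UNIV omega0"
    proof (rule ennreal_le_of_tendsto)
      show "(\<lambda>k. pi * (1 - (1 / 3 + 1 / (real k + 4))) / 2) \<longlonglongrightarrow> pi / 3" by real_asymp
      show "ennreal (pi * (1 - (1 / 3 + 1 / (real k + 4))) / 2) \<le> rel_hofer_diam (balanced_set (range f)) UNIV omega0" for k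
      proof (rule rel_hofer_diam_balanced)
        show "1 / 3 < 1 / 3 + 1 / (real k + 4)" "1 / 3 + 1 / (real k + 4) < 1" using small[of k] by linarith+
        show "1 / 3 + 1 / (real k + 4) \<in> range f" unfolding rf by blast
      qed
    qed
  qed
qed

end

section \<open>Lower bounds for k(n,d) and the conclusion\<close>

lemma k_num_ge_2: "2 \<le> k_num n d"
  unfolding k_num_def
proof (rule Inf_greatest, clarify)
  fix l :: nat and k :: "nat \<Rightarrow> nat"
  assume "2 \<le> l" "\<forall>i\<in>{1..l}. 1 \<le> k i"
  then have "(\<Sum>i=1..l. 1) \<le> (\<Sum>i=1..l. k i)" by (intro sum_mono) auto
  then have "2 \<le> (\<Sum>i=1..l. k i)" using \<open>2 \<le> l\<close> by simp
  then show "2 \<le> enat (\<Sum>i=1..l. k i)" by (simp add: numeral_eq_enat)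
qed

text \<open>A total of 2 forces two terms with \<open>k 1 = k 2 = 1\<close>. Then
  \<open>m 1 + m 2 \<ge> n\<close>, whereas the dimension condition reads
  \<open>2 * (m 1 + m 2) - 2 \<le> d\<close>.\<close>

lemma k_num_ge_3:
  assumes d: "d < 2 * real n - 2" shows "3 \<le> k_num n d"
  unfolding k_num_def
proof (rule Inf_greatest, clarify)
  fix l :: nat and k m :: "nat \<Rightarrow> nat"
  assume l: "2 \<le> l" and k: "\<forall>i\<in>{1..l}. 1 \<le> k i" and n: "n \<le> (\<Sum>i=1..l. k i * m i)"
    and dd: "(\<Sum>i=1..l. real (k i) * (2 * real (m i) - real (k i))) \<le> d"
  have ge: "(\<Sum>i=1..l. 1) \<le> (\<Sum>i=1..l. k i)" using k by (intro sum_mono) auto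
  have "3 \<le> (\<Sum>i=1..l. k i)"
  proof (rule ccontr)
    assume small: "\<not> 3 \<le> (\<Sum>i=1..l. k i)"
    then have l2: "l = 2" using ge l by simp
    have I: "{1..2::nat} = {1, 2}" by auto
    have "k 1 = 1" "k 2 = 1" using small k unfolding l2 I by auto
    then have "n \<le> m 1 + m 2" "2 * real (m 1) - 1 + (2 * real (m 2) - 1) \<le> d"
      using n dd unfolding l2 I by auto
    then show False using d by linarith
  qed
  then show "3 \<le> enat (\<Sum>i=1..l. k i)" by (simp add: numeral_eq_enat)
qed

lemma pi_div_enat_le:
  assumes "enat m \<le> k" "0 < m" shows "ennreal pi / ennreal_of_enat k \<le> ennreal (pi / real m)"
proof (cases k)
  case (enat j)
  then have j: "m \<le> j" using assms by simp
  have "ennreal pi / ennreal_of_enat k = ennreal (pi / real j)"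
    using j assms(2) by (simp add: enat ennreal_of_nat_eq_real_of_nat divide_ennreal)
  also have "\<dots> \<le> ennreal (pi / real m)" using j assms(2) by (intro ennreal_leI divide_left_mono) auto
  finally show ?thesis .
qed simp

theorem theorem6:
  assumes n: "2 \<le> CARD('n::finite)"
  shows "ennreal (pi / 2) \<le>
           rel_hofer_diam (sphere 0 1 :: ((real ^ 'n) \<times> (real ^ 'n)) set) UNIV omega0 \<and>
         (\<forall>d\<in>{real CARD('n) .. 2 * real CARD('n) - 1}.
            \<exists>X :: ((real ^ 'n) \<times> (real ^ 'n)) set.
              compact X \<and> X \<subseteq> cball 0 1 \<and> hausdorff_dim X \<le> ennreal (d + 1) \<and>
              ennreal pi / ennreal_of_enat (k_num CARD('n) d) \<le> rel_hofer_diam X UNIV omega0)"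
proof (intro conjI ballI)
  obtain a b :: 'n where ab: "a \<noteq> b" 
  proof -
    have "\<not> CARD('n) \<le> Suc 0" using n by simp
    then show thesis using that by (auto simp: card_le_Suc0_iff_eq)
  qed
  interpret plane_rotation a b using ab by unfold_locales
  show i: "ennreal (pi / 2) \<le> rel_hofer_diam (sphere 0 1 :: ((real ^ 'n) \<times> (real ^ 'n)) set) UNIV omega0"
    by (rule rel_hofer_diam_sphere)
  fix d :: real assume d: "d \<in> {real CARD('n) .. 2 * real CARD('n) - 1}"
  show "\<exists>X :: ((real ^ 'n) \<times> (real ^ 'n)) set. compact X \<and> X \<subseteq> cball 0 1 \<and> hausdorff_dim X \<le> ennreal (d + 1) \<and>
      ennreal pi / ennreal_of_enat (k_num CARD('n) d) \<le> rel_hofer_diam X UNIV omega0"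
  proof (cases "d < 2 * real CARD('n) - 2")
    case False
    \<comment> \<open>In this case \<open>d + 1\<close> is at least \<open>2 * CARD('n) - 1\<close>,
      the dimension of the sphere.\<close>
    have "hausdorff_dim (sphere 0 1 :: ((real ^ 'n) \<times> (real ^ 'n)) set) \<le> ennreal (d + 1)"
      by (rule order_trans[OF hausdorff_dim_sphere]) (use False in \<open>simp add: ennreal_leI\<close>)
    moreover have "ennreal pi / ennreal_of_enat (k_num CARD('n) d) \<le> ennreal (pi / 2)"
      using pi_div_enat_le[of 2 "k_num CARD('n) d"] k_num_ge_2 by (simp add: numeral_eq_enat)
    ultimately show ?thesis using order_trans[OF _ i] by (intro exI[of _ "sphere 0 1"]) auto
  next
    case True
    \<comment> \<open>From \<open>CARD('n) \<le> d\<close> and \<open>d < 2 * CARD('n) - 2\<close>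
      there is room for a third index.\<close>
    have "card {a, b} < CARD('n)" using True d ab by simp
    then have "{a, b} \<noteq> UNIV" by auto
    then obtain c where "c \<noteq> a" "c \<noteq> b" by blast
    then interpret plane_rotation_3 a b c by unfold_locales
    obtain X :: "((real ^ 'n) \<times> (real ^ 'n)) set" where X: "compact X" "X \<subseteq> cball 0 1"
      "hausdorff_dim X \<le> ennreal (real CARD('n) + 1)" "ennreal (pi / 3) \<le> rel_hofer_diam X UNIV omega0"
      by (rule low_dimensional_set)
    have "hausdorff_dim X \<le> ennreal (d + 1)" using d by (intro order_trans[OF X(3)] ennreal_leI) simp
    moreover have "ennreal pi / ennreal_of_enat (k_num CARD('n) d) \<le> ennreal (pi / 3)"
      using pi_div_enat_le[of 3 "k_num CARD('n) d"] k_num_ge_3[OF True] by (simp add: numeral_eq_enat)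
    ultimately show ?thesis using X(1,2) order_trans[OF _ X(4)] by blast
  qed
qed

end
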